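(* Let $p,q\geqslant 2$ be integers and let $f=h+\overline g\in\mathcal S^{p,q}_H$, with $h(z)=z+\sum_{n=2}^\infty a_nz^n$ and $g(z)=\sum_{n=2}^\infty b_nz^n$. Put $$R_q=2^{-2q/(q-1)},\qquad d_q=\frac{2\pi}{3\sqrt{3}\,R_q}.$$ Then $$|a_p|\leqslant d_q^{\,p-1}\Bigl(\frac{d_qR_q}{p}+p\Bigr).$$ Moreover, $$|a_2|\leqslant d_q\Bigl(\frac{d_qR_q}{2}+2\Bigr)-2.$$
   Context: $\mathbb D=\{z\in\mathbb C:|z|<1\}$. Every complex-valued harmonic function $f$ in $\mathbb D$ has the form $f=h+\overline{g}$ with $h,g$ holomorphic in $\mathbb D$. The class $\mathcal S_H^0$ consists of all complex-valued harmonic functions $f=h+\overline g$ in $\mathbb D$ that are univalent (injective) in $\mathbb D$ and satisfy $h(0)=g(0)=g'(0)=0$ and $h'(0)=1$; thus $h(z)=z+\sum_{n\geqslant2}a_nz^n$ and $g(z)=\sum_{n\geqslant2}b_nz^n$. For integers $p,q\geqslant2$, $\mathcal S_H^{p,q}$ denotes the class of those $f\in\mathcal S_H^0$ for which $p$ is the index of the first nonzero coefficient among $a_2,a_3,\dots$, and $q$ is the index of the first nonzero coefficient among $b_2,b_3,\dots$. *)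

theory Defs
  imports "HOL-Complex_Analysis.Complex_Analysis"
begin

abbreviation unit_disc :: "complex set"
  where "unit_disc \<equiv> ball 0 1"

(* Twice continuously (real) differentiable with vanishing Laplacian; fx, fy are the partial
   derivatives of f with respect to the real and imaginary part of the variable, fxy = (fx)_y, etc. *)
definition harmonic_on :: "(complex \<Rightarrow> complex) \<Rightarrow> complex set \<Rightarrow> bool"
  where "harmonic_on f S \<longleftrightarrow> open S \<and>
    (\<exists>fx fy fxx fxy fyx fyy.
      (\<forall>z\<in>S. (f has_derivative (\<lambda>v. Re v *\<^sub>R fx z + Im v *\<^sub>R fy z)) (at z)) \<and>
      (\<forall>z\<in>S. (fx has_derivative (\<lambda>v. Re v *\<^sub>R fxx z + Im v *\<^sub>R fxy z)) (at z)) \<and>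
      (\<forall>z\<in>S. (fy has_derivative (\<lambda>v. Re v *\<^sub>R fyx z + Im v *\<^sub>R fyy z)) (at z)) \<and>
      continuous_on S fxx \<and> continuous_on S fxy \<and> continuous_on S fyx \<and> continuous_on S fyy \<and>
      (\<forall>z\<in>S. fxx z + fyy z = 0))"

definition harmonic_decomposition ::
    "(complex \<Rightarrow> complex) \<Rightarrow> (complex \<Rightarrow> complex) \<Rightarrow> (complex \<Rightarrow> complex) \<Rightarrow> bool"
  where "harmonic_decomposition f h g \<longleftrightarrow>
    h holomorphic_on unit_disc \<and> g holomorphic_on unit_disc \<and>
    (\<forall>z\<in>unit_disc. f z = h z + cnj (g z))"

definition normalized_decomposition ::
    "(complex \<Rightarrow> complex) \<Rightarrow> (complex \<Rightarrow> complex) \<Rightarrow> (complex \<Rightarrow> complex) \<Rightarrow> bool"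
  where "normalized_decomposition f h g \<longleftrightarrow>
    harmonic_decomposition f h g \<and> h 0 = 0 \<and> g 0 = 0 \<and> deriv g 0 = 0 \<and> deriv h 0 = 1"

(* Functions are considered only on the disc: their values elsewhere are unconstrained. *)
definition S_H0 :: "(complex \<Rightarrow> complex) set"
  where "S_H0 = {f. harmonic_on f unit_disc \<and> inj_on f unit_disc \<and>
    (\<exists>h g. normalized_decomposition f h g)}"

definition first_nonzero_coeff_from_2 :: "(complex \<Rightarrow> complex) \<Rightarrow> nat \<Rightarrow> bool"
  where "first_nonzero_coeff_from_2 h p \<longleftrightarrow>
    2 \<le> p \<and> fps_nth (fps_expansion h 0) p \<noteq> 0 \<and>
    (\<forall>n. 2 \<le> n \<and> n < p \<longrightarrow> fps_nth (fps_expansion h 0) n = 0)"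

(* The normalized decomposition of f is unique on the disc, so the quantified h and g are the
   analytic and co-analytic part of f. *)
definition S_H :: "nat \<Rightarrow> nat \<Rightarrow> (complex \<Rightarrow> complex) set"
  where "S_H p q = {f \<in> S_H0. \<exists>h g. normalized_decomposition f h g \<and>
    first_nonzero_coeff_from_2 h p \<and> first_nonzero_coeff_from_2 g q}"

definition R_const :: "nat \<Rightarrow> real"
  where "R_const q = 2 powr (- (2 * real q / (real q - 1)))"

definition d_const :: "nat \<Rightarrow> real"
  where "d_const q = 2 * pi / (3 * sqrt 3 * R_const q)"

(* Hence the harmonicity requirement in S_H0 is no restriction beyond the decomposition. *)
lemma harmonic_decomposition_imp_harmonic_on:
  assumes "harmonic_decomposition f h g"
  shows "harmonic_on f unit_disc"
proof -
  let ?D = "unit_disc"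
  have hol: "h holomorphic_on ?D" "g holomorphic_on ?D"
    and feq: "\<And>z. z \<in> ?D \<Longrightarrow> f z = h z + cnj (g z)"
    using assms by (auto simp: harmonic_decomposition_def)
  note hol' = hol[THEN holomorphic_deriv, OF open_ball]
  note hol'' = hol'[THEN holomorphic_deriv, OF open_ball]
  have D: "(u has_derivative (\<lambda>v. deriv u z * v)) (at z)"
    if "u holomorphic_on ?D" "z \<in> ?D" for u z
    using holomorphic_derivI[OF that(1) open_ball that(2)] by (simp add: has_field_derivative_def)
  have C: "((\<lambda>z. cnj (u z)) has_derivative (\<lambda>v. cnj (deriv u z * v))) (at z)"
    if "u holomorphic_on ?D" "z \<in> ?D" for u z
    using D[OF that] by (rule has_derivative_cnj)
  have 1: "(f has_derivative (\<lambda>v. Re v *\<^sub>R (deriv h z + cnj (deriv g z)) +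
       Im v *\<^sub>R (\<i> * (deriv h z - cnj (deriv g z))))) (at z)" if z: "z \<in> ?D" for z
  proof -
    have "((\<lambda>z. h z + cnj (g z)) has_derivative
        (\<lambda>v. deriv h z * v + cnj (deriv g z * v))) (at z)"
      by (intro has_derivative_add D C hol z)
    then have "(f has_derivative (\<lambda>v. deriv h z * v + cnj (deriv g z * v))) (at z)"
      by (rule has_derivative_transform_within_open[OF _ open_ball z]) (simp add: feq)
    then show ?thesis
      by (rule has_derivative_eq_rhs) (auto simp: complex_eq_iff algebra_simps)
  qed
  have 2: "((\<lambda>z. deriv h z + cnj (deriv g z)) has_derivative
       (\<lambda>v. Re v *\<^sub>R (deriv (deriv h) z + cnj (deriv (deriv g) z)) +
       Im v *\<^sub>R (\<i> * (deriv (deriv h) z - cnj (deriv (deriv g) z))))) (at z)" if z: "z \<in> ?D" for z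
    by (rule has_derivative_eq_rhs[OF has_derivative_add[OF D[OF hol'(1) z] C[OF hol'(2) z]]])
       (auto simp: complex_eq_iff algebra_simps)
  have 3: "((\<lambda>z. \<i> * (deriv h z - cnj (deriv g z))) has_derivative
       (\<lambda>v. Re v *\<^sub>R (\<i> * (deriv (deriv h) z - cnj (deriv (deriv g) z))) +
       Im v *\<^sub>R (- (deriv (deriv h) z + cnj (deriv (deriv g) z))))) (at z)" if z: "z \<in> ?D" for z
    by (rule has_derivative_eq_rhs[OF has_derivative_mult_right[OF
          has_derivative_diff[OF D[OF hol'(1) z] C[OF hol'(2) z]]]])
       (auto simp: complex_eq_iff algebra_simps)
  note cont = hol''[THEN holomorphic_on_imp_continuous_on]
  show ?thesis
    unfolding harmonic_on_def
  proof (intro conjI open_ball exI ballI)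
    show "continuous_on ?D (\<lambda>z. deriv (deriv h) z + cnj (deriv (deriv g) z))"
      "continuous_on ?D (\<lambda>z. \<i> * (deriv (deriv h) z - cnj (deriv (deriv g) z)))"
      "continuous_on ?D (\<lambda>z. \<i> * (deriv (deriv h) z - cnj (deriv (deriv g) z)))"
      "continuous_on ?D (\<lambda>z. - (deriv (deriv h) z + cnj (deriv (deriv g) z)))"
      by (intro continuous_intros cont)+
  qed (use 1 2 3 in auto)
qed

end

theory Submission
  imports Defs "HOL-Complex_Analysis.Complex_Analysis"
begin

text \<open>
  A univalent harmonic map $f = h + \overline{g}$ is compared with a univalent harmonic map of the disc
  \<^emph>\<open>onto\<close> a disc, for which sharp coefficient estimates hold.

  \<^bold>\<open>Dilatation and covering.\<close> The derivative of $f$ at the origin is the identity, so the increment of $f$ along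
  every circle in the disc winds once about the origin; a point with $|g'| > |h'|$ would give winding number $-1$.
  Hence $g' = \omega h'$ with $|\omega| \le 1$, and the Schwarz lemma improves this to
  $|g'(z)| \le |z|^{q-1} |h'(z)|$ (lemma \<open>univalent_harmonic_dilatation\<close>); a zero of $h'$ would give a
  winding number larger than one (\<open>lewy\<close>). Let $\psi$ be a Riemann map from the disc onto the image of $f$.
  Then $\psi^{-1} \circ f$ maps the disc onto itself with the same dilatation, and a length-area argument
  bounds its derivative at the origin by $4^{1/(q-1)}$ (\<open>length_area_inner_radius\<close>). With the Koebe
  one-quarter theorem for $\psi$ this shows that the image of $f$ contains the disc of radius
  $R_q = 1/(4 \cdot 4^{1/(q-1)})$ (\<open>covering_theorem\<close>).

  \<^bold>\<open>Maps onto a disc.\<close> Fix $0 < r < R_q$, let $\Omega = f^{-1}(\{|w| < r\})$ and let $\varphi$ be the Riemann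
  map of the disc onto $\Omega$. The map $u = (f \circ \varphi)/r = H + \overline{G}$ is a univalent harmonic
  map of the disc onto itself. Since $\Omega$ lies compactly in the disc, $u$ is quasiconformal and therefore
  extends to the boundary as a homeomorphism of the circle (\<open>univalent_harmonic_disc_boundary\<close>). The
  coefficients of $H$ are Fourier coefficients of a monotone circle map, so $|H_n| \le 1/n$, and the sharp
  inequality of Hall gives $|H_1|^2 \ge 27/(4 \pi^2)$ because $G_1 = 0$
  (\<open>circle_map_fourier_bound\<close>, \<open>heinz_hall_circle\<close>). The second estimate says $|\varphi'(0)| \ge 1/d$ with
  $d = 2\pi/(3\sqrt{3} r)$.

  \<^bold>\<open>Comparison of coefficients.\<close> As $a_2, \dots, a_{p-1}$ vanish, the coefficient of index $p$ of
  $h \circ \varphi$ is $c_p + a_p c^p$, where $c_n$ are the coefficients of $\varphi$ and $c = c_1$. Its modulus is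
  at most $r/p$, so everything rests on a bound for $c_p$. For $p = 2$ this is the inequality
  $|c_2| \le 2 |c| (1 - |c|)$ of Pick. For $p \ge 3$ the lower coefficients of $h \circ \varphi$ are $c_2, \dots,
  c_{p-1}$, hence $|c_n| \le r/n \le |c|$ for these $n$, and the area theorem then yields $|c_p| \le p |c|$
  (\<open>univalent_coeff_bound_if_previous_small\<close>).
  Letting $r$ tend to $R_q$ gives the claim.
\<close>

section \<open>Change of variables in the plane\<close>

definition complex_of_vec :: "real^2 \<Rightarrow> complex"
  where "complex_of_vec v = Complex (vec_nth v 1) (vec_nth v 2)"

definition vec_of_complex :: "complex \<Rightarrow> real^2"
  where "vec_of_complex z = vector [Re z, Im z]"

lemma complex_of_vec_of_complex [simp]: "complex_of_vec (vec_of_complex z) = z"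
  by (simp add: complex_of_vec_def vec_of_complex_def)

lemma vec_of_complex_of_vec [simp]: "vec_of_complex (complex_of_vec v) = v"
  by (simp add: complex_of_vec_def vec_of_complex_def vec_eq_iff forall_2)

lemma bounded_linear_complex_of_vec: "bounded_linear complex_of_vec"
  by (intro linear_conv_bounded_linear[THEN iffD1])
     (auto intro!: linearI simp: complex_of_vec_def complex_eq_iff)

lemma bounded_linear_vec_of_complex: "bounded_linear vec_of_complex"
  by (intro linear_conv_bounded_linear[THEN iffD1])
     (auto intro!: linearI simp: vec_of_complex_def vec_eq_iff forall_2)

lemma continuous_complex_of_vec: "continuous_on A complex_of_vec"
  and continuous_vec_of_complex: "continuous_on B vec_of_complex"
  by (auto intro: linear_continuous_on bounded_linear_complex_of_vec bounded_linear_vec_of_complex)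

lemma measurable_complex_of_vec [measurable]: "complex_of_vec \<in> borel_measurable borel"
  and measurable_vec_of_complex [measurable]: "vec_of_complex \<in> borel_measurable borel"
  by (auto intro!: borel_measurable_continuous_onI continuous_complex_of_vec continuous_vec_of_complex)

text \<open>
  Determinants and changes of variables live on $\mathbb{R}^2$; the identification with $\mathbb{C}$ preserves
  Lebesgue measure because it does so on boxes.
\<close>
lemma lborel_complex_vec: "(lborel :: complex measure) = distr lborel borel complex_of_vec"
proof (rule lborel_eqI)
  fix l u :: complex assume le: "\<And>b. b \<in> Basis \<Longrightarrow> l \<bullet> b \<le> u \<bullet> b"
  have le': "Re l \<le> Re u" "Im l \<le> Im u"
    using le[of 1] le[of "\<i>"] by (auto simp: Basis_complex_def inner_complex_def)
  have "complex_of_vec -` box l u = box (vec_of_complex l) (vec_of_complex u)"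
    by (auto simp: box_def Basis_complex_def inner_complex_def complex_of_vec_def vec_of_complex_def
        Basis_vec_def forall_2 inner_axis UNIV_2)
  moreover have "emeasure lborel (box (vec_of_complex l) (vec_of_complex u)) =
      ennreal ((Re u - Re l) * (Im u - Im l))"
  proof -
    have B: "(Basis :: (real^2) set) = {axis 1 1, axis 2 1}"
      by (auto simp: Basis_vec_def UNIV_2)
    show ?thesis using le'
      by (subst emeasure_lborel_box)
         (auto simp: B vec_of_complex_def inner_axis axis_eq_axis)
  qed
  ultimately show "emeasure (distr lborel borel complex_of_vec) (box l u) = (\<Prod>b\<in>Basis. (u - l) \<bullet> b)"
    by (subst emeasure_distr) (auto simp: Basis_complex_def inner_complex_def)
qed simp

lemma nn_integral_complex_vec:
  assumes [measurable]: "F \<in> borel_measurable borel"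
  shows "(\<integral>\<^sup>+z. F z \<partial>(lborel :: complex measure)) = (\<integral>\<^sup>+v. F (complex_of_vec v) \<partial>lborel)"
  by (subst lborel_complex_vec, subst nn_integral_distr) auto

lemma measurable_Complex:
  "(\<lambda>(x, y). Complex x y) \<in> borel_measurable (lborel \<Otimes>\<^sub>M (lborel :: real measure))"
  unfolding Complex_eq by measurable

lemma lborel_complex_pair:
  "(lborel :: complex measure) = distr (lborel \<Otimes>\<^sub>M lborel) borel (\<lambda>(x, y). Complex x y)"
proof (rule lborel_eqI)
  have m: "(\<lambda>(x, y). Complex x y) \<in> borel_measurable (lborel \<Otimes>\<^sub>M (lborel :: real measure))"
    by (rule measurable_Complex)
  fix l u :: complex assume le: "\<And>b. b \<in> Basis \<Longrightarrow> l \<bullet> b \<le> u \<bullet> b"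
  have le': "Re l \<le> Re u" "Im l \<le> Im u"
    using le[of 1] le[of "\<i>"] by (auto simp: Basis_complex_def inner_complex_def)
  have "(\<lambda>(x, y). Complex x y) -` box l u \<inter> space (lborel \<Otimes>\<^sub>M lborel) = {Re l<..<Re u} \<times> {Im l<..<Im u}"
    by (auto simp: box_def Basis_complex_def inner_complex_def space_pair_measure)
  moreover have "emeasure (lborel \<Otimes>\<^sub>M lborel) ({Re l<..<Re u} \<times> {Im l<..<Im u}) =
      ennreal ((Re u - Re l) * (Im u - Im l))"
    using le' by (subst lborel.emeasure_pair_measure_Times) (auto simp: ennreal_mult')
  ultimately show "emeasure (distr (lborel \<Otimes>\<^sub>M lborel) borel (\<lambda>(x, y). Complex x y)) (box l u)
      = (\<Prod>b\<in>Basis. (u - l) \<bullet> b)"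
    by (subst emeasure_distr[OF m]) (auto simp: Basis_complex_def inner_complex_def)
qed simp

lemma nn_integral_complex_iterated:
  assumes F: "F \<in> borel_measurable borel"
  shows "(\<integral>\<^sup>+z. F z \<partial>(lborel :: complex measure)) = (\<integral>\<^sup>+x. \<integral>\<^sup>+y. F (Complex x y) \<partial>lborel \<partial>lborel)"
proof -
  have m: "(\<lambda>(x, y). Complex x y) \<in> borel_measurable (lborel \<Otimes>\<^sub>M (lborel :: real measure))"
    by (rule measurable_Complex)
  have m2: "(\<lambda>p. F (case p of (x, y) \<Rightarrow> Complex x y)) \<in> borel_measurable (lborel \<Otimes>\<^sub>M lborel)"
    using measurable_compose[OF m F] by simp
  show ?thesis
    by (subst lborel_complex_pair, subst nn_integral_distr[OF m],
        (simp add: F), subst lborel.nn_integral_fst[OF m2, symmetric]) simp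
qed

text \<open>
  All derivatives below are written as $v \mapsto \alpha v + \beta \overline{v}$, so that $\alpha$ and $\beta$ are
  the Wirtinger derivatives and the Jacobian is $|\alpha|^2 - |\beta|^2$.
\<close>
lemma det_real_linear_complex:
  "det (matrix (\<lambda>v. vec_of_complex (\<alpha> * complex_of_vec v + \<beta> * cnj (complex_of_vec v)))) =
    (cmod \<alpha>)\<^sup>2 - (cmod \<beta>)\<^sup>2"
  unfolding det_2 matrix_def complex_of_vec_def vec_of_complex_def cmod_power2
  by (simp add: axis_def power2_eq_square algebra_simps)

lemma ennreal_integral_eq_nn:
  fixes F :: "real^2 \<Rightarrow> real"
  assumes "F absolutely_integrable_on S" "\<And>x. x \<in> S \<Longrightarrow> F x \<ge> 0" 
  shows "(\<integral>\<^sup>+v. indicator S v * ennreal (F v) \<partial>lborel) = ennreal (integral S F)"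
proof -
  have "(\<integral>\<^sup>+v. indicator S v * ennreal (F v) \<partial>lborel) = (\<integral>\<^sup>+v. ennreal (indicator S v * F v) \<partial>lebesgue)"
    by (simp add: nn_integral_completion, intro nn_integral_cong) (auto simp: indicator_def)
  also have "\<dots> = ennreal (integral\<^sup>L lebesgue (\<lambda>v. indicator S v * F v))"
    using assms by (intro nn_integral_eq_integral) (auto simp: set_integrable_def indicator_def)
  also have "integral\<^sup>L lebesgue (\<lambda>v. indicator S v * F v) = integral S F"
    using set_lebesgue_integral_eq_integral(2)[OF assms(1)] by (simp add: set_lebesgue_integral_def)
  finally show ?thesis .
qed

lemma nn_finite_abs_integrable:
  fixes F :: "real^2 \<Rightarrow> real"
  assumes [measurable]: "(\<lambda>v. indicator S v * F v) \<in> borel_measurable borel"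
    and pos: "\<And>x. x \<in> S \<Longrightarrow> F x \<ge> 0" and fin: "(\<integral>\<^sup>+v. indicator S v * ennreal (F v) \<partial>lborel) < \<infinity>"
  shows "F absolutely_integrable_on S"
proof -
  have "(\<integral>\<^sup>+v. ennreal (norm (indicator S v * F v)) \<partial>lborel) = (\<integral>\<^sup>+v. indicator S v * ennreal (F v) \<partial>lborel)"
    by (intro nn_integral_cong) (auto simp: indicator_def pos)
  then have "integrable lborel (\<lambda>v. indicator S v * F v)"
    using fin by (intro integrableI_bounded) auto
  then have "integrable lebesgue (\<lambda>v. indicator S v * F v)"
    by (subst integrable_completion) auto
  then show ?thesis by (simp add: set_integrable_def)
qed

text \<open>
  Transport to $\mathbb{R}^2$ of the change of variables theorem. That theorem is about absolutely integrable
  functions, which is why one of the two sides is required to be finite.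
\<close>
lemma nn_integral_image:
  fixes u :: "complex \<Rightarrow> complex" and W :: "complex \<Rightarrow> real"
  assumes S: "S \<in> sets borel" and uS: "u ` S \<in> sets borel" and inj: "inj_on u S"
    and der: "\<And>z. z \<in> S \<Longrightarrow> (u has_derivative (\<lambda>v. \<alpha> z * v + \<beta> z * cnj v)) (at z within S)"
    and W: "W \<in> borel_measurable borel" and W0: "\<And>w. W w \<ge> 0"
    and F: "(\<lambda>z. indicator S z * (\<bar>(cmod (\<alpha> z))\<^sup>2 - (cmod (\<beta> z))\<^sup>2\<bar> * W (u z))) \<in> borel_measurable borel"
    and fin: "(\<integral>\<^sup>+z\<in>S. ennreal (\<bar>(cmod (\<alpha> z))\<^sup>2 - (cmod (\<beta> z))\<^sup>2\<bar> * W (u z)) \<partial>lborel) < \<infinity> \<or>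
       (\<integral>\<^sup>+w\<in>u ` S. ennreal (W w) \<partial>lborel) < \<infinity>"
  shows "(\<integral>\<^sup>+z\<in>S. ennreal (\<bar>(cmod (\<alpha> z))\<^sup>2 - (cmod (\<beta> z))\<^sup>2\<bar> * W (u z)) \<partial>lborel) =
    (\<integral>\<^sup>+w\<in>u ` S. ennreal (W w) \<partial>lborel)"
proof -
  define J where "J z = \<bar>(cmod (\<alpha> z))\<^sup>2 - (cmod (\<beta> z))\<^sup>2\<bar>" for z
  let ?c = complex_of_vec and ?v = vec_of_complex
  define S' where "S' = ?c -` S"
  define g where "g = ?v \<circ> u \<circ> ?c"
  define g' where "g' x = (\<lambda>v. ?v (\<alpha> (?c x) * ?c v + \<beta> (?c x) * cnj (?c v)))" for x
  have imS: "?c ` S' = S"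
    by (auto simp: S'_def image_iff) (metis complex_of_vec_of_complex)
  have gS: "g ` S' = ?c -` (u ` S)"
  proof -
    have "g ` S' = ?v ` u ` S" unfolding g_def imS[symmetric] image_comp by (simp add: o_assoc)
    also have "\<dots> = ?c -` (u ` S)"
      by (auto intro!: image_eqI[of _ ?v "?c x" for x])
    finally show ?thesis .
  qed
  have S'b: "S' \<in> sets borel"
    unfolding S'_def using measurable_sets[OF measurable_complex_of_vec S] by simp
  have gSb: "g ` S' \<in> sets borel"
    unfolding gS using measurable_sets[OF measurable_complex_of_vec uS] by simp
  have dg: "(g has_derivative g' x) (at x within S')" if "x \<in> S'" for x
  proof -
    have 1: "(?c has_derivative ?c) (at x within S')" 
      by (rule bounded_linear_imp_has_derivative[OF bounded_linear_complex_of_vec])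
    have 2: "(u has_derivative (\<lambda>v. \<alpha> (?c x) * v + \<beta> (?c x) * cnj v)) (at (?c x) within ?c ` S')"
      using der[of "?c x"] that by (simp add: imS) (simp add: S'_def)
    have 3: "((\<lambda>x. u (?c x)) has_derivative (\<lambda>v. \<alpha> (?c x) * ?c v + \<beta> (?c x) * cnj (?c v))) (at x within S')"
      using has_derivative_in_compose[OF 1 2] by simp
    show ?thesis unfolding g_def g'_def o_def
      using bounded_linear.has_derivative[OF bounded_linear_vec_of_complex 3] .
  qed
  have ing: "inj_on g S'"
    using inj unfolding g_def S'_def inj_on_def
    by (metis comp_apply complex_of_vec_of_complex vec_of_complex_of_vec vimage_eq)
  have det: "\<bar>det (matrix (g' x))\<bar> = J (?c x)" for x
    by (simp add: g'_def det_real_linear_complex J_def)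
  have cov: "(\<lambda>x. \<bar>det (matrix (g' x))\<bar> *\<^sub>R f (g x)) absolutely_integrable_on S' \<and>
           integral S' (\<lambda>x. \<bar>det (matrix (g' x))\<bar> *\<^sub>R f(g x)) = b
     \<longleftrightarrow> f absolutely_integrable_on (g ` S') \<and> integral (g ` S') f = b" 
     for f :: "real^2 \<Rightarrow> real^1" and b
    by (rule has_absolute_integral_change_of_variables[OF _ dg ing]) (use S'b in auto)
  define f where "f v = (vec (W (?c v)) :: real^1)" for v
  have f1: "f absolutely_integrable_on A \<longleftrightarrow> (\<lambda>v. W (?c v)) absolutely_integrable_on A"
    "f absolutely_integrable_on A \<Longrightarrow> integral A f = vec (integral A (\<lambda>v. W (?c v)))" for A
    by (simp_all add: f_def absolutely_integrable_on_1_iff o_def integral_on_1_eq)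
  have f2: "(\<lambda>x. \<bar>det (matrix (g' x))\<bar> *\<^sub>R f (g x)) = (\<lambda>x. vec (J (?c x) * W (u (?c x))))"
    by (auto simp: fun_eq_iff det f_def g_def vec_eq_iff)
  have cov1: "(\<lambda>x. J (?c x) * W (u (?c x))) absolutely_integrable_on S' \<and>
      integral S' (\<lambda>x. J (?c x) * W (u (?c x))) = c \<longleftrightarrow>
      (\<lambda>v. W (?c v)) absolutely_integrable_on (g ` S') \<and> integral (g ` S') (\<lambda>v. W (?c v)) = c" for c
    using cov[of f "vec c"] unfolding f2 f1(1)
    by (simp add: absolutely_integrable_on_1_iff o_def integral_on_1_eq f_def vec_eq_iff)
  have cov2: "(\<lambda>x. J (?c x) * W (u (?c x))) absolutely_integrable_on S' \<longleftrightarrow>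
      (\<lambda>v. W (?c v)) absolutely_integrable_on (g ` S')"
    "(\<lambda>v. W (?c v)) absolutely_integrable_on (g ` S') \<Longrightarrow> 
       integral S' (\<lambda>x. J (?c x) * W (u (?c x))) = integral (g ` S') (\<lambda>v. W (?c v))"
    using cov1 by blast+
  have e1: "(\<integral>\<^sup>+z\<in>S. ennreal (J z * W (u z)) \<partial>lborel) = 
      (\<integral>\<^sup>+x. indicator S' x * ennreal (J (?c x) * W (u (?c x))) \<partial>lborel)"
  proof -
    have "(\<integral>\<^sup>+z\<in>S. ennreal (J z * W (u z)) \<partial>lborel) = (\<integral>\<^sup>+z. ennreal (indicator S z * (J z * W (u z))) \<partial>lborel)"
      by (intro nn_integral_cong) (auto simp: indicator_def)
    also have "\<dots> = (\<integral>\<^sup>+x. ennreal (indicator S (?c x) * (J (?c x) * W (u (?c x)))) \<partial>lborel)"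
      using F unfolding J_def by (subst nn_integral_complex_vec) auto
    also have "\<dots> = (\<integral>\<^sup>+x. indicator S' x * ennreal (J (?c x) * W (u (?c x))) \<partial>lborel)"
      by (intro nn_integral_cong) (auto simp: indicator_def S'_def)
    finally show ?thesis .
  qed
  have e2: "(\<integral>\<^sup>+w\<in>u ` S. ennreal (W w) \<partial>lborel) = (\<integral>\<^sup>+x. indicator (g ` S') x * ennreal (W (?c x)) \<partial>lborel)"
  proof -
    have "(\<integral>\<^sup>+w\<in>u ` S. ennreal (W w) \<partial>lborel) = (\<integral>\<^sup>+x. ennreal (W (?c x)) * indicator (u ` S) (?c x) \<partial>lborel)"
      using W uS by (subst nn_integral_complex_vec) auto
    also have "\<dots> = (\<integral>\<^sup>+x. indicator (g ` S') x * ennreal (W (?c x)) \<partial>lborel)"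
      by (intro nn_integral_cong) (auto simp: indicator_def gS)
    finally show ?thesis .
  qed
  have J0: "J z \<ge> 0" for z by (simp add: J_def)
  have m1: "(\<lambda>v. indicator S' v * (J (?c v) * W (u (?c v)))) \<in> borel_measurable borel"
  proof -
    have "(\<lambda>v. indicator S (?c v) * (J (?c v) * W (u (?c v)))) \<in> borel_measurable borel"
      using measurable_compose[OF measurable_complex_of_vec F] by (simp add: J_def)
    moreover have "indicator S (?c v) = (indicator S' v :: real)" for v
      by (auto simp: indicator_def S'_def)
    ultimately show ?thesis by simp
  qed
  have m2: "(\<lambda>v. indicator (g ` S') v * W (?c v)) \<in> borel_measurable borel"
    using W gSb by measurable
  have ai: "(\<lambda>v. W (?c v)) absolutely_integrable_on (g ` S')"
    using fin
  proof
    assume "(\<integral>\<^sup>+z\<in>S. ennreal (\<bar>(cmod (\<alpha> z))\<^sup>2 - (cmod (\<beta> z))\<^sup>2\<bar> * W (u z)) \<partial>lborel) < \<infinity>"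
    then have "(\<lambda>x. J (?c x) * W (u (?c x))) absolutely_integrable_on S'"
      by (intro nn_finite_abs_integrable m1) (auto simp: e1[unfolded J_def] J_def W0)
    then show ?thesis using cov2 by simp
  next
    assume "(\<integral>\<^sup>+w\<in>u ` S. ennreal (W w) \<partial>lborel) < \<infinity>"
    then show ?thesis by (intro nn_finite_abs_integrable m2) (auto simp: e2 W0)
  qed
  then have "(\<lambda>x. J (?c x) * W (u (?c x))) absolutely_integrable_on S'" using cov2 by simp
  then have "(\<integral>\<^sup>+x. indicator S' x * ennreal (J (?c x) * W (u (?c x))) \<partial>lborel) = 
    ennreal (integral S' (\<lambda>x. J (?c x) * W (u (?c x))))"
    by (intro ennreal_integral_eq_nn) (auto simp: J0 W0)
  also have "\<dots> = (\<integral>\<^sup>+x. indicator (g ` S') x * ennreal (W (?c x)) \<partial>lborel)"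
    using ai by (subst ennreal_integral_eq_nn) (auto simp: W0 cov2)
  finally show ?thesis using e1 e2 by (simp add: J_def)
qed


text \<open>
  The form used in all length-area arguments: the integral over the image is at most the integral over a
  larger set \<open>B\<close>, and the other side is an iterated integral, so that a lower bound may be found line by line.
\<close>
lemma area_inequality:
  fixes \<Psi> :: "complex \<Rightarrow> complex" and W :: "complex \<Rightarrow> real"
  assumes S: "open S" and inj: "inj_on \<Psi> S"
    and der: "\<And>z. z \<in> S \<Longrightarrow> (\<Psi> has_derivative (\<lambda>v. \<alpha> z * v + \<beta> z * cnj v)) (at z)"
    and c\<alpha>: "continuous_on S \<alpha>" and c\<beta>: "continuous_on S \<beta>"
    and W: "W \<in> borel_measurable borel" and W0: "\<And>w. W w \<ge> 0"
    and B: "\<Psi> ` S \<subseteq> B" and fin: "(\<integral>\<^sup>+w\<in>B. ennreal (W w) \<partial>lborel) < \<infinity>"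
  shows "(\<integral>\<^sup>+x. \<integral>\<^sup>+y. indicator S (Complex x y) * ennreal (\<bar>(cmod (\<alpha> (Complex x y)))\<^sup>2 - (cmod (\<beta> (Complex x y)))\<^sup>2\<bar> * W (\<Psi> (Complex x y))) \<partial>lborel \<partial>lborel)
    \<le> (\<integral>\<^sup>+w\<in>B. ennreal (W w) \<partial>lborel)"
proof -
  have c: "continuous_on S \<Psi>"
    using der by (intro has_derivative_continuous_on) (auto intro: has_derivative_at_withinI)
  have op: "open (\<Psi> ` S)" using invariance_of_domain[OF c S inj] .
  have m1: "(\<lambda>z. indicator S z *\<^sub>R \<Psi> z) \<in> borel_measurable borel"
    using S c by (intro borel_measurable_continuous_on_indicator) auto
  have m2: "(\<lambda>z. indicator S z *\<^sub>R \<bar>(cmod (\<alpha> z))\<^sup>2 - (cmod (\<beta> z))\<^sup>2\<bar>) \<in> borel_measurable borel"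
    using S by (intro borel_measurable_continuous_on_indicator continuous_intros c\<alpha> c\<beta>) auto
  have "(\<lambda>z. (indicator S z *\<^sub>R \<bar>(cmod (\<alpha> z))\<^sup>2 - (cmod (\<beta> z))\<^sup>2\<bar>) * W (indicator S z *\<^sub>R \<Psi> z)) \<in> borel_measurable borel"
    by (intro borel_measurable_times m2 measurable_compose[OF m1 W])
  also have "(\<lambda>z. (indicator S z *\<^sub>R \<bar>(cmod (\<alpha> z))\<^sup>2 - (cmod (\<beta> z))\<^sup>2\<bar>) * W (indicator S z *\<^sub>R \<Psi> z)) =
    (\<lambda>z. indicator S z * (\<bar>(cmod (\<alpha> z))\<^sup>2 - (cmod (\<beta> z))\<^sup>2\<bar> * W (\<Psi> z)))"
    by (auto simp: fun_eq_iff indicator_def)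
  finally have m: "(\<lambda>z. indicator S z * (\<bar>(cmod (\<alpha> z))\<^sup>2 - (cmod (\<beta> z))\<^sup>2\<bar> * W (\<Psi> z))) \<in> borel_measurable borel" .
  have le: "(\<integral>\<^sup>+w\<in>\<Psi> ` S. ennreal (W w) \<partial>lborel) \<le> (\<integral>\<^sup>+w\<in>B. ennreal (W w) \<partial>lborel)"
    using B by (intro nn_integral_mono) (auto simp: indicator_def)
  have "(\<integral>\<^sup>+x. \<integral>\<^sup>+y. indicator S (Complex x y) * ennreal (\<bar>(cmod (\<alpha> (Complex x y)))\<^sup>2 - (cmod (\<beta> (Complex x y)))\<^sup>2\<bar> * W (\<Psi> (Complex x y))) \<partial>lborel \<partial>lborel)
     = (\<integral>\<^sup>+x. \<integral>\<^sup>+y. (\<lambda>z. ennreal (indicator S z * (\<bar>(cmod (\<alpha> z))\<^sup>2 - (cmod (\<beta> z))\<^sup>2\<bar> * W (\<Psi> z)))) (Complex x y) \<partial>lborel \<partial>lborel)"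
    by (intro nn_integral_cong) (auto simp: indicator_def)
  also have "\<dots> = (\<integral>\<^sup>+z. ennreal (indicator S z * (\<bar>(cmod (\<alpha> z))\<^sup>2 - (cmod (\<beta> z))\<^sup>2\<bar> * W (\<Psi> z))) \<partial>lborel)"
    using m by (subst nn_integral_complex_iterated) auto
  also have "\<dots> = (\<integral>\<^sup>+z\<in>S. ennreal (\<bar>(cmod (\<alpha> z))\<^sup>2 - (cmod (\<beta> z))\<^sup>2\<bar> * W (\<Psi> z)) \<partial>lborel)"
    by (intro nn_integral_cong) (auto simp: indicator_def)
  also have "\<dots> = (\<integral>\<^sup>+w\<in>\<Psi> ` S. ennreal (W w) \<partial>lborel)"
    using S op le fin by (intro nn_integral_image inj W W0 m) (auto intro: has_derivative_at_withinI der)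
  finally show ?thesis using le by simp
qed

text \<open>
  The exponential function maps a rectangle of area $2 \pi \ln (1/\delta)$ onto the annulus and has Jacobian
  $|w|^2$ in terms of the image point.
\<close>
lemma nn_integral_log_annulus:
  assumes "0 < \<delta>" "\<delta> < 1"
  shows "(\<integral>\<^sup>+w\<in>{w. \<delta> < cmod w \<and> cmod w < 1}. ennreal (1 / (cmod w)\<^sup>2) \<partial>lborel) = ennreal (2 * pi * ln (1 / \<delta>))"
proof -
  define S where "S = {z. ln \<delta> < Re z \<and> Re z < 0 \<and> 0 \<le> Im z \<and> Im z < 2 * pi}"
  have Sb: "S \<in> sets borel" unfolding S_def by measurable
  have im: "exp ` S = {w. \<delta> < cmod w \<and> cmod w < 1}"
  proof (intro equalityI subsetI)
    fix w assume "w \<in> exp ` S" then show "w \<in> {w. \<delta> < cmod w \<and> cmod w < 1}"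
      using assms by (auto simp: S_def exp_less_cancel_iff[of "ln \<delta>", symmetric, simplified exp_ln])
  next
    fix w assume w: "w \<in> {w. \<delta> < cmod w \<and> cmod w < 1}"
    then have w0: "w \<noteq> 0" "cmod w > 0" using assms by auto
    define z where "z = Complex (ln (cmod w)) (Arg2pi w)"
    have "exp z = w" 
      using Arg2pi_eq[of w] w0 by (simp add: z_def Complex_eq exp_add exp_of_real mult.commute)
    moreover have "z \<in> S" using w w0 assms Arg2pi[of w] by (auto simp: S_def z_def ln_less_zero)
    ultimately show "w \<in> exp ` S" by force
  qed
  have inj: "inj_on exp S"
  proof (rule inj_onI)
    fix z w assume zw: "z \<in> S" "w \<in> S" "exp z = exp w"
    show "z = w" by (rule exp_complex_eqI) (use zw in \<open>auto simp: S_def\<close>)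
  qed
  have one: "\<bar>(cmod (exp z))\<^sup>2 - (cmod 0)\<^sup>2\<bar> * (1 / (cmod (exp z))\<^sup>2) = 1" for z :: complex
    by simp
  have ind: "(indicator S (Complex x y) :: ennreal) = indicator {ln \<delta><..<0} x * indicator {0..<2 * pi} y" for x y
    by (auto simp: S_def indicator_def)
  have "(\<integral>\<^sup>+z\<in>S. 1 \<partial>lborel) = (\<integral>\<^sup>+x. \<integral>\<^sup>+y. indicator S (Complex x y) \<partial>lborel \<partial>lborel)"
    using Sb by (simp add: nn_integral_complex_iterated del: nn_integral_indicator)
  also have "\<dots> = ennreal (- ln \<delta>) * ennreal (2 * pi)"
    unfolding ind using assms by (simp add: nn_integral_cmult nn_integral_multc)
  finally have area: "(\<integral>\<^sup>+z\<in>S. 1 \<partial>lborel) = ennreal (2 * pi * ln (1 / \<delta>))"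
    using assms by (simp add: ennreal_mult[symmetric] ln_div mult.commute)
  have "(\<integral>\<^sup>+z\<in>S. ennreal (\<bar>(cmod (exp z))\<^sup>2 - (cmod 0)\<^sup>2\<bar> * (1 / (cmod (exp z))\<^sup>2)) \<partial>lborel) =
    (\<integral>\<^sup>+w\<in>exp ` S. ennreal (1 / (cmod w)\<^sup>2) \<partial>lborel)"
  proof (rule nn_integral_image[OF Sb _ inj])
    show "exp ` S \<in> sets borel" unfolding im by measurable
    show "(exp has_derivative (\<lambda>v. exp z * v + 0 * cnj v)) (at z within S)" for z :: complex
      using DERIV_exp[of z] by (auto simp: has_field_derivative_def intro: has_derivative_at_withinI)
    show "(\<lambda>z. indicator S z * (\<bar>(cmod (exp z))\<^sup>2 - (cmod 0)\<^sup>2\<bar> * (1 / (cmod (exp z))\<^sup>2))) \<in> borel_measurable borel"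
      unfolding one using Sb by simp
  qed (use area in \<open>simp_all only: one, simp_all\<close>)
  then show ?thesis unfolding one im using area by simp
qed

section \<open>Taylor and Fourier coefficients in the disc\<close>

abbreviation taylor_coeff :: "(complex \<Rightarrow> complex) \<Rightarrow> nat \<Rightarrow> complex"
  where "taylor_coeff H n \<equiv> fps_nth (fps_expansion H 0) n"

lemma fps_expansion_eqI: "H has_fps_expansion F \<Longrightarrow> fps_expansion H 0 = F" for H :: "complex \<Rightarrow> complex"
  by (rule fps_ext) (simp add: fps_nth_fps_expansion fps_expansion_def)

lemma has_fps_expansion_disc:
  "H holomorphic_on ball 0 1 \<Longrightarrow> H has_fps_expansion fps_expansion H 0"
  by (rule has_fps_expansion_fps_expansion[of "ball 0 1"]) auto

lemma taylor_sums:
  assumes "H holomorphic_on ball 0 1" "cmod z < 1"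
  shows "(\<lambda>n. taylor_coeff H n * z ^ n) sums H z"
  using holomorphic_power_series[of H 0 1 z] assms by (simp add: fps_expansion_def)

text \<open>
  Cauchy's formula on the circle of radius \<open>r\<close>, read as a statement about Fourier coefficients.
\<close>
lemma fourier_coeff_holomorphic:
  assumes H: "H holomorphic_on ball 0 1" and r: "0 < r" "r < 1"
  shows "((\<lambda>t. H (of_real r * cis t) * cis (- (real n * t))) has_integral 2 * pi * r ^ n * taylor_coeff H n) {0..2*pi}"
proof -
  have "((\<lambda>u. H u / (u - 0) ^ Suc n) has_contour_integral ((2 * pi * \<i>) / fact n * (deriv ^^ n) H 0)) (circlepath 0 r)"
    using H r by (intro Cauchy_has_contour_integral_higher_derivative_circlepath)
      (auto intro!: holomorphic_on_imp_continuous_on intro: holomorphic_on_subset)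
  then have 1: "((\<lambda>t. H (r * cis t) / (r * cis t) ^ Suc n * r * \<i> * cis t) has_integral
      ((2 * pi * \<i>) / fact n * (deriv ^^ n) H 0)) {0..2*pi}"
    unfolding circlepath_def by (subst (asm) has_contour_integral_part_circlepath_iff) auto
  have "((\<lambda>t. (r ^ n / \<i>) * (H (r * cis t) / (r * cis t) ^ Suc n * r * \<i> * cis t)) has_integral
      (r ^ n / \<i>) * ((2 * pi * \<i>) / fact n * (deriv ^^ n) H 0)) {0..2*pi}"
    by (rule has_integral_mult_right[OF 1])
  moreover have "(r ^ n / \<i>) * (H (r * cis t) / (r * cis t) ^ Suc n * r * \<i> * cis t) =
     H (of_real r * cis t) * cis (- (real n * t))" for t
  proof -
    have "cis (- (real n * t)) = inverse (cis t ^ n)" by (simp add: Complex.DeMoivre cis_inverse)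
    then show ?thesis using r by (simp add: field_simps)
  qed
  moreover have "(r ^ n / \<i>) * ((2 * pi * \<i>) / fact n * (deriv ^^ n) H 0) = 2 * pi * r ^ n * taylor_coeff H n"
    by (simp add: fps_expansion_def field_simps)
  ultimately show ?thesis by simp
qed

lemma fourier_coeff_holomorphic_neg:
  assumes H: "H holomorphic_on ball 0 1" and r: "0 < r" "r < 1" and n: "n \<ge> 1"
  shows "((\<lambda>t. H (of_real r * cis t) * cis (real n * t)) has_integral 0) {0..2*pi}"
proof -
  have "(\<lambda>z. H z * z ^ n) holomorphic_on ball 0 1" using H by (intro holomorphic_intros)
  from fourier_coeff_holomorphic[OF this r, of 0]
  have 1: "((\<lambda>t. H (r * cis t) * (r * cis t) ^ n) has_integral 0) {0..2*pi}"
    using n by (simp add: fps_expansion_def power_0_left)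
  have "((\<lambda>t. (1 / of_real r ^ n) * (H (r * cis t) * (r * cis t) ^ n)) has_integral (1 / of_real r ^ n) * 0) {0..2*pi}"
    by (rule has_integral_mult_right[OF 1])
  moreover have "(1 / of_real r ^ n) * (H (r * cis t) * (r * cis t) ^ n) = H (of_real r * cis t) * cis (real n * t)" for t
    using r by (simp add: power_mult_distrib Complex.DeMoivre)
  ultimately show ?thesis by simp
qed

lemma has_integral_cis_multiple:
  assumes "k \<noteq> (0::int)"
  shows "((\<lambda>t. cis (of_int k * t)) has_integral 0) {0..2*pi}"
proof -
  have "((\<lambda>t. cis (of_int k * t)) has_integral (cis (of_int k * (2 * pi)) / (\<i> * of_int k) - cis (of_int k * 0) / (\<i> * of_int k))) {0..2*pi}"
  proof (intro fundamental_theorem_of_calculus)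
    fix t
    have "((\<lambda>z. exp (\<i> * of_int k * z) / (\<i> * of_int k)) has_field_derivative exp (\<i> * of_int k * of_real t)) (at (of_real t))"
      using assms by (auto intro!: derivative_eq_intros)
    then have "((\<lambda>x. exp (\<i> * of_int k * of_real x) / (\<i> * of_int k)) has_vector_derivative exp (\<i> * of_int k * of_real t)) (at t within {0..2*pi})"
      by (intro has_vector_derivative_real_field)
    then show "((\<lambda>t. cis (of_int k * t) / (\<i> * of_int k)) has_vector_derivative cis (of_int k * t)) (at t within {0..2*pi})"
      by (simp add: cis_conv_exp mult.assoc)
  qed auto
  moreover have "cis (of_int k * (2 * pi)) = 1"
    using cis_multiple_2pi[of "of_int k"] by (simp add: mult.commute mult.left_commute)
  ultimately show ?thesis by simp
qed

text \<open>
  Bessel's inequality for the modes of index $-1$ and $n$, which carry the pole of $1/s$ and one further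
  coefficient in the area theorem.
\<close>
lemma bessel_two_modes:
  fixes V :: "real \<Rightarrow> complex" and A B :: complex
  assumes V: "continuous_on {0..2*pi} V" and n: "n \<ge> 1"
    and A: "((\<lambda>t. V t * cis t) has_integral 2 * pi * A) {0..2*pi}"
    and B: "((\<lambda>t. V t * cis (- (real n * t))) has_integral 2 * pi * B) {0..2*pi}"
  shows "2 * pi * ((cmod A)\<^sup>2 + (cmod B)\<^sup>2) \<le> integral {0..2*pi} (\<lambda>t. (cmod (V t))\<^sup>2)"
proof -
  define p where "p t = A * cis (- t) + B * cis (real n * t)" for t
  have 1: "((\<lambda>t. cnj A * (V t * cis t) + cnj B * (V t * cis (- (real n * t)))) has_integral
      (cnj A * (2 * pi * A) + cnj B * (2 * pi * B))) {0..2*pi}"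
    by (intro has_integral_add has_integral_mult_right A B)
  have 2: "cnj A * (V t * cis t) + cnj B * (V t * cis (- (real n * t))) = V t * cnj (p t)" for t
    by (simp add: p_def cis_cnj algebra_simps)
  have 3: "cnj A * (2 * pi * A) + cnj B * (2 * pi * B) = of_real (2 * pi * ((cmod A)\<^sup>2 + (cmod B)\<^sup>2))"
    by (simp add: complex_norm_square algebra_simps del: of_real_power)
  have i1: "((\<lambda>t. Re (V t * cnj (p t))) has_integral 2 * pi * ((cmod A)\<^sup>2 + (cmod B)\<^sup>2)) {0..2*pi}"
    using has_integral_Re[OF 1[unfolded 2 3]] by simp
  have "((\<lambda>t. cis (of_int (int (n + 1)) * t)) has_integral 0) {0..2*pi}"
    by (rule has_integral_cis_multiple) auto
  then have "((\<lambda>t. 2 * (cnj A * B * cis (real (n + 1) * t))) has_integral 2 * (cnj A * B * 0)) {0..2*pi}"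
    by (intro has_integral_mult_right) simp
  from has_integral_Re[OF this] have 4: "((\<lambda>t. 2 * Re (cnj A * B * cis (real (n + 1) * t))) has_integral 0) {0..2*pi}"
    by simp
  have 5: "(cmod (p t))\<^sup>2 = ((cmod A)\<^sup>2 + (cmod B)\<^sup>2) + 2 * Re (cnj A * B * cis (real (n + 1) * t))" for t
  proof -
    have c: "cnj (cis (- t)) * cis (real n * t) = cis (real (n + 1) * t)"
      by (simp add: cis_cnj cis_mult distrib_right add.commute)
    have a: "cnj (A * cis (- t)) * (B * cis (real n * t)) = cnj A * B * cis (real (n + 1) * t)"
      unfolding c[symmetric] by (simp only: complex_cnj_mult mult_ac)
    have b: "(cmod (x + y))\<^sup>2 = (cmod x)\<^sup>2 + (cmod y)\<^sup>2 + 2 * Re (cnj x * y)" for x y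
      unfolding cmod_power2 by (simp add: power2_eq_square algebra_simps)
    show ?thesis by (simp only: p_def b a norm_mult norm_cis mult_1_right)
  qed
  have i2: "((\<lambda>t. (cmod (p t))\<^sup>2) has_integral 2 * pi * ((cmod A)\<^sup>2 + (cmod B)\<^sup>2)) {0..2*pi}"
    unfolding 5 using has_integral_add[OF has_integral_const_real[of "(cmod A)\<^sup>2 + (cmod B)\<^sup>2" 0 "2*pi"] 4]
    by simp
  have i3: "((\<lambda>t. (cmod (V t))\<^sup>2) has_integral integral {0..2*pi} (\<lambda>t. (cmod (V t))\<^sup>2)) {0..2*pi}"
    by (intro integrable_integral integrable_continuous_real continuous_intros V)
  define I where "I = integral {0..2*pi} (\<lambda>t. (cmod (V t))\<^sup>2)"
  define K where "K = 2 * pi * ((cmod A)\<^sup>2 + (cmod B)\<^sup>2)"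
  have i4: "((\<lambda>t. (cmod (V t))\<^sup>2 - 2 * Re (V t * cnj (p t)) + (cmod (p t))\<^sup>2) has_integral (I - 2 * K + K)) {0..2*pi}"
    unfolding I_def K_def by (intro has_integral_add has_integral_diff has_integral_mult_right i1 i2 i3)
  have sq: "(cmod (V t))\<^sup>2 - 2 * Re (V t * cnj (p t)) + (cmod (p t))\<^sup>2 = (cmod (V t - p t))\<^sup>2" for t
    unfolding cmod_power2 by (simp add: power2_eq_square algebra_simps)
  have "0 \<le> I - 2 * K + K"
    by (rule has_integral_nonneg[OF i4[unfolded sq]]) simp
  then show ?thesis by (simp add: I_def K_def)
qed

text \<open>
  The area inequality is about Lebesgue integrals over open sets, the one-dimensional estimates are about
  gauge integrals over closed intervals; this lemma connects the two.
\<close>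
lemma nn_integral_open_interval:
  fixes f :: "real \<Rightarrow> real"
  assumes f: "(f has_integral I) {a..b}" and f0: "\<And>x. a < x \<Longrightarrow> x < b \<Longrightarrow> f x \<ge> 0"
  and m: "continuous_on {a<..<b} f"
  shows "(\<integral>\<^sup>+x. indicator {a<..<b} x * ennreal (f x) \<partial>lborel) = ennreal I"
proof -
  have 1: "(f has_integral I) {a<..<b}"
    using f has_integral_open_interval[of f I a b] by (simp add: box_real)
  have m': "(\<lambda>x. indicator {a<..<b} x *\<^sub>R f x) \<in> borel_measurable borel"
    by (rule borel_measurable_continuous_on_indicator[OF _ m]) auto
  have "((\<lambda>x. if x \<in> {a<..<b} then f x else 0) has_integral I) UNIV"
    using 1 by (subst has_integral_restrict_UNIV)
  moreover have "(\<lambda>x. if x \<in> {a<..<b} then f x else 0) = (\<lambda>x. indicator {a<..<b} x *\<^sub>R f x)"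
    by (auto simp: indicator_def fun_eq_iff)
  ultimately have "((\<lambda>x. indicator {a<..<b} x *\<^sub>R f x) has_integral I) UNIV" by simp
  from nn_integral_has_integral_lborel[OF m' _ this]
  have "(\<integral>\<^sup>+x. ennreal (indicator {a<..<b} x *\<^sub>R f x) \<partial>lborel) = ennreal I"
    using f0 by (auto simp: indicator_def)
  moreover have "(\<integral>\<^sup>+x. ennreal (indicator {a<..<b} x *\<^sub>R f x) \<partial>lborel) = (\<integral>\<^sup>+x. indicator {a<..<b} x * ennreal (f x) \<partial>lborel)"
    by (intro nn_integral_cong) (auto simp: indicator_def)
  ultimately show ?thesis by simp
qed

lemma holomorphic_div_z:
  assumes "f holomorphic_on ball 0 1" "f 0 = 0"
  obtains g where "g holomorphic_on ball 0 1" "\<And>z. z \<in> ball 0 1 \<Longrightarrow> f z = z * g z"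
    "\<And>n. taylor_coeff g n = taylor_coeff f (Suc n)"
proof -
  define g where "g z = (if z = 0 then deriv f 0 else (f z - f 0) / (z - 0))" for z
  have g: "g holomorphic_on ball 0 1"
    unfolding g_def by (rule pole_lemma_open[OF assms(1)]) auto
  have fg: "f z = z * g z" for z by (simp add: g_def assms)
  have "f has_fps_expansion fps_X * fps_expansion g 0"
    unfolding fg[abs_def] by (intro fps_expansion_intros has_fps_expansion_disc g)
  from fps_expansion_eqI[OF this] have "taylor_coeff g n = taylor_coeff f (Suc n)" for n by simp
  then show ?thesis using that[of g] g fg by blast
qed

section \<open>The area theorem\<close>

text \<open>
  Here $1/s = \tau(z)/z = 1/z + b_0 + b_1 z + \dots$, and the classical area theorem says
  $\sum n |b_n|^2 \le 1$; the lemma bounds a single term. For small $r$ the image of the circle $|z| = r$ under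
  $G = 1/s - b_0$ is an ellipse up to an error $O(r^2)$. A real-linear map \<open>T\<close> turns the ellipse into a
  circle, so that $T \circ G$ maps the annulus $r < |z| < 1$ into a disc of radius
  $M = 1/r + O(r^2)$: the exterior of this disc is connected and contains no boundary point of the image of
  $0 < |z| < r$, so it lies in that image, which is disjoint from the image of the annulus. The area of the
  image of $r < |z| < \rho$ is therefore at most $\pi M^2$, while Bessel's inequality on each circle
  bounds it from below. The error term in $M$ is small enough to disappear as $r \to 0$, and then
  $\rho \to 1$.
\<close>
lemma area_theorem:
  assumes s: "s holomorphic_on ball 0 1" and inj: "inj_on s (ball 0 1)"
    and \<tau>: "\<tau> holomorphic_on ball 0 1" and \<tau>0: "\<tau> 0 = 1"
    and s\<tau>: "\<And>z. z \<in> ball 0 1 \<Longrightarrow> s z * \<tau> z = z"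
    and n: "n \<ge> 1"
  shows "real n * (cmod (taylor_coeff \<tau> (Suc n)))\<^sup>2 \<le> 1"
proof -
  define D where "D = (ball 0 1 - {0} :: complex set)"
  have Dopen: "open D" by (auto simp: D_def)
  have s0: "s 0 = 0" using s\<tau>[of 0] \<tau>0 by simp
  have snz: "s z \<noteq> 0" if "z \<in> D" for z using that s\<tau>[of z] by (auto simp: D_def)
  obtain \<tau>1 where \<tau>1: "\<tau>1 holomorphic_on ball 0 1" "\<And>z. z \<in> ball 0 1 \<Longrightarrow> \<tau> z - 1 = z * \<tau>1 z"
  proof -
    have "(\<lambda>z. \<tau> z - 1) holomorphic_on ball 0 1" by (intro holomorphic_intros \<tau>)
    then show ?thesis
    proof (rule holomorphic_div_z)
      show "\<tau> 0 - 1 = 0" by (simp add: \<tau>0)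
      fix g assume "g holomorphic_on ball 0 1" "\<And>z. z \<in> ball 0 1 \<Longrightarrow> \<tau> z - 1 = z * g z"
      then show thesis by (rule that)
    qed
  qed
  define b0 where "b0 = \<tau>1 0"
  define Q where "Q z = \<tau>1 z - b0" for z
  have Q: "Q holomorphic_on ball 0 1" unfolding Q_def by (intro holomorphic_intros \<tau>1)
  have Q0: "Q 0 = 0" by (simp add: Q_def b0_def)
  have \<tau>Q: "\<tau> z = 1 + z * (b0 + Q z)" if "z \<in> ball 0 1" for z
    using \<tau>1(2)[OF that] by (simp add: Q_def algebra_simps)
  have coeffQ: "taylor_coeff Q n = taylor_coeff \<tau> (Suc n)" if "n \<ge> 1" for n
  proof -
    have "(\<lambda>z. 1 + z * (b0 + Q z)) has_fps_expansion 1 + fps_X * (fps_const b0 + fps_expansion Q 0)"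
      by (intro fps_expansion_intros has_fps_expansion_disc Q)
    also have "?this \<longleftrightarrow> \<tau> has_fps_expansion 1 + fps_X * (fps_const b0 + fps_expansion Q 0)"
    proof (rule has_fps_expansion_cong)
      have "eventually (\<lambda>z. z \<in> ball 0 1) (nhds (0::complex))"
        by (rule eventually_nhds_in_open) auto
      then show "eventually (\<lambda>z. 1 + z * (b0 + Q z) = \<tau> z) (nhds 0)"
        by eventually_elim (simp add: \<tau>Q)
    qed auto
    finally show ?thesis using that by (simp add: fps_expansion_eqI)
  qed
  obtain Q1 where Q1: "Q1 holomorphic_on ball 0 1" "\<And>z. z \<in> ball 0 1 \<Longrightarrow> Q z = z * Q1 z"
    by (rule holomorphic_div_z[OF Q Q0]) (rule that, auto)
  define b1 where "b1 = Q1 0"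
  obtain P where P: "P holomorphic_on ball 0 1" "\<And>z. z \<in> ball 0 1 \<Longrightarrow> Q1 z - b1 = z * P z"
  proof -
    have "(\<lambda>z. Q1 z - b1) holomorphic_on ball 0 1" by (intro holomorphic_intros Q1)
    then show ?thesis
    proof (rule holomorphic_div_z)
      show "Q1 0 - b1 = 0" by (simp add: b1_def)
      fix g assume "g holomorphic_on ball 0 1" "\<And>z. z \<in> ball 0 1 \<Longrightarrow> Q1 z - b1 = z * g z"
      then show thesis by (rule that)
    qed
  qed
  have QP: "Q z = b1 * z + z\<^sup>2 * P z" if "z \<in> ball 0 1" for z
    using P(2)[OF that] Q1(2)[OF that] by (simp add: power2_eq_square algebra_simps)
  define G where "G z = 1 / s z - b0" for z
  have GQ: "G z = 1 / z + Q z" if "z \<in> D" for z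
  proof -
    have "z \<noteq> 0" "z \<in> ball 0 1" using that by (auto simp: D_def)
    then show ?thesis using snz[OF that] s\<tau>[of z] \<tau>Q[of z] by (simp add: G_def field_simps)
  qed
  have injG: "inj_on G D"
    proof (rule inj_onI)
    fix x y assume xy: "x \<in> D" "y \<in> D" "G x = G y"
    then have "s x = s y" using snz by (simp add: G_def)
    then show "x = y" using inj xy by (auto simp: D_def inj_on_def)
  qed
  obtain C where C: "C > 0" "\<And>z. cmod z \<le> 1/2 \<Longrightarrow> cmod (P z) \<le> C"
  proof -
    have "compact (P ` cball 0 (1/2))"
      by (intro compact_continuous_image holomorphic_on_imp_continuous_on holomorphic_on_subset[OF P(1)]) auto
    then obtain C where "\<forall>x\<in>P ` cball 0 (1/2). cmod x \<le> C" using compact_imp_bounded bounded_iff by metis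
    then show ?thesis by (intro that[of "max C 1"]) (auto simp: le_max_iff_disj)
  qed
  define V where "V z = - 1 / z + z * deriv Q z" for z
  have dG: "(G has_field_derivative V z / z) (at z)" if z: "z \<in> D" for z
  proof -
    have "z \<noteq> 0" "z \<in> ball 0 1" using z by (auto simp: D_def)
    then have "((\<lambda>z. 1 / z + Q z) has_field_derivative (- 1 / z\<^sup>2 + deriv Q z)) (at z)"
      by (auto intro!: derivative_eq_intros holomorphic_derivI[OF Q] simp: power2_eq_square field_simps)
    moreover have "- 1 / z\<^sup>2 + deriv Q z = V z / z"
      using \<open>z \<noteq> 0\<close> by (simp add: V_def field_simps power2_eq_square)
    ultimately have "((\<lambda>z. 1 / z + Q z) has_field_derivative V z / z) (at z)" by simp
    then show ?thesis
      by (rule DERIV_cong_ev[THEN iffD1, rotated -1])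
         (use eventually_nhds_in_open[OF Dopen z] in \<open>auto elim!: eventually_mono simp: GQ\<close>)
  qed
  have V_cont: "continuous_on D V"
    unfolding V_def by (intro continuous_intros holomorphic_on_imp_continuous_on
        holomorphic_on_subset[OF holomorphic_deriv[OF Q]]) (auto simp: D_def)
  define t where "t = cmod (taylor_coeff \<tau> (Suc n))"
  \<comment> \<open>Bessel on the circle of radius \<open>exp x\<close>: the modes of \<open>V\<close> come from the pole and from \<open>taylor_coeff \<tau> (Suc n)\<close>\<close>
  have low: "2 * pi * (exp (-2 * x) + (real n * t)\<^sup>2 * exp (2 * real n * x)) \<le>
      integral {0..2*pi} (\<lambda>y. (cmod (V (exp (Complex x y))))\<^sup>2)" if x: "x < 0" for x
  proof -
    have expz: "exp (Complex x y) = of_real (exp x) * cis y" for y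
      by (simp add: complex_eq_iff Re_exp Im_exp)
    have inD: "exp (Complex x y) \<in> D" for y using x by (auto simp: D_def norm_exp_eq_Re)
    have H: "(\<lambda>z. z * deriv Q z) holomorphic_on ball 0 1"
      by (intro holomorphic_intros holomorphic_deriv Q) auto
    have c: "taylor_coeff (\<lambda>z. z * deriv Q z) n = of_nat n * taylor_coeff \<tau> (Suc n)"
    proof -
      have "(\<lambda>z. z * deriv Q z) has_fps_expansion fps_X * fps_deriv (fps_expansion Q 0)"
        by (intro fps_expansion_intros has_fps_expansion_disc Q)
      from fps_expansion_eqI[OF this] show ?thesis using n coeffQ[OF n] by (cases n) (auto simp: algebra_simps)
    qed
    have ex: "0 < exp x" "exp x < 1" using x by auto
    have V: "V (exp (Complex x y)) = - of_real (exp (- x)) * cis (- y) + (of_real (exp x) * cis y) * deriv Q (of_real (exp x) * cis y)" for y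
      unfolding V_def expz by (simp add: exp_minus field_simps flip: cis_inverse)
    have k1: "((\<lambda>y. cis (of_int (- int (n + 1)) * y)) has_integral 0) {0..2*pi}"
      by (rule has_integral_cis_multiple) auto
    have A: "((\<lambda>y. V (exp (Complex x y)) * cis y) has_integral 2 * pi * (- complex_of_real (exp (- x)))) {0..2*pi}"
    proof -
      have "((\<lambda>y. - of_real (exp (- x)) + (of_real (exp x) * cis y) * deriv Q (of_real (exp x) * cis y) * cis (real 1 * y))
        has_integral (2 * pi * (- complex_of_real (exp (- x))) + 0)) {0..2*pi}"
        using has_integral_add[OF has_integral_const_real[of "- of_real (exp (- x)) :: complex" 0 "2*pi"]
          fourier_coeff_holomorphic_neg[OF H ex, of 1]] by (simp add: scaleR_conv_of_real)
      moreover have "V (exp (Complex x y)) * cis y = - of_real (exp (- x)) + (of_real (exp x) * cis y) * deriv Q (of_real (exp x) * cis y) * cis (real 1 * y)" for y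
        unfolding V by (simp add: algebra_simps cis_mult)
      ultimately show ?thesis by simp
    qed
    have B: "((\<lambda>y. V (exp (Complex x y)) * cis (- (real n * y))) has_integral 2 * pi * (of_real (exp x) ^ n * (of_nat n * taylor_coeff \<tau> (Suc n)))) {0..2*pi}"
    proof -
      have "((\<lambda>y. - of_real (exp (- x)) * cis (of_int (- int (n + 1)) * y) +
          (of_real (exp x) * cis y) * deriv Q (of_real (exp x) * cis y) * cis (- (real n * y)))
        has_integral (- of_real (exp (- x)) * 0 + 2 * pi * exp x ^ n * (of_nat n * taylor_coeff \<tau> (Suc n)))) {0..2*pi}"
        unfolding c[symmetric]
        by (intro has_integral_add has_integral_mult_right k1 fourier_coeff_holomorphic[OF H ex])
      moreover have "V (exp (Complex x y)) * cis (- (real n * y)) = - of_real (exp (- x)) * cis (of_int (- int (n + 1)) * y) +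
          (of_real (exp x) * cis y) * deriv Q (of_real (exp x) * cis y) * cis (- (real n * y))" for y
        unfolding V by (simp add: algebra_simps cis_mult)
      ultimately show ?thesis by (simp add: mult.assoc)
    qed
    have ex2: "exp (-2 * x) = (exp (- x))\<^sup>2" "exp (2 * real n * x) = (exp x ^ n)\<^sup>2"
      by (simp_all add: power2_eq_square flip: exp_add exp_of_nat_mult)
    have "continuous_on {0..2*pi} (\<lambda>y. V (exp (Complex x y)))"
      unfolding Complex_eq by (intro continuous_on_compose2[OF V_cont] continuous_intros) (use inD in \<open>auto simp: Complex_eq\<close>)
    from bessel_two_modes[OF this n A B] show ?thesis
      unfolding ex2 by (simp add: norm_mult norm_power t_def power_mult_distrib mult_ac)
  qed
  \<comment> \<open>the area inequality on the annulus\<close>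
  have main: "(1 / r\<^sup>2 - 1 / \<rho>\<^sup>2) + real n * t\<^sup>2 * (\<rho> ^ (2 * n) - r ^ (2 * n)) \<le> (1 / r + 2 * C * r\<^sup>2)\<^sup>2"
    if r: "0 < r" "r < 1/2" "cmod b1 * r\<^sup>2 \<le> 1/2" and \<rho>: "r < \<rho>" "\<rho> < 1" for r \<rho>
  proof -
    define m where "m = b1 * of_real (r\<^sup>2)"
    have m: "cmod m \<le> 1/2" using r by (simp add: m_def norm_mult norm_power)
    define \<kappa> where "\<kappa> = 1 - (cmod m)\<^sup>2"
    have "(cmod m)\<^sup>2 \<le> (1/2)\<^sup>2" using m by (intro power_mono) auto
    then have \<kappa>: "3/4 \<le> \<kappa>" "\<kappa> \<le> 1" by (simp_all add: \<kappa>_def power2_eq_square)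
    \<comment> \<open>the inverse of \<open>w + m * cnj w\<close>, which maps the circle of radius \<open>1 / r\<close> to the limiting ellipse\<close>
    define T where "T w = (w - m * cnj w) / of_real \<kappa>" for w
    define M where "M = 1 / r + 2 * C * r\<^sup>2"
    have M0: "M > 0" using r C by (auto simp: M_def intro!: add_pos_pos)
    define u where "u z = T (G z)" for z
    have Tlow: "cmod w / 2 \<le> cmod (T w)" for w
    proof -
      have "cmod w - cmod (m * cnj w) \<le> cmod (w - m * cnj w)" by (rule norm_triangle_ineq2)
      moreover have "cmod (m * cnj w) \<le> 1/2 * cmod w" using mult_right_mono[OF m, of "cmod w"] by (simp add: norm_mult)
      moreover have "cmod w / 2 * \<kappa> \<le> cmod w / 2" using \<kappa> by (simp add: mult_left_le)
      ultimately have "cmod w / 2 * \<kappa> \<le> cmod (w - m * cnj w)" by linarith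
      then show ?thesis using \<kappa> by (simp add: T_def norm_divide pos_le_divide_eq mult_left_le)
    qed
    have Tdiff: "T w - T w' = T (w - w')" for w w'
      by (simp add: T_def diff_divide_distrib[symmetric] algebra_simps)
    have bounded_linear_T: "bounded_linear T"
      by (intro linear_conv_bounded_linear[THEN iffD1] linearI)
         (simp_all add: T_def add_divide_distrib diff_divide_distrib algebra_simps scaleR_conv_of_real)
    have injT: "w = w'" if "T w = T w'" for w w'
      using Tlow[of "w - w'"] Tdiff[of w w'] that by simp
    have inju: "inj_on u D"
      using injG injT by (auto simp: inj_on_def u_def)
    have contG: "continuous_on D G"
      using dG by (meson DERIV_isCont continuous_at_imp_continuous_on)
    have contu: "continuous_on D u" unfolding u_def T_def
      by (intro continuous_intros contG) (use \<kappa> in auto)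
    have circ: "cmod (u z) \<le> M" if z: "cmod z = r" for z
    proof -
      have zD: "z \<in> D" "z \<noteq> 0" "z \<in> ball 0 1" using z r by (auto simp: D_def)
      have zz: "z * cnj z = of_real (r\<^sup>2)" using z by (metis complex_norm_square of_real_power)
      then have cz: "m * cnj (1 / z) = b1 * z" using zD(2) by (simp add: m_def field_simps)
      have mm: "m * cnj m = of_real ((cmod m)\<^sup>2)" by (rule complex_norm_square[symmetric])
      define p where "p = z\<^sup>2 * P z"
      have Gz: "G z = 1 / z + m * cnj (1 / z) + p"
        using GQ[OF zD(1)] QP[OF zD(3)] cz by (simp add: p_def)
      have "G z - m * cnj (G z) = (1 - m * cnj m) * (1 / z) + (p - m * cnj p)"
        unfolding Gz by (simp add: algebra_simps)
      also have "1 - m * cnj m = of_real \<kappa>" by (simp add: mm \<kappa>_def)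
      finally have uz: "u z = 1 / z + (p - m * cnj p) / of_real \<kappa>"
        using \<kappa> by (simp add: u_def T_def add_divide_distrib)
      have cp: "cmod p \<le> r\<^sup>2 * C"
        unfolding p_def using C(2)[of z] z r by (simp add: norm_mult norm_power mult_left_mono)
      have "cmod (p - m * cnj p) \<le> cmod p + cmod (m * cnj p)" by (rule norm_triangle_ineq4)
      also have "cmod (m * cnj p) \<le> 1/2 * cmod p" using mult_right_mono[OF m, of "cmod p"] by (simp add: norm_mult)
      finally have "cmod (p - m * cnj p) \<le> 3/2 * (r\<^sup>2 * C)" using cp by simp
      also have "\<dots> \<le> (2 * (r\<^sup>2 * C)) * \<kappa>" 
      proof -
        have "2 * (r\<^sup>2 * C) * (3/4) \<le> (2 * (r\<^sup>2 * C)) * \<kappa>" by (rule mult_left_mono[OF \<kappa>(1)]) (use C in simp)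
        then show ?thesis by (simp add: mult_ac)
      qed
      finally have "cmod ((p - m * cnj p) / of_real \<kappa>) \<le> 2 * C * r\<^sup>2"
        using \<kappa> by (simp add: norm_divide pos_divide_le_eq mult_ac)
      moreover have "cmod (1 / z) = 1 / r" using z by (simp add: norm_divide)
      ultimately show ?thesis unfolding uz M_def using norm_triangle_ineq[of "1/z" "(p - m * cnj p) / of_real \<kappa>"] by linarith
    qed
    \<comment> \<open>near the pole \<open>u\<close> is large\<close>
    have near: "\<exists>\<eta>>0. \<eta> < r \<and> (\<forall>z. z \<noteq> 0 \<and> cmod z < \<eta> \<longrightarrow> cmod (u z) > K)" for K
    proof -
      define N where "N = 2 * \<bar>K\<bar> + cmod b0 + 1"
      have N: "N > 0" by (auto simp: N_def add_nonneg_pos)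
      have "isCont s 0" using holomorphic_on_imp_continuous_on[OF s] by (simp add: continuous_on_eq_continuous_at)
      then have "\<exists>d>0. \<forall>z. cmod z < d \<longrightarrow> cmod (s z) < 1 / N"
        using N s0 unfolding continuous_at_eps_delta by (auto simp: dist_norm)
      then obtain d where d: "d > 0" "\<And>z. cmod z < d \<Longrightarrow> cmod (s z) < 1 / N" by blast
      have "cmod (u z) > K" if z: "z \<noteq> 0" "cmod z < min d (r/2)" for z
      proof -
        have "s z \<noteq> 0" using snz[of z] z r by (auto simp: D_def)
        then have "N < 1 / cmod (s z)" using d(2)[of z] z N by (simp add: field_simps)
        moreover have "cmod (1 / s z) - cmod b0 \<le> cmod (G z)" unfolding G_def by (rule norm_triangle_ineq2)
        ultimately have "cmod (G z) > 2 * \<bar>K\<bar>" by (simp add: norm_divide N_def)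
        then show ?thesis using Tlow[of "G z"] by (simp add: u_def)
      qed
      then show ?thesis using d r by (intro exI[of _ "min d (r/2)"]) auto
    qed
    define X1 where "X1 = {z. 0 < cmod z \<and> cmod z < r}"
    define X2 where "X2 = {z. r < cmod z \<and> cmod z < 1}"
    have X1D: "X1 \<subseteq> D" and X2D: "X2 \<subseteq> D" using r by (auto simp: X1_def X2_def D_def)
    have oX1: "open X1" unfolding X1_def by (intro open_Collect_conj open_Collect_less continuous_intros)
    have oX2: "open X2" unfolding X2_def by (intro open_Collect_conj open_Collect_less continuous_intros)
    have big: "u ` X2 \<subseteq> cball 0 M"
    proof (rule ccontr)
      assume "\<not> ?thesis"
      then obtain w2 where w2: "w2 \<in> u ` X2" "\<not> cmod w2 \<le> M" unfolding subset_iff mem_cball_0 by blast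
      then have w2M: "cmod w2 > M" by simp
      define O' where "O' = - cball (0::complex) M"
      have conn: "connected O'"
        unfolding O'_def by (rule connected_complement_bounded_convex) (auto simp: bounded_cball)
      define A where "A = u ` X1"
      have oA: "open A" unfolding A_def
        by (intro invariance_of_domain oX1 continuous_on_subset[OF contu X1D] inj_on_subset[OF inju X1D])
      define E where "E = - (u ` {z. 0 < cmod z \<and> cmod z \<le> r})"
      have oE: "open E"
        unfolding open_dist
      proof
        fix w assume w: "w \<in> E"
        obtain \<eta> where \<eta>: "\<eta> > 0" "\<eta> < r" "\<And>z. z \<noteq> 0 \<Longrightarrow> cmod z < \<eta> \<Longrightarrow> cmod (u z) > cmod w + 1"
          using near by meson
        define Z where "Z = {z. \<eta> \<le> cmod z \<and> cmod z \<le> r}"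
        have "compact Z"
        proof -
          have "Z = cball 0 r - ball 0 \<eta>" by (auto simp: Z_def)
          then show ?thesis by (simp add: compact_diff)
        qed
        then have "compact (u ` Z)"
          using r \<eta> by (intro compact_continuous_image continuous_on_subset[OF contu]) (auto simp: Z_def D_def)
        then have "closed (u ` Z)" by (rule compact_imp_closed)
        moreover have "w \<notin> u ` Z" using w \<eta> by (auto simp: E_def Z_def)
        ultimately obtain e where e: "e > 0" "ball w e \<subseteq> - (u ` Z)"
          by (meson ComplI open_Compl open_contains_ball)
        have "w' \<in> E" if w': "dist w' w < min e 1" for w'
        proof (rule ccontr)
          assume "w' \<notin> E"
          then obtain z where z: "w' = u z" "0 < cmod z" "cmod z \<le> r" by (auto simp: E_def)
          have "cmod w' < cmod w + 1" using w' norm_triangle_ineq2[of w' w] by (auto simp: dist_norm)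
          then have "\<eta> \<le> cmod z" using \<eta>(3)[of z] z by (cases "cmod z < \<eta>") auto
          then have "w' \<in> u ` Z" using z by (auto simp: Z_def)
          then show False using e w' by (auto simp: dist_commute)
        qed
        then show "\<exists>e>0. \<forall>y. dist y w < e \<longrightarrow> y \<in> E" using e by (intro exI[of _ "min e 1"]) auto
      qed
      have "O' \<subseteq> A \<union> E"
      proof
        fix w assume w: "w \<in> O'"
        show "w \<in> A \<union> E"
        proof (rule ccontr)
          assume "w \<notin> A \<union> E"
          then obtain z where z: "w = u z" "0 < cmod z" "cmod z \<le> r" "z \<notin> X1" by (auto simp: A_def E_def)
          then have "cmod z = r" by (auto simp: X1_def)
          then show False using circ[of z] z w by (auto simp: O'_def)
        qed
      qed
      moreover have "A \<inter> E \<inter> O' = {}" by (auto simp: A_def E_def X1_def)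
      moreover have "A \<inter> O' \<noteq> {}"
      proof -
        obtain \<eta> where \<eta>: "\<eta> > 0" "\<eta> < r" "\<And>z. z \<noteq> 0 \<Longrightarrow> cmod z < \<eta> \<Longrightarrow> cmod (u z) > M"
          using near by meson
        then have "cmod (u (of_real (\<eta>/2))) > M" "complex_of_real (\<eta>/2) \<in> X1" by (auto simp: X1_def)
        then show ?thesis by (auto simp: A_def O'_def not_le)
      qed
      ultimately have "E \<inter> O' = {}" using connectedD[OF conn oA oE] by blast
      moreover have "w2 \<in> E"
      proof -
        obtain z2 where z2: "w2 = u z2" "z2 \<in> X2" using w2 by auto
        have "u z2 \<noteq> u z" if "0 < cmod z" "cmod z \<le> r" for z
        proof -
          have "z2 \<in> D" "z \<in> D" using z2 X2D that r by (auto simp: D_def)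
          moreover have "z2 \<noteq> z" using z2 that by (auto simp: X2_def)
          ultimately show ?thesis using inj_onD[OF inju] by blast
        qed
        then show ?thesis using z2 by (auto simp: E_def)
      qed
      ultimately show False using w2M by (auto simp: O'_def)
    qed
    define S where "S = {\<zeta>. ln r < Re \<zeta> \<and> Re \<zeta> < ln \<rho> \<and> 0 < Im \<zeta> \<and> Im \<zeta> < 2 * pi}"
    have oS: "open S" unfolding S_def by (intro open_Collect_conj open_Collect_less continuous_intros)
    have expS: "r < cmod (exp \<zeta>)" "cmod (exp \<zeta>) < \<rho>" "exp \<zeta> \<in> X2" "exp \<zeta> \<in> D" if "\<zeta> \<in> S" for \<zeta>
    proof -
      have "exp (ln r) < exp (Re \<zeta>)" "exp (Re \<zeta>) < exp (ln \<rho>)" using that by (auto simp: S_def)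
      then show 1: "r < cmod (exp \<zeta>)" "cmod (exp \<zeta>) < \<rho>" using r \<rho> by auto
      have "cmod (exp \<zeta>) < 1" "0 < cmod (exp \<zeta>)" using 1 \<rho> r by linarith+
      then show "exp \<zeta> \<in> X2" "exp \<zeta> \<in> D" using 1 unfolding X2_def D_def
        by (simp_all only: mem_Collect_eq Diff_iff mem_ball_0 zero_less_norm_iff) auto
    qed
    have injexp: "inj_on exp S"
    proof (rule inj_onI)
      fix z w assume zw: "z \<in> S" "w \<in> S" "exp z = exp w"
      show "z = w" by (rule exp_complex_eqI) (use zw in \<open>auto simp: S_def\<close>)
    qed
    have der: "((\<lambda>\<zeta>. u (exp \<zeta>)) has_derivative (\<lambda>v. V (exp \<zeta>) / of_real \<kappa> * v + (- m * cnj (V (exp \<zeta>)) / of_real \<kappa>) * cnj v)) (at \<zeta>)"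
      if \<zeta>: "\<zeta> \<in> S" for \<zeta>
    proof -
      have "((\<lambda>\<zeta>. G (exp \<zeta>)) has_field_derivative (V (exp \<zeta>) / exp \<zeta> * exp \<zeta>)) (at \<zeta>)"
        by (rule DERIV_chain2[OF dG DERIV_exp]) (use expS[OF \<zeta>] in auto)
      then have "((\<lambda>\<zeta>. G (exp \<zeta>)) has_derivative (\<lambda>v. V (exp \<zeta>) * v)) (at \<zeta>)"
        by (simp add: has_field_derivative_def)
      then have "((\<lambda>\<zeta>. T (G (exp \<zeta>))) has_derivative (\<lambda>v. T (V (exp \<zeta>) * v))) (at \<zeta>)"
        by (rule bounded_linear.has_derivative[OF bounded_linear_T])
      then show ?thesis unfolding u_def
        by (rule has_derivative_eq_rhs) (use \<kappa> in \<open>auto simp: T_def fun_eq_iff field_simps\<close>)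
    qed
    have cV: "continuous_on S (\<lambda>\<zeta>. V (exp \<zeta>))"
      by (intro continuous_on_compose2[OF V_cont] continuous_intros) (use expS in auto)
    have J: "\<bar>(cmod (V (exp \<zeta>) / of_real \<kappa>))\<^sup>2 - (cmod (- m * cnj (V (exp \<zeta>)) / of_real \<kappa>))\<^sup>2\<bar> * 1 = (cmod (V (exp \<zeta>)))\<^sup>2 / \<kappa>" for \<zeta>
    proof -
      have k: "(cmod m)\<^sup>2 = 1 - \<kappa>" by (simp add: \<kappa>_def)
      have "(cmod (V (exp \<zeta>) / of_real \<kappa>))\<^sup>2 - (cmod (- m * cnj (V (exp \<zeta>)) / of_real \<kappa>))\<^sup>2
          = (cmod (V (exp \<zeta>)))\<^sup>2 / \<kappa>\<^sup>2 - (cmod m)\<^sup>2 * (cmod (V (exp \<zeta>)))\<^sup>2 / \<kappa>\<^sup>2"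
        by (simp add: norm_divide norm_mult power_divide power_mult_distrib)
      also have "\<dots> = (cmod (V (exp \<zeta>)))\<^sup>2 * (1 - (cmod m)\<^sup>2) / \<kappa>\<^sup>2"
        by (simp add: algebra_simps diff_divide_distrib)
      also have "1 - (cmod m)\<^sup>2 = \<kappa>" using k by simp
      finally have "(cmod (V (exp \<zeta>) / of_real \<kappa>))\<^sup>2 - (cmod (- m * cnj (V (exp \<zeta>)) / of_real \<kappa>))\<^sup>2
          = (cmod (V (exp \<zeta>)))\<^sup>2 * \<kappa> / \<kappa>\<^sup>2" .
      then show ?thesis using \<kappa> by (simp add: power2_eq_square)
    qed
    have ballM: "(\<integral>\<^sup>+w\<in>cball (0::complex) M. ennreal 1 \<partial>lborel) = ennreal (pi * M\<^sup>2)"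
      using M0 by (simp add: emeasure_cball unit_ball_vol_2)
    have ineq: "(\<integral>\<^sup>+x. \<integral>\<^sup>+y. indicator S (Complex x y) * ennreal ((cmod (V (exp (Complex x y))))\<^sup>2 / \<kappa>) \<partial>lborel \<partial>lborel) \<le> ennreal (pi * M\<^sup>2)"
    proof -
      have "inj_on (\<lambda>\<zeta>. u (exp \<zeta>)) S"
        using injexp inju expS(4) by (auto simp: inj_on_def)
      moreover have "(\<lambda>\<zeta>. u (exp \<zeta>)) ` S \<subseteq> cball 0 M" using expS(3) big by blast
      moreover have "continuous_on S (\<lambda>\<zeta>. V (exp \<zeta>) / of_real \<kappa>)"
        "continuous_on S (\<lambda>\<zeta>. - m * cnj (V (exp \<zeta>)) / of_real \<kappa>)"
        using \<kappa> by (intro continuous_intros cV; simp)+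
      ultimately show ?thesis
        using area_inequality[OF oS _ der, of "\<lambda>_. 1" "cball 0 M"] unfolding ballM J by simp
    qed
    define f where "f x = 2 * pi / \<kappa> * (exp (-2 * x) + (real n * t)\<^sup>2 * exp (2 * real n * x))" for x
    have f0: "f x \<ge> 0" for x using \<kappa> by (auto simp: f_def intro!: mult_nonneg_nonneg add_nonneg_nonneg)
    define I where "I = pi / \<kappa> * ((1 / r\<^sup>2 - 1 / \<rho>\<^sup>2) + real n * t\<^sup>2 * (\<rho> ^ (2 * n) - r ^ (2 * n)))"
    define FF where "FF x = pi / \<kappa> * (real n * t\<^sup>2 * exp (2 * real n * x) - exp (-2 * x))" for x
    have lnr: "ln r < ln \<rho>" "ln \<rho> < 0" using r \<rho> by auto
    have "(f has_integral (FF (ln \<rho>) - FF (ln r))) {ln r..ln \<rho>}"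
    proof (rule fundamental_theorem_of_calculus)
      fix x
      have "(FF has_real_derivative f x) (at x within {ln r..ln \<rho>})"
        unfolding FF_def f_def using \<kappa> by (auto intro!: derivative_eq_intros simp: power2_eq_square algebra_simps)
      then show "(FF has_vector_derivative f x) (at x within {ln r..ln \<rho>})"
        by (simp add: has_real_derivative_iff_has_vector_derivative)
    qed (use lnr in auto)
    also have "FF (ln \<rho>) - FF (ln r) = I"
    proof -
      have e: "exp (2 * real n * ln x) = x ^ (2 * n)" "exp (-2 * ln x) = 1 / x\<^sup>2" if "x > 0" for x
        using that exp_of_nat_mult[of "2 * n" "ln x"] exp_of_nat_mult[of 2 "ln x"] by (simp_all add: exp_minus divide_inverse)
      have "0 < \<rho>" using r \<rho> by linarith
      show ?thesis unfolding FF_def I_def e[OF \<open>0 < \<rho>\<close>] e[OF r(1)] by (simp add: algebra_simps)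
    qed
    finally have eqI: "(\<integral>\<^sup>+x. indicator {ln r<..<ln \<rho>} x * ennreal (f x) \<partial>lborel) = ennreal I"
      using \<kappa> by (intro nn_integral_open_interval f0) (auto simp: f_def intro!: continuous_intros)
    have "(\<integral>\<^sup>+x. indicator {ln r<..<ln \<rho>} x * ennreal (f x) \<partial>lborel) \<le>
       (\<integral>\<^sup>+x. \<integral>\<^sup>+y. indicator S (Complex x y) * ennreal ((cmod (V (exp (Complex x y))))\<^sup>2 / \<kappa>) \<partial>lborel \<partial>lborel)"
    proof (rule nn_integral_mono)
      fix x
      show "indicator {ln r<..<ln \<rho>} x * ennreal (f x) \<le> (\<integral>\<^sup>+y. indicator S (Complex x y) * ennreal ((cmod (V (exp (Complex x y))))\<^sup>2 / \<kappa>) \<partial>lborel)"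
      proof (cases "x \<in> {ln r<..<ln \<rho>}")
        case True
        then have x: "x < 0" "ln r < x" "x < ln \<rho>" using lnr by auto
        have cont: "continuous_on A (\<lambda>y. (cmod (V (exp (Complex x y))))\<^sup>2 / \<kappa>)" for A
        proof -
          have "exp (Complex x y) \<in> D" for y using x by (auto simp: D_def norm_exp_eq_Re)
          then show ?thesis unfolding Complex_eq using \<kappa>
            by (intro continuous_intros continuous_on_compose2[OF V_cont]) (auto simp: Complex_eq)
        qed
        have "f x \<le> integral {0..2*pi} (\<lambda>y. (cmod (V (exp (Complex x y))))\<^sup>2) / \<kappa>"
          using low[OF x(1)] \<kappa> by (simp add: f_def divide_right_mono)
        also have "\<dots> = integral {0..2*pi} (\<lambda>y. (cmod (V (exp (Complex x y))))\<^sup>2 / \<kappa>)"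
          by (simp add: divide_inverse)
        finally have "ennreal (f x) \<le> ennreal (integral {0..2*pi} (\<lambda>y. (cmod (V (exp (Complex x y))))\<^sup>2 / \<kappa>))"
          by (rule ennreal_leI)
        also have "\<dots> = (\<integral>\<^sup>+y. indicator {0<..<2*pi} y * ennreal ((cmod (V (exp (Complex x y))))\<^sup>2 / \<kappa>) \<partial>lborel)"
          using \<kappa> by (intro nn_integral_open_interval[symmetric] integrable_integral integrable_continuous_real cont) auto
        also have "\<dots> = (\<integral>\<^sup>+y. indicator S (Complex x y) * ennreal ((cmod (V (exp (Complex x y))))\<^sup>2 / \<kappa>) \<partial>lborel)"
          using x by (intro nn_integral_cong) (auto simp: S_def indicator_def)
        finally show ?thesis using True by simp
      qed auto
    qed
    also note ineq
    finally have "ennreal I \<le> ennreal (pi * M\<^sup>2)" unfolding eqI .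
    then have "I \<le> pi * M\<^sup>2" by (subst (asm) ennreal_le_iff) auto
    then have "pi * ((1 / r\<^sup>2 - 1 / \<rho>\<^sup>2) + real n * t\<^sup>2 * (\<rho> ^ (2 * n) - r ^ (2 * n))) \<le> pi * (M\<^sup>2 * \<kappa>)"
      using \<kappa> by (simp add: I_def pos_divide_le_eq mult_ac)
    then have "(1 / r\<^sup>2 - 1 / \<rho>\<^sup>2) + real n * t\<^sup>2 * (\<rho> ^ (2 * n) - r ^ (2 * n)) \<le> M\<^sup>2 * \<kappa>"
      by (subst (asm) mult_le_cancel_left_pos) auto
    also have "\<dots> \<le> M\<^sup>2" using \<kappa> by (simp add: mult_left_le)
    finally show ?thesis by (simp add: M_def)
  qed
  have main2: "real n * t\<^sup>2 * \<rho> ^ (2 * n) \<le> 1 / \<rho>\<^sup>2" if \<rho>: "0 < \<rho>" "\<rho> < 1" for \<rho>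
  proof (rule tendsto_le[OF trivial_limit_at_right_real])
    have "((\<lambda>r. 1 / \<rho>\<^sup>2 + 4 * C * r + 4 * C\<^sup>2 * r ^ 4) \<longlongrightarrow> 1 / \<rho>\<^sup>2 + 4 * C * 0 + 4 * C\<^sup>2 * 0 ^ 4) (at_right 0)"
      by (intro tendsto_intros)
    then show "((\<lambda>r. 1 / \<rho>\<^sup>2 + 4 * C * r + 4 * C\<^sup>2 * r ^ 4) \<longlongrightarrow> 1 / \<rho>\<^sup>2) (at_right 0)" by simp
    have "((\<lambda>r. real n * t\<^sup>2 * (\<rho> ^ (2 * n) - r ^ (2 * n))) \<longlongrightarrow> real n * t\<^sup>2 * (\<rho> ^ (2 * n) - 0 ^ (2 * n))) (at_right 0)"
      by (intro tendsto_intros)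
    then show "((\<lambda>r. real n * t\<^sup>2 * (\<rho> ^ (2 * n) - r ^ (2 * n))) \<longlongrightarrow> real n * t\<^sup>2 * \<rho> ^ (2 * n)) (at_right 0)" using n by (simp add: power_0_left)
    have "((\<lambda>r. cmod b1 * r\<^sup>2) \<longlongrightarrow> cmod b1 * 0\<^sup>2) (at_right 0)" by (intro tendsto_intros)
    then have ev: "eventually (\<lambda>r. cmod b1 * r\<^sup>2 < 1/2) (at_right 0)"
      by (rule order_tendstoD) auto
    have ev2: "eventually (\<lambda>r. 0 < r \<and> r < min (1/2) \<rho>) (at_right (0::real))"
      using eventually_at_right_real[of 0 "min (1/2) \<rho>"] \<rho> by (auto elim!: eventually_mono)
    show "eventually (\<lambda>r. real n * t\<^sup>2 * (\<rho> ^ (2 * n) - r ^ (2 * n)) \<le> 1 / \<rho>\<^sup>2 + 4 * C * r + 4 * C\<^sup>2 * r ^ 4) (at_right 0)"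
      using ev ev2
    proof eventually_elim
      case (elim r)
      have "(1 / r + 2 * C * r\<^sup>2)\<^sup>2 = 1 / r\<^sup>2 + 4 * C * r + 4 * C\<^sup>2 * r ^ 4"
        using elim by (simp add: power2_eq_square field_simps eval_nat_numeral)
      then show ?case using main[of r \<rho>] elim \<rho> by simp
    qed
  qed
  have "real n * t\<^sup>2 * 1 ^ (2 * n) \<le> 1 / (1::real)\<^sup>2"
  proof (rule tendsto_le[of "at_left (1::real)"])
    show "((\<lambda>\<rho>. 1 / \<rho>\<^sup>2) \<longlongrightarrow> 1 / 1\<^sup>2) (at_left (1::real))" by (intro tendsto_intros) auto
    show "((\<lambda>\<rho>. real n * t\<^sup>2 * \<rho> ^ (2 * n)) \<longlongrightarrow> real n * t\<^sup>2 * 1 ^ (2 * n)) (at_left 1)" by (intro tendsto_intros)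
    show "eventually (\<lambda>\<rho>. real n * t\<^sup>2 * \<rho> ^ (2 * n) \<le> 1 / \<rho>\<^sup>2) (at_left 1)"
      using eventually_at_left_real[of 0 1] main2 by (auto elim!: eventually_mono)
  qed auto
  then show ?thesis by (simp add: t_def)
qed

section \<open>Coefficients of univalent holomorphic functions\<close>

lemma taylor_coeff_0: "taylor_coeff f 0 = f 0"
  by (simp add: fps_expansion_def)

lemma taylor_coeff_1: "taylor_coeff f (Suc 0) = deriv f 0"
  by (simp add: fps_expansion_def)

lemma fps_mult_nth_2: "fps_nth (A * B) 2 = fps_nth A 0 * fps_nth B 2 + fps_nth A 1 * fps_nth B 1 + fps_nth A 2 * fps_nth B 0"
  for A B :: "complex fps"
  by (simp add: fps_mult_nth numeral_2_eq_2)

lemma has_fps_expansion_cong_disc: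
  fixes f g :: "complex \<Rightarrow> complex"
  assumes "\<And>z. z \<in> ball 0 1 \<Longrightarrow> f z = g z" "f has_fps_expansion F"
  shows "g has_fps_expansion F"
proof (rule has_fps_expansion_cong[THEN iffD1, rotated 2, OF assms(2)])
  have "eventually (\<lambda>z. z \<in> ball 0 1) (nhds (0::complex))"
    by (rule eventually_nhds_in_open) auto
  then show "eventually (\<lambda>z. f z = g z) (nhds 0)" by eventually_elim (rule assms(1))
qed auto

text \<open>
  The quotients $\sigma = s(z)/z$ and $\tau = z/s(z)$ are holomorphic because a normalized univalent
  function has its only zero at the origin. The area theorem bounds the coefficients of $\tau$.
\<close>
lemma univalent_quotient:
  assumes s: "s holomorphic_on ball 0 1" and inj: "inj_on s (ball 0 1)" and s0: "s 0 = 0" and s1: "deriv s 0 = 1"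
  obtains \<sigma> \<tau> where "\<sigma> holomorphic_on ball 0 1" "\<tau> holomorphic_on ball 0 1" "\<sigma> 0 = 1" "\<tau> 0 = 1"
    "\<And>z. z \<in> ball 0 1 \<Longrightarrow> s z = z * \<sigma> z" "\<And>z. z \<in> ball 0 1 \<Longrightarrow> \<sigma> z * \<tau> z = 1"
    "\<And>n. taylor_coeff \<sigma> n = taylor_coeff s (Suc n)"
    "\<And>n. n \<ge> 1 \<Longrightarrow> real n * (cmod (taylor_coeff \<tau> (Suc n)))\<^sup>2 \<le> 1"
proof -
  obtain \<sigma> where \<sigma>: "\<sigma> holomorphic_on ball 0 1" "\<And>z. z \<in> ball 0 1 \<Longrightarrow> s z = z * \<sigma> z"
    "\<And>n. taylor_coeff \<sigma> n = taylor_coeff s (Suc n)"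
    by (rule holomorphic_div_z[OF s s0]) (rule that)
  have \<sigma>0: "\<sigma> 0 = 1" using \<sigma>(3)[of 0] s1 by (simp add: taylor_coeff_0 taylor_coeff_1)
  have nz: "\<sigma> z \<noteq> 0" if "z \<in> ball 0 1" for z
    using inj_onD[OF inj, of z 0] \<sigma>(2)[OF that] that s0 \<sigma>0 by (cases "z = 0") auto
  define \<tau> where "\<tau> z = 1 / \<sigma> z" for z
  have \<tau>: "\<tau> holomorphic_on ball 0 1" unfolding \<tau>_def by (intro holomorphic_intros \<sigma>) (use nz in auto)
  have st: "\<sigma> z * \<tau> z = 1" if "z \<in> ball 0 1" for z using nz[OF that] by (simp add: \<tau>_def)
  have "real n * (cmod (taylor_coeff \<tau> (Suc n)))\<^sup>2 \<le> 1" if "n \<ge> 1" for n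
  proof (rule area_theorem[OF s inj \<tau> _ _ that])
    show "\<tau> 0 = 1" by (simp add: \<tau>_def \<sigma>0)
    show "s z * \<tau> z = z" if "z \<in> ball 0 1" for z using st[OF that] \<sigma>(2)[OF that] by simp
  qed
  then show ?thesis using that[of \<sigma> \<tau>] \<sigma> \<tau> \<sigma>0 st by (simp add: \<tau>_def)
qed

text \<open>
  In $\sigma \tau = 1$ the area theorem gives $|\tau_j| \le 1$ for $j \ge 2$, and $\tau_1 = -\sigma_1$ is bounded by
  hypothesis. The recursion for the inverse series then expresses the coefficient of index $p - 1$ of $\sigma$
  as a sum of $p - 1$ products of modulus at most one.
\<close>
lemma univalent_coeff_bound_if_previous_small:
  assumes s: "s holomorphic_on ball 0 1" and inj: "inj_on s (ball 0 1)" and s0: "s 0 = 0" and s1: "deriv s 0 = 1"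
    and p: "p \<ge> 3" and small: "\<And>k. 2 \<le> k \<Longrightarrow> k < p \<Longrightarrow> cmod (taylor_coeff s k) \<le> 1"
  shows "cmod (taylor_coeff s p) \<le> real p"
proof -
  obtain \<sigma> \<tau> where \<sigma>: "\<sigma> holomorphic_on ball 0 1" "\<tau> holomorphic_on ball 0 1" "\<sigma> 0 = 1" "\<tau> 0 = 1"
    "\<And>z. z \<in> ball 0 1 \<Longrightarrow> \<sigma> z * \<tau> z = 1"
    "\<And>n. taylor_coeff \<sigma> n = taylor_coeff s (Suc n)"
    "\<And>n. n \<ge> 1 \<Longrightarrow> real n * (cmod (taylor_coeff \<tau> (Suc n)))\<^sup>2 \<le> 1"
    by (rule univalent_quotient[OF s inj s0 s1]) (rule that)
  have "(\<lambda>z. \<sigma> z * \<tau> z) has_fps_expansion fps_expansion \<sigma> 0 * fps_expansion \<tau> 0"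
    by (intro fps_expansion_intros has_fps_expansion_disc \<sigma>)
  then have "(\<lambda>z. 1) has_fps_expansion fps_expansion \<sigma> 0 * fps_expansion \<tau> 0"
    by (rule has_fps_expansion_cong_disc[rotated]) (rule \<sigma>(5))
  moreover have "(\<lambda>z::complex. 1) has_fps_expansion (1 :: complex fps)" by (rule has_fps_expansion_1)
  ultimately have prod: "fps_expansion \<sigma> 0 * fps_expansion \<tau> 0 = 1"
    by (metis fps_expansion_eqI)
  have small\<sigma>: "cmod (taylor_coeff \<sigma> k) \<le> 1" if "k < p - 1" for k
    using that small[of "Suc k"] \<sigma>(3) by (cases "k = 0") (auto simp: \<sigma>(6)[of k] taylor_coeff_0 s1 taylor_coeff_1)
  have \<tau>1: "cmod (taylor_coeff \<tau> j) \<le> 1" if j: "j \<ge> 1" for j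
  proof (cases "j = 1")
    case True
    have "fps_nth (fps_expansion \<sigma> 0 * fps_expansion \<tau> 0) 1 = 0" by (simp add: prod)
    then have "taylor_coeff \<tau> 1 = - taylor_coeff \<sigma> 1"
      by (simp add: fps_mult_nth taylor_coeff_0 \<sigma>(3,4) eq_neg_iff_add_eq_0)
    then show ?thesis using True small\<sigma>[of 1] p by simp
  next
    case False
    define n where "n = j - 1"
    have n: "n \<ge> 1" "j = Suc n" using False j by (auto simp: n_def)
    have "(cmod (taylor_coeff \<tau> j))\<^sup>2 \<le> real n * (cmod (taylor_coeff \<tau> j))\<^sup>2"
      using mult_right_mono[of 1 "real n" "(cmod (taylor_coeff \<tau> j))\<^sup>2"] n by simp
    also have "\<dots> \<le> 1\<^sup>2" using \<sigma>(7)[OF n(1)] n by simp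
    finally show ?thesis by (rule power2_le_imp_le) simp
  qed
  define m where "m = p - 1"
  have m: "m \<ge> 1" "p = Suc m" using p by (auto simp: m_def)
  have "0 = fps_nth (fps_expansion \<sigma> 0 * fps_expansion \<tau> 0) m" using m by (simp add: prod)
  also have "\<dots> = (\<Sum>k<m. taylor_coeff \<sigma> k * taylor_coeff \<tau> (m - k)) + taylor_coeff \<sigma> m"
    by (simp add: fps_mult_nth lessThan_Suc_atMost[symmetric] atMost_atLeast0[symmetric] taylor_coeff_0 \<sigma>(4))
  finally have eq: "taylor_coeff \<sigma> m = - (\<Sum>k<m. taylor_coeff \<sigma> k * taylor_coeff \<tau> (m - k))"
    by (simp add: eq_neg_iff_add_eq_0 add.commute)
  have "cmod (taylor_coeff \<sigma> m) \<le> (\<Sum>k<m. cmod (taylor_coeff \<sigma> k * taylor_coeff \<tau> (m - k)))"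
    unfolding eq norm_minus_cancel by (rule norm_sum)
  also have "\<dots> \<le> (\<Sum>k<m. 1)"
  proof (rule sum_mono)
    fix k assume "k \<in> {..<m}"
    then show "cmod (taylor_coeff \<sigma> k * taylor_coeff \<tau> (m - k)) \<le> 1"
      unfolding norm_mult using small\<sigma>[of k] \<tau>1[of "m - k"] m by (intro mult_le_one) auto
  qed
  also have "\<dots> = real m" by simp
  finally show ?thesis using \<sigma>(6)[of m] m by simp
qed

text \<open>
  The area theorem is applied to the odd square root transform $S(z) = \sqrt{s(z^2)}$, whose reciprocal has
  $-a_2/2$ as its coefficient of index one.
\<close>
lemma bieberbach:
  assumes s: "s holomorphic_on ball 0 1" and inj: "inj_on s (ball 0 1)" and s0: "s 0 = 0" and s1: "deriv s 0 = 1"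
  shows "cmod (taylor_coeff s 2) \<le> 2"
proof -
  obtain \<sigma> \<tau>' where \<sigma>: "\<sigma> holomorphic_on ball 0 1" "\<sigma> 0 = 1"
    "\<And>z. z \<in> ball 0 1 \<Longrightarrow> s z = z * \<sigma> z" "\<And>z. z \<in> ball 0 1 \<Longrightarrow> \<sigma> z * \<tau>' z = 1"
    "\<And>n. taylor_coeff \<sigma> n = taylor_coeff s (Suc n)"
    by (rule univalent_quotient[OF s inj s0 s1]) (rule that)
  have nz: "\<sigma> z \<noteq> 0" if "z \<in> ball 0 1" for z using \<sigma>(4)[OF that] by auto
  obtain \<nu>0 where \<nu>0: "\<nu>0 holomorphic_on ball 0 1" "\<And>z. z \<in> ball 0 1 \<Longrightarrow> \<sigma> z = (\<nu>0 z)\<^sup>2"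
    by (rule contractible_imp_holomorphic_sqrt[OF \<sigma>(1) convex_imp_contractible[OF convex_ball] nz]) (auto intro: that)
  have "(\<nu>0 0)\<^sup>2 = 1" using \<nu>0(2)[of 0] \<sigma>(2) by simp
  then have \<nu>00: "\<nu>0 0 \<noteq> 0" by auto
  define \<nu> where "\<nu> z = \<nu>0 z / \<nu>0 0" for z
  have \<nu>: "\<nu> holomorphic_on ball 0 1" "\<nu> 0 = 1" "\<And>z. z \<in> ball 0 1 \<Longrightarrow> \<sigma> z = \<nu> z * \<nu> z"
    unfolding \<nu>_def using \<nu>0 \<nu>00 \<open>(\<nu>0 0)\<^sup>2 = 1\<close> by (auto intro!: holomorphic_intros simp: power2_eq_square)
  have \<nu>nz: "\<nu> z \<noteq> 0" if "z \<in> ball 0 1" for z using \<nu>(3)[OF that] nz[OF that] by auto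
  define \<mu> where "\<mu> z = 1 / \<nu> z" for z
  have \<mu>: "\<mu> holomorphic_on ball 0 1" unfolding \<mu>_def using \<nu>nz by (intro holomorphic_intros \<nu>) auto
  have "(\<lambda>z. \<nu> z * \<nu> z) has_fps_expansion fps_expansion \<nu> 0 * fps_expansion \<nu> 0"
    by (intro fps_expansion_intros has_fps_expansion_disc \<nu>)
  then have "\<sigma> has_fps_expansion fps_expansion \<nu> 0 * fps_expansion \<nu> 0"
    by (rule has_fps_expansion_cong_disc[rotated]) (simp add: \<nu>(3))
  from fps_expansion_eqI[OF this] have "taylor_coeff \<sigma> 1 = 2 * taylor_coeff \<nu> 1"
    by (simp add: fps_mult_nth taylor_coeff_0 \<nu>(2))
  then have s2: "taylor_coeff s 2 = 2 * taylor_coeff \<nu> 1" using \<sigma>(5)[of 1] by (simp add: numeral_2_eq_2)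
  have "(\<lambda>z. \<nu> z * \<mu> z) has_fps_expansion fps_expansion \<nu> 0 * fps_expansion \<mu> 0"
    by (intro fps_expansion_intros has_fps_expansion_disc \<nu> \<mu>)
  then have "(\<lambda>z. 1) has_fps_expansion fps_expansion \<nu> 0 * fps_expansion \<mu> 0"
    by (rule has_fps_expansion_cong_disc[rotated]) (simp add: \<mu>_def \<nu>nz)
  moreover have "(\<lambda>z::complex. 1) has_fps_expansion (1 :: complex fps)" by (rule has_fps_expansion_1)
  ultimately have prod: "fps_expansion \<nu> 0 * fps_expansion \<mu> 0 = 1"
    by (metis fps_expansion_eqI)
  have "fps_nth (fps_expansion \<nu> 0 * fps_expansion \<mu> 0) 1 = 0" by (simp add: prod)
  then have \<mu>1: "taylor_coeff \<mu> 1 = - taylor_coeff \<nu> 1"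
    by (simp add: fps_mult_nth taylor_coeff_0 \<nu>(2) \<mu>_def[of 0] eq_neg_iff_add_eq_0)
  have sq: "z\<^sup>2 \<in> ball 0 1" if "z \<in> ball 0 1" for z :: complex
    using that by (simp add: norm_power power_less_one_iff)
  define S where "S z = z * \<nu> (z\<^sup>2)" for z
  define \<tau> where "\<tau> z = \<mu> (z\<^sup>2)" for z
  have comp: "(\<lambda>z. k (z\<^sup>2)) holomorphic_on ball 0 1" if "k holomorphic_on ball 0 1" for k
  proof -
    have "(\<lambda>z. z\<^sup>2) holomorphic_on ball (0::complex) 1" by (intro holomorphic_intros)
    moreover have "(\<lambda>z. z\<^sup>2) ` ball (0::complex) 1 \<subseteq> ball 0 1" using sq by blast
    ultimately show ?thesis using holomorphic_on_compose_gen[OF _ that] unfolding o_def by blast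
  qed
  have S2: "(S z)\<^sup>2 = s (z\<^sup>2)" if "z \<in> ball 0 1" for z
    using \<sigma>(3)[OF sq[OF that]] \<nu>(3)[OF sq[OF that]] by (simp add: S_def power2_eq_square algebra_simps)
  have injS: "inj_on S (ball 0 1)"
  proof (rule inj_onI)
    fix x y assume xy: "x \<in> ball 0 1" "y \<in> ball 0 1" "S x = S y"
    then have "s (x\<^sup>2) = s (y\<^sup>2)" using S2 by metis
    then have "x\<^sup>2 = y\<^sup>2" using inj_onD[OF inj] sq xy by blast
    then have "x = y \<or> x = - y" by (simp add: power2_eq_iff)
    then show "x = y"
    proof
      assume x: "x = - y"
      then have "S x = - S y" by (simp add: S_def)
      then have "S y = 0" using xy by (simp add: eq_neg_iff_add_eq_0)
      then have "y = 0" using \<nu>nz[OF sq[OF xy(2)]] by (simp add: S_def)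
      then show ?thesis using x by simp
    qed
  qed
  have "real 1 * (cmod (taylor_coeff \<tau> (Suc 1)))\<^sup>2 \<le> 1"
  proof (rule area_theorem[OF _ injS])
    show "S holomorphic_on ball 0 1" unfolding S_def by (intro holomorphic_intros comp \<nu>)
    show "\<tau> holomorphic_on ball 0 1" unfolding \<tau>_def by (intro comp \<mu>)
    show "\<tau> 0 = 1" by (simp add: \<tau>_def \<mu>_def \<nu>)
    show "S z * \<tau> z = z" if "z \<in> ball 0 1" for z
      using \<nu>nz[OF sq[OF that]] by (simp add: S_def \<tau>_def \<mu>_def)
  qed auto
  moreover have "taylor_coeff \<tau> 2 = taylor_coeff \<mu> 1"
  proof -
    have m: "(\<lambda>z. \<mu> z - 1) holomorphic_on ball 0 1" by (intro holomorphic_intros \<mu>)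
    have "\<mu> 0 - 1 = 0" by (simp add: \<mu>_def \<nu>)
    then obtain k where k: "k holomorphic_on ball 0 1" "\<And>z. z \<in> ball 0 1 \<Longrightarrow> \<mu> z - 1 = z * k z"
      "\<And>n. taylor_coeff k n = taylor_coeff (\<lambda>z. \<mu> z - 1) (Suc n)"
      by (rule holomorphic_div_z[OF m]) (rule that)
    have "(\<lambda>z. \<mu> z - 1) has_fps_expansion fps_expansion \<mu> 0 - 1"
      by (intro fps_expansion_intros has_fps_expansion_disc \<mu>)
    then have k0: "k 0 = taylor_coeff \<mu> 1" using k(3)[of 0] by (simp add: taylor_coeff_0 fps_expansion_eqI)
    have "(\<lambda>z. 1 + z ^ 2 * k (z\<^sup>2)) has_fps_expansion 1 + fps_X ^ 2 * fps_expansion (\<lambda>z. k (z\<^sup>2)) 0"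
      by (intro fps_expansion_intros has_fps_expansion_disc comp k)
    then have "\<tau> has_fps_expansion 1 + fps_X ^ 2 * fps_expansion (\<lambda>z. k (z\<^sup>2)) 0"
    proof (rule has_fps_expansion_cong_disc[rotated])
      fix z :: complex assume "z \<in> ball 0 1"
      then show "1 + z ^ 2 * k (z\<^sup>2) = \<tau> z" using k(2)[OF sq, of z] by (simp add: \<tau>_def algebra_simps)
    qed
    from fps_expansion_eqI[OF this] show ?thesis
      by (simp add: fps_X_power_mult_nth taylor_coeff_0 k0)
  qed
  ultimately have "(cmod (taylor_coeff \<nu> 1))\<^sup>2 \<le> 1\<^sup>2" using \<mu>1 by (simp add: numeral_2_eq_2)
  then have "cmod (taylor_coeff \<nu> 1) \<le> 1" by (rule power2_le_imp_le) simp
  then show ?thesis unfolding s2 by (simp add: norm_mult)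
qed

lemma deriv_nonzero_inj:
  assumes "\<phi> holomorphic_on ball 0 1" "inj_on \<phi> (ball 0 1)"
  shows "deriv \<phi> 0 \<noteq> 0"
  using holomorphic_injective_imp_regular[OF assms(1) open_ball assms(2)] by simp

text \<open>
  If \<open>w\<close> is omitted by \<open>\<psi>\<close>, then $w \psi / (w - \psi)$ is univalent too. The second coefficients of the two
  normalized functions differ by $c/w$ and both are bounded by two.
\<close>
lemma koebe_quarter:
  assumes \<psi>: "\<psi> holomorphic_on ball 0 1" and inj: "inj_on \<psi> (ball 0 1)" and \<psi>0: "\<psi> 0 = 0"
    and w: "w \<notin> \<psi> ` ball 0 1"
  shows "cmod (deriv \<psi> 0) \<le> 4 * cmod w"
proof -
  define c where "c = deriv \<psi> 0"
  have c: "c \<noteq> 0" unfolding c_def by (rule deriv_nonzero_inj[OF \<psi> inj])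
  have w0: "w \<noteq> 0" using w \<psi>0 by force
  have nz: "w - \<psi> z \<noteq> 0" if "z \<in> ball 0 1" for z using w that by auto
  define s where "s z = \<psi> z / c" for z
  define r where "r z = w * \<psi> z / (c * (w - \<psi> z))" for z
  have s: "s holomorphic_on ball 0 1" unfolding s_def using c by (intro holomorphic_intros \<psi>) auto
  have r: "r holomorphic_on ball 0 1" unfolding r_def using c nz by (intro holomorphic_intros \<psi>) auto
  have injs: "inj_on s (ball 0 1)" using inj c by (auto simp: s_def inj_on_def)
  have injr: "inj_on r (ball 0 1)"
  proof (rule inj_onI)
    fix x y assume xy: "x \<in> ball 0 1" "y \<in> ball 0 1" "r x = r y"
    then have "w * \<psi> x * (w - \<psi> y) = w * \<psi> y * (w - \<psi> x)" using nz[of x] nz[of y] c by (simp add: r_def field_simps)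
    then have "\<psi> x = \<psi> y" using w0 by (simp add: algebra_simps)
    then show "x = y" using inj_onD[OF inj] xy by blast
  qed
  have S: "fps_expansion s 0 = fps_expansion \<psi> 0 * fps_const (1 / c)"
    unfolding s_def[abs_def] divide_inverse
    by (rule fps_expansion_eqI, simp, intro fps_expansion_intros has_fps_expansion_disc \<psi>)
  have "(\<lambda>z. c * (r z * (w - \<psi> z))) has_fps_expansion fps_const c * (fps_expansion r 0 * (fps_const w - fps_expansion \<psi> 0))"
    by (intro fps_expansion_intros has_fps_expansion_disc \<psi> r)
  then have "(\<lambda>z. w * \<psi> z) has_fps_expansion fps_const c * (fps_expansion r 0 * (fps_const w - fps_expansion \<psi> 0))"
    by (rule has_fps_expansion_cong_disc[rotated]) (use nz c in \<open>simp add: r_def\<close>)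
  moreover have "(\<lambda>z. w * \<psi> z) has_fps_expansion fps_const w * fps_expansion \<psi> 0"
    by (intro fps_expansion_intros has_fps_expansion_disc \<psi>)
  ultimately have eq: "fps_const c * (fps_expansion r 0 * (fps_const w - fps_expansion \<psi> 0)) = fps_const w * fps_expansion \<psi> 0"
    by (metis fps_expansion_eqI)
  have r0: "taylor_coeff r 0 = 0" by (simp add: taylor_coeff_0 r_def \<psi>0)
  have \<psi>c: "taylor_coeff \<psi> 0 = 0" "taylor_coeff \<psi> 1 = c" by (simp_all add: taylor_coeff_0 taylor_coeff_1 \<psi>0 c_def)
  have "fps_nth (fps_const c * (fps_expansion r 0 * (fps_const w - fps_expansion \<psi> 0))) 1 = w * c"
    unfolding eq using \<psi>c by simp
  then have "c * (taylor_coeff r 1 * w) = w * c" using r0 \<psi>c by (simp add: fps_mult_nth)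
  then have r1: "taylor_coeff r 1 = 1" using c w0 by simp
  have "fps_nth (fps_const c * (fps_expansion r 0 * (fps_const w - fps_expansion \<psi> 0))) 2 = w * taylor_coeff \<psi> 2"
    unfolding eq by simp
  then have "c * (taylor_coeff r 2 * w - c) = w * taylor_coeff \<psi> 2" using r0 r1 \<psi>c by (simp add: fps_mult_nth_2)
  then have r2: "taylor_coeff r 2 = taylor_coeff s 2 + c / w" using c w0 by (simp add: S field_simps)
  have "cmod (taylor_coeff r 2) \<le> 2"
    using bieberbach[OF r injr] r1 by (simp add: taylor_coeff_1 r_def \<psi>0)
  moreover have "cmod (taylor_coeff s 2) \<le> 2"
  proof (rule bieberbach[OF s injs])
    show "s 0 = 0" by (simp add: s_def \<psi>0)
    have "taylor_coeff s 1 = 1" using S \<psi>c c by simp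
    then show "deriv s 0 = 1" by (simp add: taylor_coeff_1)
  qed
  ultimately have "cmod (c / w) \<le> 4"
    using norm_triangle_ineq4[of "taylor_coeff r 2" "taylor_coeff s 2"] r2 by simp
  then show ?thesis using w0 by (simp add: norm_divide field_simps c_def)
qed

text \<open>
  For every unimodular $\eta$ the composition of \<open>\<phi>\<close> with the Koebe function
  $w / (1 - \eta w)^2$ is univalent. Its normalized second coefficient is $c_2/c + 2 \eta c$, and the best
  choice of $\eta$ aligns the two summands.
\<close>
lemma pick_second_coeff:
  assumes \<phi>: "\<phi> holomorphic_on ball 0 1" and inj: "inj_on \<phi> (ball 0 1)" and \<phi>0: "\<phi> 0 = 0"
    and bd: "\<phi> ` ball 0 1 \<subseteq> ball 0 1"
  shows "cmod (taylor_coeff \<phi> 2) \<le> 2 * cmod (deriv \<phi> 0) * (1 - cmod (deriv \<phi> 0))"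
proof -
  define c where "c = deriv \<phi> 0"
  have c: "c \<noteq> 0" unfolding c_def by (rule deriv_nonzero_inj[OF \<phi> inj])
  define u where "u = taylor_coeff \<phi> 2 / c"
  define \<eta> where "\<eta> = (if u = 0 then 1 else sgn u * cnj (sgn c))"
  have \<eta>: "cmod \<eta> = 1" using c by (simp add: \<eta>_def norm_mult norm_sgn)
  have bdz: "cmod (\<phi> z) < 1" if "z \<in> ball 0 1" for z
  proof -
    have "\<phi> z \<in> ball 0 1" using bd that by blast
    then show ?thesis by simp
  qed
  have nz: "1 - \<eta> * \<phi> z \<noteq> 0" if "z \<in> ball 0 1" for z
  proof
    assume "1 - \<eta> * \<phi> z = 0"
    then have "cmod (\<eta> * \<phi> z) = 1" by simp
    then show False using bdz[OF that] \<eta> by (simp add: norm_mult)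
  qed
  define r where "r z = \<phi> z / (c * (1 - \<eta> * \<phi> z)\<^sup>2)" for z
  have r: "r holomorphic_on ball 0 1" unfolding r_def using c nz by (intro holomorphic_intros \<phi>) auto
  have injr: "inj_on r (ball 0 1)"
  proof (rule inj_onI)
    fix x y assume xy: "x \<in> ball 0 1" "y \<in> ball 0 1" "r x = r y"
    then have "\<phi> x * (1 - \<eta> * \<phi> y)\<^sup>2 = \<phi> y * (1 - \<eta> * \<phi> x)\<^sup>2" using nz[of x] nz[of y] c by (simp add: r_def field_simps)
    then have "(\<phi> x - \<phi> y) * (1 - \<eta>\<^sup>2 * (\<phi> x * \<phi> y)) = 0" by (simp add: power2_eq_square algebra_simps)
    moreover have "1 - \<eta>\<^sup>2 * (\<phi> x * \<phi> y) \<noteq> 0"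
    proof
      assume "1 - \<eta>\<^sup>2 * (\<phi> x * \<phi> y) = 0"
      then have "cmod (\<eta>\<^sup>2 * (\<phi> x * \<phi> y)) = 1" by simp
      then have "cmod (\<phi> x) * cmod (\<phi> y) = 1" using \<eta> by (simp add: norm_mult norm_power)
      moreover have "cmod (\<phi> x) < 1" "cmod (\<phi> y) < 1" using bdz xy by blast+
      ultimately show False using mult_strict_mono'[of "cmod (\<phi> x)" 1 "cmod (\<phi> y)" 1] by simp
    qed
    ultimately have "\<phi> x = \<phi> y" by simp
    then show "x = y" using inj_onD[OF inj] xy by blast
  qed
  have "(\<lambda>z. c * (r z * ((1 - \<eta> * \<phi> z) * (1 - \<eta> * \<phi> z)))) has_fps_expansion
      fps_const c * (fps_expansion r 0 * ((1 - fps_const \<eta> * fps_expansion \<phi> 0) * (1 - fps_const \<eta> * fps_expansion \<phi> 0)))"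
    by (intro fps_expansion_intros has_fps_expansion_disc \<phi> r)
  then have "\<phi> has_fps_expansion
      fps_const c * (fps_expansion r 0 * ((1 - fps_const \<eta> * fps_expansion \<phi> 0) * (1 - fps_const \<eta> * fps_expansion \<phi> 0)))"
    by (rule has_fps_expansion_cong_disc[rotated]) (use nz c in \<open>simp add: r_def power2_eq_square\<close>)
  from fps_expansion_eqI[OF this]
  have eq: "fps_const c * (fps_expansion r 0 * ((1 - fps_const \<eta> * fps_expansion \<phi> 0) * (1 - fps_const \<eta> * fps_expansion \<phi> 0))) = fps_expansion \<phi> 0" by simp
  have r0: "taylor_coeff r 0 = 0" by (simp add: taylor_coeff_0 r_def \<phi>0)
  have \<phi>c: "taylor_coeff \<phi> 0 = 0" "taylor_coeff \<phi> 1 = c" by (simp_all add: taylor_coeff_0 taylor_coeff_1 \<phi>0 c_def)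
  have "fps_nth (fps_const c * (fps_expansion r 0 * ((1 - fps_const \<eta> * fps_expansion \<phi> 0) * (1 - fps_const \<eta> * fps_expansion \<phi> 0)))) 1 = c"
    unfolding eq using \<phi>c by simp
  then have r1: "taylor_coeff r 1 = 1" using r0 \<phi>c c by (simp add: fps_mult_nth)
  have "fps_nth (fps_const c * (fps_expansion r 0 * ((1 - fps_const \<eta> * fps_expansion \<phi> 0) * (1 - fps_const \<eta> * fps_expansion \<phi> 0)))) 2 = taylor_coeff \<phi> 2"
    unfolding eq by simp
  then have "c * (taylor_coeff r 2 - 2 * \<eta> * c) = taylor_coeff \<phi> 2"
    using r0 r1 \<phi>c by (simp add: fps_mult_nth_2) (simp add: fps_mult_nth algebra_simps)
  then have r2: "taylor_coeff r 2 = u + 2 * \<eta> * c" using c by (simp add: u_def field_simps)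
  have "cmod (taylor_coeff r 2) \<le> 2"
    using bieberbach[OF r injr] r1 by (simp add: taylor_coeff_1 r_def \<phi>0)
  moreover have "cmod (u + 2 * \<eta> * c) = cmod u + 2 * cmod c"
  proof (cases "u = 0")
    case True then show ?thesis using \<eta> by (simp add: norm_mult)
  next
    case False
    have "cnj (sgn c) * c = of_real (cmod c)"
    proof -
      have "cnj c * c = of_real (cmod c) * of_real (cmod c)"
        using complex_norm_square[of c] by (simp only: power2_eq_square mult.commute of_real_mult)
      then show ?thesis using c by (simp add: sgn_eq)
    qed
    then have "\<eta> * c = sgn u * of_real (cmod c)" using False by (simp add: \<eta>_def mult.assoc)
    moreover have "u = sgn u * of_real (cmod u)" using False by (simp add: sgn_eq)
    moreover have "u + 2 * \<eta> * c = u + 2 * (\<eta> * c)" by simp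
    ultimately have "u + 2 * \<eta> * c = sgn u * of_real (cmod u) + 2 * (sgn u * of_real (cmod c))" by argo
    then have "u + 2 * \<eta> * c = sgn u * of_real (cmod u + 2 * cmod c)"
      by (simp add: algebra_simps)
    then show ?thesis using False by (simp add: norm_mult norm_sgn del: of_real_add)
  qed
  ultimately have "cmod u + 2 * cmod c \<le> 2" using r2 by simp
  then have "cmod c * cmod u \<le> cmod c * (2 - 2 * cmod c)" by (intro mult_left_mono) auto
  moreover have "cmod c * cmod u = cmod (taylor_coeff \<phi> 2)" using c by (simp add: u_def norm_divide)
  ultimately show ?thesis by (simp add: c_def algebra_simps)
qed

section \<open>Winding numbers of increments\<close>

text \<open>
  The loop whose winding number about the origin is the local degree of an injective map at \<open>z\<close>.
\<close>
definition increment_loop :: "(complex \<Rightarrow> complex) \<Rightarrow> complex \<Rightarrow> real \<Rightarrow> real \<Rightarrow> complex"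
  where "increment_loop u z r t = u (z + of_real r * cis (2 * pi * t)) - u z"

lemma winding_number_C1_loop:
  fixes \<gamma> \<gamma>' :: "real \<Rightarrow> complex"
  assumes d: "\<And>t. t \<in> {0..1} \<Longrightarrow> (\<gamma> has_vector_derivative \<gamma>' t) (at t)"
    and c: "continuous_on {0..1} \<gamma>'" and nz: "\<And>t. t \<in> {0..1} \<Longrightarrow> \<gamma> t \<noteq> 0"
  shows "winding_number \<gamma> 0 = 1 / (2 * pi * \<i>) * integral {0..1} (\<lambda>t. \<gamma>' t / \<gamma> t)"
proof -
  have "\<gamma> C1_differentiable_on {0..1}" unfolding C1_differentiable_on_def using d c by blast
  then have v: "valid_path \<gamma>" unfolding valid_path_def
    by (rule C1_differentiable_imp_piecewise)
  have "0 \<notin> path_image \<gamma>" using nz by (auto simp: path_image_def)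
  then have "winding_number \<gamma> 0 = 1 / (2 * pi * \<i>) * contour_integral \<gamma> (\<lambda>w. 1 / (w - 0))"
    by (rule winding_number_valid_path[OF v])
  also have "contour_integral \<gamma> (\<lambda>w. 1 / (w - 0)) = integral {0..1} (\<lambda>t. \<gamma>' t / \<gamma> t)"
    unfolding contour_integral_integral
    by (rule integral_cong) (simp add: vector_derivative_at[OF d])
  finally show ?thesis .
qed

lemma has_vector_derivative_cis_multiple:
  "((\<lambda>t. c * cis (2 * pi * of_int n * t)) has_vector_derivative 2 * pi * \<i> * of_int n * (c * cis (2 * pi * of_int n * t))) (at t)"
proof -
  have "((\<lambda>z. c * exp (2 * of_real pi * \<i> * of_int n * z)) has_field_derivative 2 * pi * \<i> * of_int n * (c * exp (2 * of_real pi * \<i> * of_int n * of_real t))) (at (of_real t))"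
    by (auto intro!: derivative_eq_intros)
  from has_vector_derivative_real_field[OF this] show ?thesis
    by (simp add: cis_conv_exp mult_ac)
qed

lemma winding_number_cis_multiple:
  assumes "c \<noteq> 0"
  shows "winding_number (\<lambda>t. c * cis (2 * pi * of_int n * t)) 0 = of_int n"
  using assms
  by (subst winding_number_C1_loop[OF has_vector_derivative_cis_multiple])
     (auto intro!: continuous_intros continuous_on_cis)

text \<open>
  A form of Rouche's theorem for continuous loops.
\<close>
lemma winding_number_perturb:
  assumes "path g" "path h" "pathfinish g = pathstart g" "pathfinish h = pathstart h"
    and "\<And>t. t \<in> {0..1} \<Longrightarrow> cmod (h t - g t) < cmod (g t)"
  shows "winding_number h 0 = winding_number g 0"
proof -
  have "homotopic_loops (- {0}) g h"
    by (rule homotopic_loops_nearby_explicit) (use assms in auto)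
  then show ?thesis by (metis winding_number_homotopic_loops)
qed

lemma path_cis_multiple:
  "path (\<lambda>t. c * cis (2 * pi * of_int n * t))"
  "pathfinish (\<lambda>t. c * cis (2 * pi * of_int n * t)) = pathstart (\<lambda>t. c * cis (2 * pi * of_int n * t))"
proof -
  show "path (\<lambda>t. c * cis (2 * pi * of_int n * t))"
    unfolding path_def by (intro continuous_intros continuous_on_cis)
  have "cis (2 * pi * of_int n) = 1" using cis_multiple_2pi[of "of_int n"] by (simp add: mult_ac)
  then show "pathfinish (\<lambda>t. c * cis (2 * pi * of_int n * t)) = pathstart (\<lambda>t. c * cis (2 * pi * of_int n * t))"
    by (simp add: pathfinish_def pathstart_def)
qed

lemma circle_point_in_disc:
  assumes "cmod z + r < 1" "0 \<le> r"
  shows "z + of_real r * cis t \<in> ball 0 1"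
  using norm_triangle_ineq[of z "of_real r * cis t"] assms by (simp add: norm_mult)

lemma path_increment_loop:
  assumes "continuous_on (ball 0 1) u" "cmod z + r < 1" "0 \<le> r"
  shows "path (increment_loop u z r)" "pathfinish (increment_loop u z r) = pathstart (increment_loop u z r)"
proof -
  show "path (increment_loop u z r)"
    unfolding path_def increment_loop_def
    by (intro continuous_intros continuous_on_cis continuous_on_compose2[OF assms(1)])
       (auto intro: circle_point_in_disc[OF assms(2,3), unfolded mem_ball_0])
  show "pathfinish (increment_loop u z r) = pathstart (increment_loop u z r)"
    using cis_2pi by (simp add: pathfinish_def pathstart_def increment_loop_def)
qed

text \<open>
  Moving centre and radius linearly is a homotopy of loops, and injectivity keeps the increments away from
  the origin.
\<close>
lemma winding_increment_loop_const:
  assumes c: "continuous_on (ball 0 1) u" and inj: "inj_on u (ball 0 1)"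
    and z: "cmod z + r < 1" "0 < r" and w: "cmod w + s < 1" "0 < s"
  shows "winding_number (increment_loop u z r) 0 = winding_number (increment_loop u w s) 0"
proof -
  define h where "h p = increment_loop u ((1 - fst p) *\<^sub>R z + fst p *\<^sub>R w) ((1 - fst p) * r + fst p * s) (snd p)" for p :: "real \<times> real"
  have in1: "cmod ((1 - x) *\<^sub>R z + x *\<^sub>R w) + ((1 - x) * r + x * s) < 1" "0 < (1 - x) * r + x * s" if "x \<in> {0..1}" for x
  proof -
    have "cmod ((1 - x) *\<^sub>R z + x *\<^sub>R w) \<le> (1 - x) * cmod z + x * cmod w"
      using norm_triangle_ineq[of "(1 - x) *\<^sub>R z" "x *\<^sub>R w"] that by simp
    moreover have "(1 - x) * (cmod z + r) + x * (cmod w + s) < 1"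
      by (rule convex_bound_lt[OF z(1) w(1)]) (use that in auto)
    ultimately show "cmod ((1 - x) *\<^sub>R z + x *\<^sub>R w) + ((1 - x) * r + x * s) < 1" by (simp add: algebra_simps)
    show "0 < (1 - x) * r + x * s"
      using that z w by (cases "x = 0") (auto intro!: add_nonneg_pos)
  qed
  have inb: "((1 - x) *\<^sub>R z + x *\<^sub>R w) \<in> ball 0 1" 
    "((1 - x) *\<^sub>R z + x *\<^sub>R w) + of_real ((1 - x) * r + x * s) * cis t \<in> ball 0 1" if "x \<in> {0..1}" for x t
    using in1[OF that] circle_point_in_disc[of "(1 - x) *\<^sub>R z + x *\<^sub>R w" "(1 - x) * r + x * s" t] by auto
  have "homotopic_loops (- {0}) (increment_loop u z r) (increment_loop u w s)"
    unfolding homotopic_loops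
  proof (intro exI[of _ h] conjI ballI)
    show "continuous_on ({0..1} \<times> {0..1}) h"
      unfolding h_def increment_loop_def
      by (intro continuous_intros continuous_on_cis continuous_on_compose2[OF c] image_subsetI) (use inb in \<open>auto simp: mem_Times_iff\<close>)
    show "h \<in> {0..1} \<times> {0..1} \<rightarrow> - {0}"
    proof
      fix p assume p: "p \<in> {0..1::real} \<times> {0..1::real}"
      then have x: "fst p \<in> {0..1}" by auto
      let ?z = "(1 - fst p) *\<^sub>R z + fst p *\<^sub>R w" and ?r = "(1 - fst p) * r + fst p * s"
      have "of_real ?r * cis (2 * pi * snd p) \<noteq> (0::complex)"
        using in1(2)[OF x] by (simp del: of_real_add of_real_mult of_real_diff)
      then have "?z + of_real ?r * cis (2 * pi * snd p) \<noteq> ?z" by simp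
      then have "u (?z + of_real ?r * cis (2 * pi * snd p)) \<noteq> u ?z"
        using inj_onD[OF inj _ inb(2)[OF x] inb(1)[OF x]] by blast
      then show "h p \<in> - {0}" unfolding h_def increment_loop_def by simp
    qed
    show "pathfinish (h \<circ> Pair t) = pathstart (h \<circ> Pair t)" if "t \<in> {0..1}" for t
      using cis_2pi by (simp add: pathfinish_def pathstart_def h_def increment_loop_def)
  qed (auto simp: h_def)
  then show ?thesis by (rule winding_number_homotopic_loops)
qed

text \<open>
  On small circles the increment is a perturbation of $\alpha v$ or of $\beta \overline{v}$, whichever is
  larger, and these loops have winding number $1$ and $-1$.
\<close>
lemma winding_increment_loop_derivative:
  assumes c: "continuous_on (ball 0 1) u" and z: "z \<in> ball 0 1"
    and d: "(u has_derivative (\<lambda>v. \<alpha> * v + \<beta> * cnj v)) (at z)"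
  shows "cmod \<beta> < cmod \<alpha> \<Longrightarrow> \<exists>r. 0 < r \<and> cmod z + r < 1 \<and> winding_number (increment_loop u z r) 0 = 1"
    and "cmod \<alpha> < cmod \<beta> \<Longrightarrow> \<exists>r. 0 < r \<and> cmod z + r < 1 \<and> winding_number (increment_loop u z r) 0 = -1"
proof -
  have approx: "\<exists>r. 0 < r \<and> cmod z + r < 1 \<and> (\<forall>t. cmod (u (z + of_real r * cis t) - u z - (\<alpha> * (of_real r * cis t) + \<beta> * cnj (of_real r * cis t))) \<le> e * r)"
    if "e > 0" for e
  proof -
    have "\<forall>e>0. \<exists>d>0. \<forall>y. cmod (y - z) < d \<longrightarrow> cmod (u y - u z - (\<alpha> * (y - z) + \<beta> * cnj (y - z))) \<le> e * cmod (y - z)"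
      using d unfolding has_derivative_at_alt by (rule conjunct2)
    from this[rule_format, OF that] obtain d0
      where "d0 > 0 \<and> (\<forall>y. cmod (y - z) < d0 \<longrightarrow> cmod (u y - u z - (\<alpha> * (y - z) + \<beta> * cnj (y - z))) \<le> e * cmod (y - z))" ..
    then have d0: "d0 > 0" "\<And>y. cmod (y - z) < d0 \<Longrightarrow> cmod (u y - u z - (\<alpha> * (y - z) + \<beta> * cnj (y - z))) \<le> e * cmod (y - z)"
      by simp_all
    define r where "r = min (d0 / 2) ((1 - cmod z) / 2)"
    have r: "0 < r" "r < d0" "cmod z + r < 1" using d0(1) z by (auto simp: r_def min_def field_simps)
    have "cmod (u (z + of_real r * cis t) - u z - (\<alpha> * (of_real r * cis t) + \<beta> * cnj (of_real r * cis t))) \<le> e * r" for t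
      using d0(2)[of "z + of_real r * cis t"] r by (simp add: norm_mult)
    then show ?thesis using r by blast
  qed
  show "\<exists>r. 0 < r \<and> cmod z + r < 1 \<and> winding_number (increment_loop u z r) 0 = 1" if lt: "cmod \<beta> < cmod \<alpha>"
  proof -
    obtain r where r: "0 < r" "cmod z + r < 1" 
      and a: "\<And>t. cmod (u (z + of_real r * cis t) - u z - (\<alpha> * (of_real r * cis t) + \<beta> * cnj (of_real r * cis t))) \<le> (cmod \<alpha> - cmod \<beta>) / 2 * r"
      using approx[of "(cmod \<alpha> - cmod \<beta>) / 2"] lt by auto
    let ?g = "\<lambda>t. (\<alpha> * of_real r) * cis (2 * pi * of_int 1 * t)"
    have "winding_number (increment_loop u z r) 0 = winding_number ?g 0"
    proof (rule winding_number_perturb[OF path_cis_multiple(1) path_increment_loop(1)[OF c r(2)] path_cis_multiple(2) path_increment_loop(2)[OF c r(2)]])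
      fix t :: real
      let ?v = "of_real r * cis (2 * pi * t)"
      have "increment_loop u z r t - ?g t = (u (z + ?v) - u z - (\<alpha> * ?v + \<beta> * cnj ?v)) + \<beta> * cnj ?v"
        by (simp add: increment_loop_def)
      then have "cmod (increment_loop u z r t - ?g t) \<le> cmod (u (z + ?v) - u z - (\<alpha> * ?v + \<beta> * cnj ?v)) + cmod (\<beta> * cnj ?v)"
        by (metis norm_triangle_ineq)
      also have "\<dots> \<le> (cmod \<alpha> - cmod \<beta>) / 2 * r + cmod \<beta> * r" using a[of "2 * pi * t"] r by (simp add: norm_mult)
      also have "\<dots> < cmod \<alpha> * r" using lt r mult_strict_right_mono[OF lt r(1)] by (simp add: field_simps)
      also have "\<dots> = cmod (?g t)" using r by (simp add: norm_mult)
      finally show "cmod (increment_loop u z r t - ?g t) < cmod (?g t)" .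
    qed (use r in auto)
    also have "\<dots> = of_int 1" by (rule winding_number_cis_multiple) (use lt r in auto)
    finally show ?thesis using r by auto
  qed
  show "\<exists>r. 0 < r \<and> cmod z + r < 1 \<and> winding_number (increment_loop u z r) 0 = -1" if lt: "cmod \<alpha> < cmod \<beta>"
  proof -
    obtain r where r: "0 < r" "cmod z + r < 1" 
      and a: "\<And>t. cmod (u (z + of_real r * cis t) - u z - (\<alpha> * (of_real r * cis t) + \<beta> * cnj (of_real r * cis t))) \<le> (cmod \<beta> - cmod \<alpha>) / 2 * r"
      using approx[of "(cmod \<beta> - cmod \<alpha>) / 2"] lt by auto
    let ?g = "\<lambda>t. (\<beta> * of_real r) * cis (2 * pi * of_int (-1) * t)"
    have "winding_number (increment_loop u z r) 0 = winding_number ?g 0"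
    proof (rule winding_number_perturb[OF path_cis_multiple(1) path_increment_loop(1)[OF c r(2)] path_cis_multiple(2) path_increment_loop(2)[OF c r(2)]])
      fix t :: real
      let ?v = "of_real r * cis (2 * pi * t)"
      have "increment_loop u z r t - ?g t = (u (z + ?v) - u z - (\<alpha> * ?v + \<beta> * cnj ?v)) + \<alpha> * ?v"
        by (simp add: increment_loop_def cis_cnj)
      then have "cmod (increment_loop u z r t - ?g t) \<le> cmod (u (z + ?v) - u z - (\<alpha> * ?v + \<beta> * cnj ?v)) + cmod (\<alpha> * ?v)"
        by (metis norm_triangle_ineq)
      also have "\<dots> \<le> (cmod \<beta> - cmod \<alpha>) / 2 * r + cmod \<alpha> * r" using a[of "2 * pi * t"] r by (simp add: norm_mult)
      also have "\<dots> < cmod \<beta> * r" using lt r mult_strict_right_mono[OF lt r(1)] by (simp add: field_simps)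
      also have "\<dots> = cmod (?g t)" using r by (simp add: norm_mult)
      finally show "cmod (increment_loop u z r t - ?g t) < cmod (?g t)" .
    qed (use r in auto)
    also have "\<dots> = of_int (-1)" by (rule winding_number_cis_multiple) (use lt r in auto)
    finally show ?thesis using r by auto
  qed
qed

lemma winding_increment_loop_eq_1:
  assumes c: "continuous_on (ball 0 1) u" and inj: "inj_on u (ball 0 1)"
    and d: "(u has_derivative (\<lambda>v. \<alpha> * v + \<beta> * cnj v)) (at 0)" and ab: "cmod \<beta> < cmod \<alpha>"
    and z: "cmod z + r < 1" "0 < r"
  shows "winding_number (increment_loop u z r) 0 = 1"
proof -
  obtain s where s: "0 < s" "cmod (0::complex) + s < 1" "winding_number (increment_loop u 0 s) 0 = 1"
    using winding_increment_loop_derivative(1)[OF c _ d ab] by auto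
  then show ?thesis using winding_increment_loop_const[OF c inj z s(2,1)] by simp
qed

section \<open>Dilatation and the theorem of Lewy\<close>

text \<open>
  Where the denominator vanishes the quotient is bounded, so the singularity is removable.
\<close>
lemma holomorphic_quotient_of_dominated:
  assumes h: "h holomorphic_on ball 0 1" and g: "g holomorphic_on ball 0 1" and h0: "h 0 \<noteq> 0"
    and le: "\<And>z. z \<in> ball 0 1 \<Longrightarrow> cmod (g z) \<le> cmod (h z)"
  obtains \<omega> where "\<omega> holomorphic_on ball 0 1" "\<And>z. z \<in> ball 0 1 \<Longrightarrow> g z = \<omega> z * h z"
    "\<And>z. z \<in> ball 0 1 \<Longrightarrow> cmod (\<omega> z) \<le> 1"
proof -
  define f where "f z = g z / h z" for z
  define \<omega> where "\<omega> = remove_sings f"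
  have loc: "\<exists>r k. 0 < r \<and> ball a r \<subseteq> ball 0 1 \<and> k holomorphic_on ball a r \<and> (\<forall>z\<in>ball a r. \<omega> z = k z) \<and> (\<forall>z\<in>ball a r - {a}. h z \<noteq> 0 \<and> k z = f z)"
    if a: "a \<in> ball 0 1" for a
  proof -
    have "\<exists>r>0. ball a r \<subseteq> ball 0 1 \<and> (\<forall>z\<in>ball a r - {a}. h z \<noteq> 0)"
    proof (cases "h a = 0")
      case True
      obtain r where "0 < r" "ball a r \<subseteq> ball 0 1" "\<And>z. z \<in> ball a r - {a} \<Longrightarrow> h z \<noteq> 0"
        by (rule isolated_zeros[OF h _ _ a True, of 0]) (use h0 in auto)
      then show ?thesis by blast
    next
      case False
      have "open (ball 0 1 \<inter> h -` (- {0}))"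
        by (rule continuous_open_preimage[OF holomorphic_on_imp_continuous_on[OF h] open_ball]) auto
      moreover have "a \<in> ball 0 1 \<inter> h -` (- {0})" using a False by simp
      ultimately obtain r where "r > 0" "ball a r \<subseteq> ball 0 1 \<inter> h -` (- {0})"
        by (rule openE)
      then show ?thesis by (intro exI[of _ r]) auto
    qed
    then obtain r where r: "r > 0" "ball a r \<subseteq> ball 0 1" "\<And>z. z \<in> ball a r - {a} \<Longrightarrow> h z \<noteq> 0" by blast
    have hf: "f holomorphic_on ball a r - {a}" unfolding f_def
      by (intro holomorphic_intros holomorphic_on_subset[OF g] holomorphic_on_subset[OF h]) (use r in auto)
    have fb: "cmod (f z) \<le> 1" if "z \<in> ball a r - {a}" for z
      using le[of z] r that by (auto simp: f_def norm_divide divide_le_eq)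
    have "\<forall>\<^sub>F z in at a. cmod (f z) \<le> 1"
      unfolding eventually_at using fb r(1) by (intro exI[of _ r]) (auto simp: dist_commute)
    then have "\<exists>k. k holomorphic_on ball a r \<and> (\<forall>z\<in>ball a r - {a}. k z = f z)"
      using holomorphic_on_extend_bounded[OF hf] r(1) by auto
    then obtain k where k: "k holomorphic_on ball a r" "\<And>z. z \<in> ball a r - {a} \<Longrightarrow> k z = f z" by blast
    have "\<omega> z = k z" if z: "z \<in> ball a r" for z
    proof -
      have "k \<midarrow>z\<rightarrow> k z"
        using holomorphic_on_imp_continuous_on[OF k(1)] z by (simp add: continuous_on_eq_continuous_at isContD)
      moreover have "eventually (\<lambda>w. k w = f w) (at z)"
      proof -
        have "eventually (\<lambda>w. w \<in> ball a r - {a}) (at z)"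
        proof (cases "z = a")
          case True then show ?thesis using r(1) by (auto simp: eventually_at dist_commute)
        next
          case False
          have "open (ball a r - {a})" by auto
          then have "eventually (\<lambda>w. w \<in> ball a r - {a}) (nhds z)" using False z by (intro eventually_nhds_in_open) auto
          then show ?thesis by (auto simp: eventually_at_filter elim: eventually_mono)
        qed
        then show ?thesis by eventually_elim (rule k(2))
      qed
      ultimately have "f \<midarrow>z\<rightarrow> k z" by (simp add: tendsto_cong)
      then show ?thesis unfolding \<omega>_def by (rule remove_sings_eqI)
    qed
    then show ?thesis using r k by (intro exI[of _ r] exI[of _ k]) auto
  qed
  have hol: "\<omega> holomorphic_on ball 0 1"
    unfolding holomorphic_on_def
  proof
    fix a :: complex assume a: "a \<in> ball 0 1"
    obtain r k where rk: "0 < r" "k holomorphic_on ball a r" "\<And>z. z \<in> ball a r \<Longrightarrow> \<omega> z = k z" using loc[OF a] by blast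
    then have "\<omega> holomorphic_on ball a r" by (metis holomorphic_transform)
    then show "\<omega> field_differentiable at a within ball 0 1"
      using rk(1) by (meson centre_in_ball field_differentiable_at_within holomorphic_on_imp_differentiable_at open_ball)
  qed
  have cl: "cmod (\<omega> a) \<le> 1 \<and> g a = \<omega> a * h a" if a: "a \<in> ball 0 1" for a
  proof
    obtain r k where rk: "0 < r" "ball a r \<subseteq> ball 0 1" "k holomorphic_on ball a r" "\<And>z. z \<in> ball a r \<Longrightarrow> \<omega> z = k z"
      "\<And>z. z \<in> ball a r - {a} \<Longrightarrow> h z \<noteq> 0 \<and> k z = f z" using loc[OF a] by blast
    have ev: "eventually (\<lambda>z. z \<in> ball a r - {a}) (at a)" using rk(1) by (auto simp: eventually_at dist_commute)
    have lim: "(u \<longlongrightarrow> u a) (at a)" if "u holomorphic_on ball 0 1" for u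
      using holomorphic_on_imp_continuous_on[OF that] a by (simp add: continuous_on_eq_continuous_at isContD)
    have "((\<lambda>z. cmod (\<omega> z)) \<longlongrightarrow> cmod (\<omega> a)) (at a)" by (intro tendsto_norm lim hol)
    moreover have "eventually (\<lambda>z. cmod (\<omega> z) \<le> 1) (at a)"
      using ev
    proof eventually_elim
      case (elim z)
      then have "\<omega> z = g z / h z" "h z \<noteq> 0" "z \<in> ball 0 1" using rk by (auto simp: f_def)
      then show ?case using le[of z] by (simp add: norm_divide divide_le_eq)
    qed
    ultimately show "cmod (\<omega> a) \<le> 1" by (rule tendsto_upperbound) auto
    have "((\<lambda>z. \<omega> z * h z) \<longlongrightarrow> \<omega> a * h a) (at a)" by (intro tendsto_mult lim hol h)
    moreover have "eventually (\<lambda>z. g z = \<omega> z * h z) (at a)"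
      using ev
    proof eventually_elim
      case (elim z)
      then have "\<omega> z = g z / h z" "h z \<noteq> 0" using rk by (auto simp: f_def)
      then show ?case by simp
    qed
    ultimately have "(g \<longlongrightarrow> \<omega> a * h a) (at a)" by (simp add: tendsto_cong)
    then show "g a = \<omega> a * h a" using lim[OF g] tendsto_unique[of "at a"] by (metis at_neq_bot)
  qed
  show ?thesis using that[OF hol] cl by blast
qed

text \<open>
  The Schwarz lemma applied once for each vanishing coefficient: the quotient by $z$ is again bounded by
  one, by the maximum principle on discs of radius tending to one.
\<close>
lemma schwarz_higher_order:
  assumes "\<omega> holomorphic_on ball 0 1" "\<And>z. z \<in> ball 0 1 \<Longrightarrow> cmod (\<omega> z) \<le> 1"
    and "\<And>j. j < n \<Longrightarrow> taylor_coeff \<omega> j = 0" and "z \<in> ball 0 1"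
  shows "cmod (\<omega> z) \<le> cmod z ^ n"
  using assms
proof (induction n arbitrary: \<omega> z)
  case 0 then show ?case by simp
next
  case (Suc n)
  have "\<omega> 0 = 0" using Suc.prems(3)[of 0] by (simp add: fps_expansion_def)
  then obtain k where k: "k holomorphic_on ball 0 1" "\<And>z. z \<in> ball 0 1 \<Longrightarrow> \<omega> z = z * k z"
    "\<And>n. taylor_coeff k n = taylor_coeff \<omega> (Suc n)"
    by (rule holomorphic_div_z[OF Suc.prems(1)]) (rule that)
  have kb: "cmod (k w) \<le> 1" if w: "w \<in> ball 0 1" for w
  proof -
    have b: "cmod (k w) \<le> 1 / r" if r: "cmod w < r" "0 < r" "r < 1" for r
    proof (rule maximum_modulus_frontier[of k "ball 0 r"])
      show "k holomorphic_on interior (ball 0 r)" using r by (auto intro: holomorphic_on_subset[OF k(1)])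
      show "continuous_on (closure (ball 0 r)) k"
        by (rule holomorphic_on_imp_continuous_on, rule holomorphic_on_subset[OF k(1)]) (use r in auto)
      show "cmod (k z) \<le> 1 / r" if "z \<in> frontier (ball 0 r)" for z
      proof -
        have z: "cmod z = r" "z \<in> ball 0 1" using that r by auto
        have "r * cmod (k z) \<le> 1" using k(2)[OF z(2)] Suc.prems(2)[OF z(2)] z(1) by (simp add: norm_mult)
        then show ?thesis using r by (simp add: field_simps)
      qed
    qed (use r in auto)
    show ?thesis
    proof (rule tendsto_lowerbound)
      show "((\<lambda>r. 1 / r) \<longlongrightarrow> 1) (at_left (1::real))"
        by (auto intro!: tendsto_eq_intros)
      have "eventually (\<lambda>r. r \<in> {cmod w<..<1}) (at_left (1::real))"
        by (rule eventually_at_left_real) (use w in auto)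
      then show "eventually (\<lambda>r. cmod (k w) \<le> 1 / r) (at_left (1::real))"
      proof eventually_elim
        case (elim r)
        then have "0 < r" using norm_ge_zero[of w] by (auto simp del: norm_ge_zero)
        then show ?case using elim b by auto
      qed
    qed auto
  qed
  have "cmod (k z) \<le> cmod z ^ n"
    by (rule Suc.IH[OF k(1) kb]) (use Suc.prems k(3) in auto)
  then show ?case using k(2)[OF Suc.prems(4)] by (simp add: norm_mult mult_left_mono)
qed

text \<open>
  At the origin the derivative of \<open>f\<close> is the identity, so all increment loops have winding number one. A
  point with $|g'| > |h'|$ would produce a loop with winding number $-1$.
\<close>
lemma univalent_harmonic_sense_preserving:
  assumes h: "h holomorphic_on ball 0 1" and g: "g holomorphic_on ball 0 1"
    and f: "\<And>z. z \<in> ball 0 1 \<Longrightarrow> f z = h z + cnj (g z)" and inj: "inj_on f (ball 0 1)"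
    and h1: "deriv h 0 = 1" and g1: "deriv g 0 = 0"
  shows "continuous_on (ball 0 1) f"
    and "\<And>z. z \<in> ball 0 1 \<Longrightarrow> (f has_derivative (\<lambda>v. deriv h z * v + cnj (deriv g z) * cnj v)) (at z)"
    and "\<And>z r. cmod z + r < 1 \<Longrightarrow> 0 < r \<Longrightarrow> winding_number (increment_loop f z r) 0 = 1"
    and "\<And>z. z \<in> ball 0 1 \<Longrightarrow> cmod (deriv g z) \<le> cmod (deriv h z)"
proof -
  have D: "(u has_derivative (\<lambda>v. deriv u z * v)) (at z)"
    if "u holomorphic_on ball 0 1" "z \<in> ball 0 1" for u z
    using holomorphic_derivI[OF that(1) open_ball that(2)] by (simp add: has_field_derivative_def)
  show d: "(f has_derivative (\<lambda>v. deriv h z * v + cnj (deriv g z) * cnj v)) (at z)" if z: "z \<in> ball 0 1" for z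
  proof -
    have "((\<lambda>z. h z + cnj (g z)) has_derivative (\<lambda>v. deriv h z * v + cnj (deriv g z * v))) (at z)"
      by (intro has_derivative_add has_derivative_cnj D h g z)
    then have "(f has_derivative (\<lambda>v. deriv h z * v + cnj (deriv g z * v))) (at z)"
      by (rule has_derivative_transform_within_open[OF _ open_ball z]) (simp add: f)
    then show ?thesis by simp
  qed
  show c: "continuous_on (ball 0 1) f"
    using d by (intro has_derivative_continuous_on) (auto intro: has_derivative_at_withinI)
  show w: "winding_number (increment_loop f z r) 0 = 1" if "cmod z + r < 1" "0 < r" for z r
    by (rule winding_increment_loop_eq_1[OF c inj d[of 0] _ that]) (use h1 g1 in auto)
  show "cmod (deriv g z) \<le> cmod (deriv h z)" if z: "z \<in> ball 0 1" for z
  proof (rule ccontr)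
    assume "\<not> ?thesis"
    then have "cmod (deriv h z) < cmod (cnj (deriv g z))" by simp
    from winding_increment_loop_derivative(2)[OF c z d[OF z] this] w[of z] show False by auto
  qed
qed

text \<open>
  By the recursion for products of power series, the vanishing of $g'$ to order \<open>n\<close> passes to the quotient
  $g'/h'$, since $h'(0) = 1$.
\<close>
lemma univalent_harmonic_dilatation:
  assumes h: "h holomorphic_on ball 0 1" and g: "g holomorphic_on ball 0 1"
    and f: "\<And>z. z \<in> ball 0 1 \<Longrightarrow> f z = h z + cnj (g z)" and inj: "inj_on f (ball 0 1)"
    and h1: "deriv h 0 = 1" and g0: "\<And>j. 1 \<le> j \<Longrightarrow> j \<le> n \<Longrightarrow> taylor_coeff g j = 0" and n: "n \<ge> 1"
    and z: "z \<in> ball 0 1"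
  shows "cmod (deriv g z) \<le> cmod z ^ n * cmod (deriv h z)"
proof -
  have g1: "deriv g 0 = 0" using g0[of 1] n by (simp add: fps_expansion_def)
  have hg: "deriv h holomorphic_on ball 0 1" "deriv g holomorphic_on ball 0 1"
    by (intro holomorphic_deriv h g open_ball)+
  obtain \<omega> where \<omega>: "\<omega> holomorphic_on ball 0 1" "\<And>z. z \<in> ball 0 1 \<Longrightarrow> deriv g z = \<omega> z * deriv h z"
    "\<And>z. z \<in> ball 0 1 \<Longrightarrow> cmod (\<omega> z) \<le> 1"
    by (rule holomorphic_quotient_of_dominated[OF hg]) 
       (use h1 univalent_harmonic_sense_preserving(4)[OF h g f inj h1 g1] that in auto)
  have "(\<lambda>z. \<omega> z * deriv h z) has_fps_expansion fps_expansion \<omega> 0 * fps_expansion (deriv h) 0"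
    by (intro fps_expansion_intros has_fps_expansion_disc \<omega> hg)
  then have "deriv g has_fps_expansion fps_expansion \<omega> 0 * fps_expansion (deriv h) 0"
    by (rule has_fps_expansion_cong_disc[rotated]) (simp add: \<omega>(2))
  then have eq1: "fps_expansion (deriv g) 0 = fps_expansion \<omega> 0 * fps_expansion (deriv h) 0" by (rule fps_expansion_eqI)
  have eq2: "fps_expansion (deriv g) 0 = fps_deriv (fps_expansion g 0)"
    by (rule fps_expansion_eqI) (intro fps_expansion_intros has_fps_expansion_disc g)
  have hd0: "taylor_coeff (deriv h) 0 = 1" using h1 by (simp add: fps_expansion_def)
  have "taylor_coeff \<omega> j = 0" if "j < n" for j
    using that
  proof (induction j rule: less_induct)
    case (less j)
    have "0 = fps_nth (fps_expansion (deriv g) 0) j" unfolding eq2 using g0[of "Suc j"] less.prems by simp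
    also have "\<dots> = (\<Sum>i<j. taylor_coeff \<omega> i * taylor_coeff (deriv h) (j - i)) + taylor_coeff \<omega> j"
      unfolding eq1 by (simp add: fps_mult_nth lessThan_Suc_atMost[symmetric] atMost_atLeast0[symmetric] hd0)
    also have "(\<Sum>i<j. taylor_coeff \<omega> i * taylor_coeff (deriv h) (j - i)) = 0"
      using less by (intro sum.neutral) auto
    finally show ?case by simp
  qed
  then have "cmod (\<omega> z) \<le> cmod z ^ n" by (intro schwarz_higher_order \<omega> z)
  then show ?thesis using \<omega>(2)[OF z] by (simp add: norm_mult mult_right_mono)
qed

text \<open>
  Let \<open>m\<close> be the order of the zero of $h - h(z)$ at \<open>z\<close>. Because $|g'| \le k |h'|$ near \<open>z\<close> with a constant
  $k < 1$, the increment of $\overline{g}$ over a small circle is smaller than that of \<open>h\<close>, and the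
  increment loop of \<open>f\<close> has winding number \<open>m\<close>. Injectivity forces $m = 1$.
\<close>
lemma lewy:
  assumes h: "h holomorphic_on ball 0 1" and g: "g holomorphic_on ball 0 1"
    and f: "\<And>z. z \<in> ball 0 1 \<Longrightarrow> f z = h z + cnj (g z)" and inj: "inj_on f (ball 0 1)"
    and h1: "deriv h 0 = 1" and g1: "deriv g 0 = 0"
    and dil: "\<And>z. z \<in> ball 0 1 \<Longrightarrow> cmod (deriv g z) \<le> cmod z * cmod (deriv h z)"
    and z: "z \<in> ball 0 1"
  shows "deriv h z \<noteq> 0"
proof -
  have cont: "continuous_on (ball 0 1) f"
    by (rule univalent_harmonic_sense_preserving(1)[OF h g _ inj h1 g1]) (rule f)
  have winding: "winding_number (increment_loop f z r) 0 = 1" if "cmod z + r < 1" "0 < r" for r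
    by (rule univalent_harmonic_sense_preserving(3)[OF h g _ inj h1 g1 that]) (rule f)
  define H where "H w = h w - h z" for w
  have H: "H holomorphic_on ball 0 1" unfolding H_def by (intro holomorphic_intros h)
  have dH: "deriv H w = deriv h w" if "w \<in> ball 0 1" for w
    unfolding H_def using holomorphic_derivI[OF h open_ball that]
    by (intro DERIV_imp_deriv) (auto intro!: derivative_eq_intros)
  have "\<not> H constant_on ball 0 1"
  proof
    assume "H constant_on ball 0 1"
    then obtain c where c: "\<And>w. w \<in> ball 0 1 \<Longrightarrow> H w = c" by (auto simp: constant_on_def)
    have "deriv H 0 = deriv (\<lambda>_. c) 0"
    proof (rule deriv_cong_ev)
      have "eventually (\<lambda>z. z \<in> ball 0 1) (nhds (0::complex))" by (rule eventually_nhds_in_open) auto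
      then show "\<forall>\<^sub>F x in nhds 0. H x = c" by eventually_elim (rule c)
    qed simp
    then show False using dH[of 0] h1 by simp
  qed
  moreover have "H z = 0" by (simp add: H_def)
  ultimately obtain A r0 m where A: "0 < m" "0 < r0" "ball z r0 \<subseteq> ball 0 1" "A holomorphic_on ball z r0"
    "\<And>w. w \<in> ball z r0 \<Longrightarrow> H w = (w - z) ^ m * A w" "\<And>w. w \<in> ball z r0 \<Longrightarrow> A w \<noteq> 0"
    using holomorphic_factor_zero_nonconstant[OF H open_ball connected_ball z] by metis
  define Q where "Q w = of_nat m * A w + (w - z) * deriv A w" for w
  have Qd: "deriv h w = (w - z) ^ (m - 1) * Q w" if w: "w \<in> ball z r0" for w
  proof -
    have "((\<lambda>w. (w - z) ^ m * A w) has_field_derivative (of_nat m * (w - z) ^ (m - 1) * A w + (w - z) ^ m * deriv A w)) (at w)"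
      using holomorphic_derivI[OF A(4) open_ball w] by (auto intro!: derivative_eq_intros)
    then have "(H has_field_derivative (of_nat m * (w - z) ^ (m - 1) * A w + (w - z) ^ m * deriv A w)) (at w)"
      by (rule has_field_derivative_transform_within_open[OF _ open_ball w]) (simp add: A(5))
    then have "deriv h w = of_nat m * (w - z) ^ (m - 1) * A w + (w - z) ^ m * deriv A w"
      using dH[of w] w A(3) by (metis DERIV_imp_deriv subsetD)
    also have "(w - z) ^ m = (w - z) ^ (m - 1) * (w - z)" using A(1) by (metis power_minus_mult)
    finally show ?thesis by (simp add: Q_def algebra_simps)
  qed
  define k where "k = (1 + cmod z) / 2"
  have k: "cmod z < k" "k < 1" using z by (auto simp: k_def)
  define a where "a = cmod (A z)"
  have a0: "a > 0" using A(2) A(6)[of z] by (simp add: a_def)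
  define \<delta> where "\<delta> = (1 - k) / 4"
  have \<delta>: "\<delta> > 0" using k by (simp add: \<delta>_def)
  have cA: "isCont A z" and cQ: "isCont Q z"
  proof -
    have "continuous_on (ball z r0) A" "continuous_on (ball z r0) (deriv A)"
      by (intro holomorphic_on_imp_continuous_on holomorphic_deriv A open_ball)+
    then show "isCont A z" "isCont Q z" unfolding Q_def using A(2)
      by (auto intro!: continuous_intros simp: continuous_on_eq_continuous_at)
  qed
  obtain r1 where r1: "r1 > 0" "\<And>w. cmod (w - z) < r1 \<Longrightarrow> cmod (A w - A z) < \<delta> * a"
    using cA \<delta> a0 unfolding continuous_at_eps_delta dist_norm by (metis mult_pos_pos)
  obtain r2 where r2: "r2 > 0" "\<And>w. cmod (w - z) < r2 \<Longrightarrow> cmod (Q w - Q z) < \<delta> * a"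
    using cQ \<delta> a0 unfolding continuous_at_eps_delta dist_norm by (metis mult_pos_pos)
  define r where "r = min (min r0 (min r1 r2)) (min ((1 - cmod z) / 2) (k - cmod z)) / 2"
  have r: "0 < r" "r < r0" "r < r1" "r < r2" "cmod z + r < 1" "cmod z + r < k"
    using A(2) r1(1) r2(1) z k by (auto simp: r_def min_def field_simps)
  have Qz: "Q z = of_nat m * A z" by (simp add: Q_def)
  have gbound: "cmod (g (z + v) - g z) \<le> k * (1 + \<delta>) * a * cmod v ^ m" if v: "cmod v = r" for v
  proof -
    define C where "C = k * (real m * a + \<delta> * a) * cmod v ^ m"
    have seg: "cmod (of_real s * v) \<le> r" if "s \<in> {0..1}" for s
      using that v r by (simp add: norm_mult mult_left_le_one_le)
    have inb: "z + of_real s * v \<in> ball z r0" "z + of_real s * v \<in> ball 0 1" "cmod (z + of_real s * v) < k" if "s \<in> {0..1}" for s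
    proof -
      have "cmod (z + of_real s * v) \<le> cmod z + r"
        using seg[OF that] norm_triangle_ineq[of z "of_real s * v"] by linarith
      then show "z + of_real s * v \<in> ball 0 1" "cmod (z + of_real s * v) < k" using r by auto
      show "z + of_real s * v \<in> ball z r0" using seg[OF that] r by (simp add: dist_norm)
    qed
    have "((\<lambda>s. deriv g (z + of_real s * v) * v) has_integral (g (z + of_real 1 * v) - g (z + of_real 0 * v))) {0..1}"
    proof (rule fundamental_theorem_of_calculus)
      fix s :: real assume s: "s \<in> {0..1}"
      have "(g has_field_derivative deriv g (z + of_real s * v)) (at (z + of_real s * v))"
        using holomorphic_derivI[OF g open_ball inb(2)[OF s]] .
      then have "((\<lambda>x. g (z + x * v)) has_field_derivative deriv g (z + of_real s * v) * v) (at (of_real s))"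
        by (rule DERIV_chain2) (auto intro!: derivative_eq_intros)
      then show "((\<lambda>s. g (z + of_real s * v)) has_vector_derivative deriv g (z + of_real s * v) * v) (at s within {0..1})"
        by (rule has_vector_derivative_real_field)
    qed auto
    then have gi: "((\<lambda>s. deriv g (z + of_real s * v) * v) has_integral (g (z + v) - g z)) {0..1}" by simp
    have ci: "((\<lambda>s. C * s ^ (m - 1)) has_integral (C * (1 / real m))) {0..1}"
    proof -
      have "((\<lambda>s. s ^ (m - 1)) has_integral (1 ^ m / real m - 0 ^ m / real m)) {0..1::real}"
        using A(1) by (intro fundamental_theorem_of_calculus)
          (auto intro!: derivative_eq_intros simp flip: has_real_derivative_iff_has_vector_derivative)
      then have "((\<lambda>s. s ^ (m - 1)) has_integral (1 / real m)) {0..1::real}" using A(1) by (simp add: power_0_left)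
      then show ?thesis by (rule has_integral_mult_right)
    qed
    have pt: "cmod (deriv g (z + of_real s * v) * v) \<le> C * s ^ (m - 1)" if s: "s \<in> {0..1}" for s
    proof -
      let ?w = "z + of_real s * v"
      have "cmod (deriv g ?w) \<le> cmod ?w * cmod (deriv h ?w)" by (rule dil[OF inb(2)[OF s]])
      also have "\<dots> \<le> k * cmod (deriv h ?w)" using inb(3)[OF s] by (intro mult_right_mono) auto
      also have "cmod (deriv h ?w) = (s * cmod v) ^ (m - 1) * cmod (Q ?w)"
        using Qd[OF inb(1)[OF s]] s by (simp add: norm_mult norm_power)
      finally have gQ: "cmod (deriv g ?w) \<le> k * ((s * cmod v) ^ (m - 1) * cmod (Q ?w))" .
      have "cmod (Q ?w) \<le> real m * a + \<delta> * a"
      proof -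
        have "cmod (Q ?w) \<le> cmod (Q z) + cmod (Q ?w - Q z)" using norm_triangle_sub[of "Q ?w" "Q z"] by simp
        also have "cmod (Q ?w - Q z) \<le> \<delta> * a" using r2(2)[of ?w] seg[OF s] r by simp
        finally show ?thesis by (simp add: Qz norm_mult a_def)
      qed
      then have "k * ((s * cmod v) ^ (m - 1) * cmod (Q ?w)) \<le> k * ((s * cmod v) ^ (m - 1) * (real m * a + \<delta> * a))"
        using s order_trans[OF norm_ge_zero, of z k] k by (intro mult_left_mono) auto
      with gQ have "cmod (deriv g ?w) \<le> k * ((s * cmod v) ^ (m - 1) * (real m * a + \<delta> * a))"
        by (rule order_trans)
      then have "cmod (deriv g ?w) * cmod v \<le> k * ((s * cmod v) ^ (m - 1) * (real m * a + \<delta> * a)) * cmod v"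
        by (intro mult_right_mono) auto
      also have "\<dots> = C * s ^ (m - 1)"
      proof -
        have "cmod v ^ m = cmod v ^ (m - 1) * cmod v" using A(1) by (metis power_minus_mult)
        then show ?thesis by (simp add: C_def power_mult_distrib mult_ac)
      qed
      finally show ?thesis by (simp add: norm_mult)
    qed
    have "cmod (g (z + v) - g z) \<le> C * (1 / real m)"
      using integral_norm_bound_integral[of "\<lambda>s. deriv g (z + of_real s * v) * v" "{0..1}" "\<lambda>s. C * s ^ (m - 1)"] gi ci pt
      by (auto simp: has_integral_integrable_integral)
    also have "C * (1 / real m) = k * (1 + \<delta> / real m) * a * cmod v ^ m" using A(1) by (simp add: C_def field_simps)
    also have "\<dots> \<le> k * (1 + \<delta>) * a * cmod v ^ m"
    proof (intro mult_right_mono mult_left_mono add_left_mono)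
      show "\<delta> / real m \<le> \<delta>" using A(1) \<delta> by (simp add: divide_le_eq)
      show "0 \<le> k" using k norm_ge_zero[of z] by linarith
    qed (use a0 in auto)
    finally show ?thesis .
  qed
  have mono_close: "\<delta> + k * (1 + \<delta>) < 1"
  proof -
    have "k * \<delta> < 1 * \<delta>" using k \<delta> by (intro mult_strict_right_mono) auto
    then have "\<delta> + k * (1 + \<delta>) < k + 2 * \<delta>" by (simp add: algebra_simps)
    also have "\<dots> < 1" using k by (simp add: \<delta>_def field_simps)
    finally show ?thesis .
  qed
  let ?g = "\<lambda>t. (A z * of_real r ^ m) * cis (2 * pi * of_int (int m) * t)"
  have "winding_number (increment_loop f z r) 0 = winding_number ?g 0"
  proof (rule winding_number_perturb[OF path_cis_multiple(1) path_increment_loop(1)[OF cont r(5)] path_cis_multiple(2) path_increment_loop(2)[OF cont r(5)]])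
    fix t :: real
    define v where "v = of_real r * cis (2 * pi * t)"
    have v: "cmod v = r" using r by (simp add: v_def norm_mult)
    have inb: "z + v \<in> ball z r0" "z + v \<in> ball 0 1" using v r circle_point_in_disc[OF r(5), of "2*pi*t"] by (auto simp: dist_norm v_def)
    have vm: "A z * v ^ m = ?g t"
      by (simp add: v_def power_mult_distrib Complex.DeMoivre mult_ac)
    have "increment_loop f z r t - ?g t = v ^ m * (A (z + v) - A z) + cnj (g (z + v) - g z)"
      using f[OF inb(2)] f[OF z] A(5)[OF inb(1)] vm by (simp add: increment_loop_def H_def v_def algebra_simps)
    then have "cmod (increment_loop f z r t - ?g t) \<le> cmod (v ^ m * (A (z + v) - A z)) + cmod (cnj (g (z + v) - g z))"
      by (metis norm_triangle_ineq)
    also have "cmod (v ^ m * (A (z + v) - A z)) \<le> r ^ m * (\<delta> * a)"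
      using r1(2)[of "z + v"] v r by (simp add: norm_mult norm_power mult_left_mono)
    also have "cmod (cnj (g (z + v) - g z)) \<le> k * (1 + \<delta>) * a * r ^ m" using gbound[OF v] v by (simp only: complex_mod_cnj)
    finally have "cmod (increment_loop f z r t - ?g t) \<le> (\<delta> + k * (1 + \<delta>)) * (a * r ^ m)" by (simp add: algebra_simps)
    also have "\<dots> < 1 * (a * r ^ m)" using mono_close a0 r by (intro mult_strict_right_mono) auto
    also have "\<dots> = cmod (?g t)" using r by (simp add: a_def norm_mult norm_power)
    finally show "cmod (increment_loop f z r t - ?g t) < cmod (?g t)" .
  qed (use r in auto)
  also have "\<dots> = of_int (int m)" by (rule winding_number_cis_multiple) (use a0 r in \<open>auto simp: a_def\<close>)
  finally have "of_nat m = (1::complex)" using winding[OF r(5,1)] by simp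
  then have "m = 1" by simp
  then show ?thesis using Qd[of z] A(2) A(6)[of z] Qz by simp
qed

section \<open>The covering theorem\<close>

text \<open>
  The Cauchy--Schwarz inequality, in the form $L^2 \ge 2 L - 1$.
\<close>
lemma integral_square_ge_length:
  fixes L :: "real \<Rightarrow> real"
  assumes "continuous_on {a..b} L" "a < b" "b - a \<le> integral {a..b} L"
  shows "b - a \<le> integral {a..b} (\<lambda>x. (L x)\<^sup>2)"
proof -
  have i1: "(L has_integral integral {a..b} L) {a..b}"
    by (intro integrable_integral integrable_continuous_real assms)
  have i2: "((\<lambda>x. (L x)\<^sup>2) has_integral integral {a..b} (\<lambda>x. (L x)\<^sup>2)) {a..b}"
    by (intro integrable_integral integrable_continuous_real continuous_intros assms)
  have "((\<lambda>x. (L x)\<^sup>2 - 2 * L x + 1) has_integral (integral {a..b} (\<lambda>x. (L x)\<^sup>2) - 2 * integral {a..b} L + (b - a))) {a..b}"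
    using has_integral_add[OF has_integral_diff[OF i2 has_integral_mult_right[OF i1, of 2]] has_integral_const_real[of 1 a b]] assms(2) by simp
  moreover have "(L x)\<^sup>2 - 2 * L x + 1 \<ge> 0" for x
    using zero_le_power2[of "L x - 1"] by (simp add: power2_diff)
  ultimately have "0 \<le> integral {a..b} (\<lambda>x. (L x)\<^sup>2) - 2 * integral {a..b} L + (b - a)"
    by (rule has_integral_nonneg)
  then show ?thesis using assms(3) by linarith
qed

text \<open>
  The image of a circle about the origin winds once about the origin, so its length in the metric
  $|dw|/|w|$ is at least $2\pi$.
\<close>
lemma circle_image_length:
  fixes u :: "complex \<Rightarrow> complex"
  assumes d: "\<And>z. z \<in> ball 0 1 \<Longrightarrow> (u has_derivative (\<lambda>v. \<alpha> z * v + \<beta> z * cnj v)) (at z)"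
    and c\<alpha>: "continuous_on (ball 0 1) \<alpha>" and c\<beta>: "continuous_on (ball 0 1) \<beta>"
    and r: "0 < r" "r < 1" and u0: "u 0 = 0"
    and nz: "\<And>z. z \<in> ball 0 1 \<Longrightarrow> z \<noteq> 0 \<Longrightarrow> u z \<noteq> 0"
    and w: "winding_number (increment_loop u 0 r) 0 = 1"
  shows "2 * pi \<le> integral {0..2*pi} (\<lambda>y. r * (cmod (\<alpha> (of_real r * cis y)) + cmod (\<beta> (of_real r * cis y))) / cmod (u (of_real r * cis y)))"
proof -
  have cu: "continuous_on (ball 0 1) u"
    using d by (intro has_derivative_continuous_on) (auto intro: has_derivative_at_withinI)
  let ?p = "\<lambda>y. of_real r * cis y"
  have inb: "?p y \<in> ball 0 1" "?p y \<noteq> 0" for y using r by (auto simp: norm_mult)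
  define D where "D y = \<alpha> (?p y) * (\<i> * ?p y) + \<beta> (?p y) * cnj (\<i> * ?p y)" for y
  have dp: "((\<lambda>t. ?p (2 * pi * t)) has_vector_derivative 2 * pi * (\<i> * ?p (2 * pi * t))) (at t)" for t
    using has_vector_derivative_cis_multiple[of "of_real r" 1 t] by (simp add: mult_ac)
  have dl: "(increment_loop u 0 r has_vector_derivative complex_of_real (2 * pi) * D (2 * pi * t)) (at t)" for t
  proof -
    have il: "increment_loop u 0 r = (\<lambda>t. u (?p (2 * pi * t)))"
      by (simp add: increment_loop_def fun_eq_iff u0)
    have eq: "(\<lambda>s. \<alpha> (?p (2 * pi * t)) * (s *\<^sub>R (2 * pi * (\<i> * ?p (2 * pi * t)))) + \<beta> (?p (2 * pi * t)) * cnj (s *\<^sub>R (2 * pi * (\<i> * ?p (2 * pi * t)))))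
        = (\<lambda>s. s *\<^sub>R (complex_of_real (2 * pi) * D (2 * pi * t)))"
      by (auto simp: fun_eq_iff D_def algebra_simps scaleR_conv_of_real)
    show ?thesis unfolding il has_vector_derivative_def eq[symmetric]
      by (rule has_derivative_compose[OF dp[of t, unfolded has_vector_derivative_def] d[OF inb(1)]])
  qed
  have cont: "continuous_on A (\<lambda>y. k (?p y))" if "continuous_on (ball 0 1) k" for A and k :: "complex \<Rightarrow> complex"
    by (intro continuous_on_compose2[OF that] continuous_intros continuous_on_cis) (use inb in auto)
  have cD: "continuous_on A D" for A unfolding D_def
    by (intro continuous_intros continuous_on_cis cont c\<alpha> c\<beta>)
  have cq: "continuous_on A (\<lambda>y. D y / u (?p y))" for A
    by (intro continuous_intros cD cont cu) (use nz inb in auto)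
  have "winding_number (increment_loop u 0 r) 0 = 1 / (2 * pi * \<i>) * integral {0..1} (\<lambda>t. complex_of_real (2 * pi) * D (2 * pi * t) / increment_loop u 0 r t)"
  proof (rule winding_number_C1_loop)
    show "(increment_loop u 0 r has_vector_derivative complex_of_real (2 * pi) * D (2 * pi * t)) (at t)" for t by (rule dl)
    show "continuous_on {0..1} (\<lambda>t. complex_of_real (2 * pi) * D (2 * pi * t))"
      by (intro continuous_intros continuous_on_compose2[OF cD[of UNIV]]) auto
    show "increment_loop u 0 r t \<noteq> 0" for t using nz inb by (auto simp: increment_loop_def u0)
  qed
  also have "(\<lambda>t. complex_of_real (2 * pi) * D (2 * pi * t) / increment_loop u 0 r t) = (\<lambda>t. complex_of_real (2 * pi) * (D (2 * pi * t) / u (?p (2 * pi * t))))"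
    by (simp add: increment_loop_def u0)
  also have "integral {0..1} (\<lambda>t. complex_of_real (2 * pi) * (D (2 * pi * t) / u (?p (2 * pi * t)))) = integral {0..2*pi} (\<lambda>y. D y / u (?p y))"
  proof -
    have "((\<lambda>y. D y / u (?p y)) has_integral integral {0..2*pi} (\<lambda>y. D y / u (?p y))) {0..2*pi}"
      by (intro integrable_integral integrable_continuous_real cq)
    from has_integral_stretch_real[OF this, of "2 * pi"]
    have "((\<lambda>t. D (2 * pi * t) / u (?p (2 * pi * t))) has_integral (1 / (2 * pi)) *\<^sub>R integral {0..2*pi} (\<lambda>y. D y / u (?p y))) ((\<lambda>x. x / (2 * pi)) ` {0..2*pi})"
      by simp
    also have "(\<lambda>x. x / (2 * pi)) ` {0..2*pi} = {0..1}"
      by (subst image_divide_atLeastAtMost) auto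
    finally have "((\<lambda>t. complex_of_real (2 * pi) * (D (2 * pi * t) / u (?p (2 * pi * t)))) has_integral complex_of_real (2 * pi) * ((1 / (2 * pi)) *\<^sub>R integral {0..2*pi} (\<lambda>y. D y / u (?p y)))) {0..1}"
      by (rule has_integral_mult_right)
    then show ?thesis by (simp add: integral_unique scaleR_conv_of_real)
  qed
  finally have "integral {0..2*pi} (\<lambda>y. D y / u (?p y)) = 2 * pi * \<i>" using w by (simp add: field_simps)
  then have "2 * pi = cmod (integral {0..2*pi} (\<lambda>y. D y / u (?p y)))" by (simp add: norm_mult)
  also have "\<dots> \<le> integral {0..2*pi} (\<lambda>y. r * (cmod (\<alpha> (?p y)) + cmod (\<beta> (?p y))) / cmod (u (?p y)))"
  proof (rule integral_norm_bound_integral)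
    show "(\<lambda>y. D y / u (?p y)) integrable_on {0..2*pi}" by (intro integrable_continuous_real cq)
    show "(\<lambda>y. r * (cmod (\<alpha> (?p y)) + cmod (\<beta> (?p y))) / cmod (u (?p y))) integrable_on {0..2*pi}"
      by (intro integrable_continuous_real continuous_intros cont c\<alpha> c\<beta> cu) (use nz inb in auto)
    fix y
    have "cmod (D y) \<le> cmod (\<alpha> (?p y) * (\<i> * ?p y)) + cmod (\<beta> (?p y) * cnj (\<i> * ?p y))" unfolding D_def by (rule norm_triangle_ineq)
    also have "\<dots> = r * (cmod (\<alpha> (?p y)) + cmod (\<beta> (?p y)))" using r by (simp add: norm_mult algebra_simps)
    finally show "cmod (D y / u (?p y)) \<le> r * (cmod (\<alpha> (?p y)) + cmod (\<beta> (?p y))) / cmod (u (?p y))"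
      by (simp add: norm_divide divide_right_mono)
  qed
  finally show ?thesis .
qed

text \<open>
  In logarithmic coordinates $\zeta = \ln z$ the circle of radius $e^x$ becomes a vertical segment, whose
  image has logarithmic length at least $2\pi$. By the Cauchy--Schwarz inequality and the dilatation
  bound, its contribution to the logarithmic area is at least $2 \pi \kappa(x)$ with
  $\kappa(x) = (1 - e^{nx})/(1 + e^{nx})$. If the image of $|z| = \epsilon$ stays outside radius $\delta$, the total
  logarithmic area of the image of $\epsilon < |z| < 1$ is at most $2 \pi \ln (1/\delta)$. Integrating $\kappa$
  compares $\epsilon$ with $\delta$ up to the factor $4^{1/n}$, and $\delta/\epsilon$ tends to $|\alpha(0)|$.
\<close>
lemma length_area_inner_radius:
  fixes u :: "complex \<Rightarrow> complex"
  assumes inj: "inj_on u (ball 0 1)" and im: "u ` ball 0 1 = ball 0 1" and u0: "u 0 = 0"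
    and d: "\<And>z. z \<in> ball 0 1 \<Longrightarrow> (u has_derivative (\<lambda>v. \<alpha> z * v + \<beta> z * cnj v)) (at z)"
    and c\<alpha>: "continuous_on (ball 0 1) \<alpha>" and c\<beta>: "continuous_on (ball 0 1) \<beta>"
    and dil: "\<And>z. z \<in> ball 0 1 \<Longrightarrow> cmod (\<beta> z) \<le> cmod z ^ n * cmod (\<alpha> z)" and n: "n \<ge> 1"
    and a0: "\<alpha> 0 \<noteq> 0"
  shows "cmod (\<alpha> 0) \<le> 4 powr (1 / real n)"
proof -
  have \<beta>0: "\<beta> 0 = 0" using dil[of 0] n by (simp add: power_0_left)
  have cu: "continuous_on (ball 0 1) u"
    using d by (intro has_derivative_continuous_on) (auto intro: has_derivative_at_withinI)
  have nz: "u z \<noteq> 0" if "z \<in> ball 0 1" "z \<noteq> 0" for z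
    using inj_onD[OF inj, of z 0] that u0 by auto
  have wn: "winding_number (increment_loop u 0 r) 0 = 1" if "0 < r" "r < 1" for r
    by (rule winding_increment_loop_eq_1[OF cu inj d[of 0]]) (use a0 \<beta>0 that in auto)
  have main: "- ln \<epsilon> - 2 / real n * ln 2 \<le> - ln \<delta>"
    if \<epsilon>: "0 < \<epsilon>" "\<epsilon> < 1" and \<delta>: "0 < \<delta>" and sph: "\<And>z. cmod z = \<epsilon> \<Longrightarrow> \<delta> < cmod (u z)" for \<epsilon> \<delta>
  proof -
    have "cmod (u (of_real \<epsilon>)) < 1" using im \<epsilon> by (metis imageI mem_ball_0 norm_of_real abs_of_pos)
    then have \<delta>1: "\<delta> < 1" using sph[of "of_real \<epsilon>"] \<epsilon> by simp
    have out: "\<delta> < cmod (u z)" if z: "\<epsilon> < cmod z" "cmod z < 1" for z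
    proof (rule ccontr)
      assume "\<not> ?thesis"
      then have uz: "u z \<in> cball 0 \<delta>" by simp
      define X1 where "X1 = ball (0::complex) \<epsilon>"
      define X2 where "X2 = {z::complex. \<epsilon> < cmod z \<and> cmod z < 1}"
      have o2: "open X2" unfolding X2_def by (intro open_Collect_conj open_Collect_less continuous_intros)
      have sub: "X1 \<subseteq> ball 0 1" "X2 \<subseteq> ball 0 1" using \<epsilon> by (auto simp: X1_def X2_def)
      have op: "open (u ` X1)" "open (u ` X2)"
        by (intro invariance_of_domain continuous_on_subset[OF cu] inj_on_subset[OF inj] sub o2; simp add: X1_def)+
      have "cball 0 \<delta> \<subseteq> u ` X1 \<union> u ` X2"
      proof
        fix w :: complex assume w: "w \<in> cball 0 \<delta>"
        then have "w \<in> u ` ball 0 1" using \<delta>1 by (simp add: im)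
        then obtain y where y: "w = u y" "cmod y < 1" by auto
        then have "cmod y \<noteq> \<epsilon>" using sph[of y] w by auto
        then show "w \<in> u ` X1 \<union> u ` X2" using y by (cases "cmod y < \<epsilon>") (auto simp: X1_def X2_def)
      qed
      moreover have "u ` X1 \<inter> u ` X2 = {}"
        using inj_on_image_Int[OF inj sub] by (auto simp: X1_def X2_def)
      moreover have "0 \<in> u ` X1 \<inter> cball 0 \<delta>" using \<epsilon> \<delta> u0 by (auto simp: X1_def intro!: image_eqI[of _ u 0])
      moreover have "u z \<in> u ` X2 \<inter> cball 0 \<delta>" using uz z by (auto simp: X2_def)
      ultimately show False using connectedD[OF connected_cball op, of 0 \<delta>] by blast
    qed
    define S where "S = {\<zeta>. ln \<epsilon> < Re \<zeta> \<and> Re \<zeta> < 0 \<and> 0 < Im \<zeta> \<and> Im \<zeta> < 2 * pi}"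
    have oS: "open S" unfolding S_def by (intro open_Collect_conj open_Collect_less continuous_intros)
    have expS: "\<epsilon> < cmod (exp \<zeta>)" "cmod (exp \<zeta>) < 1" "exp \<zeta> \<in> ball 0 1" if "\<zeta> \<in> S" for \<zeta>
    proof -
      have "exp (ln \<epsilon>) < exp (Re \<zeta>)" "exp (Re \<zeta>) < exp 0" using that by (auto simp: S_def)
      then show "\<epsilon> < cmod (exp \<zeta>)" "cmod (exp \<zeta>) < 1" using \<epsilon> by auto
      then show "exp \<zeta> \<in> ball 0 1" by (simp del: norm_exp_eq_Re)
    qed
    have injexp: "inj_on exp S"
    proof (rule inj_onI)
      fix z w assume zw: "z \<in> S" "w \<in> S" "exp z = exp w"
      show "z = w" by (rule exp_complex_eqI) (use zw in \<open>auto simp: S_def\<close>)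
    qed
    define \<alpha>' where "\<alpha>' \<zeta> = \<alpha> (exp \<zeta>) * exp \<zeta>" for \<zeta>
    define \<beta>' where "\<beta>' \<zeta> = \<beta> (exp \<zeta>) * cnj (exp \<zeta>)" for \<zeta>
    have der: "((\<lambda>\<zeta>. u (exp \<zeta>)) has_derivative (\<lambda>v. \<alpha>' \<zeta> * v + \<beta>' \<zeta> * cnj v)) (at \<zeta>)" if \<zeta>: "\<zeta> \<in> S" for \<zeta>
    proof -
      have "(exp has_derivative (\<lambda>v. exp \<zeta> * v)) (at \<zeta>)"
        using DERIV_exp[of \<zeta>] by (simp add: has_field_derivative_def)
      from has_derivative_compose[OF this d[OF expS(3)[OF \<zeta>]]] show ?thesis
        by (simp add: \<alpha>'_def \<beta>'_def mult.assoc)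
    qed
    have cexp: "continuous_on S (\<lambda>\<zeta>. k (exp \<zeta>))" if "continuous_on (ball 0 1) k" for k :: "complex \<Rightarrow> complex"
      by (intro continuous_on_compose2[OF that] continuous_intros) (use expS in auto)
    have c\<alpha>': "continuous_on S \<alpha>'" unfolding \<alpha>'_def by (intro continuous_intros cexp c\<alpha>)
    have c\<beta>': "continuous_on S \<beta>'" unfolding \<beta>'_def by (intro continuous_intros cexp c\<beta>)
    define J where "J \<zeta> = \<bar>(cmod (\<alpha>' \<zeta>))\<^sup>2 - (cmod (\<beta>' \<zeta>))\<^sup>2\<bar> * (1 / (cmod (u (exp \<zeta>)))\<^sup>2)" for \<zeta>
    have upper: "(\<integral>\<^sup>+x. \<integral>\<^sup>+y. indicator S (Complex x y) * ennreal (J (Complex x y)) \<partial>lborel \<partial>lborel) \<le> ennreal (2 * pi * ln (1 / \<delta>))"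
    proof -
      have ii: "inj_on (\<lambda>\<zeta>. u (exp \<zeta>)) S"
        using injexp inj expS(3) by (auto simp: inj_on_def)
      have sub: "(\<lambda>\<zeta>. u (exp \<zeta>)) ` S \<subseteq> {w. \<delta> < cmod w \<and> cmod w < 1}"
      proof
        fix w assume "w \<in> (\<lambda>\<zeta>. u (exp \<zeta>)) ` S"
        then obtain \<zeta> where \<zeta>: "w = u (exp \<zeta>)" "\<zeta> \<in> S" by auto
        have "u (exp \<zeta>) \<in> ball 0 1" using im expS(3)[OF \<zeta>(2)] by blast
        then show "w \<in> {w. \<delta> < cmod w \<and> cmod w < 1}" using out[OF expS(1,2)[OF \<zeta>(2)]] \<zeta>(1) by simp
      qed
      have m: "(\<lambda>w::complex. 1 / (cmod w)\<^sup>2) \<in> borel_measurable borel" by measurable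
      show ?thesis
        using area_inequality[OF oS ii der c\<alpha>' c\<beta>' m _ sub] 
        unfolding nn_integral_log_annulus[OF \<delta> \<delta>1] J_def by simp
    qed
    \<comment> \<open>the reciprocal of the maximal dilatation on the circle of radius \<open>exp x\<close>\<close>
    define \<kappa> where "\<kappa> x = (1 - exp (real n * x)) / (1 + exp (real n * x))" for x
    have \<kappa>0: "\<kappa> x \<ge> 0" if "x \<le> 0" for x
    proof -
      have "exp (real n * x) \<le> 1" using that by (simp add: mult_nonneg_nonpos)
      then show ?thesis unfolding \<kappa>_def by (intro divide_nonneg_pos) (auto simp: add_pos_pos)
    qed
    define FF where "FF x = 2 * pi * (x - 2 / real n * ln (1 + exp (real n * x)))" for x
    have lne: "ln \<epsilon> < 0" using \<epsilon> by simp
    have "((\<lambda>x. 2 * pi * \<kappa> x) has_integral (FF 0 - FF (ln \<epsilon>))) {ln \<epsilon>..0}"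
    proof (rule fundamental_theorem_of_calculus)
      fix x
      have pos: "1 + exp (real n * x) > 0" by (simp add: add_pos_pos)
      have "(FF has_real_derivative 2 * pi * (1 - 2 / real n * (exp (real n * x) * real n / (1 + exp (real n * x))))) (at x within {ln \<epsilon>..0})"
        unfolding FF_def using pos by (auto intro!: derivative_eq_intros)
      moreover have "1 - 2 / real n * (exp (real n * x) * real n / (1 + exp (real n * x))) = \<kappa> x"
        using pos n by (simp add: \<kappa>_def field_simps)
      ultimately show "(FF has_vector_derivative 2 * pi * \<kappa> x) (at x within {ln \<epsilon>..0})"
        by (simp add: has_real_derivative_iff_has_vector_derivative)
    qed (use lne in auto)
    then have eqI: "(\<integral>\<^sup>+x. indicator {ln \<epsilon><..<0} x * ennreal (2 * pi * \<kappa> x) \<partial>lborel) = ennreal (FF 0 - FF (ln \<epsilon>))"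
    proof (rule nn_integral_open_interval)
      show "0 \<le> 2 * pi * \<kappa> x" if "ln \<epsilon> < x" "x < 0" for x using \<kappa>0[of x] that by simp
      have "1 + exp (real n * x) \<noteq> 0" for x by (metis add_pos_pos exp_gt_zero less_numeral_extra(3) zero_less_one)
      then show "continuous_on {ln \<epsilon><..<0} (\<lambda>x. 2 * pi * \<kappa> x)" unfolding \<kappa>_def by (intro continuous_intros) auto
    qed
    have "(\<integral>\<^sup>+x. indicator {ln \<epsilon><..<0} x * ennreal (2 * pi * \<kappa> x) \<partial>lborel) \<le>
       (\<integral>\<^sup>+x. \<integral>\<^sup>+y. indicator S (Complex x y) * ennreal (J (Complex x y)) \<partial>lborel \<partial>lborel)"
    proof (rule nn_integral_mono)
      fix x
      show "indicator {ln \<epsilon><..<0} x * ennreal (2 * pi * \<kappa> x) \<le> (\<integral>\<^sup>+y. indicator S (Complex x y) * ennreal (J (Complex x y)) \<partial>lborel)"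
      proof (cases "x \<in> {ln \<epsilon><..<0}")
        case True
        then have x: "ln \<epsilon> < x" "x < 0" by auto
        define r where "r = exp x"
        have r: "0 < r" "r < 1" using x by (auto simp: r_def)
        have ez: "exp (Complex x y) = of_real r * cis y" for y by (simp add: complex_eq_iff Re_exp Im_exp r_def)
        have inb: "of_real r * cis y \<in> ball 0 1" "of_real r * cis y \<noteq> 0" for y using r by (auto simp: norm_mult)
        have cont: "continuous_on A (\<lambda>y. k (of_real r * cis y))" if "continuous_on (ball 0 1) k" for A and k :: "complex \<Rightarrow> complex"
          by (intro continuous_on_compose2[OF that] continuous_intros continuous_on_cis) (use inb in auto)
        define L where "L y = r * (cmod (\<alpha> (of_real r * cis y)) + cmod (\<beta> (of_real r * cis y))) / cmod (u (of_real r * cis y))" for y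
        have cL: "continuous_on A L" for A unfolding L_def
          by (intro continuous_intros cont c\<alpha> c\<beta> cu) (use nz inb in auto)
        have cJ: "continuous_on A (\<lambda>y. J (Complex x y))" for A
          unfolding J_def \<alpha>'_def \<beta>'_def ez
          by (intro continuous_intros continuous_on_cis cont c\<alpha> c\<beta> cu) (use nz inb in auto)
        have "2 * pi - 0 \<le> integral {0..2*pi} (\<lambda>y. (L y)\<^sup>2)"
          by (rule integral_square_ge_length[OF cL])
             (use circle_image_length[OF d c\<alpha> c\<beta> r u0 nz wn[OF r]] in \<open>simp_all add: L_def[abs_def]\<close>)
        then have "2 * pi * \<kappa> x \<le> \<kappa> x * integral {0..2*pi} (\<lambda>y. (L y)\<^sup>2)"
          using \<kappa>0[of x] x by (simp add: mult.commute mult_left_mono)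
        also have "\<dots> = integral {0..2*pi} (\<lambda>y. \<kappa> x * (L y)\<^sup>2)" by simp
        also have "\<dots> \<le> integral {0..2*pi} (\<lambda>y. J (Complex x y))"
        proof (rule integral_le)
          show "(\<lambda>y. \<kappa> x * (L y)\<^sup>2) integrable_on {0..2*pi}" by (intro integrable_continuous_real continuous_intros cL)
          show "(\<lambda>y. J (Complex x y)) integrable_on {0..2*pi}" by (intro integrable_continuous_real cJ)
          fix y
          let ?z = "of_real r * cis y"
          define A where "A = cmod (\<alpha> ?z)"
          define B where "B = cmod (\<beta> ?z)"
          define s where "s = exp (real n * x)"
          have s: "0 < s" "s < 1" using x n by (auto simp: s_def mult_pos_neg)
          have sr: "s = r ^ n" by (simp add: s_def r_def exp_of_nat_mult)
          have AB: "0 \<le> A" "0 \<le> B" "B \<le> s * A"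
            using dil[OF inb(1)[of y]] r by (auto simp: A_def B_def sr norm_mult)
          have "s * A \<le> 1 * A" using s AB by (intro mult_right_mono) auto
          then have BA: "B \<le> A" using AB by simp
          have "(A + B) * (B - s * A) \<le> 0" using AB by (intro mult_nonneg_nonpos) auto
          then have "(A + B)\<^sup>2 * (1 - s) \<le> (A\<^sup>2 - B\<^sup>2) * (1 + s)" by (simp add: power2_eq_square algebra_simps)
          moreover have "\<kappa> x = (1 - s) / (1 + s)" by (simp add: \<kappa>_def s_def)
          ultimately have k1: "\<kappa> x * (A + B)\<^sup>2 \<le> A\<^sup>2 - B\<^sup>2" using s by (simp add: divide_le_eq mult.commute)
          have "B\<^sup>2 \<le> A\<^sup>2" using AB BA by (intro power_mono) auto
          then have J1: "J (Complex x y) = (A\<^sup>2 - B\<^sup>2) * (r\<^sup>2 / (cmod (u ?z))\<^sup>2)"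
            unfolding J_def \<alpha>'_def \<beta>'_def ez using r
            by (simp add: norm_mult A_def B_def power_mult_distrib left_diff_distrib[symmetric] abs_mult)
          have "\<kappa> x * (L y)\<^sup>2 = \<kappa> x * (A + B)\<^sup>2 * (r\<^sup>2 / (cmod (u ?z))\<^sup>2)"
            by (simp add: L_def A_def B_def power_divide power_mult_distrib)
          also have "\<dots> \<le> J (Complex x y)" unfolding J1 by (intro mult_right_mono k1) auto
          finally show "\<kappa> x * (L y)\<^sup>2 \<le> J (Complex x y)" .
        qed
        finally have "ennreal (2 * pi * \<kappa> x) \<le> ennreal (integral {0..2*pi} (\<lambda>y. J (Complex x y)))" by (rule ennreal_leI)
        also have "\<dots> = (\<integral>\<^sup>+y. indicator {0<..<2*pi} y * ennreal (J (Complex x y)) \<partial>lborel)"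
          by (intro nn_integral_open_interval[symmetric] integrable_integral integrable_continuous_real cJ) (simp add: J_def)
        also have "\<dots> = (\<integral>\<^sup>+y. indicator S (Complex x y) * ennreal (J (Complex x y)) \<partial>lborel)"
          using x by (intro nn_integral_cong) (auto simp: S_def indicator_def)
        finally show ?thesis using True by simp
      qed auto
    qed
    also note upper
    finally have "ennreal (FF 0 - FF (ln \<epsilon>)) \<le> ennreal (2 * pi * ln (1 / \<delta>))" unfolding eqI .
    then have "FF 0 - FF (ln \<epsilon>) \<le> 2 * pi * ln (1 / \<delta>)" using \<delta> \<delta>1 by (subst (asm) ennreal_le_iff) auto
    then have "2 * pi * (- (2 / real n * ln 2) - ln \<epsilon> + 2 / real n * ln (1 + exp (real n * ln \<epsilon>))) \<le> 2 * pi * ln (1 / \<delta>)"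
      by (simp add: FF_def algebra_simps)
    then have "- (2 / real n * ln 2) - ln \<epsilon> + 2 / real n * ln (1 + exp (real n * ln \<epsilon>)) \<le> ln (1 / \<delta>)"
      by (subst (asm) mult_le_cancel_left_pos) auto
    moreover have "0 \<le> 2 / real n * ln (1 + exp (real n * ln \<epsilon>))" by (intro mult_nonneg_nonneg) auto
    moreover have "ln (1 / \<delta>) = - ln \<delta>" using \<delta> by (simp add: ln_div)
    ultimately show ?thesis by linarith
  qed
  have bound: "a \<le> 4 powr (1 / real n)" if a: "0 < a" "a < cmod (\<alpha> 0)" for a
  proof -
    define \<eta> where "\<eta> = (cmod (\<alpha> 0) - a) / 2"
    have \<eta>: "\<eta> > 0" using a by (simp add: \<eta>_def)
    have "\<forall>e>0. \<exists>d>0. \<forall>y. cmod (y - 0) < d \<longrightarrow> cmod (u y - u 0 - (\<alpha> 0 * (y - 0) + \<beta> 0 * cnj (y - 0))) \<le> e * cmod (y - 0)"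
      by (rule conjunct2[OF d[of 0, unfolded has_derivative_at_alt]]) simp
    from this[rule_format, OF \<eta>] obtain d0
      where "d0 > 0 \<and> (\<forall>y. cmod (y - 0) < d0 \<longrightarrow> cmod (u y - u 0 - (\<alpha> 0 * (y - 0) + \<beta> 0 * cnj (y - 0))) \<le> \<eta> * cmod (y - 0))" ..
    then have d0: "d0 > 0" "\<And>y. cmod (y - 0) < d0 \<Longrightarrow> cmod (u y - u 0 - (\<alpha> 0 * (y - 0) + \<beta> 0 * cnj (y - 0))) \<le> \<eta> * cmod (y - 0)"
      by simp_all
    define \<epsilon> where "\<epsilon> = min (d0 / 2) (1 / 2)"
    have \<epsilon>: "0 < \<epsilon>" "\<epsilon> < 1" "\<epsilon> < d0" using d0(1) by (auto simp: \<epsilon>_def)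
    have "- ln \<epsilon> - 2 / real n * ln 2 \<le> - ln (a * \<epsilon>)"
    proof (rule main[OF \<epsilon>(1,2)])
      show "0 < a * \<epsilon>" using a \<epsilon> by simp
      fix z :: complex assume z: "cmod z = \<epsilon>"
      have "cmod (u z - \<alpha> 0 * z) \<le> \<eta> * \<epsilon>" using d0(2)[of z] z \<epsilon> by (simp add: u0 \<beta>0)
      moreover have "cmod (\<alpha> 0 * z) - cmod (u z) \<le> cmod (u z - \<alpha> 0 * z)" by (metis norm_minus_commute norm_triangle_ineq2)
      ultimately have "cmod (\<alpha> 0) * \<epsilon> - \<eta> * \<epsilon> \<le> cmod (u z)" using z by (simp add: norm_mult)
      moreover have "a * \<epsilon> < (cmod (\<alpha> 0) - \<eta>) * \<epsilon>" using a \<epsilon> by (intro mult_strict_right_mono) (auto simp: \<eta>_def field_simps)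
      ultimately show "a * \<epsilon> < cmod (u z)" by (simp add: algebra_simps)
    qed
    then have "ln a \<le> 2 / real n * ln 2" using a \<epsilon> by (simp add: ln_mult)
    then have "exp (ln a) \<le> exp (2 / real n * ln 2)" by simp
    also have "exp (2 / real n * ln 2) = 4 powr (1 / real n)"
    proof -
      have "ln 4 = 2 * ln (2::real)" using ln_realpow[of 2 2] by simp
      then show ?thesis by (simp add: powr_def)
    qed
    finally show ?thesis using a by simp
  qed
  show ?thesis
  proof (rule dense_le_bounded[of 0])
    show "0 < cmod (\<alpha> 0)" using a0 by simp
  qed (rule bound)
qed

text \<open>
  The Riemann mapping theorem together with a Moebius transformation that moves the image of the origin to
  the origin.
\<close>
lemma riemann_map_normalized:
  assumes "open \<Omega>" "simply_connected \<Omega>" "0 \<in> \<Omega>" "\<Omega> \<noteq> UNIV"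
  obtains \<psi> k where "\<psi> holomorphic_on ball 0 1" "k holomorphic_on \<Omega>" "\<psi> 0 = 0" "k 0 = 0"
    "\<And>z. z \<in> ball 0 1 \<Longrightarrow> \<psi> z \<in> \<Omega> \<and> k (\<psi> z) = z" "\<And>w. w \<in> \<Omega> \<Longrightarrow> k w \<in> ball 0 1 \<and> \<psi> (k w) = w"
proof -
  obtain F G where FG: "F holomorphic_on \<Omega>" "G holomorphic_on ball 0 1"
    "\<And>z. z \<in> \<Omega> \<Longrightarrow> F z \<in> ball 0 1 \<and> G (F z) = z" "\<And>z. z \<in> ball 0 1 \<Longrightarrow> G z \<in> \<Omega> \<and> F (G z) = z"
    using Riemann_mapping_theorem[of \<Omega>] assms by blast
  define b where "b = F 0"
  have b: "cmod b < 1" "cmod (- b) < 1" using FG(3)[OF assms(3)] by (auto simp: b_def)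
  define M where "M = Moebius_function 0 b"
  define N where "N = Moebius_function 0 (- b)"
  have M: "M holomorphic_on ball 0 1" "\<And>z. z \<in> ball 0 1 \<Longrightarrow> M z \<in> ball 0 1" "M b = 0"
    using Moebius_function_holomorphic[OF b(1)] Moebius_function_norm_lt_1[OF b(1)] by (auto simp: M_def Moebius_function_eq_zero)
  have N: "N holomorphic_on ball 0 1" "\<And>z. z \<in> ball 0 1 \<Longrightarrow> N z \<in> ball 0 1" "N 0 = b"
    using Moebius_function_holomorphic[OF b(2)] Moebius_function_norm_lt_1[OF b(2)] by (auto simp: N_def Moebius_function_of_zero)
  have MN: "M (N z) = z" "N (M z) = z" if "z \<in> ball 0 1" for z
    using Moebius_function_compose[of b "- b" z] Moebius_function_compose[of "- b" b z] b that by (auto simp: M_def N_def)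
  show ?thesis
  proof (rule that[of "\<lambda>z. G (N z)" "\<lambda>w. M (F w)"])
    show "(\<lambda>z. G (N z)) holomorphic_on ball 0 1"
      using holomorphic_on_compose_gen[OF N(1) FG(2)] N(2) by (auto simp: o_def image_subset_iff)
    show "(\<lambda>w. M (F w)) holomorphic_on \<Omega>"
      using holomorphic_on_compose_gen[OF FG(1) M(1)] FG(3) by (auto simp: o_def image_subset_iff)
    show "G (N 0) = 0" using N(3) FG(3)[OF assms(3)] by (simp add: b_def)
    show "M (F 0) = 0" using M(3) by (simp add: b_def)
    show "G (N z) \<in> \<Omega> \<and> M (F (G (N z))) = z" if "z \<in> ball 0 1" for z
      using FG(4)[OF N(2)[OF that]] MN[OF that] by simp
    show "M (F w) \<in> ball 0 1 \<and> G (N (M (F w))) = w" if "w \<in> \<Omega>" for w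
      using FG(3)[OF that] MN[of "F w"] M(2)[of "F w"] by simp
  qed
qed

text \<open>
  Compose \<open>f\<close> with the inverse \<open>k\<close> of a Riemann map of its image. Composition with a holomorphic function on
  the left multiplies both Wirtinger derivatives by the same factor in modulus, so the dilatation is
  unchanged and the length-area estimate bounds $|k'(0)|$; the one-quarter theorem bounds the derivative of
  the Riemann map in terms of the omitted value.
\<close>
lemma covering_theorem:
  assumes h: "h holomorphic_on ball 0 1" and g: "g holomorphic_on ball 0 1"
    and f: "\<And>z. z \<in> ball 0 1 \<Longrightarrow> f z = h z + cnj (g z)" and inj: "inj_on f (ball 0 1)"
    and h0: "h 0 = 0" and g0: "g 0 = 0" and h1: "deriv h 0 = 1"
    and gn: "\<And>j. 1 \<le> j \<Longrightarrow> j \<le> n \<Longrightarrow> taylor_coeff g j = 0" and n: "n \<ge> 1"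
    and w: "w \<notin> f ` ball 0 1"
  shows "1 / (4 * 4 powr (1 / real n)) \<le> cmod w"
proof -
  have g1: "deriv g 0 = 0" using gn[of 1] n by (simp add: fps_expansion_def)
  have cont: "continuous_on (ball 0 1) f"
    by (rule univalent_harmonic_sense_preserving(1)[OF h g _ inj h1 g1]) (rule f)
  have df: "(f has_derivative (\<lambda>v. deriv h z * v + cnj (deriv g z) * cnj v)) (at z)" if "z \<in> ball 0 1" for z
    by (rule univalent_harmonic_sense_preserving(2)[OF h g _ inj h1 g1 that]) (rule f)
  have dil: "cmod (deriv g z) \<le> cmod z ^ n * cmod (deriv h z)" if "z \<in> ball 0 1" for z
    by (rule univalent_harmonic_dilatation[OF h g _ inj h1 _ n that]) (rule f gn; assumption)+
  define \<Omega> where "\<Omega> = f ` ball 0 1"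
  have op: "open \<Omega>" unfolding \<Omega>_def by (intro invariance_of_domain cont inj open_ball)
  have "ball (0::complex) 1 homeomorphic \<Omega>" unfolding \<Omega>_def by (intro invariance_of_domain_homeomorphic cont inj) auto
  then have sc: "simply_connected \<Omega>"
    using homeomorphic_simply_connected_eq convex_imp_simply_connected[OF convex_ball] by metis
  have f0: "f 0 = 0" using f[of 0] h0 g0 by simp
  have z\<Omega>: "0 \<in> \<Omega>" unfolding \<Omega>_def using f0 by (auto intro!: image_eqI[of _ f 0])
  have "\<Omega> \<noteq> UNIV" using w by (auto simp: \<Omega>_def)
  then obtain \<psi> k where \<psi>: "\<psi> holomorphic_on ball 0 1" "k holomorphic_on \<Omega>" "\<psi> 0 = 0" "k 0 = 0"
    "\<And>z. z \<in> ball 0 1 \<Longrightarrow> \<psi> z \<in> \<Omega> \<and> k (\<psi> z) = z" "\<And>w. w \<in> \<Omega> \<Longrightarrow> k w \<in> ball 0 1 \<and> \<psi> (k w) = w"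
    by (rule riemann_map_normalized[OF op sc z\<Omega>]) (rule that)
  have f\<Omega>: "f z \<in> \<Omega>" if "z \<in> ball 0 1" for z using that by (auto simp: \<Omega>_def)
  have dk: "(k has_field_derivative deriv k w) (at w)" if "w \<in> \<Omega>" for w
    by (rule holomorphic_derivI[OF \<psi>(2) op that])
  have inj\<psi>: "inj_on \<psi> (ball 0 1)" by (rule inj_on_inverseI[of _ k]) (use \<psi>(5) in auto)
  have "w \<notin> \<psi> ` ball 0 1" using \<psi>(5) w by (auto simp: \<Omega>_def)
  then have koebe: "cmod (deriv \<psi> 0) \<le> 4 * cmod w" by (rule koebe_quarter[OF \<psi>(1) inj\<psi> \<psi>(3)])
  have kd: "deriv k 0 * deriv \<psi> 0 = 1"
  proof -
    have "(\<psi> has_field_derivative deriv \<psi> 0) (at 0)" by (rule holomorphic_derivI[OF \<psi>(1)]) auto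
    moreover have "(k has_field_derivative deriv k 0) (at (\<psi> 0))" using dk[OF z\<Omega>] \<psi>(3) by simp
    ultimately have "((\<lambda>z. k (\<psi> z)) has_field_derivative deriv k 0 * deriv \<psi> 0) (at 0)" by (rule DERIV_chain2[rotated])
    then have "((\<lambda>z. z) has_field_derivative deriv k 0 * deriv \<psi> 0) (at (0::complex))"
      by (rule has_field_derivative_transform_within_open[OF _ open_ball[of 0 1]]) (use \<psi>(5) in auto)
    then show ?thesis using DERIV_ident DERIV_unique by blast
  qed
  have fk: "continuous_on (ball 0 1) (\<lambda>z. deriv k (f z))"
    by (rule continuous_on_compose2[OF holomorphic_on_imp_continuous_on[OF holomorphic_deriv[OF \<psi>(2) op]] cont]) (use f\<Omega> in auto)
  have hd: "continuous_on (ball 0 1) (deriv h)" "continuous_on (ball 0 1) (deriv g)"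
    by (intro holomorphic_on_imp_continuous_on holomorphic_deriv h g open_ball)+
  have "cmod (deriv k (f 0) * deriv h 0) \<le> 4 powr (1 / real n)"
  proof (rule length_area_inner_radius[where u = "\<lambda>z. k (f z)" and \<alpha> = "\<lambda>z. deriv k (f z) * deriv h z" and \<beta> = "\<lambda>z. deriv k (f z) * cnj (deriv g z)"])
    show "inj_on (\<lambda>z. k (f z)) (ball 0 1)"
    proof (rule inj_onI)
      fix x y assume xy: "x \<in> ball 0 1" "y \<in> ball 0 1" "k (f x) = k (f y)"
      then have "f x = f y" using \<psi>(6) f\<Omega> by metis
      then show "x = y" using inj xy by (auto dest: inj_onD)
    qed
    show "(\<lambda>z. k (f z)) ` ball 0 1 = ball 0 1"
    proof (intro equalityI subsetI)
      fix y :: complex assume y: "y \<in> ball 0 1"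
      then have "\<psi> y \<in> f ` ball 0 1" using \<psi>(5)[OF y] by (simp add: \<Omega>_def)
      then obtain z where "z \<in> ball 0 1" "\<psi> y = f z" by blast
      then show "y \<in> (\<lambda>z. k (f z)) ` ball 0 1" using \<psi>(5)[OF y] by (metis image_eqI)
    qed (use \<psi>(6) f\<Omega> in auto)
    show "((\<lambda>z. k (f z)) has_derivative (\<lambda>v. deriv k (f z) * deriv h z * v + deriv k (f z) * cnj (deriv g z) * cnj v)) (at z)" if "z \<in> ball 0 1" for z
      using has_derivative_compose[OF df[OF that] dk[OF f\<Omega>[OF that], unfolded has_field_derivative_def]]
      by (simp add: algebra_simps)
    show "continuous_on (ball 0 1) (\<lambda>z. deriv k (f z) * deriv h z)" "continuous_on (ball 0 1) (\<lambda>z. deriv k (f z) * cnj (deriv g z))"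
      by (intro continuous_intros fk hd)+
    show "cmod (deriv k (f z) * cnj (deriv g z)) \<le> cmod z ^ n * cmod (deriv k (f z) * deriv h z)" if "z \<in> ball 0 1" for z
      using mult_left_mono[OF dil[OF that], of "cmod (deriv k (f z))"] by (simp add: norm_mult mult_ac)
    show "deriv k (f 0) * deriv h 0 \<noteq> 0" using kd f0 h1 by auto
  qed (use f0 \<psi> n in auto)
  then have "cmod (deriv k 0) \<le> 4 powr (1 / real n)" using f0 h1 by simp
  then have "cmod (deriv k 0) * cmod (deriv \<psi> 0) \<le> 4 powr (1 / real n) * (4 * cmod w)"
    using koebe by (intro mult_mono) auto
  moreover have "cmod (deriv k 0) * cmod (deriv \<psi> 0) = 1" using kd by (metis norm_mult norm_one)
  ultimately show ?thesis by (simp add: field_simps)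
qed

section \<open>Chords of circle maps\<close>

text \<open>
  Equality holds for the equilateral triangle. This is the origin of the constant $27/(4\pi^2)$.
\<close>
lemma sin_sq_triangle:
  fixes a b c :: real
  assumes "a + b + c = pi"
  shows "(sin a)\<^sup>2 + (sin b)\<^sup>2 + (sin c)\<^sup>2 \<le> 9/4"
proof -
  have c: "c = pi - (a + b)" using assms by simp
  have 1: "(sin a)\<^sup>2 + (sin b)\<^sup>2 = 1 - cos (a + b) * cos (a - b)"
  proof -
    have "cos (a + b) * cos (a - b) = (cos a)\<^sup>2 * (cos b)\<^sup>2 - (sin a)\<^sup>2 * (sin b)\<^sup>2"
      by (simp add: cos_add cos_diff power2_eq_square algebra_simps)
    also have "\<dots> = 1 - (sin a)\<^sup>2 - (sin b)\<^sup>2"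
      by (simp add: cos_squared_eq algebra_simps)
    finally show ?thesis by simp
  qed
  define k where "k = cos (a + b)"
  have "- (k * cos (a - b)) \<le> \<bar>k\<bar> * \<bar>cos (a - b)\<bar>" by (metis abs_ge_minus_self abs_mult)
  also have "\<dots> \<le> \<bar>k\<bar> * 1" by (intro mult_left_mono) auto
  finally have 2: "- (k * cos (a - b)) \<le> \<bar>k\<bar>" by simp
  have 3: "(sin c)\<^sup>2 = 1 - k\<^sup>2" by (simp add: c k_def sin_squared_eq)
  have "0 \<le> (\<bar>k\<bar> - 1/2)\<^sup>2" by simp
  then have "\<bar>k\<bar> - k\<^sup>2 \<le> 1/4" by (simp add: power2_eq_square algebra_simps)
  then show ?thesis using 1 2 3 by (simp add: k_def)
qed

lemma sin_sq_merge:
  fixes a b :: real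
  assumes "0 \<le> a" "0 \<le> b" "a + b \<le> pi / 2"
  shows "(sin a)\<^sup>2 + (sin b)\<^sup>2 \<le> (sin (a + b))\<^sup>2"
proof -
  have "(sin (a + b))\<^sup>2 - (sin a)\<^sup>2 - (sin b)\<^sup>2 = 2 * sin a * sin b * cos (a + b)"
  proof -
    have 1: "(sin (a + b))\<^sup>2 = (sin a)\<^sup>2 * (cos b)\<^sup>2 + (cos a)\<^sup>2 * (sin b)\<^sup>2 + 2 * sin a * sin b * cos a * cos b"
      by (simp add: sin_add power2_eq_square algebra_simps)
    show ?thesis unfolding 1 cos_add cos_squared_eq by (simp add: power2_eq_square algebra_simps)
  qed
  also have "\<dots> \<ge> 0" using assms by (intro mult_nonneg_nonneg sin_ge_zero cos_ge_zero) auto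
  finally show ?thesis by simp
qed

text \<open>
  Among four or more nonnegative angles with sum $\pi$, two can be merged without decreasing the sum of the
  squared sines, because some two of them have sum at most $\pi/2$; so three angles are the worst case.
\<close>
lemma sum_sin_sq_partition:
  fixes xs :: "real list"
  shows "(\<forall>x\<in>set xs. 0 \<le> x) \<Longrightarrow> sum_list xs = pi \<Longrightarrow> (\<Sum>x\<leftarrow>xs. (sin x)\<^sup>2) \<le> 9/4"
proof (induction "length xs" arbitrary: xs rule: less_induct)
  case (less xs)
  show ?case
  proof (cases "length xs \<le> 3")
    case True
    then consider "xs = []" | a where "xs = [a]" | a b where "xs = [a, b]" | a b c where "xs = [a, b, c]"
      by (cases xs; cases "tl xs"; cases "tl (tl xs)"; cases "tl (tl (tl xs))") auto
    then show ?thesis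
    proof cases
      case 1 then show ?thesis by simp
    next
      case 2 then show ?thesis using less.prems by simp
    next
      case (3 a b) then show ?thesis using sin_sq_triangle[of a b 0] less.prems by simp
    next
      case (4 a b c) then show ?thesis using sin_sq_triangle[of a b c] less.prems by (simp add: add.assoc)
    qed
  next
    case False
    then obtain a b c d ys where xs: "xs = a # b # c # d # ys"
      by (metis (no_types) Suc_le_length_iff not_less_eq_eq numeral_3_eq_3)
    have nn: "0 \<le> a" "0 \<le> b" "0 \<le> c" "0 \<le> d" "0 \<le> sum_list ys"
      using less.prems(1) xs by (auto intro: sum_list_nonneg)
    have s: "a + b + c + d + sum_list ys = pi" using less.prems(2) xs by simp
    show ?thesis
    proof (cases "a + b \<le> pi / 2")
      case True
      have "(\<Sum>x\<leftarrow>(a + b) # c # d # ys. (sin x)\<^sup>2) \<le> 9/4"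
        by (rule less.hyps) (use less.prems(1) s xs nn in auto)
      then show ?thesis using sin_sq_merge[of a b] nn True xs by simp
    next
      case False
      have "(\<Sum>x\<leftarrow>a # b # (c + d) # ys. (sin x)\<^sup>2) \<le> 9/4"
        by (rule less.hyps) (use less.prems(1) s xs nn in auto)
      then show ?thesis using sin_sq_merge[of c d] nn False xs s by simp
    qed
  qed
qed

lemma cmod_cis_diff_sq: "(cmod (cis \<beta> - cis \<alpha>))\<^sup>2 = 4 * (sin ((\<beta> - \<alpha>) / 2))\<^sup>2"
proof -
  have "(cmod (cis \<beta> - cis \<alpha>))\<^sup>2 = 2 - 2 * cos (\<beta> - \<alpha>)"
    unfolding cmod_power2 by (simp add: cos_diff power2_diff algebra_simps)
  also have "cos (\<beta> - \<alpha>) = 1 - 2 * (sin ((\<beta> - \<alpha>) / 2))\<^sup>2"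
    by (metis cos_double_sin field_sum_of_halves mult_2)
  finally show ?thesis by simp
qed

lemma integral_periodic_shift:
  fixes f :: "real \<Rightarrow> 'a::euclidean_space"
  assumes c: "continuous_on UNIV f" and p: "\<And>y. f (y + 2 * pi) = f y"
  shows "integral {0..2*pi} (\<lambda>y. f (y + a)) = integral {0..2*pi} f"
proof -
  have int: "f integrable_on {u..v}" for u v by (intro integrable_continuous_real continuous_on_subset[OF c]) auto
  have shift: "integral {u..v} (\<lambda>y. f (y + b)) = integral {u+b..v+b} f" for u v b
  proof -
    have "continuous_on {u+b..v+b} f" by (rule continuous_on_subset[OF c]) auto
    from integral_shift[OF this] show ?thesis by (simp add: o_def)
  qed
  have base: "integral {0..2*pi} (\<lambda>y. f (y + b)) = integral {0..2*pi} f" if b: "0 \<le> b" "b \<le> 2 * pi" for b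
  proof -
    have "integral {0..2*pi} (\<lambda>y. f (y + b)) = integral {b..2*pi+b} f" using shift[of 0 "2*pi" b] by simp
    also have "\<dots> = integral {b..2*pi} f + integral {2*pi..2*pi+b} f"
      using b by (intro Henstock_Kurzweil_Integration.integral_combine[symmetric] int) auto
    also have "integral {2*pi..2*pi+b} f = integral {0..b} (\<lambda>y. f (y + 2*pi))"
      using shift[of 0 b "2*pi"] by (simp add: add.commute)
    also have "\<dots> = integral {0..b} f" by (simp add: p)
    also have "integral {b..2*pi} f + integral {0..b} f = integral {0..2*pi} f"
      using b by (subst add.commute, intro Henstock_Kurzweil_Integration.integral_combine int) auto
    finally show ?thesis .
  qed
  have pn: "f (y + 2 * pi * of_int n) = f y" for y n
  proof (induction n rule: int_induct[of _ 0])
    case (step1 i)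
    have "f (y + 2 * pi * of_int (i + 1)) = f ((y + 2 * pi * of_int i) + 2 * pi)" by (simp add: algebra_simps)
    then show ?case using p step1 by simp
  next
    case (step2 i)
    have "f (y + 2 * pi * of_int i) = f ((y + 2 * pi * of_int (i - 1)) + 2 * pi)" by (simp add: algebra_simps)
    then show ?case using p step2 by simp
  qed simp
  define n where "n = \<lfloor>a / (2 * pi)\<rfloor>"
  define b where "b = a - 2 * pi * of_int n"
  have "of_int n \<le> a / (2 * pi)" "a / (2 * pi) < of_int n + 1" by (auto simp: n_def)
  then have b: "0 \<le> b" "b \<le> 2 * pi" by (auto simp: b_def field_simps)
  have "f (y + a) = f (y + b)" for y
    using pn[of "y + b" n] by (simp add: b_def)
  then show ?thesis using base[OF b] by simp
qed


definition chord_energy :: "(real \<Rightarrow> complex) \<Rightarrow> real \<Rightarrow> real"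
  where "chord_energy F x = integral {0..2*pi} (\<lambda>y. (cmod (F (y + x) - F y))\<^sup>2)"

lemma continuous_chord_energy:
  assumes "continuous_on UNIV F"
  shows "continuous_on A (chord_energy F)"
proof -
  have "continuous_on (A \<times> cbox 0 (2*pi)) (\<lambda>(x, y). (cmod (F (y + x) - F y))\<^sup>2)"
    unfolding split_beta by (intro continuous_intros continuous_on_compose2[OF assms]) auto
  from integral_continuous_on_param[OF this] show ?thesis
    by (simp add: chord_energy_def[abs_def])
qed

text \<open>
  A monotone circle map sends the points $y, y + x, \dots, y + Nx$ to the vertices of a polygon inscribed
  in the unit circle that goes around once. The squared side lengths sum to at most $4 \cdot 9/4 = 9$;
  integrate over $y$. The last side has parameter length $2\pi - Nx$.
\<close>
lemma chord_energy_partition: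
  fixes \<theta> :: "real \<Rightarrow> real"
  assumes c: "continuous_on UNIV \<theta>" and m: "mono \<theta>" and p: "\<And>t. \<theta> (t + 2 * pi) = \<theta> t + 2 * pi"
    and x: "0 \<le> x" "real N * x \<le> 2 * pi"
  shows "real N * chord_energy (cis \<circ> \<theta>) x + chord_energy (cis \<circ> \<theta>) (2 * pi - real N * x) \<le> 18 * pi"
proof -
  let ?F = "cis \<circ> \<theta>"
  have cF: "continuous_on UNIV ?F" by (intro continuous_on_compose c continuous_on_cis continuous_on_id)
  have pF: "?F (t + 2 * pi) = ?F t" for t by (simp add: p complex_eq_iff)
  define q where "q k y = (cmod (?F (y + real k * x + x) - ?F (y + real k * x)))\<^sup>2" for k y
  define r where "r y = (cmod (?F (y + real N * x + (2 * pi - real N * x)) - ?F (y + real N * x)))\<^sup>2" for y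
  have cq: "continuous_on A (q k)" for A k unfolding q_def
    by (intro continuous_intros continuous_on_compose2[OF cF]) auto
  have cr: "continuous_on A r" for A unfolding r_def
    by (intro continuous_intros continuous_on_compose2[OF cF]) auto
  have iq: "integral {0..2*pi} (q k) = chord_energy ?F x" for k
  proof -
    have c1: "continuous_on UNIV (\<lambda>y. (cmod (?F (y + x) - ?F y))\<^sup>2)"
      by (intro continuous_intros continuous_on_compose2[OF cF]) auto
    have p1: "(cmod (?F (y + 2 * pi + x) - ?F (y + 2 * pi)))\<^sup>2 = (cmod (?F (y + x) - ?F y))\<^sup>2" for y
      using pF[of y] pF[of "y + x"] by (simp add: add_ac)
    show ?thesis unfolding q_def chord_energy_def using integral_periodic_shift[OF c1 p1, of "real k * x"] by simp
  qed
  have ir: "integral {0..2*pi} r = chord_energy ?F (2 * pi - real N * x)"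
  proof -
    let ?x = "2 * pi - real N * x"
    have c1: "continuous_on UNIV (\<lambda>y. (cmod (?F (y + ?x) - ?F y))\<^sup>2)"
      by (intro continuous_intros continuous_on_compose2[OF cF]) auto
    have p1: "(cmod (?F (y + 2 * pi + ?x) - ?F (y + 2 * pi)))\<^sup>2 = (cmod (?F (y + ?x) - ?F y))\<^sup>2" for y
      using pF[of y] pF[of "y + ?x"] by (simp add: add_ac)
    show ?thesis unfolding r_def chord_energy_def using integral_periodic_shift[OF c1 p1, of "real N * x"] by simp
  qed
  have pt: "(\<Sum>k<N. q k y) + r y \<le> 9" for y
  proof -
    define xs where "xs = map (\<lambda>k. (\<theta> (y + real (Suc k) * x) - \<theta> (y + real k * x)) / 2) [0..<N] @ [(\<theta> (y + 2 * pi) - \<theta> (y + real N * x)) / 2]"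
    have nn: "\<forall>v\<in>set xs. 0 \<le> v" unfolding xs_def using x by (auto intro!: monoD[OF m] simp: algebra_simps)
    have tel: "(\<Sum>k<N. \<theta> (y + real (Suc k) * x) - \<theta> (y + real k * x)) = \<theta> (y + real N * x) - \<theta> y"
      using sum_lessThan_telescope[of "\<lambda>k. \<theta> (y + real k * x)" N] by simp
    have "sum_list xs = (\<Sum>k<N. (\<theta> (y + real (Suc k) * x) - \<theta> (y + real k * x)) / 2) + (\<theta> (y + 2 * pi) - \<theta> (y + real N * x)) / 2"
      by (simp add: xs_def interv_sum_list_conv_sum_set_nat atLeast0LessThan)
    also have "\<dots> = pi" using tel p[of y] by (simp add: sum_divide_distrib[symmetric] field_simps)
    finally have "sum_list xs = pi" .
    from sum_sin_sq_partition[OF nn this]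
    have "(\<Sum>k<N. (sin ((\<theta> (y + real (Suc k) * x) - \<theta> (y + real k * x)) / 2))\<^sup>2) + (sin ((\<theta> (y + 2 * pi) - \<theta> (y + real N * x)) / 2))\<^sup>2 \<le> 9/4"
      by (simp add: xs_def interv_sum_list_conv_sum_set_nat atLeast0LessThan o_def)
    moreover have "q k y = 4 * (sin ((\<theta> (y + real (Suc k) * x) - \<theta> (y + real k * x)) / 2))\<^sup>2" for k
      unfolding q_def o_def cmod_cis_diff_sq by (simp add: algebra_simps)
    moreover have "r y = 4 * (sin ((\<theta> (y + 2 * pi) - \<theta> (y + real N * x)) / 2))\<^sup>2"
      unfolding r_def o_def cmod_cis_diff_sq by (simp add: algebra_simps)
    ultimately show ?thesis by (simp add: sum_distrib_left[symmetric])
  qed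
  have "integral {0..2*pi} (\<lambda>y. (\<Sum>k<N. q k y) + r y) \<le> integral {0..2*pi} (\<lambda>y. 9)"
    by (intro integral_le integrable_continuous_real continuous_intros cq cr pt)
  moreover have "integral {0..2*pi} (\<lambda>y. (\<Sum>k<N. q k y) + r y) = (\<Sum>k<N. integral {0..2*pi} (q k)) + integral {0..2*pi} r"
  proof -
    have "integral {0..2*pi} (\<lambda>y. (\<Sum>k<N. q k y) + r y) = integral {0..2*pi} (\<lambda>y. \<Sum>k<N. q k y) + integral {0..2*pi} r"
      by (intro Henstock_Kurzweil_Integration.integral_add integrable_continuous_real continuous_intros cq cr)
    also have "integral {0..2*pi} (\<lambda>y. \<Sum>k<N. q k y) = (\<Sum>k<N. integral {0..2*pi} (q k))"
      by (intro Henstock_Kurzweil_Integration.integral_sum integrable_continuous_real cq) auto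
    finally show ?thesis .
  qed
  ultimately show ?thesis by (simp add: iq ir)
qed

section \<open>Hall's weight and the folding recursion\<close>

text \<open>
  Restricted to $[0, 2\pi/3]$ it vanishes at the right end, and its cosine coefficients of order at least two
  are nonpositive. The interval ends at the angle between the vertices of the extremal triangle.
\<close>
definition hall_weight :: "real \<Rightarrow> real"
  where "hall_weight x = sqrt 3 * cos (x - pi / 6)"

text \<open>
  The weight of index \<open>k\<close> is used on $[0, 2\pi/(k+3)]$. The next one arises when the part of the integral over
  $[2\pi/(k+4), 2\pi/(k+3)]$ is folded back by the substitution $x \mapsto 2\pi - (k+3) x$.
\<close>
fun hall_remainder :: "nat \<Rightarrow> real \<Rightarrow> real"
  where "hall_remainder 0 x = hall_weight x"
  | "hall_remainder (Suc k) x = hall_remainder k x - hall_remainder k ((2 * pi - x) / real (k + 3)) / (real (k + 3))\<^sup>2"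

declare hall_remainder.simps(2) [simp del]

lemma continuous_hall_weight: "continuous_on A hall_weight"
  unfolding hall_weight_def by (intro continuous_intros)

lemma continuous_hall_remainder: "continuous_on A (hall_remainder k)"
proof (induction k arbitrary: A)
  case 0 then show ?case using continuous_hall_weight[of A] by (simp add: hall_weight_def cong: continuous_on_cong)
next
  case (Suc k)
  have "continuous_on A (\<lambda>x. hall_remainder k x - hall_remainder k ((2 * pi - x) / real (k + 3)) / (real (k + 3))\<^sup>2)"
    by (intro continuous_intros Suc continuous_on_compose2[OF Suc[of UNIV]]) auto
  then show ?case by (simp only: hall_remainder.simps(2))
qed

lemma hall_weight_bounds:
  shows "hall_weight x \<le> sqrt 3"
    and "0 \<le> x \<Longrightarrow> x \<le> 2 * pi / 3 \<Longrightarrow> 0 \<le> hall_weight x"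
    and "0 \<le> x \<Longrightarrow> x \<le> pi / 2 \<Longrightarrow> sqrt 3 / 2 \<le> hall_weight x"
proof -
  show "hall_weight x \<le> sqrt 3" by (simp add: hall_weight_def mult_left_le)
  show "0 \<le> hall_weight x" if "0 \<le> x" "x \<le> 2 * pi / 3"
    unfolding hall_weight_def using that by (intro mult_nonneg_nonneg cos_ge_zero) auto
  show "sqrt 3 / 2 \<le> hall_weight x" if x: "0 \<le> x" "x \<le> pi / 2"
  proof -
    have "\<bar>x - pi / 6\<bar> \<le> pi / 3" using x by (auto simp: abs_if)
    then have "cos (pi / 3) \<le> cos \<bar>x - pi / 6\<bar>" by (intro cos_monotone_0_pi_le) auto
    then have "1 / 2 \<le> cos (x - pi / 6)" by (simp add: cos_60 abs_if split: if_splits) (metis cos_minus minus_diff_eq)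
    then have "sqrt 3 * (1 / 2) \<le> sqrt 3 * cos (x - pi / 6)" by (intro mult_left_mono) auto
    then show ?thesis by (simp add: hall_weight_def)
  qed
qed

text \<open>
  Folding must keep the weight nonnegative. Step $N$ costs at most $\sqrt{3}/N^2$, these costs are dominated
  by the telescoping differences of $\sqrt{3}/(N-1)$ and sum to at most $\sqrt{3}/2$, and Hall's weight
  is at least $\sqrt{3}/2$ on $[0, \pi/2]$.
\<close>
lemma hall_remainder_bounds:
  assumes "0 \<le> x" "x \<le> 2 * pi / real (k + 3)"
  shows "0 \<le> hall_remainder k x \<and> hall_remainder k x \<le> sqrt 3 \<and>
    hall_weight x - sqrt 3 * (1 / 2 - 1 / real (k + 2)) \<le> hall_remainder k x"
  using assms
proof (induction k arbitrary: x)
  case 0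
  then show ?case using hall_weight_bounds[of x] by simp
next
  case (Suc k)
  define N where "N = real (k + 3)"
  have N: "N \<ge> 3" "real (Suc k + 3) = N + 1" "real (k + 2) = N - 1" "real (Suc k + 2) = N" by (auto simp: N_def)
  have x: "0 \<le> x" "x \<le> 2 * pi / (N + 1)" using Suc.prems N by auto
  have "2 * pi / (N + 1) \<le> 2 * pi / N" using N by (intro divide_left_mono) auto
  then have x1: "x \<le> 2 * pi / N" using x by linarith
  define y where "y = (2 * pi - x) / N"
  have "x * 1 \<le> 2 * pi / (N + 1) * (N + 1)" using x N by (intro mult_mono) auto
  then have "0 \<le> 2 * pi - x" using N by simp
  then have y: "0 \<le> y" "y \<le> 2 * pi / N" using x N by (auto simp: y_def intro: divide_right_mono)
  have IHx: "0 \<le> hall_remainder k x" "hall_remainder k x \<le> sqrt 3"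
    "hall_weight x - sqrt 3 * (1 / 2 - 1 / (N - 1)) \<le> hall_remainder k x"
    using Suc.IH[of x] x x1 N by (auto simp: N_def)
  have IHy: "0 \<le> hall_remainder k y" "hall_remainder k y \<le> sqrt 3" using Suc.IH[of y] y by (auto simp: N_def)
  have r: "hall_remainder (Suc k) x = hall_remainder k x - hall_remainder k y / N\<^sup>2"
    by (simp only: y_def N_def hall_remainder.simps(2))
  have "hall_remainder k y / N\<^sup>2 \<le> sqrt 3 * (1 / (N - 1) - 1 / N)"
  proof -
    have "hall_remainder k y / N\<^sup>2 \<le> sqrt 3 / N\<^sup>2" using IHy N by (intro divide_right_mono) auto
    also have "\<dots> \<le> sqrt 3 / (N * (N - 1))" using N by (intro divide_left_mono) (auto simp: power2_eq_square)
    also have "\<dots> = sqrt 3 * (1 / (N - 1) - 1 / N)" using N by (simp add: field_simps)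
    finally show ?thesis .
  qed
  then have low: "hall_weight x - sqrt 3 * (1 / 2 - 1 / N) \<le> hall_remainder (Suc k) x"
    using IHx(3) unfolding r right_diff_distrib by linarith
  have "2 * pi / (N + 1) \<le> 2 * pi / 4" using N by (intro divide_left_mono) auto
  then have "sqrt 3 / 2 \<le> hall_weight x" using x by (intro hall_weight_bounds) auto
  moreover have "0 \<le> sqrt 3 * (1 / N)" using N by simp
  ultimately have "0 \<le> hall_remainder (Suc k) x" using low by (simp add: algebra_simps)
  moreover have "hall_remainder (Suc k) x \<le> sqrt 3" using IHx(2) IHy(1) N by (simp add: r) (smt (verit) divide_nonneg_nonneg zero_le_power2)
  ultimately show ?case using low N by simp
qed

text \<open>
  On the folded part, the hypothesis with $N = k + 3$ gives $E(x) \le - E(2\pi - Nx)/N$; the second factor $1/N$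
  in the recursion is the Jacobian of the substitution.
\<close>
lemma hall_step:
  fixes E :: "real \<Rightarrow> real"
  assumes cE: "continuous_on UNIV E"
    and E: "\<And>N x. N \<ge> 1 \<Longrightarrow> 0 \<le> x \<Longrightarrow> real N * x \<le> 2 * pi \<Longrightarrow> real N * E x + E (2 * pi - real N * x) \<le> 0"
  shows "integral {0..2 * pi / real (k + 3)} (\<lambda>x. hall_remainder k x * E x)
     \<le> integral {0..2 * pi / real (Suc k + 3)} (\<lambda>x. hall_remainder (Suc k) x * E x)"
proof -
  define N where "N = real (k + 3)"
  have N: "N \<ge> 3" "real (Suc k + 3) = N + 1" by (auto simp: N_def)
  define a where "a = 2 * pi / (N + 1)"
  define b where "b = 2 * pi / N"
  have ab: "0 \<le> a" "a \<le> b" using N by (auto simp: a_def b_def intro!: divide_left_mono)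
  let ?v = "hall_remainder k"
  define f where "f t = ?v ((2 * pi - t) / N) * E t" for t
  have cf: "continuous_on A f" for A unfolding f_def
    using N by (intro continuous_intros continuous_on_compose2[OF continuous_hall_remainder[of UNIV]] continuous_on_subset[OF cE]) auto
  have cvE: "continuous_on A (\<lambda>x. ?v x * E x)" for A
    by (intro continuous_intros continuous_hall_remainder continuous_on_subset[OF cE]) auto
  have int1: "integral {0..b} (\<lambda>x. ?v x * E x) = integral {0..a} (\<lambda>x. ?v x * E x) + integral {a..b} (\<lambda>x. ?v x * E x)"
    using ab by (intro Henstock_Kurzweil_Integration.integral_combine[symmetric] integrable_continuous_real cvE) auto
  have "(f has_integral integral {0..a} f) (cbox 0 a)"
    using integrable_integral[OF integrable_continuous_real[OF cf]] by simp
  from has_integral_affinity[OF this, of "- N" "2 * pi"]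
  have "((\<lambda>x. f (- N * x + 2 * pi)) has_integral integral {0..a} f / N) ((\<lambda>x. (1 / - N) * x + - ((1 / - N) * (2 * pi))) ` {0..a})"
    using N by (simp add: divide_inverse mult.commute)
  also have "(\<lambda>x. (1 / - N) * x + - ((1 / - N) * (2 * pi))) ` {0..a} = {a..b}"
  proof -
    have "N \<noteq> 0" "N + 1 \<noteq> 0" using N(1) by auto
    then have ba: "b - a / N = a" by (simp add: a_def b_def divide_simps) (simp add: algebra_simps)
    have "(\<lambda>x. (1 / - N) * x + - ((1 / - N) * (2 * pi))) = (\<lambda>x. b - x / N)" using N by (auto simp: fun_eq_iff b_def field_simps)
    moreover have "(\<lambda>x. b - x / N) ` {0..a} = {b - a / N..b}"
    proof (intro equalityI subsetI)
      fix y assume "y \<in> {b - a / N..b}"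
      then have "N * (b - y) \<in> {0..a}" "b - (N * (b - y)) / N = y" using N by (auto simp: field_simps)
      then show "y \<in> (\<lambda>x. b - x / N) ` {0..a}" by (metis image_eqI)
    qed (use N in \<open>auto simp: divide_right_mono\<close>)
    ultimately show ?thesis using ba by (simp only:)
  qed
  finally have sub: "((\<lambda>x. f (- N * x + 2 * pi)) has_integral integral {0..a} f / N) {a..b}" .
  have feq: "f (- N * x + 2 * pi) = ?v x * E (2 * pi - N * x)" for x
    using N by (simp add: f_def)
  have "integral {a..b} (\<lambda>x. ?v x * E x) \<le> - (1 / N) * (integral {0..a} f / N)"
  proof (rule has_integral_le)
    show "((\<lambda>x. ?v x * E x) has_integral integral {a..b} (\<lambda>x. ?v x * E x)) {a..b}"
      by (intro integrable_integral integrable_continuous_real cvE)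
    show "((\<lambda>x. - (1 / N) * (?v x * E (2 * pi - N * x))) has_integral - (1 / N) * (integral {0..a} f / N)) {a..b}"
      using has_integral_mult_right[OF sub[unfolded feq]] .
    fix x assume x: "x \<in> {a..b}"
    have v: "0 \<le> ?v x" using hall_remainder_bounds[of x k] x ab by (auto simp: b_def N_def)
    have "N * x \<le> 2 * pi" using x N by (auto simp: b_def field_simps)
    then have "N * E x + E (2 * pi - N * x) \<le> 0" using E[of "k + 3" x] x ab by (auto simp: N_def)
    then have "E x \<le> - (1 / N) * E (2 * pi - N * x)" using N by (simp add: field_simps)
    then have "?v x * E x \<le> ?v x * (- (1 / N) * E (2 * pi - N * x))" using v by (rule mult_left_mono)
    then show "?v x * E x \<le> - (1 / N) * (?v x * E (2 * pi - N * x))" by (simp add: algebra_simps)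
  qed
  also have "- (1 / N) * (integral {0..a} f / N) = integral {0..a} (\<lambda>x. - (f x / N\<^sup>2))"
    by (simp add: power2_eq_square divide_inverse)
  finally have "integral {0..b} (\<lambda>x. ?v x * E x) \<le> integral {0..a} (\<lambda>x. ?v x * E x) + integral {0..a} (\<lambda>x. - (f x / N\<^sup>2))"
    using int1 by simp
  also have "\<dots> = integral {0..a} (\<lambda>x. ?v x * E x + - (f x / N\<^sup>2))"
    using N by (intro Henstock_Kurzweil_Integration.integral_add[symmetric] integrable_continuous_real continuous_intros cvE cf) auto
  also have "(\<lambda>x. ?v x * E x + - (f x / N\<^sup>2)) = (\<lambda>x. hall_remainder (Suc k) x * E x)"
    by (simp add: fun_eq_iff f_def N_def hall_remainder.simps(2) left_diff_distrib)
  finally show ?thesis unfolding N(2) by (simp only: a_def b_def N_def)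
qed

text \<open>
  After infinitely many folding steps the interval of integration has shrunk to a point.
\<close>
lemma hall_weighted_nonpos:
  fixes E :: "real \<Rightarrow> real"
  assumes cE: "continuous_on UNIV E"
    and E: "\<And>N x. N \<ge> 1 \<Longrightarrow> 0 \<le> x \<Longrightarrow> real N * x \<le> 2 * pi \<Longrightarrow> real N * E x + E (2 * pi - real N * x) \<le> 0"
  shows "integral {0..2 * pi / 3} (\<lambda>x. hall_weight x * E x) \<le> 0"
proof -
  define I where "I k = integral {0..2 * pi / real (k + 3)} (\<lambda>x. hall_remainder k x * E x)" for k
  have mono: "I 0 \<le> I k" for k
  proof (induction k)
    case (Suc k)
    then show ?case using hall_step[OF cE E, of k] unfolding I_def by (rule order_trans)
  qed simp
  have "compact (E ` {0..2 * pi})" by (intro compact_continuous_image continuous_on_subset[OF cE]) auto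
  then obtain B where B: "\<And>x. x \<in> {0..2 * pi} \<Longrightarrow> \<bar>E x\<bar> \<le> B"
    using compact_imp_bounded bounded_iff by (metis imageI real_norm_def)
  have B0: "0 \<le> B" using B[of 0] by (simp add: order_trans[OF abs_ge_zero])
  have le: "I k \<le> sqrt 3 * B * (2 * pi / real (k + 3))" for k
  proof -
    have le2: "2 * pi / real (k + 3) \<le> 2 * pi / 1" by (intro divide_left_mono) auto
    have "I k \<le> integral {0..2 * pi / real (k + 3)} (\<lambda>x. sqrt 3 * B)"
      unfolding I_def
    proof (rule integral_le)
      show "(\<lambda>x. hall_remainder k x * E x) integrable_on {0..2 * pi / real (k + 3)}"
        by (intro integrable_continuous_real continuous_intros continuous_hall_remainder continuous_on_subset[OF cE]) auto
      fix x assume x: "x \<in> {0..2 * pi / real (k + 3)}"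
      then have v: "0 \<le> hall_remainder k x" "hall_remainder k x \<le> sqrt 3" using hall_remainder_bounds[of x k] by auto
      have "E x \<le> B" using B[of x] x le2 by auto
      then have "hall_remainder k x * E x \<le> hall_remainder k x * B" using v by (intro mult_left_mono)
      also have "\<dots> \<le> sqrt 3 * B" using v B0 by (intro mult_right_mono)
      finally show "hall_remainder k x * E x \<le> sqrt 3 * B" .
    qed (rule integrable_const_ivl)
    then show ?thesis by (simp add: mult_ac)
  qed
  have "I 0 \<le> 0"
  proof (rule tendsto_lowerbound)
    have "((\<lambda>k. sqrt 3 * B * (2 * pi * inverse (real (k + 3)))) \<longlonglongrightarrow> sqrt 3 * B * (2 * pi * 0))"
      by (intro tendsto_intros LIMSEQ_ignore_initial_segment[OF lim_inverse_n])
    then show "(\<lambda>k. sqrt 3 * B * (2 * pi / real (k + 3))) \<longlonglongrightarrow> 0" by (simp add: divide_inverse)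
    show "\<forall>\<^sub>F k in sequentially. I 0 \<le> sqrt 3 * B * (2 * pi / real (k + 3))"
      using mono le order_trans by (intro always_eventually) blast
  qed auto
  then show ?thesis by (simp add: I_def)
qed

section \<open>Hall's inequality for circle maps\<close>

text \<open>
  For a unimodular function this is $2\pi$ minus half of the chord energy; for a trigonometric polynomial it
  is diagonal in the coefficients.
\<close>
definition autocorrelation :: "(real \<Rightarrow> complex) \<Rightarrow> real \<Rightarrow> real"
  where "autocorrelation F x = Re (integral {0..2*pi} (\<lambda>y. F (y + x) * cnj (F y)))"

lemma continuous_autocorrelation:
  assumes "continuous_on UNIV F"
  shows "continuous_on A (autocorrelation F)"
proof -
  have "continuous_on (A \<times> cbox 0 (2*pi)) (\<lambda>(x, y). F (y + x) * cnj (F y))"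
    unfolding split_beta by (intro continuous_intros continuous_on_compose2[OF assms]) auto
  from integral_continuous_on_param[OF this] show ?thesis
    unfolding autocorrelation_def[abs_def] by (intro continuous_intros) simp
qed

text \<open>
  The property for which Hall's weight is designed: among the modes that are not excluded by the
  normalization, only the mode of index one contributes positively.
\<close>
lemma hall_weight_fourier_le_0:
  fixes n :: real
  assumes n: "n = of_int k" "\<bar>n\<bar> \<ge> 2"
  shows "integral {0..2 * pi / 3} (\<lambda>x. hall_weight x * cos (n * x)) \<le> 0"
proof -
  have nz: "n + 1 \<noteq> 0" "n - 1 \<noteq> 0" using n(2) by auto
  have sq: "n\<^sup>2 > 1"
  proof -
    have "2\<^sup>2 \<le> \<bar>n\<bar>\<^sup>2" using n(2) by (intro power_mono) auto
    then show ?thesis by simp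
  qed
  define a where "a = 2 * pi / 3 * n"
  define P where "P x = sqrt 3 / 2 * (sin ((n + 1) * x - pi / 6) / (n + 1) + sin ((n - 1) * x + pi / 6) / (n - 1))" for x
  have "((\<lambda>x. hall_weight x * cos (n * x)) has_integral P (2 * pi / 3) - P 0) {0..2 * pi / 3}"
  proof (rule fundamental_theorem_of_calculus)
    fix x
    have "(P has_real_derivative sqrt 3 / 2 * (cos ((n + 1) * x - pi / 6) + cos ((n - 1) * x + pi / 6))) (at x within {0..2 * pi / 3})"
      unfolding P_def using nz by (auto intro!: derivative_eq_intros)
    moreover have "sqrt 3 / 2 * (cos ((n + 1) * x - pi / 6) + cos ((n - 1) * x + pi / 6)) = hall_weight x * cos (n * x)"
    proof -
      have "cos ((n + 1) * x - pi / 6) = cos (n * x + (x - pi / 6))" "cos ((n - 1) * x + pi / 6) = cos (n * x - (x - pi / 6))"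
        by (simp_all add: algebra_simps)
      then show ?thesis by (simp add: hall_weight_def cos_add cos_diff)
    qed
    ultimately show "(P has_vector_derivative hall_weight x * cos (n * x)) (at x within {0..2 * pi / 3})"
      by (simp add: has_real_derivative_iff_has_vector_derivative)
  qed auto
  then have "integral {0..2 * pi / 3} (\<lambda>x. hall_weight x * cos (n * x)) = P (2 * pi / 3) - P 0"
    by (rule integral_unique)
  also have "P (2 * pi / 3) = sqrt 3 / 2 * (cos a / (n + 1) - cos a / (n - 1))"
  proof -
    have e: "(n + 1) * (2 * pi / 3) - pi / 6 = a + pi / 2" "(n - 1) * (2 * pi / 3) + pi / 6 = a - pi / 2"
      by (simp_all add: a_def field_simps)
    have "sin (a + pi / 2) = cos a" "sin (a - pi / 2) = - cos a" by (simp_all add: sin_add sin_diff)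
    then show ?thesis unfolding P_def e by (simp add: algebra_simps)
  qed
  also have "P 0 = sqrt 3 / 2 * (- (1/2) / (n + 1) + (1/2) / (n - 1))" by (simp add: P_def sin_30)
  also have "sqrt 3 / 2 * (cos a / (n + 1) - cos a / (n - 1)) - sqrt 3 / 2 * (- (1/2) / (n + 1) + (1/2) / (n - 1))
      = sqrt 3 / 2 * ((cos a + 1/2) * (1 / (n + 1) - 1 / (n - 1)))"
    by (simp add: algebra_simps diff_divide_distrib add_divide_distrib)
  also have "1 / (n + 1) - 1 / (n - 1) = - 2 / (n\<^sup>2 - 1)"
    using nz sq by (simp add: field_simps power2_eq_square)
  also have "sqrt 3 / 2 * ((cos a + 1/2) * (- 2 / (n\<^sup>2 - 1))) \<le> 0"
  proof -
    have "cos (3 * a) = 1"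
      using cos_int_2pin[of k] by (simp add: a_def n(1) mult_ac)
    then have "4 * cos a ^ 3 - 3 * cos a = 1" by (simp add: cos_treble_cos)
    then have "(cos a - 1) * (2 * cos a + 1)\<^sup>2 = 0" by (simp add: power2_eq_square power3_eq_cube algebra_simps)
    then have "cos a \<ge> - 1/2" by (auto simp: field_simps)
    then have "0 \<le> (cos a + 1/2) * (2 / (n\<^sup>2 - 1))" using sq by (intro mult_nonneg_nonneg) auto
    then have "0 \<le> sqrt 3 / 2 * ((cos a + 1/2) * (2 / (n\<^sup>2 - 1)))" by (rule mult_nonneg_nonneg[rotated]) simp
    then show ?thesis by simp
  qed
  finally show ?thesis .
qed

lemma hall_weight_fourier_1: "integral {0..2 * pi / 3} (\<lambda>x. hall_weight x * cos x) = pi / 2"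
proof -
  define P where "P x = sqrt 3 / 2 * (sin (2 * x - pi / 6) / 2 + sqrt 3 / 2 * x)" for x
  have "((\<lambda>x. hall_weight x * cos x) has_integral P (2 * pi / 3) - P 0) {0..2 * pi / 3}"
  proof (rule fundamental_theorem_of_calculus)
    fix x
    have "(P has_real_derivative sqrt 3 / 2 * (cos (2 * x - pi / 6) + sqrt 3 / 2)) (at x within {0..2 * pi / 3})"
      unfolding P_def by (auto intro!: derivative_eq_intros)
    moreover have "sqrt 3 / 2 * (cos (2 * x - pi / 6) + sqrt 3 / 2) = hall_weight x * cos x"
    proof -
      have "cos (2 * x - pi / 6) = cos (x + (x - pi / 6))" "sqrt 3 / 2 = cos (x - (x - pi / 6))"
        by (simp_all add: algebra_simps cos_30)
      then have "cos (2 * x - pi / 6) + sqrt 3 / 2 = 2 * cos x * cos (x - pi / 6)"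
        by (simp only: cos_add cos_diff[of x])
      then show ?thesis by (simp add: hall_weight_def)
    qed
    ultimately show "(P has_vector_derivative hall_weight x * cos x) (at x within {0..2 * pi / 3})"
      by (simp add: has_real_derivative_iff_has_vector_derivative)
  qed auto
  then have "integral {0..2 * pi / 3} (\<lambda>x. hall_weight x * cos x) = P (2 * pi / 3) - P 0"
    by (rule integral_unique)
  also have "\<dots> = pi / 2"
  proof -
    have "2 * (2 * pi / 3) - pi / 6 = pi + pi / 6" by simp
    then have s: "sin (2 * (2 * pi / 3) - pi / 6) = - (1/2)" by (simp only: sin_periodic_pi2 sin_30)
    show ?thesis unfolding P_def s by (simp add: sin_30 field_simps)
  qed
  finally show ?thesis .
qed

lemma hall_weight_integral: "integral {0..2 * pi / 3} hall_weight = 3 * sqrt 3 / 2"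
proof -
  define P where "P x = sqrt 3 * sin (x - pi / 6)" for x
  have "(hall_weight has_integral P (2 * pi / 3) - P 0) {0..2 * pi / 3}"
    unfolding P_def hall_weight_def
    by (rule fundamental_theorem_of_calculus)
       (auto intro!: derivative_eq_intros simp flip: has_real_derivative_iff_has_vector_derivative)
  then have "integral {0..2 * pi / 3} hall_weight = P (2 * pi / 3) - P 0" by (rule integral_unique)
  also have "2 * pi / 3 - pi / 6 = pi / 2" by simp
  then have "P (2 * pi / 3) - P 0 = 3 * sqrt 3 / 2" unfolding P_def by (simp only:) (simp add: sin_30)
  finally show ?thesis .
qed

lemma hall_weight_first_moment: "integral {0..2 * pi / 3} (\<lambda>x. hall_weight x * x) = 2 * pi / sqrt 3 - 3 / 2"
proof -
  define P where "P x = sqrt 3 * (x * sin (x - pi / 6) + cos (x - pi / 6))" for x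
  have "((\<lambda>x. hall_weight x * x) has_integral P (2 * pi / 3) - P 0) {0..2 * pi / 3}"
    unfolding P_def hall_weight_def
    by (rule fundamental_theorem_of_calculus)
       (auto intro!: derivative_eq_intros simp flip: has_real_derivative_iff_has_vector_derivative)
  then have "integral {0..2 * pi / 3} (\<lambda>x. hall_weight x * x) = P (2 * pi / 3) - P 0" by (rule integral_unique)
  also have "2 * pi / 3 - pi / 6 = pi / 2" by simp
  then have "P (2 * pi / 3) - P 0 = 2 * pi / sqrt 3 - 3 / 2" unfolding P_def
    by (simp only:) (simp add: cos_30 field_simps)
  finally show ?thesis .
qed

lemma has_integral_cis_int:
  "((\<lambda>t. cis (of_int k * t)) has_integral (if k = 0 then 2 * pi else 0)) {0..2*pi}"
  using has_integral_cis_multiple[of k] has_integral_const_real[of "1::complex" 0 "2*pi"]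
  by (auto simp: scaleR_conv_of_real)

lemma autocorrelation_trig_polynomial:
  assumes I: "finite I"
  shows "autocorrelation (\<lambda>t. \<Sum>n\<in>I. \<gamma> n * cis (of_int n * t)) x
    = 2 * pi * (\<Sum>n\<in>I. (cmod (\<gamma> n))\<^sup>2 * cos (of_int n * x))"
proof -
  let ?T = "\<lambda>t. \<Sum>n\<in>I. \<gamma> n * cis (of_int n * t)"
  have "((\<lambda>y. \<Sum>n\<in>I. \<Sum>m\<in>I. (\<gamma> n * cnj (\<gamma> m) * cis (of_int n * x)) * cis (of_int (n - m) * y)) has_integral
      (\<Sum>n\<in>I. \<Sum>m\<in>I. (\<gamma> n * cnj (\<gamma> m) * cis (of_int n * x)) * of_real (if n - m = 0 then 2 * pi else 0))) {0..2*pi}"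
    by (intro has_integral_sum I has_integral_mult_right has_integral_cis_int)
  moreover have "(\<Sum>n\<in>I. \<Sum>m\<in>I. (\<gamma> n * cnj (\<gamma> m) * cis (of_int n * x)) * cis (of_int (n - m) * y)) = ?T (y + x) * cnj (?T y)" for y
  proof -
    have eqnm: "(\<gamma> n * cnj (\<gamma> m) * cis (of_int n * x)) * cis (of_int (n - m) * y) = (\<gamma> n * cis (of_int n * (y + x))) * cnj (\<gamma> m * cis (of_int m * y))" for n m
      by (simp add: cis_cnj mult_ac) (simp add: cis_mult algebra_simps)
    show ?thesis unfolding cnj_sum sum_product by (intro sum.cong refl) (rule eqnm)
  qed
  moreover have "(\<Sum>n\<in>I. \<Sum>m\<in>I. (\<gamma> n * cnj (\<gamma> m) * cis (of_int n * x)) * of_real (if n - m = 0 then 2 * pi else 0)) =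
     (\<Sum>n\<in>I. of_real (2 * pi * (cmod (\<gamma> n))\<^sup>2) * cis (of_int n * x))"
  proof (rule sum.cong[OF refl])
    fix n assume n: "n \<in> I"
    have "(\<Sum>m\<in>I. (\<gamma> n * cnj (\<gamma> m) * cis (of_int n * x)) * of_real (if n - m = 0 then 2 * pi else 0)) =
       (\<Sum>m\<in>I. if m = n then (\<gamma> n * cnj (\<gamma> n) * cis (of_int n * x)) * of_real (2 * pi) else 0)"
      by (intro sum.cong) auto
    also have "\<dots> = (\<gamma> n * cnj (\<gamma> n) * cis (of_int n * x)) * of_real (2 * pi)" using n I by simp
    also have "\<gamma> n * cnj (\<gamma> n) = of_real ((cmod (\<gamma> n))\<^sup>2)" by (rule complex_norm_square[symmetric])
    finally show "(\<Sum>m\<in>I. (\<gamma> n * cnj (\<gamma> m) * cis (of_int n * x)) * of_real (if n - m = 0 then 2 * pi else 0)) = of_real (2 * pi * (cmod (\<gamma> n))\<^sup>2) * cis (of_int n * x)"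
      by (simp add: mult_ac)
  qed
  ultimately have "((\<lambda>y. ?T (y + x) * cnj (?T y)) has_integral (\<Sum>n\<in>I. of_real (2 * pi * (cmod (\<gamma> n))\<^sup>2) * cis (of_int n * x))) {0..2*pi}"
    by simp
  then have "autocorrelation ?T x = Re (\<Sum>n\<in>I. of_real (2 * pi * (cmod (\<gamma> n))\<^sup>2) * cis (of_int n * x))"
    unfolding autocorrelation_def by (simp only: integral_unique)
  also have "\<dots> = 2 * pi * (\<Sum>n\<in>I. (cmod (\<gamma> n))\<^sup>2 * cos (of_int n * x))"
    by (simp add: sum_distrib_left mult_ac del: of_real_mult of_real_power)
  finally show ?thesis .
qed

lemma hall_form_trig_polynomial:
  assumes I: "finite I" and g0: "\<gamma> 0 = 0" and g1: "\<gamma> (-1) = 0" and ga: "cmod (\<gamma> 1) \<le> a"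
  shows "integral {0..2 * pi / 3} (\<lambda>x. hall_weight x * autocorrelation (\<lambda>t. \<Sum>n\<in>I. \<gamma> n * cis (of_int n * t)) x) \<le> pi\<^sup>2 * a\<^sup>2"
proof -
  define \<omega> where "\<omega> n = integral {0..2 * pi / 3} (\<lambda>x. hall_weight x * cos (of_int n * x))" for n :: int
  have "((\<lambda>x. 2 * pi * (\<Sum>n\<in>I. (cmod (\<gamma> n))\<^sup>2 * (hall_weight x * cos (of_int n * x)))) has_integral
     (2 * pi * (\<Sum>n\<in>I. (cmod (\<gamma> n))\<^sup>2 * \<omega> n))) {0..2 * pi / 3}"
    unfolding \<omega>_def
    by (intro has_integral_mult_right has_integral_sum I integrable_integral integrable_continuous_real continuous_intros continuous_hall_weight)
  moreover have "2 * pi * (\<Sum>n\<in>I. (cmod (\<gamma> n))\<^sup>2 * (hall_weight x * cos (of_int n * x)))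
     = hall_weight x * autocorrelation (\<lambda>t. \<Sum>n\<in>I. \<gamma> n * cis (of_int n * t)) x" for x
    unfolding autocorrelation_trig_polynomial[OF I] by (simp add: sum_distrib_left mult_ac)
  ultimately have "integral {0..2 * pi / 3} (\<lambda>x. hall_weight x * autocorrelation (\<lambda>t. \<Sum>n\<in>I. \<gamma> n * cis (of_int n * t)) x)
     = 2 * pi * (\<Sum>n\<in>I. (cmod (\<gamma> n))\<^sup>2 * \<omega> n)"
    by (simp add: integral_unique)
  also have "\<dots> \<le> 2 * pi * (a\<^sup>2 * (pi / 2))"
  proof (intro mult_left_mono)
    have "(\<Sum>n\<in>I. (cmod (\<gamma> n))\<^sup>2 * \<omega> n) \<le> (\<Sum>n\<in>I. if n = 1 then a\<^sup>2 * (pi / 2) else 0)"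
    proof (rule sum_mono)
      fix n assume "n \<in> I"
      consider "n = 1" | "n = 0 \<or> n = -1" | "\<bar>n\<bar> \<ge> 2" by linarith
      then show "(cmod (\<gamma> n))\<^sup>2 * \<omega> n \<le> (if n = 1 then a\<^sup>2 * (pi / 2) else 0)"
      proof cases
        case 1
        have k1: "(cmod (\<gamma> 1))\<^sup>2 \<le> a\<^sup>2" using ga by (intro power_mono) auto
        have k2: "\<omega> 1 = pi / 2" by (simp add: \<omega>_def hall_weight_fourier_1)
        have "(cmod (\<gamma> 1))\<^sup>2 * (pi / 2) \<le> a\<^sup>2 * (pi / 2)" by (rule mult_right_mono[OF k1]) simp
        then show ?thesis by (simp only: 1 k2 if_True simp_thms)
      next
        case 2 then show ?thesis using g0 g1 by auto
      next
        case 3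
        then have "\<bar>real_of_int n\<bar> \<ge> 2" by linarith
        from hall_weight_fourier_le_0[OF refl this] have "\<omega> n \<le> 0" by (simp add: \<omega>_def)
        then have "(cmod (\<gamma> n))\<^sup>2 * \<omega> n \<le> 0" by (simp add: mult_nonneg_nonpos)
        then show ?thesis using 3 by auto
      qed
    qed
    also have "\<dots> \<le> a\<^sup>2 * (pi / 2)" using I by simp
    finally show "(\<Sum>n\<in>I. (cmod (\<gamma> n))\<^sup>2 * \<omega> n) \<le> a\<^sup>2 * (pi / 2)" .
  qed auto
  also have "\<dots> = pi\<^sup>2 * a\<^sup>2" by (simp add: power2_eq_square)
  finally show ?thesis .
qed

text \<open>
  Integrate the autocorrelation of the circle map against Hall's weight over $[0, 2\pi/3]$. On the Fourier
  side only the coefficient of index one survives, which gives at most $\pi^2 a^2$. On the geometric side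
  the polygon inequality says that $E(x) = $ (chord energy) $- 9x$ satisfies the hypothesis of
  \<open>hall_weighted_nonpos\<close>, which gives at least $27/4$. The approximation hypothesis is satisfied by
  boundary values of $H + \overline{G}$ with $H(0) = G(0) = G'(0) = 0$ and $|H'(0)| \le a$.
\<close>
lemma heinz_hall_circle:
  fixes \<theta> :: "real \<Rightarrow> real"
  assumes c: "continuous_on UNIV \<theta>" and m: "mono \<theta>" and p: "\<And>t. \<theta> (t + 2 * pi) = \<theta> t + 2 * pi"
    and approx: "\<And>\<epsilon>. \<epsilon> > 0 \<Longrightarrow> \<exists>I \<gamma>. finite I \<and> \<gamma> 0 = 0 \<and> \<gamma> (-1) = 0 \<and> cmod (\<gamma> 1) \<le> a \<and>
       (\<forall>t. cmod (cis (\<theta> t) - (\<Sum>n\<in>I. \<gamma> n * cis (of_int n * t))) \<le> \<epsilon>)"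
  shows "27 / (4 * pi\<^sup>2) \<le> a\<^sup>2"
proof -
  let ?F = "cis \<circ> \<theta>"
  have cF: "continuous_on UNIV ?F" by (intro continuous_on_compose c continuous_on_cis continuous_on_id)
  define S where "S G = integral {0..2 * pi / 3} (\<lambda>x. hall_weight x * autocorrelation G x)" for G
  have contint: "(\<lambda>x. hall_weight x * autocorrelation G x) integrable_on {0..2 * pi / 3}" if "continuous_on UNIV G" for G
    by (intro integrable_continuous_real continuous_intros continuous_hall_weight continuous_autocorrelation that)
  have ac: "autocorrelation ?F x = 2 * pi - chord_energy ?F x / 2" for x
  proof -
    have i1: "((\<lambda>y. ?F (y + x) * cnj (?F y)) has_integral integral {0..2*pi} (\<lambda>y. ?F (y + x) * cnj (?F y))) {0..2*pi}"
      by (intro integrable_integral integrable_continuous_real continuous_intros continuous_on_compose2[OF cF]) auto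
    have i2: "((\<lambda>y. (cmod (?F (y + x) - ?F y))\<^sup>2) has_integral chord_energy ?F x) {0..2*pi}"
      unfolding chord_energy_def
      by (intro integrable_integral integrable_continuous_real continuous_intros continuous_on_compose2[OF cF]) auto
    have e: "Re (?F (y + x) * cnj (?F y)) = 1 - (cmod (?F (y + x) - ?F y))\<^sup>2 / 2" for y
    proof -
      have "(cmod (u - v))\<^sup>2 = (cmod u)\<^sup>2 + (cmod v)\<^sup>2 - 2 * Re (u * cnj v)" for u v
        unfolding cmod_power2 by (simp add: power2_eq_square algebra_simps)
      from this[of "?F (y + x)" "?F y"] show ?thesis by (simp add: field_simps)
    qed
    have "((\<lambda>y. 1 - (cmod (?F (y + x) - ?F y))\<^sup>2 / 2) has_integral autocorrelation ?F x) {0..2*pi}"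
      using has_integral_Re[OF i1] unfolding e autocorrelation_def .
    moreover have "((\<lambda>y. 1 - (cmod (?F (y + x) - ?F y))\<^sup>2 / 2) has_integral (2 * pi - chord_energy ?F x / 2)) {0..2*pi}"
      using has_integral_diff[OF has_integral_const_real[of "1::real" 0 "2*pi"] has_integral_divide[OF i2, of 2]] by simp
    ultimately show ?thesis by (rule has_integral_unique)
  qed
  \<comment> \<open>upper bound from the Fourier side\<close>
  have up: "S ?F \<le> pi\<^sup>2 * a\<^sup>2"
  proof (rule field_le_epsilon)
    fix e :: real assume e: "e > 0"
    define K where "K = 2 * pi / 3 * (sqrt 3 * (6 * pi))"
    have K: "K > 0" by (simp add: K_def)
    define \<epsilon> where "\<epsilon> = min 1 (e / K)"
    have \<epsilon>: "0 < \<epsilon>" "\<epsilon> \<le> 1" "K * \<epsilon> \<le> e" using e K by (auto simp: \<epsilon>_def min_def field_simps)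
    obtain I \<gamma> where I: "finite I" "\<gamma> 0 = 0" "\<gamma> (-1) = 0" "cmod (\<gamma> 1) \<le> a"
      and close: "\<And>t. cmod (cis (\<theta> t) - (\<Sum>n\<in>I. \<gamma> n * cis (of_int n * t))) \<le> \<epsilon>"
      using approx[OF \<epsilon>(1)] by blast
    define T where "T t = (\<Sum>n\<in>I. \<gamma> n * cis (of_int n * t))" for t
    have cT: "continuous_on UNIV T" unfolding T_def by (intro continuous_intros continuous_on_cis)
    have pt: "cmod (?F u * cnj (?F v) - T u * cnj (T v)) \<le> 3 * \<epsilon>" for u v
    proof -
      have "?F u * cnj (?F v) - T u * cnj (T v) = (?F u - T u) * cnj (?F v) + T u * cnj (?F v - T v)"
        by (simp add: algebra_simps)
      then have "cmod (?F u * cnj (?F v) - T u * cnj (T v)) \<le> cmod ((?F u - T u) * cnj (?F v)) + cmod (T u * cnj (?F v - T v))"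
        by (metis norm_triangle_ineq)
      also have "cmod ((?F u - T u) * cnj (?F v)) \<le> \<epsilon>" using close[of u] by (simp add: norm_mult T_def)
      also have "cmod (T u * cnj (?F v - T v)) \<le> 2 * \<epsilon>"
      proof -
        have "cmod (T u) \<le> cmod (?F u) + cmod (?F u - T u)" using norm_triangle_sub[of "T u" "?F u"] by (simp add: norm_minus_commute)
        then have "cmod (T u) \<le> 2" using close[of u] \<epsilon> by (simp add: T_def)
        moreover have "cmod (?F v - T v) \<le> \<epsilon>" using close[of v] by (simp add: T_def)
        ultimately show ?thesis unfolding norm_mult complex_mod_cnj by (intro mult_mono) auto
      qed
      finally show ?thesis by simp
    qed
    have ax: "autocorrelation ?F x \<le> autocorrelation T x + 6 * pi * \<epsilon>" for x
    proof -
      have "autocorrelation ?F x - autocorrelation T x = Re (integral {0..2*pi} (\<lambda>y. ?F (y + x) * cnj (?F y) - T (y + x) * cnj (T y)))"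
        unfolding autocorrelation_def
        by (subst Henstock_Kurzweil_Integration.integral_diff)
           (auto intro!: integrable_continuous_real continuous_intros continuous_on_compose2[OF cF] continuous_on_compose2[OF cT] simp del: o_apply)
      also have "\<dots> \<le> cmod (integral {0..2*pi} (\<lambda>y. ?F (y + x) * cnj (?F y) - T (y + x) * cnj (T y)))" by (rule complex_Re_le_cmod)
      also have "\<dots> \<le> 3 * \<epsilon> * (2 * pi - 0)"
        by (rule integral_bound) (auto intro!: continuous_intros continuous_on_compose2[OF cF] continuous_on_compose2[OF cT] pt simp del: o_apply)
      finally show ?thesis by (simp add: algebra_simps)
    qed
    have "S ?F \<le> integral {0..2 * pi / 3} (\<lambda>x. hall_weight x * autocorrelation T x + sqrt 3 * (6 * pi) * \<epsilon>)"
      unfolding S_def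
    proof (rule integral_le)
      show "(\<lambda>x. hall_weight x * autocorrelation ?F x) integrable_on {0..2 * pi / 3}" by (rule contint[OF cF])
      show "(\<lambda>x. hall_weight x * autocorrelation T x + sqrt 3 * (6 * pi) * \<epsilon>) integrable_on {0..2 * pi / 3}"
        by (intro integrable_add contint[OF cT] integrable_const_ivl)
      fix x assume x: "x \<in> {0..2 * pi / 3}"
      have w: "0 \<le> hall_weight x" "hall_weight x \<le> sqrt 3" using hall_weight_bounds x by auto
      have "hall_weight x * autocorrelation ?F x \<le> hall_weight x * (autocorrelation T x + 6 * pi * \<epsilon>)"
        using ax w by (intro mult_left_mono)
      also have "\<dots> = hall_weight x * autocorrelation T x + hall_weight x * (6 * pi * \<epsilon>)" by (simp add: algebra_simps)
      also have "hall_weight x * (6 * pi * \<epsilon>) \<le> sqrt 3 * (6 * pi * \<epsilon>)" using w \<epsilon> by (intro mult_right_mono) auto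
      finally show "hall_weight x * autocorrelation ?F x \<le> hall_weight x * autocorrelation T x + sqrt 3 * (6 * pi) * \<epsilon>"
        by (simp add: mult.assoc)
    qed
    also have "\<dots> = S T + K * \<epsilon>"
      unfolding S_def by (subst Henstock_Kurzweil_Integration.integral_add[OF contint[OF cT] integrable_const_ivl]) (simp add: K_def)
    also have "S T \<le> pi\<^sup>2 * a\<^sup>2"
      unfolding S_def T_def[abs_def] by (rule hall_form_trig_polynomial[OF I])
    finally show "S ?F \<le> pi\<^sup>2 * a\<^sup>2 + e" using \<epsilon>(3) by linarith
  qed
  \<comment> \<open>lower bound from the geometric side\<close>
  define E where "E x = chord_energy ?F x - 9 * x" for x
  have cE: "continuous_on A E" for A unfolding E_def by (intro continuous_intros continuous_chord_energy cF)
  have "integral {0..2 * pi / 3} (\<lambda>x. hall_weight x * E x) \<le> 0"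
  proof (rule hall_weighted_nonpos[OF cE])
    fix N :: nat and x :: real assume "N \<ge> 1" "0 \<le> x" "real N * x \<le> 2 * pi"
    then show "real N * E x + E (2 * pi - real N * x) \<le> 0"
      using chord_energy_partition[OF c m p, of x N] by (simp add: E_def algebra_simps)
  qed
  moreover have "S ?F = 2 * pi * integral {0..2 * pi / 3} hall_weight
      - 9 / 2 * integral {0..2 * pi / 3} (\<lambda>x. hall_weight x * x)
      - 1 / 2 * integral {0..2 * pi / 3} (\<lambda>x. hall_weight x * E x)"
  proof -
    have "((\<lambda>x. 2 * pi * hall_weight x - 9 / 2 * (hall_weight x * x) - 1 / 2 * (hall_weight x * E x)) has_integral
       (2 * pi * integral {0..2 * pi / 3} hall_weight
      - 9 / 2 * integral {0..2 * pi / 3} (\<lambda>x. hall_weight x * x)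
      - 1 / 2 * integral {0..2 * pi / 3} (\<lambda>x. hall_weight x * E x))) {0..2 * pi / 3}"
      by (intro has_integral_diff has_integral_mult_right integrable_integral integrable_continuous_real continuous_intros continuous_hall_weight cE)
    moreover have "2 * pi * hall_weight x - 9 / 2 * (hall_weight x * x) - 1 / 2 * (hall_weight x * E x) = hall_weight x * autocorrelation ?F x" for x
      unfolding ac E_def by (simp add: field_simps)
    ultimately show ?thesis unfolding S_def by (simp add: integral_unique)
  qed
  moreover have "2 * pi * (3 * sqrt 3 / 2) - 9 / 2 * (2 * pi / sqrt 3 - 3 / 2) = 27 / 4"
    by (simp add: field_simps)
  ultimately have "27 / 4 \<le> S ?F" by (simp add: hall_weight_integral hall_weight_first_moment)
  then have "27 / 4 \<le> pi\<^sup>2 * a\<^sup>2" using up by linarith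
  then show ?thesis by (simp add: field_simps)
qed

section \<open>Boundary behaviour of quasiconformal maps\<close>

lemma law_of_cosines_identity:
  fixes E c s :: real
  shows "(1 - E * c)\<^sup>2 + (E * s)\<^sup>2 = 1 + E * (E * (c\<^sup>2 + s\<^sup>2) - 2 * c)"
  by (simp add: power2_eq_square algebra_simps)

text \<open>
  The Courant--Lebesgue argument. In the coordinates $z = \zeta (1 - e^\xi)$ the arcs about the boundary point
  \<open>\<zeta>\<close> become vertical segments of length at most $\pi$. If all of them had images of diameter at least
  \<open>\<eta>\<close>, each would contribute at least $\eta^2/(\pi K)$ to the area of the image, which is at most $\pi$; but
  there are arbitrarily long ranges of logarithmic radii.
\<close>
lemma quasiconformal_arc_oscillation:
  fixes u :: "complex \<Rightarrow> complex"
  assumes inj: "inj_on u (ball 0 1)" and im: "u ` ball 0 1 = ball 0 1"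
    and d: "\<And>z. z \<in> ball 0 1 \<Longrightarrow> (u has_derivative (\<lambda>v. \<alpha> z * v + \<beta> z * cnj v)) (at z)"
    and c\<alpha>: "continuous_on (ball 0 1) \<alpha>" and c\<beta>: "continuous_on (ball 0 1) \<beta>"
    and qc: "\<And>z. z \<in> ball 0 1 \<Longrightarrow> (cmod (\<alpha> z) + cmod (\<beta> z))\<^sup>2 \<le> K * ((cmod (\<alpha> z))\<^sup>2 - (cmod (\<beta> z))\<^sup>2)"
    and K: "K > 0" and \<zeta>: "cmod \<zeta> = 1" and \<eta>: "\<eta> > 0" and \<delta>: "\<delta> > 0"
  obtains \<rho> where "0 < \<rho>" "\<rho> < \<delta>" "\<rho> < 1"
    "\<And>z z'. z \<in> ball 0 1 \<Longrightarrow> z' \<in> ball 0 1 \<Longrightarrow> cmod (z - \<zeta>) = \<rho> \<Longrightarrow> cmod (z' - \<zeta>) = \<rho> \<Longrightarrow> cmod (u z - u z') < \<eta>"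
proof -
  have cu: "continuous_on (ball 0 1) u"
    using d by (intro has_derivative_continuous_on) (auto intro: has_derivative_at_withinI)
  \<comment> \<open>circles about \<open>\<zeta>\<close> correspond to vertical lines\<close>
  define p where "p \<xi> = \<zeta> * (1 - exp \<xi>)" for \<xi>
  define c where "c = \<eta>\<^sup>2 / (pi * K)"
  have c: "c > 0" using \<eta> K by (simp add: c_def)
  define X2 where "X2 = ln (min \<delta> 1)"
  \<comment> \<open>chosen such that \<open>(X2 - X1) * c\<close> exceeds the area \<open>pi\<close> of the disc\<close>
  define X1 where "X1 = X2 - pi / c - 1"
  have "0 < pi / c" using c by simp
  then have X: "X1 < X2" by (simp add: X1_def)
  have X2: "exp x < \<delta>" "exp x < 1" if "x < X2" for x
  proof -
    have "exp x < exp X2" using that by simp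
    then show "exp x < \<delta>" "exp x < 1" using \<delta> by (auto simp: X2_def)
  qed
  define S where "S = {\<xi>. X1 < Re \<xi> \<and> Re \<xi> < X2 \<and> - (pi / 2) < Im \<xi> \<and> Im \<xi> < pi / 2 \<and> exp (Re \<xi>) < 2 * cos (Im \<xi>)}"
  have oS: "open S" unfolding S_def by (intro open_Collect_conj open_Collect_less continuous_intros)
  have pdisc: "p \<xi> \<in> ball 0 1 \<longleftrightarrow> exp (Re \<xi>) < 2 * cos (Im \<xi>)" for \<xi>
  proof -
    have "(cmod (p \<xi>))\<^sup>2 = (1 - exp (Re \<xi>) * cos (Im \<xi>))\<^sup>2 + (exp (Re \<xi>) * sin (Im \<xi>))\<^sup>2"
      unfolding p_def norm_mult \<zeta> by (simp add: cmod_power2 Re_exp Im_exp)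
    also have "\<dots> = 1 + exp (Re \<xi>) * (exp (Re \<xi>) * ((cos (Im \<xi>))\<^sup>2 + (sin (Im \<xi>))\<^sup>2) - 2 * cos (Im \<xi>))"
      by (rule law_of_cosines_identity)
    also have "\<dots> = 1 + exp (Re \<xi>) * (exp (Re \<xi>) - 2 * cos (Im \<xi>))" by simp
    finally have e: "(cmod (p \<xi>))\<^sup>2 = 1 + exp (Re \<xi>) * (exp (Re \<xi>) - 2 * cos (Im \<xi>))" .
    have "p \<xi> \<in> ball 0 1 \<longleftrightarrow> (cmod (p \<xi>))\<^sup>2 < 1" by (simp add: power_less_one_iff)
    also have "\<dots> \<longleftrightarrow> exp (Re \<xi>) * (exp (Re \<xi>) - 2 * cos (Im \<xi>)) < 0" unfolding e by simp
    also have "\<dots> \<longleftrightarrow> exp (Re \<xi>) - 2 * cos (Im \<xi>) < 0" by (simp add: mult_less_0_iff)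
    finally show ?thesis by simp
  qed
  have pS: "p \<xi> \<in> ball 0 1" if "\<xi> \<in> S" for \<xi> using that pdisc by (auto simp: S_def)
  have injp: "inj_on p S"
  proof (rule inj_onI)
    fix z w assume zw: "z \<in> S" "w \<in> S" "p z = p w"
    then have "exp z = exp w" using \<zeta> by (auto simp: p_def)
    then show "z = w" by (rule exp_complex_eqI[rotated]) (use zw in \<open>auto simp: S_def\<close>)
  qed
  define \<alpha>' where "\<alpha>' \<xi> = \<alpha> (p \<xi>) * (- \<zeta> * exp \<xi>)" for \<xi>
  define \<beta>' where "\<beta>' \<xi> = \<beta> (p \<xi>) * cnj (- \<zeta> * exp \<xi>)" for \<xi>
  have dp: "(p has_derivative (\<lambda>v. - \<zeta> * exp \<xi> * v)) (at \<xi>)" for \<xi>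
    unfolding p_def has_field_derivative_def[symmetric] by (auto intro!: derivative_eq_intros)
  have der: "((\<lambda>\<xi>. u (p \<xi>)) has_derivative (\<lambda>v. \<alpha>' \<xi> * v + \<beta>' \<xi> * cnj v)) (at \<xi>)" if "\<xi> \<in> S" for \<xi>
    using has_derivative_compose[OF dp d[OF pS[OF that]]] by (simp add: \<alpha>'_def \<beta>'_def mult.assoc)
  have cp: "continuous_on A p" for A unfolding p_def by (intro continuous_intros)
  have c\<alpha>': "continuous_on S \<alpha>'" unfolding \<alpha>'_def
    by (intro continuous_intros continuous_on_compose2[OF c\<alpha> cp]) (use pS in auto)
  have c\<beta>': "continuous_on S \<beta>'" unfolding \<beta>'_def
    by (intro continuous_intros continuous_on_compose2[OF c\<beta> cp]) (use pS in auto)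
  define J where "J \<xi> = \<bar>(cmod (\<alpha>' \<xi>))\<^sup>2 - (cmod (\<beta>' \<xi>))\<^sup>2\<bar>" for \<xi>
  have cJ: "continuous_on S J" unfolding J_def by (intro continuous_intros c\<alpha>' c\<beta>')
  have qc': "(cmod (\<alpha>' \<xi>) + cmod (\<beta>' \<xi>))\<^sup>2 \<le> K * J \<xi>" if "\<xi> \<in> S" for \<xi>
  proof -
    define \<mu> where "\<mu> = cmod (- \<zeta> * exp \<xi>)"
    let ?m = "\<mu>\<^sup>2"
    have ab: "cmod (\<alpha>' \<xi>) = \<mu> * cmod (\<alpha> (p \<xi>))" "cmod (\<beta>' \<xi>) = \<mu> * cmod (\<beta> (p \<xi>))"
      unfolding \<alpha>'_def \<beta>'_def \<mu>_def norm_mult complex_mod_cnj by (rule mult.commute)+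
    have "(cmod (\<alpha>' \<xi>) + cmod (\<beta>' \<xi>))\<^sup>2 = ?m * (cmod (\<alpha> (p \<xi>)) + cmod (\<beta> (p \<xi>)))\<^sup>2"
      by (simp only: ab distrib_left[symmetric] power_mult_distrib)
    also have "\<dots> \<le> ?m * (K * ((cmod (\<alpha> (p \<xi>)))\<^sup>2 - (cmod (\<beta> (p \<xi>)))\<^sup>2))"
      by (intro mult_left_mono qc pS that) auto
    also have "\<dots> = K * ((cmod (\<alpha>' \<xi>))\<^sup>2 - (cmod (\<beta>' \<xi>))\<^sup>2)"
      by (simp only: ab power_mult_distrib right_diff_distrib mult.left_commute)
    also have "\<dots> \<le> K * J \<xi>" using K by (simp add: J_def)
    finally show ?thesis .
  qed
  have ballpi: "(\<integral>\<^sup>+w\<in>ball (0::complex) 1. ennreal 1 \<partial>lborel) = ennreal pi"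
    by (simp add: emeasure_ball unit_ball_vol_2)
  have upper: "(\<integral>\<^sup>+x. \<integral>\<^sup>+y. indicator S (Complex x y) * ennreal (J (Complex x y)) \<partial>lborel \<partial>lborel) \<le> ennreal pi"
  proof -
    have ii: "inj_on (\<lambda>\<xi>. u (p \<xi>)) S"
      using injp inj pS by (auto simp: inj_on_def)
    have sub: "(\<lambda>\<xi>. u (p \<xi>)) ` S \<subseteq> ball 0 1" using im pS by blast
    show ?thesis
      using area_inequality[OF oS ii der c\<alpha>' c\<beta>' _ _ sub, of "\<lambda>_. 1"] unfolding ballpi J_def by simp
  qed
  have "\<exists>x. X1 < x \<and> x < X2 \<and> (\<forall>y1 y2. Complex x y1 \<in> S \<longrightarrow> Complex x y2 \<in> S \<longrightarrow> cmod (u (p (Complex x y1)) - u (p (Complex x y2))) < \<eta>)"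
  proof (rule ccontr)
    assume neg: "\<not> ?thesis"
    have low: "ennreal c \<le> (\<integral>\<^sup>+y. indicator S (Complex x y) * ennreal (J (Complex x y)) \<partial>lborel)" if x: "X1 < x" "x < X2" for x
    proof -
      have "\<exists>y1 y2. Complex x y1 \<in> S \<and> Complex x y2 \<in> S \<and> \<eta> \<le> cmod (u (p (Complex x y1)) - u (p (Complex x y2))) \<and> y1 < y2"
      proof -
        have "\<not> (\<forall>y1 y2. Complex x y1 \<in> S \<longrightarrow> Complex x y2 \<in> S \<longrightarrow> cmod (u (p (Complex x y1)) - u (p (Complex x y2))) < \<eta>)"
          using neg x by blast
        then obtain y1 y2 where y: "Complex x y1 \<in> S" "Complex x y2 \<in> S" "\<eta> \<le> cmod (u (p (Complex x y1)) - u (p (Complex x y2)))"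
          by (auto simp: not_less)
        then have "y1 \<noteq> y2" using \<eta> by auto
        then consider "y1 < y2" | "y2 < y1" by linarith
        then show ?thesis
        proof cases
          case 1 then show ?thesis using y by blast
        next
          case 2
          then have "\<eta> \<le> cmod (u (p (Complex x y2)) - u (p (Complex x y1)))" using y(3) by (simp only: norm_minus_commute)
          then show ?thesis using y(1,2) 2 by blast
        qed
      qed
      then obtain y1 y2 where y: "Complex x y1 \<in> S" "Complex x y2 \<in> S" "\<eta> \<le> cmod (u (p (Complex x y1)) - u (p (Complex x y2)))" "y1 < y2" by blast
      have seg: "Complex x y \<in> S" if "y \<in> {y1..y2}" for y
      proof -
        have "exp x < 2 * cos y"
        proof (cases "y \<ge> 0")
          case True
          then have "cos y2 \<le> cos y" using that y(2) by (intro cos_monotone_0_pi_le) (auto simp: S_def)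
          then show ?thesis using y(2) by (auto simp: S_def)
        next
          case False
          then have "cos (- y1) \<le> cos (- y)" using that y(1) by (intro cos_monotone_0_pi_le) (auto simp: S_def)
          then show ?thesis using y(1) by (auto simp: S_def)
        qed
        then show ?thesis using y(1,2) that by (auto simp: S_def)
      qed
      have cC: "continuous_on {y1..y2} (Complex x)" unfolding Complex_eq[abs_def] by (intro continuous_intros)
      define L where "L y = cmod (\<alpha>' (Complex x y)) + cmod (\<beta>' (Complex x y))" for y
      have cL: "continuous_on {y1..y2} L" unfolding L_def
        by (intro continuous_intros continuous_on_compose2[OF c\<alpha>' cC] continuous_on_compose2[OF c\<beta>' cC]) (use seg in auto)
      have cJ2: "continuous_on {y1..y2} (\<lambda>y. J (Complex x y))"
        by (intro continuous_on_compose2[OF cJ cC]) (use seg in auto)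
      have len: "\<eta> \<le> integral {y1..y2} L"
      proof -
        define D where "D y = \<alpha>' (Complex x y) * \<i> + \<beta>' (Complex x y) * cnj \<i>" for y
        have "((\<lambda>y. u (p (Complex x y))) has_vector_derivative D y) (at y within {y1..y2})" if "y \<in> {y1..y2}" for y
        proof -
          have "((\<lambda>y. Complex x y) has_derivative (\<lambda>s. s *\<^sub>R \<i>)) (at y within {y1..y2})"
            unfolding Complex_eq by (auto intro!: derivative_eq_intros simp: scaleR_conv_of_real)
          from has_derivative_compose[OF this der[OF seg[OF that]]]
          have "((\<lambda>y. u (p (Complex x y))) has_derivative (\<lambda>s. \<alpha>' (Complex x y) * (s *\<^sub>R \<i>) + \<beta>' (Complex x y) * cnj (s *\<^sub>R \<i>))) (at y within {y1..y2})"
            by simp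
          then show ?thesis unfolding has_vector_derivative_def
            by (rule has_derivative_eq_rhs) (auto simp: fun_eq_iff D_def algebra_simps scaleR_conv_of_real)
        qed
        then have ftc: "(D has_integral (u (p (Complex x y2)) - u (p (Complex x y1)))) {y1..y2}"
          using y(4) by (intro fundamental_theorem_of_calculus) auto
        have "cmod (integral {y1..y2} D) \<le> integral {y1..y2} L"
        proof (rule integral_norm_bound_integral)
          show "D integrable_on {y1..y2}" using ftc by blast
          show "L integrable_on {y1..y2}" by (intro integrable_continuous_real cL)
          show "cmod (D y) \<le> L y" for y
            unfolding D_def L_def using norm_triangle_ineq[of "\<alpha>' (Complex x y) * \<i>" "\<beta>' (Complex x y) * cnj \<i>"] by (simp add: norm_mult)
        qed
        then show ?thesis using y(3) integral_unique[OF ftc] by (simp add: norm_minus_commute)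
      qed
      \<comment> \<open>the speed for which \<open>L\<^sup>2 \<ge> 2 * l * L - l\<^sup>2\<close> is sharp when length \<open>\<eta>\<close> is covered in time \<open>pi\<close>\<close>
      define l where "l = \<eta> / pi"
      have "0 \<le> integral {y1..y2} (\<lambda>y. K * J (Complex x y) - 2 * l * L y + l\<^sup>2)"
      proof (rule integral_nonneg)
        show "(\<lambda>y. K * J (Complex x y) - 2 * l * L y + l\<^sup>2) integrable_on {y1..y2}"
          by (intro integrable_continuous_real continuous_intros cL cJ2)
        fix y assume "y \<in> {y1..y2}"
        then have "(L y)\<^sup>2 \<le> K * J (Complex x y)" using qc'[OF seg] by (simp add: L_def)
        moreover have "0 \<le> (L y - l)\<^sup>2" by simp
        ultimately show "0 \<le> K * J (Complex x y) - 2 * l * L y + l\<^sup>2" by (simp add: power2_diff algebra_simps)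
      qed
      moreover have "((\<lambda>y. K * J (Complex x y) - 2 * l * L y + l\<^sup>2) has_integral
          (K * integral {y1..y2} (\<lambda>y. J (Complex x y)) - 2 * l * integral {y1..y2} L + (y2 - y1) * l\<^sup>2)) {y1..y2}"
        using has_integral_add[OF has_integral_diff[OF has_integral_mult_right[OF integrable_integral[OF integrable_continuous_real[OF cJ2]], of K]
          has_integral_mult_right[OF integrable_integral[OF integrable_continuous_real[OF cL]], of "2 * l"]] has_integral_const_real[of "l\<^sup>2" y1 y2]] y(4)
        by simp
      ultimately have "0 \<le> K * integral {y1..y2} (\<lambda>y. J (Complex x y)) - 2 * l * integral {y1..y2} L + (y2 - y1) * l\<^sup>2"
        by (simp add: integral_unique)
      moreover have "2 * l * \<eta> \<le> 2 * l * integral {y1..y2} L" using len \<eta> by (intro mult_left_mono) (auto simp: l_def)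
      moreover have "(y2 - y1) * l\<^sup>2 \<le> pi * l\<^sup>2" using y by (intro mult_right_mono) (auto simp: S_def)
      moreover have "pi * l\<^sup>2 = l * \<eta>" by (simp add: l_def power2_eq_square)
      ultimately have "l * \<eta> \<le> K * integral {y1..y2} (\<lambda>y. J (Complex x y))" by linarith
      moreover have "l * \<eta> = K * c" using K by (simp add: l_def c_def power2_eq_square)
      ultimately have "c \<le> integral {y1..y2} (\<lambda>y. J (Complex x y))" using K by (simp add: mult_le_cancel_left_pos)
      then have "ennreal c \<le> ennreal (integral {y1..y2} (\<lambda>y. J (Complex x y)))" by (rule ennreal_leI)
      also have "\<dots> = (\<integral>\<^sup>+y. indicator {y1<..<y2} y * ennreal (J (Complex x y)) \<partial>lborel)"
        by (intro nn_integral_open_interval[symmetric] integrable_integral integrable_continuous_real cJ2 continuous_on_subset[OF cJ2]) (auto simp: J_def)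
      also have "\<dots> \<le> (\<integral>\<^sup>+y. indicator S (Complex x y) * ennreal (J (Complex x y)) \<partial>lborel)"
        using seg by (intro nn_integral_mono) (auto simp: indicator_def)
      finally show ?thesis .
    qed
    have "(\<integral>\<^sup>+x. indicator {X1<..<X2} x * ennreal c \<partial>lborel) \<le> (\<integral>\<^sup>+x. \<integral>\<^sup>+y. indicator S (Complex x y) * ennreal (J (Complex x y)) \<partial>lborel \<partial>lborel)"
      using low by (intro nn_integral_mono) (auto simp: indicator_def)
    also have "\<dots> \<le> ennreal pi" by (rule upper)
    also have "(\<integral>\<^sup>+x. indicator {X1<..<X2} x * ennreal c \<partial>lborel) = ennreal ((X2 - X1) * c)"
      using X c by (simp add: nn_integral_multc ennreal_mult'')
    finally have "(X2 - X1) * c \<le> pi" by simp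
    then show False using c mult_pos_pos[OF c c] by (simp add: X1_def field_simps)
  qed
  then obtain x where x: "X1 < x" "x < X2"
    and osc: "\<And>y1 y2. Complex x y1 \<in> S \<Longrightarrow> Complex x y2 \<in> S \<Longrightarrow> cmod (u (p (Complex x y1)) - u (p (Complex x y2))) < \<eta>" by blast
  have rep: "\<exists>y. Complex x y \<in> S \<and> z = p (Complex x y)" if z: "z \<in> ball 0 1" "cmod (z - \<zeta>) = exp x" for z
  proof -
    define w where "w = 1 - z / \<zeta>"
    have zw: "z = \<zeta> * (1 - w)" using \<zeta> by (auto simp: w_def)
    have "cmod w = exp x"
    proof -
      have "z - \<zeta> = - \<zeta> * w" using zw by (simp add: algebra_simps)
      then show ?thesis using z(2) \<zeta> by (simp add: norm_mult)
    qed
    then have w0: "w \<noteq> 0" by auto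
    have we: "w = exp (Complex x (Arg w))"
      using Arg_eq[OF w0] \<open>cmod w = exp x\<close> by (simp add: Complex_eq exp_add exp_of_real)
    have "cmod (z / \<zeta>) < 1" using z \<zeta> by (simp add: norm_divide)
    then have "Re (z / \<zeta>) < 1" using complex_Re_le_cmod[of "z / \<zeta>"] by linarith
    then have "0 < Re w" by (simp add: w_def)
    then have "\<bar>Arg w\<bar> < pi / 2" using Re_Ln_pos_lt[OF w0] w0 by (simp add: Arg_eq_Im_Ln) 
    moreover have "z = p (Complex x (Arg w))" unfolding p_def we[symmetric] by (rule zw)
    ultimately show ?thesis using z(1) x pdisc[of "Complex x (Arg w)"] by (intro exI[of _ "Arg w"]) (auto simp: S_def)
  qed
  show ?thesis
  proof (rule that[of "exp x"])
    show "exp x < \<delta>" "exp x < 1" using X2[OF x(2)] by auto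
    show "cmod (u z - u z') < \<eta>" if "z \<in> ball 0 1" "z' \<in> ball 0 1" "cmod (z - \<zeta>) = exp x" "cmod (z' - \<zeta>) = exp x" for z z'
      using rep[of z] rep[of z'] osc that by blast
  qed simp
qed

text \<open>
  Choose an arc with small image near the boundary point. The image has small diameter and lies close to the
  unit circle, so a chord cuts off a small cap of the disc that contains it. The rest \<open>V\<close> of the disc is
  connected, contains the origin and does not meet the image of the arc; therefore the region behind the arc
  is mapped into the cap.
\<close>
lemma quasiconformal_boundary_oscillation:
  fixes u :: "complex \<Rightarrow> complex"
  assumes inj: "inj_on u (ball 0 1)" and im: "u ` ball 0 1 = ball 0 1" and u0: "u 0 = 0"
    and d: "\<And>z. z \<in> ball 0 1 \<Longrightarrow> (u has_derivative (\<lambda>v. \<alpha> z * v + \<beta> z * cnj v)) (at z)"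
    and c\<alpha>: "continuous_on (ball 0 1) \<alpha>" and c\<beta>: "continuous_on (ball 0 1) \<beta>"
    and qc: "\<And>z. z \<in> ball 0 1 \<Longrightarrow> (cmod (\<alpha> z) + cmod (\<beta> z))\<^sup>2 \<le> K * ((cmod (\<alpha> z))\<^sup>2 - (cmod (\<beta> z))\<^sup>2)"
    and K: "K > 0" and \<zeta>: "cmod \<zeta> = 1" and e: "e > 0"
  shows "\<exists>\<rho>>0. \<forall>z\<in>ball 0 1 \<inter> ball \<zeta> \<rho>. \<forall>z'\<in>ball 0 1 \<inter> ball \<zeta> \<rho>. cmod (u z - u z') < e"
proof -
  have cu: "continuous_on (ball 0 1) u"
    using d by (intro has_derivative_continuous_on) (auto intro: has_derivative_at_withinI)
  \<comment> \<open>a cap of height \<open>2 * \<eta>\<close> has diameter at most \<open>4 * (e / 5)\<close>\<close>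
  define \<eta> where "\<eta> = min (1 / 3) ((e / 5)\<^sup>2)"
  have \<eta>: "0 < \<eta>" "\<eta> < 1 / 2" "\<eta> \<le> (e / 5)\<^sup>2" using e by (auto simp: \<eta>_def min_def)
  obtain g where g: "homeomorphism (ball 0 1) (u ` ball 0 1) u g"
    by (rule invariance_of_domain_homeomorphism[OF open_ball cu _ inj]) auto
  define C where "C = g ` cball 0 (1 - \<eta>)"
  have sub: "cball 0 (1 - \<eta>) \<subseteq> (ball 0 1 :: complex set)" using \<eta> by auto
  have "compact C" unfolding C_def
    using g sub im by (intro compact_continuous_image) (auto simp: homeomorphism_def intro: continuous_on_subset)
  moreover have "C \<subseteq> ball 0 1"
  proof -
    have "g ` ball 0 1 = ball 0 1" using g im by (simp add: homeomorphism_def)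
    then show ?thesis unfolding C_def using image_mono[OF sub, of g] by simp
  qed
  ultimately have "open (- C)" "\<zeta> \<in> - C" using \<zeta> by (auto intro: compact_imp_closed)
  then obtain \<delta> where \<delta>: "\<delta> > 0" "ball \<zeta> \<delta> \<subseteq> - C" by (meson open_contains_ball)
  have near: "cmod (u z) > 1 - \<eta>" if "z \<in> ball 0 1" "cmod (z - \<zeta>) < \<delta>" for z
  proof (rule ccontr)
    assume "\<not> ?thesis"
    then have "g (u z) \<in> C" unfolding C_def by (intro imageI) simp
    then have "z \<in> C" using g that(1) by (simp add: homeomorphism_def)
    moreover have "z \<in> ball \<zeta> \<delta>" using that(2) by (simp add: dist_norm norm_minus_commute)
    ultimately show False using \<delta> by blast
  qed
  obtain \<rho> where \<rho>: "0 < \<rho>" "\<rho> < \<delta>" "\<rho> < 1"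
    and osc: "\<And>z z'. z \<in> ball 0 1 \<Longrightarrow> z' \<in> ball 0 1 \<Longrightarrow> cmod (z - \<zeta>) = \<rho> \<Longrightarrow> cmod (z' - \<zeta>) = \<rho> \<Longrightarrow> cmod (u z - u z') < \<eta>"
    using quasiconformal_arc_oscillation[OF inj im d c\<alpha> c\<beta> qc K \<zeta> \<eta>(1) \<delta>(1)] by metis
  define z1 where "z1 = \<zeta> * of_real (1 - \<rho>)"
  have z1: "z1 \<in> ball 0 1" "cmod (z1 - \<zeta>) = \<rho>"
  proof -
    show "z1 \<in> ball 0 1" using \<rho> \<zeta> unfolding z1_def by (simp add: norm_mult del: of_real_diff)
    have "z1 - \<zeta> = \<zeta> * of_real (- \<rho>)" by (simp add: z1_def algebra_simps)
    then show "cmod (z1 - \<zeta>) = \<rho>" using \<rho> \<zeta> by (simp add: norm_mult)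
  qed
  define w1 where "w1 = u z1"
  have w1: "1 - \<eta> < cmod w1" unfolding w1_def using near z1 \<rho> by auto
  have w10: "w1 \<noteq> 0" using w1 \<eta> by auto
  define s where "s = sgn w1"
  have s: "cmod s = 1" "Re (w1 * cnj s) = cmod w1"
  proof -
    show "cmod s = 1" using w10 by (simp add: s_def norm_sgn)
    have "w1 * cnj s = (w1 * cnj w1) / of_real (cmod w1)" by (simp add: s_def sgn_eq)
    also have "w1 * cnj w1 = of_real (cmod w1) * of_real (cmod w1)"
      using complex_norm_square[of w1] by (simp only: power2_eq_square of_real_mult)
    finally have "w1 * cnj s = of_real (cmod w1)" using w10 by simp
    then show "Re (w1 * cnj s) = cmod w1" by simp
  qed
  define X1 where "X1 = ball 0 1 \<inter> ball \<zeta> \<rho>"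
  define X2 where "X2 = {z \<in> ball 0 1. \<rho> < cmod (z - \<zeta>)}"
  have o2: "open X2"
  proof -
    have "X2 = ball 0 1 \<inter> {z. \<rho> < cmod (z - \<zeta>)}" by (auto simp: X2_def)
    then show ?thesis by (auto intro!: open_Int open_Collect_less continuous_intros)
  qed
  have o1: "open X1" by (auto simp: X1_def)
  have subX: "X1 \<subseteq> ball 0 1" "X2 \<subseteq> ball 0 1" by (auto simp: X1_def X2_def)
  have op: "open (u ` X1)" "open (u ` X2)"
    by (intro invariance_of_domain continuous_on_subset[OF cu] inj_on_subset[OF inj] subX o1 o2)+
  define V where "V = ball 0 1 \<inter> {w. Re (w * cnj s) < 1 - 2 * \<eta>}"
  have half: "{w. Re (w * cnj s) < 1 - 2 * \<eta>} = {w. s \<bullet> w < 1 - 2 * \<eta>}"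
    by (auto simp: inner_complex_def algebra_simps)
  have "convex V" unfolding V_def half by (intro convex_Int convex_ball convex_halfspace_lt)
  then have conV: "connected V" by (rule convex_connected)
  have "V \<subseteq> u ` X1 \<union> u ` X2"
  proof
    fix w assume w: "w \<in> V"
    then have "w \<in> u ` ball 0 1" by (simp add: im V_def)
    then obtain y where y: "w = u y" "y \<in> ball 0 1" by auto
    have "cmod (y - \<zeta>) \<noteq> \<rho>"
    proof
      assume "cmod (y - \<zeta>) = \<rho>"
      then have "cmod (w - w1) < \<eta>" unfolding w1_def y(1) using osc y(2) z1 by blast
      then have "cmod ((w1 - w) * cnj s) < \<eta>" using s by (simp add: norm_mult norm_minus_commute)
      then have "Re ((w1 - w) * cnj s) < \<eta>" using complex_Re_le_cmod le_less_trans by blast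
      then have "Re (w1 * cnj s) - Re (w * cnj s) < \<eta>" by (simp add: algebra_simps)
      then show False using w w1 s by (simp add: V_def)
    qed
    then show "w \<in> u ` X1 \<union> u ` X2" using y
      by (cases "cmod (y - \<zeta>) < \<rho>") (auto simp: X1_def X2_def dist_norm norm_minus_commute)
  qed
  moreover have "u ` X1 \<inter> u ` X2 = {}"
    using inj_on_image_Int[OF inj subX] by (auto simp: X1_def X2_def dist_norm norm_minus_commute)
  moreover have "0 \<in> u ` X2 \<inter> V"
  proof
    have "0 \<in> X2" using \<rho> \<zeta> by (simp add: X2_def)
    then show "0 \<in> u ` X2" using u0 by (metis imageI)
    show "0 \<in> V" using \<eta> by (simp add: V_def)
  qed
  ultimately have disj: "u ` X1 \<inter> V = {}" using connectedD[OF conV op] by blast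
  have cap: "cmod (u z - s) \<le> 2 * (e / 5)" if z: "z \<in> X1" for z
  proof -
    have uz: "u z \<in> ball 0 1" using im z subX by blast
    then have "u z \<notin> {w. Re (w * cnj s) < 1 - 2 * \<eta>}" using disj z by (auto simp: V_def)
    then have re: "1 - 2 * \<eta> \<le> Re (u z * cnj s)" by simp
    have "(cmod (u z - s))\<^sup>2 = (cmod (u z))\<^sup>2 + (cmod s)\<^sup>2 - 2 * Re (u z * cnj s)"
      unfolding cmod_power2 by (simp add: power2_eq_square algebra_simps)
    moreover have "(cmod (u z))\<^sup>2 \<le> 1" using uz by (simp add: power_le_one)
    ultimately have "(cmod (u z - s))\<^sup>2 \<le> 4 * \<eta>" using re s by simp
    also have "\<dots> \<le> (2 * (e / 5))\<^sup>2" using \<eta>(3) by (simp add: power2_eq_square)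
    finally show ?thesis by (rule power2_le_imp_le) (use e in simp)
  qed
  have "cmod (u z - u z') < e" if "z \<in> X1" "z' \<in> X1" for z z'
  proof -
    have "cmod (u z - u z') \<le> cmod (u z - s) + cmod (u z' - s)" using norm_triangle_ineq4[of "u z - s" "u z' - s"] by simp
    then show ?thesis using cap[OF that(1)] cap[OF that(2)] e by simp
  qed
  then show ?thesis using \<rho>(1) by (intro exI[of _ \<rho>]) (auto simp: X1_def)
qed

text \<open>
  By compactness of the closed disc, the local oscillation estimates give uniform continuity.
\<close>
lemma quasiconformal_extends_continuously:
  fixes u :: "complex \<Rightarrow> complex"
  assumes inj: "inj_on u (ball 0 1)" and im: "u ` ball 0 1 = ball 0 1" and u0: "u 0 = 0"
    and d: "\<And>z. z \<in> ball 0 1 \<Longrightarrow> (u has_derivative (\<lambda>v. \<alpha> z * v + \<beta> z * cnj v)) (at z)"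
    and c\<alpha>: "continuous_on (ball 0 1) \<alpha>" and c\<beta>: "continuous_on (ball 0 1) \<beta>"
    and qc: "\<And>z. z \<in> ball 0 1 \<Longrightarrow> (cmod (\<alpha> z) + cmod (\<beta> z))\<^sup>2 \<le> K * ((cmod (\<alpha> z))\<^sup>2 - (cmod (\<beta> z))\<^sup>2)"
    and K: "K > 0"
  obtains U where "continuous_on (cball 0 1) U" "\<And>z. z \<in> ball 0 1 \<Longrightarrow> U z = u z"
proof -
  have cu: "continuous_on (ball 0 1) u"
    using d by (intro has_derivative_continuous_on) (auto intro: has_derivative_at_withinI)
  have "uniformly_continuous_on (ball 0 1) u"
    unfolding uniformly_continuous_on_def
  proof (intro allI impI)
    fix e :: real assume e: "e > 0"
    have loc: "\<exists>\<rho>>0. \<forall>z\<in>ball 0 1 \<inter> ball l \<rho>. \<forall>z'\<in>ball 0 1 \<inter> ball l \<rho>. cmod (u z - u z') < e" if l: "l \<in> cball 0 1" for l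
    proof (cases "cmod l = 1")
      case True
      show ?thesis by (rule quasiconformal_boundary_oscillation[OF inj im u0 d c\<alpha> c\<beta> qc K True e])
    next
      case False
      then have "l \<in> ball 0 1" using l by auto
      then have "isCont u l" using cu by (simp add: continuous_on_eq_continuous_at)
      then obtain \<rho> where \<rho>: "\<rho> > 0" "\<And>z. dist z l < \<rho> \<Longrightarrow> dist (u z) (u l) < e / 2"
        unfolding continuous_at_eps_delta using e by (metis half_gt_zero)
      have "cmod (u z - u z') < e" if "dist l z < \<rho>" "dist l z' < \<rho>" for z z'
      proof -
        have "dist (u z) (u z') < e"
          by (rule dist_triangle_half_l[of _ "u l"]) (use \<rho>(2)[of z] \<rho>(2)[of z'] that in \<open>auto simp: dist_commute\<close>)
        then show ?thesis by (simp add: dist_norm)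
      qed
      then show ?thesis using \<rho>(1) by auto
    qed
    then obtain \<rho> where \<rho>: "\<And>l. l \<in> cball 0 1 \<Longrightarrow> \<rho> l > 0 \<and> (\<forall>z\<in>ball 0 1 \<inter> ball l (\<rho> l). \<forall>z'\<in>ball 0 1 \<inter> ball l (\<rho> l). cmod (u z - u z') < e)"
      by metis
    let ?G = "(\<lambda>l. ball l (\<rho> l)) ` cball 0 1"
    have "cball 0 1 \<subseteq> \<Union> ?G" using \<rho> by force
    then obtain \<epsilon> where \<epsilon>: "0 < \<epsilon>" "\<And>x. x \<in> cball 0 1 \<Longrightarrow> \<exists>G\<in>?G. ball x \<epsilon> \<subseteq> G"
      using Heine_Borel_lemma[of "cball (0::complex) 1" ?G] compact_cball by blast
    have "dist (u x') (u x) < e" if x: "x \<in> ball 0 1" "x' \<in> ball 0 1" "dist x' x < \<epsilon>" for x x'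
    proof -
      have "x \<in> cball 0 1" using x by auto
      then obtain l where l: "l \<in> cball 0 1" "ball x \<epsilon> \<subseteq> ball l (\<rho> l)" using \<epsilon>(2) by blast
      have "x \<in> ball x \<epsilon>" "x' \<in> ball x \<epsilon>" using x \<epsilon>(1) by (auto simp: dist_commute)
      then have "x \<in> ball l (\<rho> l)" "x' \<in> ball l (\<rho> l)" using l(2) by blast+
      then show ?thesis using \<rho>[OF l(1)] x by (auto simp: dist_norm)
    qed
    then show "\<exists>d>0. \<forall>x\<in>ball 0 1. \<forall>x'\<in>ball 0 1. dist x' x < d \<longrightarrow> dist (u x') (u x) < e" using \<epsilon>(1) by blast
  qed
  then obtain U where "uniformly_continuous_on (closure (ball 0 1)) U" "\<And>z. z \<in> ball 0 1 \<Longrightarrow> u z = U z"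
    by (rule uniformly_continuous_on_extension_on_closure) (rule that)
  then show ?thesis using that[of U] by (auto intro: uniformly_continuous_imp_continuous)
qed

text \<open>
  The inverse of $v \mapsto \alpha v + \beta \overline{v}$ has the coefficients
  $\overline{\alpha}/J$ and $-\beta/J$, where $J$ is the Jacobian; in particular the inverse map has the same
  dilatation.
\<close>
lemma quasiconformal_inverse_derivative:
  fixes u :: "complex \<Rightarrow> complex"
  assumes hom: "homeomorphism (ball 0 1) (ball 0 1) u k"
    and d: "\<And>z. z \<in> ball 0 1 \<Longrightarrow> (u has_derivative (\<lambda>v. \<alpha> z * v + \<beta> z * cnj v)) (at z)"
    and J: "\<And>z. z \<in> ball 0 1 \<Longrightarrow> (cmod (\<beta> z))\<^sup>2 < (cmod (\<alpha> z))\<^sup>2" and w: "w \<in> ball 0 1"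
  shows "(k has_derivative (\<lambda>v. cnj (\<alpha> (k w)) / of_real ((cmod (\<alpha> (k w)))\<^sup>2 - (cmod (\<beta> (k w)))\<^sup>2) * v
      + (- \<beta> (k w) / of_real ((cmod (\<alpha> (k w)))\<^sup>2 - (cmod (\<beta> (k w)))\<^sup>2)) * cnj v)) (at w)"
proof (rule has_derivative_inverse_basic[where f = u and T = "ball 0 1"])
  let ?a = "\<alpha> (k w)" and ?b = "\<beta> (k w)"
  have kw: "k w \<in> ball 0 1" using hom w by (auto simp: homeomorphism_def)
  show "(u has_derivative (\<lambda>v. ?a * v + ?b * cnj v)) (at (k w))" by (rule d[OF kw])
  let ?J = "of_real ((cmod ?a)\<^sup>2 - (cmod ?b)\<^sup>2) :: complex"
  have J0: "?J \<noteq> 0" unfolding of_real_eq_0_iff using J[OF kw] by linarith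
  have Je: "?J = ?a * cnj ?a - ?b * cnj ?b" unfolding of_real_diff complex_norm_square ..
  show "bounded_linear (\<lambda>v. cnj ?a / ?J * v + (- ?b / ?J) * cnj v)"
    by (intro bounded_linear_add bounded_linear_mult_right bounded_linear_const_mult bounded_linear_cnj)
  show "(\<lambda>v. cnj ?a / ?J * v + (- ?b / ?J) * cnj v) \<circ> (\<lambda>v. ?a * v + ?b * cnj v) = id"
  proof
    fix v
    have "((\<lambda>v. cnj ?a / ?J * v + (- ?b / ?J) * cnj v) \<circ> (\<lambda>v. ?a * v + ?b * cnj v)) v
      = (?a * cnj ?a - ?b * cnj ?b) * v / ?J"
      by (simp add: add_divide_distrib[symmetric] diff_divide_distrib[symmetric] algebra_simps del: of_real_diff of_real_power)
    also have "\<dots> = v" unfolding Je[symmetric] using J0 by simp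
    finally show "((\<lambda>v. cnj ?a / ?J * v + (- ?b / ?J) * cnj v) \<circ> (\<lambda>v. ?a * v + ?b * cnj v)) v = id v" by simp
  qed
  show "continuous (at w) k" using hom w by (auto simp: homeomorphism_def continuous_on_eq_continuous_at)
  show "u (k z) = z" if "z \<in> ball 0 1" for z using hom that by (auto simp: homeomorphism_def)
qed (use w in auto)

section \<open>Harmonic maps of the disc onto itself\<close>

text \<open>
  Both \<open>u\<close> and its inverse are quasiconformal, so both extend continuously to the closed disc and the boundary
  map is a homeomorphism of the circle. A continuous logarithm provides the lift \<open>\<theta>\<close>; it is injective, and
  it increases by $2\pi$ because the boundary curve has the winding number of nearby circles.
\<close>
lemma univalent_harmonic_disc_boundary:
  fixes u :: "complex \<Rightarrow> complex"
  assumes inj: "inj_on u (ball 0 1)" and im: "u ` ball 0 1 = ball 0 1" and u0: "u 0 = 0"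
    and d: "\<And>z. z \<in> ball 0 1 \<Longrightarrow> (u has_derivative (\<lambda>v. \<alpha> z * v + \<beta> z * cnj v)) (at z)"
    and c\<alpha>: "continuous_on (ball 0 1) \<alpha>" and c\<beta>: "continuous_on (ball 0 1) \<beta>"
    and qc: "\<And>z. z \<in> ball 0 1 \<Longrightarrow> cmod (\<beta> z) \<le> k * cmod (\<alpha> z)" and k: "0 \<le> k" "k < 1"
    and nz: "\<And>z. z \<in> ball 0 1 \<Longrightarrow> \<alpha> z \<noteq> 0"
  obtains U \<theta> where "continuous_on (cball 0 1) U" "\<And>z. z \<in> ball 0 1 \<Longrightarrow> U z = u z"
    "continuous_on UNIV \<theta>" "mono \<theta>" "\<And>t. \<theta> (t + 2 * pi) = \<theta> t + 2 * pi" "\<And>t. U (cis t) = cis (\<theta> t)"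
proof -
  have cu: "continuous_on (ball 0 1) u"
    using d by (intro has_derivative_continuous_on) (auto intro: has_derivative_at_withinI)
  obtain g where g: "homeomorphism (ball 0 1) (u ` ball 0 1) u g"
    by (rule invariance_of_domain_homeomorphism[OF open_ball cu _ inj]) auto
  then have hom: "homeomorphism (ball 0 1) (ball 0 1) u g" unfolding im .
  have gb: "g w \<in> ball 0 1" "u (g w) = w" if "w \<in> ball 0 1" for w using hom that by (auto simp: homeomorphism_def)
  have gu: "g (u z) = z" "u z \<in> ball 0 1" if "z \<in> ball 0 1" for z using hom that by (auto simp: homeomorphism_def)
  have J: "(cmod (\<beta> z))\<^sup>2 < (cmod (\<alpha> z))\<^sup>2" if "z \<in> ball 0 1" for z
  proof -
    have "k * cmod (\<alpha> z) < 1 * cmod (\<alpha> z)" using k nz[OF that] by (intro mult_strict_right_mono) auto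
    then show ?thesis using qc[OF that] by (intro power_strict_mono) auto
  qed
  define K where "K = (1 + k) / (1 - k)"
  have K: "K > 0" using k by (simp add: K_def)
  have qcK: "(A + B)\<^sup>2 \<le> K * (A\<^sup>2 - B\<^sup>2)" if "0 \<le> A" "0 \<le> B" "B \<le> k * A" for A B :: real
  proof -
    have "(A + B) * (B - k * A) \<le> 0" using that by (intro mult_nonneg_nonpos) auto
    then have "(A + B)\<^sup>2 * (1 - k) \<le> (A\<^sup>2 - B\<^sup>2) * (1 + k)" by (simp add: power2_eq_square algebra_simps)
    then show ?thesis using k by (simp add: K_def field_simps)
  qed
  have qc1: "(cmod (\<alpha> z) + cmod (\<beta> z))\<^sup>2 \<le> K * ((cmod (\<alpha> z))\<^sup>2 - (cmod (\<beta> z))\<^sup>2)" if "z \<in> ball 0 1" for z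
    by (rule qcK) (use qc[OF that] in auto)
  obtain U where "continuous_on (cball 0 1) U \<and> (\<forall>z\<in>ball 0 1. U z = u z)"
  proof (rule quasiconformal_extends_continuously[OF inj im u0 d c\<alpha> c\<beta> qc1 K])
    fix U assume "continuous_on (cball 0 1) U" "\<And>z. z \<in> ball 0 1 \<Longrightarrow> U z = u z"
    then show thesis by (intro that[of U]) auto
  qed
  then have U: "continuous_on (cball 0 1) U" "\<And>z. z \<in> ball 0 1 \<Longrightarrow> U z = u z" by simp_all
  \<comment> \<open>the inverse map is quasiconformal with the same constant\<close>
  define j where "j w = (cmod (\<alpha> (g w)))\<^sup>2 - (cmod (\<beta> (g w)))\<^sup>2" for w
  have jpos: "j w > 0" if "w \<in> ball 0 1" for w using J[OF gb(1)[OF that]] by (simp add: j_def)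
  have cg: "continuous_on (ball 0 1) g" using hom by (simp add: homeomorphism_def)
  have c\<alpha>g: "continuous_on (ball 0 1) (\<lambda>w. \<alpha> (g w))" by (rule continuous_on_compose2[OF c\<alpha> cg]) (use gb in auto)
  have c\<beta>g: "continuous_on (ball 0 1) (\<lambda>w. \<beta> (g w))" by (rule continuous_on_compose2[OF c\<beta> cg]) (use gb in auto)
  have cj: "continuous_on (ball 0 1) (\<lambda>w. complex_of_real (j w))" unfolding j_def by (intro continuous_intros c\<alpha>g c\<beta>g)
  have jne: "complex_of_real (j w) \<noteq> 0" if "w \<in> ball 0 1" for w using jpos[OF that] by simp
  obtain V where V: "continuous_on (cball 0 1) V" "\<And>z. z \<in> ball 0 1 \<Longrightarrow> V z = g z"
  proof (rule quasiconformal_extends_continuously[of g "\<lambda>w. cnj (\<alpha> (g w)) / of_real (j w)" "\<lambda>w. - \<beta> (g w) / of_real (j w)" K])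
    show "inj_on g (ball 0 1)" by (rule inj_on_inverseI[of _ u]) (rule gb)
    show "g ` ball 0 1 = ball 0 1" using hom by (simp add: homeomorphism_def)
    show "g 0 = 0" using gu[of 0] u0 by simp
    show "(g has_derivative (\<lambda>v. cnj (\<alpha> (g w)) / of_real (j w) * v + - \<beta> (g w) / of_real (j w) * cnj v)) (at w)" if "w \<in> ball 0 1" for w
      using quasiconformal_inverse_derivative[OF hom d J that] unfolding j_def .
    show "continuous_on (ball 0 1) (\<lambda>w. cnj (\<alpha> (g w)) / of_real (j w))" "continuous_on (ball 0 1) (\<lambda>w. - \<beta> (g w) / of_real (j w))"
      by (intro continuous_intros c\<alpha>g c\<beta>g cj ballI jne; assumption)+
    show "(cmod (cnj (\<alpha> (g w)) / of_real (j w)) + cmod (- \<beta> (g w) / of_real (j w)))\<^sup>2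
      \<le> K * ((cmod (cnj (\<alpha> (g w)) / of_real (j w)))\<^sup>2 - (cmod (- \<beta> (g w) / of_real (j w)))\<^sup>2)" if w: "w \<in> ball 0 1" for w
    proof -
      have "cmod (\<beta> (g w)) / j w \<le> k * (cmod (\<alpha> (g w)) / j w)"
        using divide_right_mono[OF qc[OF gb(1)[OF w]], of "j w"] jpos[OF w] by simp
      then show ?thesis using jpos[OF w] by (intro qcK) (auto simp: norm_divide)
    qed
  qed (use K that in auto)
  have cl: "closure (ball 0 1) = (cball 0 1 :: complex set)" by simp
  have Ub: "cmod (U z) \<le> 1" if "z \<in> cball 0 1" for z
  proof -
    have "U ` closure (ball 0 1) \<subseteq> cball 0 1"
    proof (rule image_closure_subset)
      show "continuous_on (closure (ball 0 1)) U" using U(1) by simp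
      show "U ` ball 0 1 \<subseteq> cball 0 1" using U(2) gu(2) by force
    qed simp
    then show ?thesis using that cl by (metis imageI mem_cball_0 subsetD)
  qed
  have VU: "V (U z) = z" if z: "z \<in> cball 0 1" for z
  proof -
    have cVU: "continuous_on (cball 0 1) (\<lambda>z. V (U z))"
      by (rule continuous_on_compose2[OF V(1) U(1)]) (use Ub in auto)
    have "(\<lambda>z. V (U z) - z) z = 0"
    proof (rule continuous_constant_on_closure[of "ball 0 1" "\<lambda>z. V (U z) - z"])
      show "continuous_on (closure (ball 0 1)) (\<lambda>z. V (U z) - z)" unfolding cl by (intro continuous_intros cVU)
      show "V (U x) - x = 0" if "x \<in> ball 0 1" for x using U(2)[OF that] V(2)[OF gu(2)[OF that]] gu(1)[OF that] by simp
    qed (use z in simp)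
    then show ?thesis by simp
  qed
  have Ucirc: "cmod (U z) = 1" if z: "cmod z = 1" for z
  proof (rule ccontr)
    assume "cmod (U z) \<noteq> 1"
    then have "U z \<in> ball 0 1" using Ub[of z] z by simp
    then have "z \<in> ball 0 1" using VU[of z] V(2)[of "U z"] gb(1)[of "U z"] z by simp
    then show False using z by simp
  qed
  define \<phi> where "\<phi> t = U (cis t)" for t
  have c\<phi>: "continuous_on A \<phi>" for A unfolding \<phi>_def
    by (intro continuous_on_compose2[OF U(1)] continuous_on_cis continuous_intros) auto
  have \<phi>1: "cmod (\<phi> t) = 1" for t unfolding \<phi>_def by (rule Ucirc) simp
  have \<phi>nz: "\<phi> t \<noteq> 0" for t using \<phi>1[of t] by auto
  obtain G where G: "continuous_on UNIV G" "\<And>t. \<phi> t = exp (G t)"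
    by (rule continuous_logarithm_on_contractible[of UNIV \<phi>]) (use c\<phi> \<phi>nz that in \<open>auto simp: convex_imp_contractible\<close>)
  define \<theta> where "\<theta> t = Im (G t)" for t
  have "Re (G t) = 0" for t using \<phi>1[of t] by (simp add: G(2))
  then have G\<theta>: "G t = \<i> * of_real (\<theta> t)" for t by (simp add: \<theta>_def complex_eq_iff)
  have \<phi>\<theta>: "\<phi> t = cis (\<theta> t)" for t by (simp add: G(2) G\<theta> cis_conv_exp)
  have c\<theta>: "continuous_on A \<theta>" for A unfolding \<theta>_def by (intro continuous_intros continuous_on_subset[OF G(1)]) auto
  \<comment> \<open>the boundary curve winds once about the origin\<close>
  let ?b = "\<lambda>s. \<phi> (2 * pi * s)"
  have wb: "winding_number ?b 0 = 1"
  proof -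
    have "uniformly_continuous_on (cball 0 1) U" by (intro compact_uniformly_continuous U(1)) simp
    then obtain e where e: "e > 0" "\<And>x y. x \<in> cball 0 1 \<Longrightarrow> y \<in> cball 0 1 \<Longrightarrow> dist y x < e \<Longrightarrow> dist (U y) (U x) < 1"
      by (rule uniformly_continuous_onE[OF _ zero_less_one]) (rule that)
    define r where "r = max (1/2) (1 - e / 2)"
    have r: "0 < r" "r < 1" "1 - r < e" using e(1) by (auto simp: r_def max_def)
    have pb: "path ?b" "pathfinish ?b = pathstart ?b"
    proof -
      show "path ?b" unfolding path_def by (intro continuous_on_compose2[OF c\<phi>[of UNIV]] continuous_intros) auto
      show "pathfinish ?b = pathstart ?b" using cis_2pi by (simp add: pathfinish_def pathstart_def \<phi>_def)
    qed
    have r': "cmod 0 + r < 1" using r by simp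
    have "winding_number (increment_loop u 0 r) 0 = winding_number ?b 0"
    proof (rule winding_number_perturb[OF pb(1) path_increment_loop(1)[OF cu r'] pb(2) path_increment_loop(2)[OF cu r']])
      fix s :: real
      have i: "of_real r * cis (2 * pi * s) \<in> ball 0 1" using r by (simp add: norm_mult)
      have "dist (of_real r * cis (2 * pi * s)) (cis (2 * pi * s)) = cmod (of_real (1 - r) * cis (2 * pi * s))"
        by (simp add: dist_norm norm_minus_commute algebra_simps)
      also have "\<dots> < e" using r by (simp add: norm_mult del: of_real_diff)
      finally have "dist (U (of_real r * cis (2 * pi * s))) (U (cis (2 * pi * s))) < 1"
        using i by (intro e(2)) auto
      then show "cmod (increment_loop u 0 r s - ?b s) < cmod (?b s)"
        using \<phi>1 U(2)[OF i] by (simp add: increment_loop_def u0 \<phi>_def dist_norm)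
    qed (use r in auto)
    moreover have "winding_number (increment_loop u 0 r) 0 = 1"
    proof (rule winding_increment_loop_eq_1[OF cu inj d[of 0] _ r' r(1)])
      show "cmod (\<beta> 0) < cmod (\<alpha> 0)" using J[of 0] by (simp add: power2_less_imp_less)
    qed simp
    ultimately show ?thesis by simp
  qed
  have per: "\<theta> (t + 2 * pi) = \<theta> t + 2 * pi" for t
  proof -
    define D where "D t = \<theta> (t + 2 * pi) - \<theta> t" for t
    have cD: "continuous_on UNIV D" unfolding D_def by (intro continuous_intros continuous_on_compose2[OF c\<theta>[of UNIV]]) auto
    have "\<exists>n::int. D t = 2 * pi * of_int n" for t
    proof -
      have "cis (t + 2 * pi) = cis t" by (simp add: complex_eq_iff)
      then have "\<phi> (t + 2 * pi) = \<phi> t" by (simp only: \<phi>_def)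
      then have "cis (\<theta> (t + 2 * pi)) = cis (\<theta> t)" by (simp only: \<phi>\<theta>)
      then have "cis (D t) = 1" by (simp add: D_def cis_divide[symmetric])
      then have "cos (D t) = 1" by (simp add: complex_eq_iff)
      then obtain n :: int where "D t = of_int n * 2 * pi" unfolding cos_one_2pi_int ..
      then have "D t = 2 * pi * of_int n" by simp
      then show ?thesis ..
    qed
    then have discrete: "D t \<in> range (\<lambda>n::int. 2 * pi * of_int n)" for t by blast
    have "D constant_on UNIV"
    proof (rule continuous_discrete_range_constant[OF _ cD])
      fix x
      show "\<exists>e>0. \<forall>y. y \<in> UNIV \<and> D y \<noteq> D x \<longrightarrow> e \<le> norm (D y - D x)"
      proof (intro exI[of _ "2 * pi"] conjI allI impI)
        fix y assume y: "y \<in> UNIV \<and> D y \<noteq> D x"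
        obtain m n :: int where mn: "D y = 2 * pi * of_int m" "D x = 2 * pi * of_int n" using discrete[of y] discrete[of x] by (elim rangeE)
        then have "m \<noteq> n" using y by auto
        then have "1 \<le> \<bar>m - n\<bar>" by simp
        then have "1 \<le> \<bar>real_of_int m - real_of_int n\<bar>" by linarith
        then have "2 * pi * 1 \<le> 2 * pi * \<bar>real_of_int m - real_of_int n\<bar>" by (intro mult_left_mono) auto
        then show "2 * pi \<le> norm (D y - D x)" by (simp add: mn right_diff_distrib[symmetric] abs_mult)
      qed simp
    qed simp
    then have Dc: "D t = D 0" for t by (auto simp: constant_on_def)
    have "winding_number (exp \<circ> (\<lambda>s. G (2 * pi * s))) 0 = (G (2 * pi * 1) - G (2 * pi * 0)) / (2 * of_real pi * \<i>)"
      by (subst winding_number_compose_exp)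
         (auto simp: path_def pathfinish_def pathstart_def intro!: continuous_on_compose2[OF G(1)] continuous_intros)
    moreover have "exp \<circ> (\<lambda>s. G (2 * pi * s)) = ?b" by (simp add: fun_eq_iff G(2))
    ultimately have "G (2 * pi) - G 0 = 2 * of_real pi * \<i>" using wb by (simp add: field_simps)
    then have "D 0 = 2 * pi" by (simp add: D_def \<theta>_def minus_complex.sel(2)[symmetric] del: minus_complex.sel)
    then show ?thesis using Dc[of t] by (simp add: D_def)
  qed
  have peri: "\<theta> (t + 2 * pi * of_int n) = \<theta> t + 2 * pi * of_int n" for t n
  proof (induction n rule: int_induct[of _ 0])
    case (step1 i)
    have e: "t + 2 * pi * of_int (i + 1) = (t + 2 * pi * of_int i) + 2 * pi" by (simp add: algebra_simps)
    show ?case unfolding e per step1(2) by (simp add: algebra_simps)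
  next
    case (step2 i)
    have e: "t + 2 * pi * of_int i = (t + 2 * pi * of_int (i - 1)) + 2 * pi" by (simp add: algebra_simps)
    have "\<theta> (t + 2 * pi * of_int (i - 1)) + 2 * pi = \<theta> t + 2 * pi * of_int i"
      using per[of "t + 2 * pi * of_int (i - 1)"] step2(2) unfolding e[symmetric] by simp
    moreover have "2 * pi * of_int (i - 1) = 2 * pi * of_int i - 2 * pi" by (simp add: algebra_simps)
    ultimately show ?case by linarith
  qed simp
  have inj\<theta>: "inj_on \<theta> A" for A
  proof (rule inj_onI)
    fix s t assume st: "\<theta> s = \<theta> t"
    then have "U (cis s) = U (cis t)" using \<phi>\<theta>[of s] \<phi>\<theta>[of t] by (simp add: \<phi>_def)
    moreover have "V (U (cis s)) = cis s" "V (U (cis t)) = cis t" by (rule VU; simp)+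
    ultimately have "cis s = cis t" by metis
    then have "cis (s - t) = 1" by (simp add: cis_divide[symmetric])
    then have "cos (s - t) = 1" by (simp add: complex_eq_iff)
    then obtain n :: int where "s - t = of_int n * 2 * pi" unfolding cos_one_2pi_int ..
    then have n: "s = t + 2 * pi * of_int n" by (simp add: algebra_simps)
    then have "n = 0" using peri[of t n] st by simp
    then show "s = t" using n by simp
  qed
  have mono\<theta>: "mono \<theta>"
  proof (rule monoI)
    fix s t :: real assume "s \<le> t"
    show "\<theta> s \<le> \<theta> t"
    proof (cases "s = t")
      case False
      define n where "n = \<lceil>(t - s) / (2 * pi)\<rceil> + 1"
      have n: "(t - s) / (2 * pi) < of_int n" unfolding n_def by linarith
      then have b: "t < s + 2 * pi * of_int n" by (simp add: field_simps)
      have "0 < (t - s) / (2 * pi)" using False \<open>s \<le> t\<close> by simp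
      then have n0: "0 < real_of_int n" using n by linarith
      have "\<theta> s < \<theta> t \<and> \<theta> t < \<theta> (s + 2 * pi * of_int n) \<or> \<theta> (s + 2 * pi * of_int n) < \<theta> t \<and> \<theta> t < \<theta> s"
        by (rule continuous_inj_imp_mono[OF _ b c\<theta> inj\<theta>]) (use False \<open>s \<le> t\<close> in simp)
      moreover have "\<theta> s < \<theta> (s + 2 * pi * of_int n)" using n0 by (simp add: peri)
      ultimately show ?thesis by linarith
    qed simp
  qed
  have "U (cis t) = cis (\<theta> t)" for t using \<phi>\<theta>[of t] by (simp only: \<phi>_def)
  from that[OF U(1) _ c\<theta> mono\<theta> per this] U(2) show ?thesis by blast
qed

text \<open>
  Translation by \<open>s\<close> multiplies the coefficient by $e^{ins}$, so that $|C| |e^{ins} - 1|$ is at most the mean of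
  $|e^{i\theta(t+s)} - e^{i\theta(t)}| \le \theta(t+s) - \theta(t)$, and the mean displacement of a lift of degree one is
  \<open>s\<close>. Divide by \<open>s\<close> and let it tend to zero.
\<close>
lemma circle_map_fourier_bound:
  fixes \<theta> :: "real \<Rightarrow> real" and C :: complex
  assumes c: "continuous_on UNIV \<theta>" and m: "mono \<theta>" and p: "\<And>t. \<theta> (t + 2 * pi) = \<theta> t + 2 * pi"
    and C: "((\<lambda>t. cis (\<theta> t) * cis (- (real n * t))) has_integral 2 * pi * C) {0..2*pi}" and n: "n \<ge> 1"
  shows "cmod C \<le> 1 / real n"
proof -
  let ?f = "\<lambda>t. cis (\<theta> t) * cis (- (real n * t))"
  have cf: "continuous_on A (\<lambda>t. cis (\<theta> (t + s)) * cis (- (real n * t)))" for A s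
    by (intro continuous_intros continuous_on_cis continuous_on_compose2[OF c]) auto
  have key: "cmod C * \<bar>2 * sin (real n * s / 2)\<bar> \<le> s" if s: "s > 0" for s
  proof -
    have i1: "((\<lambda>t. ?f (t + s)) has_integral 2 * pi * C) {0..2*pi}"
    proof -
      have per: "?f (t + 2 * pi) = ?f t" for t
      proof -
        have "- (real n * (t + 2 * pi)) = - (real n * t) + 2 * pi * (- real n)" by (simp add: algebra_simps)
        then have "cis (- (real n * (t + 2 * pi))) = cis (- (real n * t)) * cis (2 * pi * (- real n))"
          by (simp only: cis_mult)
        moreover have "cis (2 * pi * (- real n)) = 1" by (rule cis_multiple_2pi) simp
        moreover have "cis (\<theta> (t + 2 * pi)) = cis (\<theta> t)" by (simp add: p complex_eq_iff)
        ultimately show ?thesis by simp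
      qed
      have "integral {0..2*pi} (\<lambda>t. ?f (t + s)) = integral {0..2*pi} ?f"
        by (rule integral_periodic_shift[where f = ?f and a = s, OF _ per]) (use cf[of UNIV 0] in simp)
      also have "\<dots> = 2 * pi * C" using C by (rule integral_unique)
      finally show ?thesis
        by (intro has_integral_eq_rhs[OF integrable_integral] integrable_continuous_real continuous_intros continuous_on_cis continuous_on_compose2[OF c]) auto
    qed
    have i0: "((\<lambda>t. cis (real n * s) * ?f (t + s) - ?f t) has_integral (cis (real n * s) * (2 * pi * C) - 2 * pi * C)) {0..2*pi}"
      by (intro has_integral_diff has_integral_mult_right i1 C)
    have "cis (real n * s) * ?f (t + s) - ?f t = (cis (\<theta> (t + s)) - cis (\<theta> t)) * cis (- (real n * t))" for t
    proof -
      have "cis (real n * s) * cis (- (real n * (t + s))) = cis (- (real n * t))" by (simp add: cis_mult algebra_simps)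
      then have "cis (real n * s) * ?f (t + s) = cis (\<theta> (t + s)) * cis (- (real n * t))" by (simp add: mult_ac)
      then show ?thesis by (simp add: algebra_simps)
    qed
    moreover have "cis (real n * s) * (2 * pi * C) - 2 * pi * C = (2 * pi * C) * (cis (real n * s) - 1)"
      by (simp add: algebra_simps)
    ultimately have i2: "((\<lambda>t. (cis (\<theta> (t + s)) - cis (\<theta> t)) * cis (- (real n * t))) has_integral (2 * pi * C) * (cis (real n * s) - 1)) {0..2*pi}"
      using i0 by (simp only:)
    have i3: "((\<lambda>t. \<theta> (t + s) - \<theta> t) has_integral 2 * pi * s) {0..2*pi}"
    proof -
      define \<delta> where "\<delta> t = \<theta> t - t" for t
      have c\<delta>: "continuous_on A \<delta>" for A unfolding \<delta>_def by (intro continuous_intros continuous_on_subset[OF c]) auto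
      have "integral {0..2*pi} (\<lambda>t. \<delta> (t + s)) = integral {0..2*pi} \<delta>"
        by (rule integral_periodic_shift[OF c\<delta>]) (simp add: \<delta>_def p)
      then have a: "((\<lambda>t. \<delta> (t + s)) has_integral integral {0..2*pi} \<delta>) {0..2*pi}"
        by (intro has_integral_eq_rhs[OF integrable_integral] integrable_continuous_real continuous_on_compose2[OF c\<delta>[of UNIV]] continuous_intros) auto
      have b: "(\<delta> has_integral integral {0..2*pi} \<delta>) {0..2*pi}"
        by (intro integrable_integral integrable_continuous_real c\<delta>)
      have "((\<lambda>t. \<delta> (t + s) - \<delta> t + s) has_integral (integral {0..2*pi} \<delta> - integral {0..2*pi} \<delta> + (2 * pi - 0) *\<^sub>R s)) {0..2*pi}"
        using has_integral_const_real[of s 0 "2*pi"] by (intro has_integral_add has_integral_diff a b) simp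
      then show ?thesis by (simp add: \<delta>_def)
    qed
    have "cmod (integral {0..2*pi} (\<lambda>t. (cis (\<theta> (t + s)) - cis (\<theta> t)) * cis (- (real n * t)))) \<le> integral {0..2*pi} (\<lambda>t. \<theta> (t + s) - \<theta> t)"
    proof (rule integral_norm_bound_integral)
      show "(\<lambda>t. (cis (\<theta> (t + s)) - cis (\<theta> t)) * cis (- (real n * t))) integrable_on {0..2*pi}" using i2 by blast
      show "(\<lambda>t. \<theta> (t + s) - \<theta> t) integrable_on {0..2*pi}" using i3 by blast
      fix t
      have mon: "0 \<le> \<theta> (t + s) - \<theta> t" using monoD[OF m, of t "t + s"] s by simp
      have "(cmod (cis (\<theta> (t + s)) - cis (\<theta> t)))\<^sup>2 = \<bar>2 * sin ((\<theta> (t + s) - \<theta> t) / 2)\<bar>\<^sup>2"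
        unfolding cmod_cis_diff_sq by (simp add: power_mult_distrib)
      then have "cmod (cis (\<theta> (t + s)) - cis (\<theta> t)) = \<bar>2 * sin ((\<theta> (t + s) - \<theta> t) / 2)\<bar>"
        by (rule power2_eq_imp_eq) auto
      also have "\<dots> \<le> \<theta> (t + s) - \<theta> t" using mon abs_sin_x_le_abs_x[of "(\<theta> (t + s) - \<theta> t) / 2"] by (simp add: abs_mult)
      finally show "cmod ((cis (\<theta> (t + s)) - cis (\<theta> t)) * cis (- (real n * t))) \<le> \<theta> (t + s) - \<theta> t"
        by (simp add: norm_mult)
    qed
    then have "cmod ((2 * pi * C) * (cis (real n * s) - 1)) \<le> 2 * pi * s"
      unfolding integral_unique[OF i2] integral_unique[OF i3] .
    moreover have "cmod (cis (real n * s) - 1) = \<bar>2 * sin (real n * s / 2)\<bar>"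
    proof -
      have "(cmod (cis (real n * s) - cis 0))\<^sup>2 = \<bar>2 * sin (real n * s / 2)\<bar>\<^sup>2"
        unfolding cmod_cis_diff_sq by (simp add: power_mult_distrib)
      then have "cmod (cis (real n * s) - cis 0) = \<bar>2 * sin (real n * s / 2)\<bar>" by (rule power2_eq_imp_eq) auto
      then show ?thesis by simp
    qed
    moreover have "cmod ((2 * pi * C) * (cis (real n * s) - 1)) = 2 * pi * (cmod C * cmod (cis (real n * s) - 1))"
      unfolding norm_mult by simp
    ultimately have "2 * pi * (cmod C * \<bar>2 * sin (real n * s / 2)\<bar>) \<le> 2 * pi * s" by (simp only:)
    then show ?thesis by (subst (asm) mult_le_cancel_left_pos) auto
  qed
  have "cmod C * real n \<le> 1"
  proof (rule tendsto_upperbound)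
    have "((\<lambda>x. sin x / x) \<longlongrightarrow> 1) (at_right (0::real))"
    proof (rule tendsto_mono[OF at_le])
      show "((\<lambda>x. sin x / x) \<longlongrightarrow> 1) (at (0::real))"
        using DERIV_sin[of "0::real"] by (simp add: DERIV_def)
    qed simp
    moreover have "filterlim (\<lambda>s. real n * s / 2) (at_right 0) (at_right 0)"
      unfolding filterlim_at
    proof
      show "\<forall>\<^sub>F s in at_right 0. real n * s / 2 \<in> {0<..} \<and> real n * s / 2 \<noteq> 0"
        using n by (auto simp: eventually_at_filter)
      have "((\<lambda>s. real n * s / 2) \<longlongrightarrow> real n * 0 / 2) (at_right 0)" by (intro tendsto_intros) auto
      then show "((\<lambda>s. real n * s / 2) \<longlongrightarrow> 0) (at_right 0)" by simp
    qed
    ultimately have "((\<lambda>s. sin (real n * s / 2) / (real n * s / 2)) \<longlongrightarrow> 1) (at_right (0::real))"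
      by (rule filterlim_compose)
    then have "((\<lambda>s. cmod C * real n * \<bar>sin (real n * s / 2) / (real n * s / 2)\<bar>) \<longlongrightarrow> cmod C * real n * \<bar>1\<bar>) (at_right (0::real))"
      by (intro tendsto_intros)
    then show "((\<lambda>s. cmod C * real n * \<bar>sin (real n * s / 2) / (real n * s / 2)\<bar>) \<longlongrightarrow> cmod C * real n) (at_right (0::real))" by simp
    show "\<forall>\<^sub>F s in at_right (0::real). cmod C * real n * \<bar>sin (real n * s / 2) / (real n * s / 2)\<bar> \<le> 1"
      unfolding eventually_at_filter
    proof (rule always_eventually, intro allI impI)
      fix s :: real assume "s \<noteq> 0" "s \<in> {0<..}"
      then have s: "s > 0" by simp
      have "cmod C * real n * \<bar>sin (real n * s / 2) / (real n * s / 2)\<bar> = cmod C * \<bar>2 * sin (real n * s / 2)\<bar> / s"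
        using s n by (simp add: abs_mult abs_divide field_simps)
      also have "\<dots> \<le> 1" using key[OF s] s by (simp add: divide_le_eq)
      finally show "cmod C * real n * \<bar>sin (real n * s / 2) / (real n * s / 2)\<bar> \<le> 1" .
    qed
  qed auto
  then show ?thesis using n by (simp add: field_simps)
qed

text \<open>
  The coefficients of \<open>H\<close> are Fourier coefficients of the boundary map, as limits of the same integrals over
  smaller circles; partial sums of the power series on such a circle provide the trigonometric polynomials
  for Hall's inequality.
\<close>
lemma univalent_harmonic_disc_coeffs:
  assumes H: "H holomorphic_on ball 0 1" and G: "G holomorphic_on ball 0 1"
    and u: "\<And>z. z \<in> ball 0 1 \<Longrightarrow> u z = H z + cnj (G z)"
    and inj: "inj_on u (ball 0 1)" and im: "u ` ball 0 1 = ball 0 1"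
    and H0: "H 0 = 0" and G0: "G 0 = 0" and G1: "deriv G 0 = 0"
    and qc: "\<And>z. z \<in> ball 0 1 \<Longrightarrow> cmod (deriv G z) \<le> k * cmod (deriv H z)" and k: "0 \<le> k" "k < 1"
    and nz: "\<And>z. z \<in> ball 0 1 \<Longrightarrow> deriv H z \<noteq> 0"
  shows "\<And>n. n \<ge> 1 \<Longrightarrow> cmod (taylor_coeff H n) \<le> 1 / real n"
    and "27 / (4 * pi\<^sup>2) \<le> (cmod (deriv H 0))\<^sup>2"
proof -
  have D: "(v has_derivative (\<lambda>x. deriv v z * x)) (at z)"
    if "v holomorphic_on ball 0 1" "z \<in> ball 0 1" for v z
    using holomorphic_derivI[OF that(1) open_ball that(2)] by (simp add: has_field_derivative_def)
  have d: "(u has_derivative (\<lambda>v. deriv H z * v + cnj (deriv G z) * cnj v)) (at z)" if z: "z \<in> ball 0 1" for z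
  proof -
    have "((\<lambda>z. H z + cnj (G z)) has_derivative (\<lambda>v. deriv H z * v + cnj (deriv G z * v))) (at z)"
      by (intro has_derivative_add has_derivative_cnj D H G z)
    then have "(u has_derivative (\<lambda>v. deriv H z * v + cnj (deriv G z * v))) (at z)"
      by (rule has_derivative_transform_within_open[OF _ open_ball z]) (simp add: u)
    then show ?thesis by simp
  qed
  have cH: "continuous_on (ball 0 1) (deriv H)" "continuous_on (ball 0 1) (\<lambda>z. cnj (deriv G z))"
    by (intro continuous_intros holomorphic_on_imp_continuous_on holomorphic_deriv H G open_ball)+
  have u0: "u 0 = 0" using u[of 0] H0 G0 by simp
  obtain U \<theta> where U: "continuous_on (cball 0 1) U" "\<And>z. z \<in> ball 0 1 \<Longrightarrow> U z = u z"
    and \<theta>: "continuous_on UNIV \<theta>" "mono \<theta>" "\<And>t. \<theta> (t + 2 * pi) = \<theta> t + 2 * pi" "\<And>t. U (cis t) = cis (\<theta> t)"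
    by (rule univalent_harmonic_disc_boundary[OF inj im u0 d cH _ k nz]) (use qc that in auto)
  have uc: "uniformly_continuous_on (cball 0 1) U" by (intro compact_uniformly_continuous U(1)) simp
  have close: "\<exists>r. 0 < r \<and> r < 1 \<and> (\<forall>s. r \<le> s \<and> s < 1 \<longrightarrow> (\<forall>t. cmod (cis (\<theta> t) - u (of_real s * cis t)) < \<epsilon>))" if \<epsilon>: "\<epsilon> > 0" for \<epsilon>
  proof -
    obtain e where e: "e > 0" "\<And>x y. x \<in> cball 0 1 \<Longrightarrow> y \<in> cball 0 1 \<Longrightarrow> dist y x < e \<Longrightarrow> dist (U y) (U x) < \<epsilon>"
      by (rule uniformly_continuous_onE[OF uc \<epsilon>]) (rule that)
    define r where "r = max (1/2) (1 - e / 2)"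
    have r: "0 < r" "r < 1" "1 - r < e" using e(1) by (auto simp: r_def max_def)
    have "cmod (cis (\<theta> t) - u (of_real s * cis t)) < \<epsilon>" if s: "r \<le> s" "s < 1" for s t
    proof -
      have i: "of_real s * cis t \<in> ball 0 1" using s r by (simp add: norm_mult)
      have "dist (cis t) (of_real s * cis t) = cmod (of_real (1 - s) * cis t)"
        by (simp add: dist_norm algebra_simps)
      also have "\<dots> < e" using r s by (simp add: norm_mult del: of_real_diff)
      finally have "dist (U (cis t)) (U (of_real s * cis t)) < \<epsilon>"
        using i by (intro e(2)) auto
      then show ?thesis by (simp add: \<theta>(4) U(2)[OF i] dist_norm)
    qed
    then show ?thesis using r by blast
  qed
  show "cmod (taylor_coeff H n) \<le> 1 / real n" if n: "n \<ge> 1" for n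
  proof (rule circle_map_fourier_bound[OF \<theta>(1,2,3) _ n])
    let ?f = "\<lambda>t. cis (\<theta> t) * cis (- (real n * t))"
    define I where "I = integral {0..2*pi} ?f"
    have cf: "continuous_on {0..2*pi} ?f"
      by (intro continuous_intros continuous_on_cis continuous_on_subset[OF \<theta>(1)]) auto
    have hf: "(?f has_integral I) {0..2*pi}" unfolding I_def by (intro integrable_integral integrable_continuous_real cf)
    have ir: "((\<lambda>t. u (of_real r * cis t) * cis (- (real n * t))) has_integral 2 * pi * r ^ n * taylor_coeff H n) {0..2*pi}"
      if r: "0 < r" "r < 1" for r
    proof -
      have "((\<lambda>t. cnj (G (of_real r * cis t) * cis (real n * t))) has_integral cnj 0) {0..2*pi}"
        using iffD2[OF has_integral_cnj fourier_coeff_holomorphic_neg[OF G r n]] by (simp only: o_def)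
      then have "((\<lambda>t. H (of_real r * cis t) * cis (- (real n * t)) + cnj (G (of_real r * cis t) * cis (real n * t))) has_integral (2 * pi * r ^ n * taylor_coeff H n + cnj 0)) {0..2*pi}"
        by (intro has_integral_add fourier_coeff_holomorphic H r)
      moreover have "H (of_real r * cis t) * cis (- (real n * t)) + cnj (G (of_real r * cis t) * cis (real n * t)) = u (of_real r * cis t) * cis (- (real n * t))" for t
      proof -
        have "of_real r * cis t \<in> ball 0 1" using r by (simp add: norm_mult)
        from u[OF this] show ?thesis by (simp add: cis_cnj algebra_simps)
      qed
      ultimately show ?thesis by simp
    qed
    have lim: "((\<lambda>r. 2 * pi * r ^ n * taylor_coeff H n) \<longlongrightarrow> I) (at_left (1::real))"
    proof (rule tendstoI)
      fix e :: real assume e: "e > 0"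
      obtain r where r: "0 < r" "r < 1" "\<And>s t. r \<le> s \<Longrightarrow> s < 1 \<Longrightarrow> cmod (cis (\<theta> t) - u (of_real s * cis t)) < e / (4 * pi)"
        using close[of "e / (4 * pi)"] e by auto
      have "eventually (\<lambda>s. s \<in> {r<..<1}) (at_left (1::real))" by (rule eventually_at_left_real[OF r(2)])
      then show "\<forall>\<^sub>F s in at_left 1. dist (2 * pi * s ^ n * taylor_coeff H n) I < e"
      proof eventually_elim
        case (elim s)
        then have s: "0 < s" "s < 1" "r \<le> s" using r(1) by auto
        have i: "((\<lambda>t. ?f t - u (of_real s * cis t) * cis (- (real n * t))) has_integral (I - 2 * pi * s ^ n * taylor_coeff H n)) {0..2*pi}"
          by (intro has_integral_diff hf ir s)
        have "cmod (integral {0..2*pi} (\<lambda>t. ?f t - u (of_real s * cis t) * cis (- (real n * t)))) \<le> integral {0..2*pi} (\<lambda>t. e / (4 * pi))"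
        proof (rule integral_norm_bound_integral)
          show "(\<lambda>t. ?f t - u (of_real s * cis t) * cis (- (real n * t))) integrable_on {0..2*pi}" using i by blast
          show "(\<lambda>t. e / (4 * pi)) integrable_on {0..2*pi}" by (rule integrable_const_ivl)
          fix t
          have "cmod (?f t - u (of_real s * cis t) * cis (- (real n * t))) = cmod (cis (\<theta> t) - u (of_real s * cis t))"
            by (simp add: left_diff_distrib[symmetric] norm_mult)
          then show "cmod (?f t - u (of_real s * cis t) * cis (- (real n * t))) \<le> e / (4 * pi)" using r(3)[OF s(3,2), of t] by simp
        qed
        then have "cmod (I - 2 * pi * s ^ n * taylor_coeff H n) \<le> e / 2"
          unfolding integral_unique[OF i] by simp
        also have "\<dots> < e" using e by simp
        finally show ?case by (simp add: dist_norm norm_minus_commute)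
      qed
    qed
    have "((\<lambda>r. complex_of_real (2 * pi * r ^ n) * taylor_coeff H n) \<longlongrightarrow> complex_of_real (2 * pi * 1 ^ n) * taylor_coeff H n) (at_left (1::real))"
      by (intro tendsto_intros)
    from tendsto_unique[OF _ lim this] have "I = 2 * pi * taylor_coeff H n" by simp
    then show "(?f has_integral 2 * pi * taylor_coeff H n) {0..2*pi}" using hf by simp
  qed
  show "27 / (4 * pi\<^sup>2) \<le> (cmod (deriv H 0))\<^sup>2"
  proof (rule heinz_hall_circle[OF \<theta>(1,2,3)])
    fix \<epsilon> :: real assume \<epsilon>: "\<epsilon> > 0"
    obtain r where r01: "0 < r" "r < 1" "\<forall>s. r \<le> s \<and> s < 1 \<longrightarrow> (\<forall>t. cmod (cis (\<theta> t) - u (of_real s * cis t)) < \<epsilon> / 2)"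
      using close[OF half_gt_zero[OF \<epsilon>]] by blast
    then have r: "0 < r" "r < 1" "\<And>t. cmod (cis (\<theta> t) - u (of_real r * cis t)) < \<epsilon> / 2" by simp_all
    define z where "z t = of_real r * cis t" for t
    have zb: "cmod (z t) < 1" for t using r by (simp add: z_def norm_mult)
    have trunc: "\<exists>N0. \<forall>N\<ge>N0. \<forall>t. cmod (v (z t) - (\<Sum>n<N. taylor_coeff v n * of_real r ^ n * cis (real n * t))) < \<epsilon> / 4"
      if v: "v holomorphic_on ball 0 1" for v
    proof -
      define s where "s = (1 + r) / 2"
      have s: "r < s" "0 < s" "s < 1" using r by (auto simp: s_def)
      have "summable (\<lambda>n. taylor_coeff v n * of_real s ^ n)"
        using taylor_sums[OF v, of "of_real s"] s by (auto simp: sums_iff)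
      then have sm: "summable (\<lambda>n. cmod (taylor_coeff v n * of_real r ^ n))"
        by (rule powser_insidea) (use s r in simp)
      have "\<exists>N. \<forall>n\<ge>N. norm (\<Sum>i. cmod (taylor_coeff v (i + n) * of_real r ^ (i + n))) < \<epsilon> / 4"
        by (rule suminf_exist_split[OF _ sm]) (use \<epsilon> in simp)
      then obtain N0 where *: "\<forall>n\<ge>N0. norm (\<Sum>i. cmod (taylor_coeff v (i + n) * of_real r ^ (i + n))) < \<epsilon> / 4" ..
      have N0: "(\<Sum>n. cmod (taylor_coeff v (n + N) * of_real r ^ (n + N))) < \<epsilon> / 4" if "N \<ge> N0" for N
        by (rule le_less_trans[OF abs_ge_self *[rule_format, OF that, unfolded real_norm_def]])
      have "cmod (v (z t) - (\<Sum>n<N. taylor_coeff v n * of_real r ^ n * cis (real n * t))) < \<epsilon> / 4" if N: "N \<ge> N0" for N t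
      proof -
        have e: "taylor_coeff v n * z t ^ n = taylor_coeff v n * of_real r ^ n * cis (real n * t)" for n
          by (simp add: z_def power_mult_distrib Complex.DeMoivre)
        have sms: "(\<lambda>n. taylor_coeff v n * z t ^ n) sums v (z t)" by (rule taylor_sums[OF v zb])
        have "v (z t) - (\<Sum>n<N. taylor_coeff v n * z t ^ n) = (\<Sum>n. taylor_coeff v (n + N) * z t ^ (n + N))"
          using suminf_minus_initial_segment[OF sums_summable[OF sms], of N] sums_unique[OF sms] by simp
        also have "cmod \<dots> \<le> (\<Sum>n. cmod (taylor_coeff v (n + N) * z t ^ (n + N)))"
        proof (rule summable_norm)
          show "summable (\<lambda>n. cmod (taylor_coeff v (n + N) * z t ^ (n + N)))"
            using summable_ignore_initial_segment[OF sm, of N] r by (simp add: norm_mult norm_power z_def)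
        qed
        also have "\<dots> = (\<Sum>n. cmod (taylor_coeff v (n + N) * of_real r ^ (n + N)))"
          using r by (simp add: norm_mult norm_power z_def)
        also have "\<dots> < \<epsilon> / 4" by (rule N0[OF N])
        finally show ?thesis unfolding e .
      qed
      then show ?thesis by blast
    qed
    obtain N1 where N1: "\<And>N t. N \<ge> N1 \<Longrightarrow> cmod (H (z t) - (\<Sum>n<N. taylor_coeff H n * of_real r ^ n * cis (real n * t))) < \<epsilon> / 4"
      using trunc[OF H] by blast
    obtain N2 where N2: "\<And>N t. N \<ge> N2 \<Longrightarrow> cmod (G (z t) - (\<Sum>n<N. taylor_coeff G n * of_real r ^ n * cis (real n * t))) < \<epsilon> / 4"
      using trunc[OF G] by blast
    define N where "N = max 2 (max N1 N2)"
    define I where "I = {- int N<..<int N}"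
    define \<gamma> where "\<gamma> n = (if n \<ge> 0 then taylor_coeff H (nat n) * of_real r ^ nat n else cnj (taylor_coeff G (nat (- n)) * of_real r ^ nat (- n)))" for n :: int
    have Hc: "taylor_coeff H 0 = 0" "taylor_coeff H (Suc 0) = deriv H 0" "taylor_coeff G 0 = 0" "taylor_coeff G (Suc 0) = 0"
      using H0 G0 G1 by (simp_all add: fps_expansion_def)
    have "\<gamma> 0 = 0" "\<gamma> (-1) = 0" by (simp_all add: \<gamma>_def Hc)
    moreover have "cmod (\<gamma> 1) \<le> cmod (deriv H 0)" using r by (simp add: \<gamma>_def Hc norm_mult mult_left_le)
    moreover have "cmod (cis (\<theta> t) - (\<Sum>n\<in>I. \<gamma> n * cis (of_int n * t))) \<le> \<epsilon>" for t
    proof -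
      define SH where "SH = (\<Sum>n<N. taylor_coeff H n * of_real r ^ n * cis (real n * t))"
      define SG where "SG = (\<Sum>n<N. taylor_coeff G n * of_real r ^ n * cis (real n * t))"
      have "(\<Sum>n\<in>I. \<gamma> n * cis (of_int n * t)) = SH + cnj SG"
      proof -
        have "I = int ` {..<N} \<union> (\<lambda>n. - int n) ` {1..<N}"
        proof (intro equalityI subsetI)
          fix n assume n: "n \<in> I"
          show "n \<in> int ` {..<N} \<union> (\<lambda>n. - int n) ` {1..<N}"
          proof (cases "n \<ge> 0")
            case True then show ?thesis using n by (intro UnI1 image_eqI[of _ _ "nat n"]) (auto simp: I_def)
          next
            case False then show ?thesis using n by (intro UnI2 image_eqI[of _ _ "nat (- n)"]) (auto simp: I_def)
          qed
        qed (auto simp: I_def)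
        moreover have "int ` {..<N} \<inter> (\<lambda>n. - int n) ` {1..<N} = {}" by auto
        ultimately have "(\<Sum>n\<in>I. \<gamma> n * cis (of_int n * t)) = (\<Sum>n\<in>int ` {..<N}. \<gamma> n * cis (of_int n * t)) + (\<Sum>n\<in>(\<lambda>n. - int n) ` {1..<N}. \<gamma> n * cis (of_int n * t))"
          by (simp add: sum.union_disjoint)
        also have "(\<Sum>n\<in>int ` {..<N}. \<gamma> n * cis (of_int n * t)) = SH"
          unfolding SH_def by (subst sum.reindex) (auto simp: \<gamma>_def)
        also have "(\<Sum>n\<in>(\<lambda>n. - int n) ` {1..<N}. \<gamma> n * cis (of_int n * t)) = (\<Sum>n\<in>{1..<N}. cnj (taylor_coeff G n * of_real r ^ n * cis (real n * t)))"
          by (subst sum.reindex) (auto simp: \<gamma>_def inj_on_def cis_cnj intro!: sum.cong)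
        also have "\<dots> = (\<Sum>n<N. cnj (taylor_coeff G n * of_real r ^ n * cis (real n * t)))"
          by (rule sum.mono_neutral_left) (auto simp: Hc not_le less_Suc_eq)
        also have "\<dots> = cnj SG" by (simp only: SG_def cnj_sum)
        finally show ?thesis .
      qed
      moreover have "u (z t) = H (z t) + cnj (G (z t))" using u zb by simp
      ultimately have E: "cis (\<theta> t) - (\<Sum>n\<in>I. \<gamma> n * cis (of_int n * t)) = (cis (\<theta> t) - u (z t)) + ((H (z t) - SH) + cnj (G (z t) - SG))"
        by simp
      have T: "cmod ((H (z t) - SH) + cnj (G (z t) - SG)) \<le> cmod (H (z t) - SH) + cmod (G (z t) - SG)"
        using norm_triangle_ineq[of "H (z t) - SH" "cnj (G (z t) - SG)"] by (simp only: complex_mod_cnj)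
      have "cmod (cis (\<theta> t) - (\<Sum>n\<in>I. \<gamma> n * cis (of_int n * t))) \<le> cmod (cis (\<theta> t) - u (z t)) + (cmod (H (z t) - SH) + cmod (G (z t) - SG))"
        unfolding E using norm_triangle_ineq[of "cis (\<theta> t) - u (z t)" "(H (z t) - SH) + cnj (G (z t) - SG)"] T
        by (rule order_trans[OF _ add_left_mono])
      also have "\<dots> \<le> \<epsilon> / 2 + (\<epsilon> / 4 + \<epsilon> / 4)"
      proof -
        have "N1 \<le> N" "N2 \<le> N" by (auto simp: N_def)
        from r(3)[of t] N1[OF this(1), of t] N2[OF this(2), of t] show ?thesis
          unfolding SH_def SG_def z_def[symmetric] by linarith
      qed
      finally show ?thesis by simp
    qed
    ultimately show "\<exists>I \<gamma>. finite I \<and> \<gamma> 0 = 0 \<and> \<gamma> (-1) = 0 \<and> cmod (\<gamma> 1) \<le> cmod (deriv H 0) \<and>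
       (\<forall>t. cmod (cis (\<theta> t) - (\<Sum>n\<in>I. \<gamma> n * cis (of_int n * t))) \<le> \<epsilon>)"
      by (intro exI[of _ I] exI[of _ \<gamma>]) (auto simp: I_def)
  qed
qed

section \<open>Coefficient bounds\<close>

text \<open>
  The derivative determines $h'$ as its complex-linear part.
\<close>
lemma harmonic_parts_unique:
  assumes h: "h holomorphic_on ball 0 1" and g: "g holomorphic_on ball 0 1"
    and h': "h' holomorphic_on ball 0 1" and g': "g' holomorphic_on ball 0 1"
    and eq: "\<And>z. z \<in> ball 0 1 \<Longrightarrow> h z + cnj (g z) = h' z + cnj (g' z)"
    and h0: "h 0 = h' 0" and z: "z \<in> ball 0 1"
  shows "h z = h' z \<and> g z = g' z"
proof -
  have D: "(v has_derivative (\<lambda>x. deriv v z * x)) (at z)"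
    if "v holomorphic_on ball 0 1" "z \<in> ball 0 1" for v z
    using holomorphic_derivI[OF that(1) open_ball that(2)] by (simp add: has_field_derivative_def)
  have d: "((\<lambda>z. k z + cnj (l z)) has_derivative (\<lambda>v. deriv k z * v + cnj (deriv l z * v))) (at z)"
    if "z \<in> ball 0 1" "k holomorphic_on ball 0 1" "l holomorphic_on ball 0 1" for z k l
    by (intro has_derivative_add has_derivative_cnj D that)
  have dh: "deriv h z = deriv h' z" if z: "z \<in> ball 0 1" for z
  proof -
    have "((\<lambda>z. h z + cnj (g z)) has_derivative (\<lambda>v. deriv h' z * v + cnj (deriv g' z * v))) (at z)"
      by (rule has_derivative_transform_within_open[OF d[OF z h' g'] open_ball z]) (simp add: eq)
    from has_derivative_unique[OF d[OF z h g] this]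
    have e: "deriv h z * v + cnj (deriv g z * v) = deriv h' z * v + cnj (deriv g' z * v)" for v
      by (rule fun_cong)
    have "deriv h z - deriv h' z = cnj (deriv g' z - deriv g z)" using e[of 1] by (simp add: algebra_simps)
    moreover have "\<i> * (deriv h z - deriv h' z) = - \<i> * cnj (deriv g' z - deriv g z)" using e[of \<i>] by (simp add: algebra_simps)
    ultimately have "\<i> * (deriv h z - deriv h' z) = - \<i> * (deriv h z - deriv h' z)" by simp
    then show ?thesis by simp
  qed
  have "h z - h' z = h 0 - h' 0"
  proof (rule has_field_derivative_zero_constant[of "ball 0 1" "\<lambda>z. h z - h' z", THEN exE])
    show "((\<lambda>z. h z - h' z) has_field_derivative 0) (at x within ball 0 1)" if "x \<in> ball 0 1" for x
      using DERIV_diff[OF holomorphic_derivI[OF h open_ball that] holomorphic_derivI[OF h' open_ball that]] dh[OF that]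
      by (simp add: has_field_derivative_at_within)
    fix c assume "\<forall>x\<in>ball 0 1. h x - h' x = c"
    then show "h z - h' z = h 0 - h' 0" using z by simp
  qed simp
  then show ?thesis using eq[OF z] h0 by simp
qed

lemma R_const_eq:
  assumes "2 \<le> q"
  shows "R_const q = 1 / (4 * 4 powr (1 / real (q - 1)))"
proof -
  have q: "real (q - 1) = real q - 1" "real q - 1 > 0" using assms by auto
  have e: "2 * real q / (real q - 1) = 2 + 2 * (1 / (real q - 1))" using q by (simp add: field_simps)
  have "(2::real) powr (2 * real q / (real q - 1)) = 2 powr 2 * 2 powr (2 * (1 / (real q - 1)))"
    unfolding e by (rule powr_add)
  also have "(2::real) powr (2 * (1 / (real q - 1))) = 4 powr (1 / (real q - 1))"
    using powr_powr[of "2::real" 2 "1 / (real q - 1)", symmetric] by simp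
  finally show ?thesis unfolding R_const_def powr_minus_divide q by simp
qed

text \<open>
  The set \<open>\<Omega>\<close> is the preimage of the disc of radius \<open>r\<close> and lies compactly in the unit disc, so
  $|g'| \le |z| |h'| \le \rho |h'|$ on \<open>\<Omega>\<close> with $\rho < 1$. This makes $u = (f \circ \varphi)/r$ quasiconformal,
  and the estimates for harmonic maps onto the disc apply to it.
\<close>
lemma coefficient_bounds_from_subdisc:
  assumes h: "h holomorphic_on ball 0 1" and g: "g holomorphic_on ball 0 1"
    and f: "\<And>z. z \<in> ball 0 1 \<Longrightarrow> f z = h z + cnj (g z)" and inj: "inj_on f (ball 0 1)"
    and h0: "h 0 = 0" and g0: "g 0 = 0" and h1: "deriv h 0 = 1" and g1: "deriv g 0 = 0"
    and p: "2 \<le> p" and hp: "\<And>n. 2 \<le> n \<Longrightarrow> n < p \<Longrightarrow> taylor_coeff h n = 0"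
    and r: "0 < r" and cov: "cball 0 r \<subseteq> f ` ball 0 1"
  defines "d \<equiv> 2 * pi / (3 * sqrt 3 * r)"
  shows "cmod (taylor_coeff h p) \<le> d ^ (p - 1) * (d * r / real p + real p)"
    and "p = 2 \<Longrightarrow> cmod (taylor_coeff h 2) \<le> d * (d * r / 2 + 2) - 2"
proof -
  have cont: "continuous_on (ball 0 1) f"
    by (rule univalent_harmonic_sense_preserving(1)[OF h g _ inj h1 g1]) (rule f)
  have df: "(f has_derivative (\<lambda>v. deriv h z * v + cnj (deriv g z) * cnj v)) (at z)" if "z \<in> ball 0 1" for z
    by (rule univalent_harmonic_sense_preserving(2)[OF h g _ inj h1 g1 that]) (rule f)
  have gc: "taylor_coeff g j = 0" if "1 \<le> j" "j \<le> 1" for j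
    using that g1 by (cases "j = 1") (auto simp: fps_expansion_def)
  have "cmod (deriv g z) \<le> cmod z ^ 1 * cmod (deriv h z)" if "z \<in> ball 0 1" for z
    by (rule univalent_harmonic_dilatation[OF h g _ inj h1 _ _ that]) (rule f gc order_refl; assumption?)+
  then have dil: "cmod (deriv g z) \<le> cmod z * cmod (deriv h z)" if "z \<in> ball 0 1" for z using that by simp
  have lw: "deriv h z \<noteq> 0" if "z \<in> ball 0 1" for z by (rule lewy[OF h g f inj h1 g1 dil that])
  obtain e where e: "homeomorphism (ball 0 1) (f ` ball 0 1) f e"
    by (rule invariance_of_domain_homeomorphism[OF open_ball cont _ inj]) auto
  have eb: "e w \<in> ball 0 1" "f (e w) = w" if "w \<in> cball 0 r" for w
    using e cov that by (auto simp: homeomorphism_def)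
  have ef: "e (f z) = z" if "z \<in> ball 0 1" for z using e that by (auto simp: homeomorphism_def)
  have ce: "continuous_on (cball 0 r) e" using e cov by (auto simp: homeomorphism_def intro: continuous_on_subset)
  define \<Omega> where "\<Omega> = e ` ball 0 r"
  have bc: "ball 0 r \<subseteq> (cball 0 r :: complex set)" by auto
  have inje: "inj_on e (ball 0 r)" by (rule inj_on_inverseI[of _ f]) (use eb bc in auto)
  have ceb: "continuous_on (ball 0 r) e" by (rule continuous_on_subset[OF ce bc])
  have op: "open \<Omega>" unfolding \<Omega>_def by (intro invariance_of_domain ceb inje open_ball)
  have "ball (0::complex) r homeomorphic \<Omega>" unfolding \<Omega>_def by (intro invariance_of_domain_homeomorphic ceb inje) auto
  then have sc: "simply_connected \<Omega>"
    using homeomorphic_simply_connected_eq convex_imp_simply_connected[OF convex_ball] by metis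
  have f0: "f 0 = 0" using f[of 0] h0 g0 by simp
  have e0: "e 0 = 0" using ef[of 0] f0 by simp
  have z\<Omega>: "0 \<in> \<Omega>" unfolding \<Omega>_def using r e0 by (auto intro!: image_eqI[of _ e 0])
  have \<Omega>1: "\<Omega> \<subseteq> ball 0 1" unfolding \<Omega>_def using eb bc by blast
  then have "\<Omega> \<noteq> UNIV" by (metis UNIV_I ball_subset_cball bounded_ball bounded_subset not_bounded_UNIV)
  then obtain \<phi> k where \<phi>: "\<phi> holomorphic_on ball 0 1" "k holomorphic_on \<Omega>" "\<phi> 0 = 0" "k 0 = 0"
    "\<And>z. z \<in> ball 0 1 \<Longrightarrow> \<phi> z \<in> \<Omega> \<and> k (\<phi> z) = z" "\<And>w. w \<in> \<Omega> \<Longrightarrow> k w \<in> ball 0 1 \<and> \<phi> (k w) = w"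
    by (rule riemann_map_normalized[OF op sc z\<Omega>]) (rule that)
  have \<phi>D: "\<phi> z \<in> ball 0 1" if "z \<in> ball 0 1" for z using \<phi>(5)[OF that] \<Omega>1 by blast
  have inj\<phi>: "inj_on \<phi> (ball 0 1)" by (rule inj_on_inverseI[of _ k]) (use \<phi>(5) in auto)
  have "compact (e ` cball 0 r)" by (intro compact_continuous_image ce compact_cball)
  moreover have "e ` cball 0 r \<noteq> {}" using r by auto
  ultimately obtain x where x: "x \<in> e ` cball 0 r" "\<And>y. y \<in> e ` cball 0 r \<Longrightarrow> cmod y \<le> cmod x"
    using continuous_attains_sup[of "e ` cball 0 r" cmod] continuous_on_norm_id by blast
  define \<rho> where "\<rho> = cmod x"
  have \<rho>: "0 \<le> \<rho>" "\<rho> < 1" using x(1) eb by (auto simp: \<rho>_def)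
  have \<Omega>\<rho>: "cmod z \<le> \<rho>" if "z \<in> \<Omega>" for z using that x(2) bc unfolding \<Omega>_def \<rho>_def by blast
  define H where "H z = h (\<phi> z) / of_real r" for z
  define G where "G z = g (\<phi> z) / of_real r" for z
  define u where "u z = f (\<phi> z) / of_real r" for z
  have comp: "(\<lambda>z. v (\<phi> z)) holomorphic_on ball 0 1" if "v holomorphic_on ball 0 1" for v
    using holomorphic_on_compose_gen[OF \<phi>(1) that] \<phi>D by (auto simp: o_def image_subset_iff)
  have H: "H holomorphic_on ball 0 1" and G: "G holomorphic_on ball 0 1"
    unfolding H_def G_def using r by (intro holomorphic_intros comp h g; simp)+
  have dcomp: "deriv (\<lambda>z. v (\<phi> z) / of_real r) z = deriv v (\<phi> z) * deriv \<phi> z / of_real r"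
    if "v holomorphic_on ball 0 1" "z \<in> ball 0 1" for v z
  proof (rule DERIV_imp_deriv)
    have "(\<phi> has_field_derivative deriv \<phi> z) (at z)" by (rule holomorphic_derivI[OF \<phi>(1) open_ball that(2)])
    moreover have "(v has_field_derivative deriv v (\<phi> z)) (at (\<phi> z))" by (rule holomorphic_derivI[OF that(1) open_ball \<phi>D[OF that(2)]])
    ultimately have "((\<lambda>z. v (\<phi> z)) has_field_derivative deriv v (\<phi> z) * deriv \<phi> z) (at z)" by (rule DERIV_chain2[rotated])
    then show "((\<lambda>z. v (\<phi> z) / of_real r) has_field_derivative deriv v (\<phi> z) * deriv \<phi> z / of_real r) (at z)"
      by (rule DERIV_cdivide)
  qed
  have \<phi>nz: "deriv \<phi> z \<noteq> 0" if "z \<in> ball 0 1" for z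
    by (rule holomorphic_injective_imp_regular[OF \<phi>(1) open_ball inj\<phi> that])
  define c where "c = deriv \<phi> 0"
  have c0: "c \<noteq> 0" unfolding c_def by (rule \<phi>nz) simp
  have HG: "(\<forall>n\<ge>1. cmod (taylor_coeff H n) \<le> 1 / real n) \<and> 27 / (4 * pi\<^sup>2) \<le> (cmod (deriv H 0))\<^sup>2"
  proof (intro conjI allI impI)
    have uHG: "u z = H z + cnj (G z)" if "z \<in> ball 0 1" for z
      using f[OF \<phi>D[OF that]] by (simp add: u_def H_def G_def add_divide_distrib)
    have uinj: "inj_on u (ball 0 1)"
    proof (rule inj_onI)
      fix x y assume xy: "x \<in> ball 0 1" "y \<in> ball 0 1" "u x = u y"
      then have "f (\<phi> x) = f (\<phi> y)" using r by (simp add: u_def)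
      then have "\<phi> x = \<phi> y" using inj \<phi>D xy by (meson inj_onD)
      then show "x = y" using inj\<phi> xy by (meson inj_onD)
    qed
    have uim: "u ` ball 0 1 = ball 0 1"
    proof (intro equalityI subsetI)
      fix y assume "y \<in> u ` ball 0 1"
      then obtain z where z: "y = u z" "z \<in> ball 0 1" by auto
      obtain w where w: "w \<in> ball 0 r" "\<phi> z = e w" using \<phi>(5)[OF z(2)] by (auto simp: \<Omega>_def)
      then have "f (\<phi> z) = w" using eb(2)[of w] bc by auto
      then show "y \<in> ball 0 1" using w r by (simp add: z u_def norm_divide)
    next
      fix y :: complex assume y: "y \<in> ball 0 1"
      define w where "w = of_real r * y"
      have w: "w \<in> ball 0 r" using y r by (simp add: w_def norm_mult)
      then have "e w \<in> \<Omega>" by (simp add: \<Omega>_def)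
      then have "k (e w) \<in> ball 0 1" "\<phi> (k (e w)) = e w" using \<phi>(6) by blast+
      moreover have "f (e w) = w" using eb(2)[of w] w bc by auto
      ultimately have "u (k (e w)) = y" using r by (simp add: u_def w_def)
      then show "y \<in> u ` ball 0 1" using \<open>k (e w) \<in> ball 0 1\<close> by blast
    qed
    have z0: "H 0 = 0" "G 0 = 0" by (simp_all add: H_def G_def \<phi>(3) h0 g0)
    have G1: "deriv G 0 = 0" unfolding G_def using dcomp[OF g, of 0] by (simp add: \<phi>(3) g1)
    have qc: "cmod (deriv G z) \<le> \<rho> * cmod (deriv H z)" if z: "z \<in> ball 0 1" for z
    proof -
      have "cmod (deriv g (\<phi> z)) \<le> cmod (\<phi> z) * cmod (deriv h (\<phi> z))" by (rule dil[OF \<phi>D[OF z]])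
      also have "\<dots> \<le> \<rho> * cmod (deriv h (\<phi> z))" using \<Omega>\<rho>[of "\<phi> z"] \<phi>(5)[OF z] by (intro mult_right_mono) auto
      finally have "cmod (deriv g (\<phi> z)) * (cmod (deriv \<phi> z) / r) \<le> \<rho> * cmod (deriv h (\<phi> z)) * (cmod (deriv \<phi> z) / r)"
        using r by (intro mult_right_mono) auto
      then show ?thesis unfolding H_def G_def dcomp[OF g z] dcomp[OF h z] using r by (simp add: norm_mult norm_divide mult_ac)
    qed
    have nz: "deriv H z \<noteq> 0" if z: "z \<in> ball 0 1" for z
      unfolding H_def dcomp[OF h z] using lw[OF \<phi>D[OF z]] \<phi>nz[OF z] r by simp
    show "cmod (taylor_coeff H n) \<le> 1 / real n" if "1 \<le> n" for n
      by (rule univalent_harmonic_disc_coeffs(1)[OF H G uHG uinj uim z0 G1 qc \<rho> nz that])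
    show "27 / (4 * pi\<^sup>2) \<le> (cmod (deriv H 0))\<^sup>2"
      by (rule univalent_harmonic_disc_coeffs(2)[OF H G uHG uinj uim z0 G1 qc \<rho> nz])
  qed
  have d0: "d > 0" using r by (simp add: d_def)
  have cd: "1 / d \<le> cmod c"
  proof -
    have "deriv H 0 = c / of_real r" unfolding H_def using dcomp[OF h, of 0] by (simp add: \<phi>(3) h1 c_def)
    then have "27 / (4 * pi\<^sup>2) \<le> (cmod c / r)\<^sup>2" using HG r by (simp add: norm_divide)
    moreover have "27 / (4 * pi\<^sup>2) = (3 * sqrt 3 / (2 * pi))\<^sup>2" by (simp add: power_divide power_mult_distrib)
    ultimately have "3 * sqrt 3 / (2 * pi) \<le> cmod c / r" using r by (metis power2_le_imp_le divide_nonneg_pos norm_ge_zero)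
    then show ?thesis using r by (simp add: d_def field_simps)
  qed
  have c1: "0 < cmod c" using c0 by simp
  have inv: "1 / cmod c \<le> d" using cd d0 c1 by (simp add: field_simps)
  \<comment> \<open>coefficients of the composition\<close>
  have \<Phi>: "taylor_coeff \<phi> 0 = 0" "taylor_coeff \<phi> 1 = c" by (simp_all add: taylor_coeff_0 taylor_coeff_1 \<phi>(3) c_def)
  have "(h \<circ> \<phi>) has_fps_expansion (fps_expansion h 0 oo fps_expansion \<phi> 0)"
    by (intro has_fps_expansion_compose has_fps_expansion_disc h \<phi> \<Phi>)
  then have "(\<lambda>z. h (\<phi> z)) has_fps_expansion (fps_expansion h 0 oo fps_expansion \<phi> 0)" by (simp add: o_def)
  then have "(\<lambda>z. (1 / of_real r) * h (\<phi> z)) has_fps_expansion fps_const (1 / of_real r) * (fps_expansion h 0 oo fps_expansion \<phi> 0)"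
    by (intro fps_expansion_intros)
  moreover have "(\<lambda>z. (1 / of_real r) * h (\<phi> z)) = H" by (simp add: H_def fun_eq_iff)
  ultimately have Hc: "taylor_coeff H n = (fps_nth (fps_expansion h 0 oo fps_expansion \<phi> 0) n) / of_real r" for n
    by (simp add: fps_expansion_eqI)
  have hc: "taylor_coeff h 0 = 0" "taylor_coeff h 1 = 1" by (simp_all add: taylor_coeff_0 taylor_coeff_1 h0 h1)
  have low: "fps_nth (fps_expansion h 0 oo fps_expansion \<phi> 0) n = taylor_coeff \<phi> n" if n: "1 \<le> n" "n < p" for n
  proof -
    have "fps_nth (fps_expansion h 0 oo fps_expansion \<phi> 0) n = (\<Sum>i=0..n. taylor_coeff h i * fps_nth (fps_expansion \<phi> 0 ^ i) n)"
      by (rule fps_compose_nth)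
    also have "\<dots> = (\<Sum>i\<in>{1}. taylor_coeff h i * fps_nth (fps_expansion \<phi> 0 ^ i) n)"
    proof (rule sum.mono_neutral_right)
      show "\<forall>i\<in>{0..n} - {1}. taylor_coeff h i * fps_nth (fps_expansion \<phi> 0 ^ i) n = 0"
      proof
        fix i assume i: "i \<in> {0..n} - {1}"
        have "taylor_coeff h i = 0" using hp[of i] i n hc(1) by (cases "i = 0") auto
        then show "taylor_coeff h i * fps_nth (fps_expansion \<phi> 0 ^ i) n = 0" by simp
      qed
    qed (use n in auto)
    also have "\<dots> = taylor_coeff \<phi> n" using hc by simp
    finally show ?thesis .
  qed
  have top: "fps_nth (fps_expansion h 0 oo fps_expansion \<phi> 0) p = taylor_coeff \<phi> p + taylor_coeff h p * c ^ p"
  proof -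
    have "fps_nth (fps_expansion h 0 oo fps_expansion \<phi> 0) p = (\<Sum>i=0..p. taylor_coeff h i * fps_nth (fps_expansion \<phi> 0 ^ i) p)"
      by (rule fps_compose_nth)
    also have "\<dots> = (\<Sum>i\<in>{1, p}. taylor_coeff h i * fps_nth (fps_expansion \<phi> 0 ^ i) p)"
    proof (rule sum.mono_neutral_right)
      show "\<forall>i\<in>{0..p} - {1, p}. taylor_coeff h i * fps_nth (fps_expansion \<phi> 0 ^ i) p = 0"
      proof
        fix i assume i: "i \<in> {0..p} - {1, p}"
        have "taylor_coeff h i = 0" using hp[of i] i hc(1) by (cases "i = 0") auto
        then show "taylor_coeff h i * fps_nth (fps_expansion \<phi> 0 ^ i) p = 0" by simp
      qed
    qed (use p in auto)
    also have "\<dots> = taylor_coeff \<phi> p + taylor_coeff h p * c ^ p"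
      using p hc \<Phi> startsby_zero_power_nth_same[of "fps_expansion \<phi> 0" p] by simp
    finally show ?thesis .
  qed
  have small: "cmod (taylor_coeff \<phi> n) \<le> r / real n" if n: "1 \<le> n" "n < p" for n
  proof -
    have "cmod (taylor_coeff \<phi> n) / r \<le> 1 / real n" using HG[THEN conjunct1, rule_format, OF n(1)] Hc[of n] low[OF n] r by (simp add: norm_divide)
    then show ?thesis using r by (simp add: field_simps)
  qed
  have "cmod (taylor_coeff \<phi> p + taylor_coeff h p * c ^ p) / r \<le> 1 / real p"
    using HG[THEN conjunct1, rule_format, of p] p Hc[of p] top r by (simp add: norm_divide)
  then have "cmod (taylor_coeff \<phi> p + taylor_coeff h p * c ^ p) \<le> r / real p" using r by (simp add: field_simps)
  moreover have "cmod (taylor_coeff h p * c ^ p) \<le> cmod (taylor_coeff \<phi> p + taylor_coeff h p * c ^ p) + cmod (taylor_coeff \<phi> p)"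
    using norm_triangle_ineq4[of "taylor_coeff \<phi> p + taylor_coeff h p * c ^ p" "taylor_coeff \<phi> p"] by simp
  ultimately have key: "cmod (taylor_coeff h p) * cmod c ^ p \<le> r / real p + cmod (taylor_coeff \<phi> p)"
    by (simp add: norm_mult norm_power)
  have im\<phi>: "\<phi> ` ball 0 1 \<subseteq> ball 0 1" using \<phi>D by blast
  have pick: "cmod (taylor_coeff \<phi> 2) \<le> 2 * cmod c * (1 - cmod c)"
    using pick_second_coeff[OF \<phi>(1) inj\<phi> \<phi>(3) im\<phi>] by (simp add: c_def)
  have \<phi>p: "cmod (taylor_coeff \<phi> p) \<le> real p * cmod c"
  proof (cases "p = 2")
    case True
    have "2 * cmod c * (1 - cmod c) \<le> 2 * cmod c * 1" by (intro mult_left_mono) auto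
    then show ?thesis using pick True by simp
  next
    case False
    define s where "s z = \<phi> z / c" for z
    have s: "s holomorphic_on ball 0 1" unfolding s_def using c0 by (intro holomorphic_intros \<phi>) auto
    have sf: "taylor_coeff s n = taylor_coeff \<phi> n / c" for n
    proof -
      have "(\<lambda>z. (1 / c) * \<phi> z) has_fps_expansion fps_const (1 / c) * fps_expansion \<phi> 0"
        by (intro fps_expansion_intros has_fps_expansion_disc \<phi>)
      moreover have "(\<lambda>z. (1 / c) * \<phi> z) = s" by (simp add: s_def fun_eq_iff)
      ultimately show ?thesis by (simp add: fps_expansion_eqI)
    qed
    have "cmod (taylor_coeff s p) \<le> real p"
    proof (rule univalent_coeff_bound_if_previous_small[OF s])
      show "inj_on s (ball 0 1)" using inj\<phi> c0 by (auto simp: s_def inj_on_def)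
      show "s 0 = 0" by (simp add: s_def \<phi>(3))
      show "deriv s 0 = 1" using sf[of 1] \<Phi> c0 by (simp add: taylor_coeff_1)
      show "3 \<le> p" using p False by simp
      fix n assume n: "2 \<le> n" "n < p"
      have "cmod (taylor_coeff \<phi> n) \<le> r / real n" using small n by simp
      also have "\<dots> \<le> r / 2" using n r by (intro divide_left_mono) auto
      also have "\<dots> \<le> cmod c"
      proof -
        have "pi \<le> 3 * sqrt 3"
        proof -
          have "1 \<le> sqrt 3" by simp
          moreover have "pi < 4" by (rule pi_less_4)
          moreover have "(4/3)\<^sup>2 \<le> (3::real)" by (simp add: power2_eq_square)
          then have "4/3 \<le> sqrt 3" by (rule real_le_rsqrt)
          ultimately show ?thesis by linarith
        qed
        then have "r / 2 \<le> 1 / d" using r by (simp add: d_def field_simps)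
        then show ?thesis using cd by linarith
      qed
      finally show "cmod (taylor_coeff s n) \<le> 1" using c1 by (simp add: sf norm_divide divide_le_eq)
    qed
    then show ?thesis using c1 by (simp add: sf norm_divide divide_le_eq)
  qed
  show "cmod (taylor_coeff h p) \<le> d ^ (p - 1) * (d * r / real p + real p)"
  proof -
    have pp: "x ^ p = x ^ (p - 1) * x" for x :: real using p by (metis power_minus_mult not_numeral_le_zero zero_less_iff_neq_zero)
    have "cmod (taylor_coeff h p) * cmod c ^ p \<le> r / real p + real p * cmod c" using key \<phi>p by linarith
    then have "cmod (taylor_coeff h p) \<le> (r / real p + real p * cmod c) / cmod c ^ p" using c1 by (simp add: field_simps)
    also have "\<dots> = (1 / cmod c) ^ (p - 1) * ((1 / cmod c) * r / real p + real p)"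
      using c1 p by (simp add: pp power_divide field_simps)
    also have "\<dots> \<le> d ^ (p - 1) * (d * r / real p + real p)"
      using inv c1 r d0 by (intro mult_mono power_mono add_right_mono divide_right_mono mult_right_mono) auto
    finally show ?thesis .
  qed
  show "cmod (taylor_coeff h 2) \<le> d * (d * r / 2 + 2) - 2" if "p = 2"
  proof -
    have "cmod (taylor_coeff h 2) * (cmod c)\<^sup>2 \<le> r / 2 + 2 * cmod c * (1 - cmod c)" using key pick that by simp
    then have "cmod (taylor_coeff h 2) \<le> (r / 2 + 2 * cmod c * (1 - cmod c)) / (cmod c)\<^sup>2" using c1 by (simp add: field_simps)
    also have "\<dots> = (1 / cmod c) * ((1 / cmod c) * r / 2 + 2) - 2"
      using c1 by (simp add: power2_eq_square field_simps)
    also have "\<dots> \<le> d * (d * r / 2 + 2) - 2"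
      using inv c1 r d0 by (intro diff_right_mono mult_mono add_right_mono divide_right_mono mult_right_mono) auto
    finally show ?thesis .
  qed
qed

theorem proposition2:
  fixes p q :: nat and f h g :: "complex \<Rightarrow> complex" and a b :: "nat \<Rightarrow> complex"
  assumes "2 \<le> p" and "2 \<le> q"
    and "f \<in> S_H p q"
    and "harmonic_decomposition f h g"
    and "\<forall>z\<in>unit_disc. (\<lambda>n. a (n + 2) * z ^ (n + 2)) sums (h z - z)"
    and "\<forall>z\<in>unit_disc. (\<lambda>n. b (n + 2) * z ^ (n + 2)) sums g z"
  shows "cmod (a p) \<le> d_const q ^ (p - 1) * (d_const q * R_const q / real p + real p)
    \<and> cmod (a 2) \<le> d_const q * (d_const q * R_const q / 2 + 2) - 2"
proof -
  have h: "h holomorphic_on ball 0 1" and g: "g holomorphic_on ball 0 1"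
    and f: "\<And>z. z \<in> ball 0 1 \<Longrightarrow> f z = h z + cnj (g z)"
    using assms(4) by (auto simp: harmonic_decomposition_def)
  have inj: "inj_on f (ball 0 1)" using assms(3) by (auto simp: S_H_def S_H0_def)
  obtain h' g' where norm: "normalized_decomposition f h' g'" and first: "first_nonzero_coeff_from_2 h' p" "first_nonzero_coeff_from_2 g' q"
    using assms(3) by (auto simp: S_H_def)
  then have h': "h' holomorphic_on ball 0 1" and g': "g' holomorphic_on ball 0 1"
    and f': "\<And>z. z \<in> ball 0 1 \<Longrightarrow> f z = h' z + cnj (g' z)"
    and zero: "h' 0 = 0" "g' 0 = 0" "deriv g' 0 = 0" "deriv h' 0 = 1"
    by (auto simp: normalized_decomposition_def harmonic_decomposition_def)
  have h0: "h 0 = 0"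
  proof -
    have "(\<lambda>n. a (n + 2) * 0 ^ (n + 2)) sums (h 0 - 0)" using assms(5) by (metis centre_in_ball zero_less_one)
    moreover have "(\<lambda>n. a (n + 2) * 0 ^ (n + 2)) sums 0" by simp
    ultimately show ?thesis by (simp add: sums_unique2)
  qed
  have eq: "h z = h' z" "g z = g' z" if "z \<in> ball 0 1" for z
    using harmonic_parts_unique[OF h g h' g' _ _ that] f f' h0 zero by auto
  have "h' has_fps_expansion fps_expansion h 0"
    by (rule has_fps_expansion_cong_disc[OF _ has_fps_expansion_disc[OF h]]) (rule eq)
  then have hfps: "fps_expansion h' 0 = fps_expansion h 0" by (rule fps_expansion_eqI)
  \<comment> \<open>the coefficients in the hypotheses are the Taylor coefficients\<close>
  have coeff: "taylor_coeff h n = a n" if n: "2 \<le> n" for n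
  proof -
    define A where "A n = (if n < 2 then (if n = 1 then 1 else 0) else a n)" for n
    have "(\<lambda>n. A n * z ^ n) sums h z" if z: "z \<in> ball 0 1" for z
    proof -
      have "(\<lambda>n. A (n + 2) * z ^ (n + 2)) sums (h z - z)" using assms(5) z by (simp add: A_def)
      then have "(\<lambda>n. A n * z ^ n) sums (h z - z + (\<Sum>i<2. A i * z ^ i))" by (rule sums_iff_shift[THEN iffD1])
      then show ?thesis by (simp add: A_def numeral_2_eq_2)
    qed
    moreover have "eventually (\<lambda>z. z \<in> ball 0 1) (nhds (0::complex))" by (rule eventually_nhds_in_open) auto
    ultimately have "eventually (\<lambda>z. (\<lambda>n. fps_nth (Abs_fps A) n * z ^ n) sums h z) (nhds 0)"
      by (auto elim!: eventually_mono)
    then have "h has_fps_expansion Abs_fps A" by (rule has_fps_expansionI)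
    then show ?thesis using n by (simp add: fps_expansion_eqI A_def)
  qed
  have hp: "taylor_coeff h' n = 0" if "2 \<le> n" "n < p" for n
    using first(1) that by (simp add: first_nonzero_coeff_from_2_def)
  have gq: "taylor_coeff g' j = 0" if "1 \<le> j" "j \<le> q - 1" for j
    using first(2) that zero assms(2) by (cases "j = 1") (auto simp: first_nonzero_coeff_from_2_def taylor_coeff_1)
  define R where "R = R_const q"
  have R: "R = 1 / (4 * 4 powr (1 / real (q - 1)))" unfolding R_def by (rule R_const_eq[OF assms(2)])
  have R0: "0 < R" unfolding R by simp
  have R1: "R \<le> 1 / 4"
  proof -
    have "1 \<le> (4::real) powr (1 / real (q - 1))" by (rule ge_one_powr_ge_zero) auto
    then show ?thesis unfolding R by (simp add: divide_le_eq)
  qed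
  have cover: "cball 0 r \<subseteq> f ` ball 0 1" if r: "r < R" for r
  proof
    fix w :: complex assume "w \<in> cball 0 r"
    then have "\<not> R \<le> cmod w" using r by simp
    then show "w \<in> f ` ball 0 1"
      using covering_theorem[OF h' g' f' inj zero(1,2,4) gq, of "q - 1"] assms(2) unfolding R by fastforce
  qed
  define D where "D r = 2 * pi / (3 * sqrt 3 * r)" for r
  have DR: "D R = d_const q" by (simp add: D_def R_def d_const_def)
  have limD: "(D \<longlongrightarrow> D R) (at_left R)" unfolding D_def using R0 by (intro tendsto_intros) auto
  have ev: "eventually (\<lambda>r. r \<in> {0<..<R}) (at_left R)" by (rule eventually_at_left_real[OF R0])
  have bound: "cmod (taylor_coeff h' p) \<le> D r ^ (p - 1) * (D r * r / real p + real p)" if "0 < r" "r < R" for r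
    unfolding D_def by (rule coefficient_bounds_from_subdisc(1)[OF h' g' f' inj zero(1,2,4,3) assms(1) hp that(1) cover[OF that(2)]])
  have bound2: "cmod (taylor_coeff h' 2) \<le> D r * (D r * r / 2 + 2) - 2" if "0 < r" "r < R" "p = 2" for r
    unfolding D_def by (rule coefficient_bounds_from_subdisc(2)[OF h' g' f' inj zero(1,2,4,3) assms(1) hp that(1) cover[OF that(2)] that(3)])
  have ap: "taylor_coeff h' p = a p" "taylor_coeff h' 2 = a 2" using coeff[of p] coeff[of 2] assms(1) by (simp_all add: hfps)
  have "cmod (a p) \<le> D R ^ (p - 1) * (D R * R / real p + real p)"
  proof (rule tendsto_lowerbound)
    show "((\<lambda>r. D r ^ (p - 1) * (D r * r / real p + real p)) \<longlongrightarrow> D R ^ (p - 1) * (D R * R / real p + real p)) (at_left R)"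
      using assms(1) by (intro tendsto_intros limD) auto
    show "\<forall>\<^sub>F r in at_left R. cmod (a p) \<le> D r ^ (p - 1) * (D r * r / real p + real p)"
      using ev by eventually_elim (use bound ap in auto)
  qed simp
  moreover have "cmod (a 2) \<le> D R * (D R * R / 2 + 2) - 2"
  proof (cases "p = 2")
    case True
    show ?thesis
    proof (rule tendsto_lowerbound)
      show "((\<lambda>r. D r * (D r * r / 2 + 2) - 2) \<longlongrightarrow> D R * (D R * R / 2 + 2) - 2) (at_left R)"
        by (intro tendsto_intros limD) auto
      show "\<forall>\<^sub>F r in at_left R. cmod (a 2) \<le> D r * (D r * r / 2 + 2) - 2"
        using ev by eventually_elim (use bound2 ap True in auto)
    qed simp
  next
    case False
    \<comment> \<open>here the asserted bound is nonnegative because \<open>d_const q \<ge> 1\<close>\<close>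
    then have "a 2 = 0" using hp[of 2] ap assms(1) by simp
    moreover have "1 \<le> D R"
    proof -
      have "sqrt 3 \<le> 2" by (rule real_le_lsqrt) auto
      then have "3 * sqrt 3 * (1 / 4) \<le> 2 * pi" using pi_ge_two by linarith
      moreover have "3 * sqrt 3 * R \<le> 3 * sqrt 3 * (1 / 4)" using R1 by (intro mult_left_mono) auto
      ultimately have "3 * sqrt 3 * R \<le> 2 * pi" by linarith
      then show ?thesis using R0 by (simp add: D_def)
    qed
    then have "1 * (0 + 2) \<le> D R * (D R * R / 2 + 2)" using R0 by (intro mult_mono add_mono) auto
    ultimately show ?thesis by simp
  qed
  ultimately show ?thesis unfolding DR[symmetric] R_def[symmetric] by (rule conjI)
qed

end
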